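(* Let $1<k<2$ and let $\pi_k$ be the coupling constructed in the context. Then, for every $h\in C^1([-3,3])$ with convex derivative, $$V_k(h)=\int h(y-x)\,\pi_k(\mathrm dx,\mathrm dy).$$ For $h\in C^3([-3,3])$ with $h'''\ge0$, the dual functions $\phi,\psi,\theta$ defined in the context satisfy $$\phi(x)+\psi(y)+\theta(x)(y-x)\le h(y-x)\qquad\text{for all }x\in[-1,1],\ y\in[-2,2]\cap[x-k,\infty),$$ with equality on the support of $\pi_k$.
   Context: Problem. $\mu$ is uniform on $[-1,1]$, $\nu$ uniform on $[-2,2]$. $\mathcal M_k(\mu,\nu)$ is the set of Borel probability measures $\pi$ on $\mathbb R^2$ with marginals $\mu,\nu$, concentrated on $\{y\ge x-k\}$, whose conditional laws satisfy $\int y\,\pi_x(\mathrm dy)=x$ for $\mu$-a.e. $x$. $V_k(h)=\inf_{\pi\in\mathcal M_k(\mu,\nu)}\int h(y-x)\,\mathrm d\pi$. Construction of $\pi_k$. Put $b=k-2$ and, for $0\le\delta\le1$, $z(\delta)=2-\delta+2k\log\frac{k-1}{k-\delta}$, $y(\delta)=z(\delta)-k$, $A(\delta)=(2-k)\delta-\frac{\delta^2}2+2k[\delta\log(k-1)+(k-\delta)\log(k-\delta)-(k-\delta)]$, $T(\delta)=A(1)-A(\delta)-\big(\frac{(1+\delta)^2}4-1\big)$, $\mathcal W(\delta)=b^2-2b(\delta-1)+2k[(k-\delta)\log\frac{k-\delta}{k-1}+\delta-1]$. $z$ is strictly increasing with $z(1)=1$; $\delta_b\in(0,1)$ is the unique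 solution of $z(\delta_b)=b$; $\delta_0\in(\delta_b,1)$ is the unique zero of $T$ there; $x_0=-\frac{1+\delta_0}2\in(-1,b)$. The maps $D,U$ on $[-1,1]$ are: - $D(-1)=U(-1)=-1$; for $-1<x\le x_0$, $D(x)=y(L)$, $U(x)=y(R)$ with $(L,R)$ the unique solution of $R-L=2(x+1)$, $A(R)-A(L)=x^2-1$, $\delta_b\le L<R\le1$; - for $x_0\le x\le b$, parametrically $x=b-\delta+W(\delta)$, $D=z(\delta)-k$, $U=b-\delta+2W(\delta)$, $\delta\in[\delta_b,\delta_0]$, $W=\sqrt{\mathcal W}$; - for $b\le x\le 1$, $x=z(\delta)$, $D=x-k$, $U=x+\delta$, $\delta\in[\delta_b,1]$. With $q(x)=\frac{x-D(x)}{U(x)-D(x)}$ for $x>-1$, $q(-1)=\frac12$, set $\pi_k(\mathrm dx,\mathrm dy)=\mu(\mathrm dx)[(1-q(x))\delta_{D(x)}(\mathrm dy)+q(x)\delta_{U(x)}(\mathrm dy)]$. The maps are continuous; $D$ is strictly decreasing from $[-1,b]$ onto $[-2,-1]$; $U$ is strictly increasing from $[-1,1]$ onto $[-1,2]$; and $\pi_k\in\mathcal M_k(\mu,\nu)$. Auxiliary kernel. Put $d(x)=D(x)-x$, $w(x)=U(x)-x$. For $x\in[b,1]$ let $\alpha(x)=(D|_{[-1,b]})^{-1}(x-k)$ if $b\le x\le k-1$, $\alpha(x)=(U|_{[-1,x_0]})^{-1}(x-k)$ if $k-1\le x\le1$ (both equal $-1$ at $x=k-1$), and $\zeta(x)=x-k-\alpha(x)$.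 Define probability measures $Q_x$: $Q_{-1}=\delta_0$ (Dirac mass at $0$); $Q_x=\mathrm{Unif}[d(x),w(x)]$ for $-1<x\le b$; and for $b\le x\le1$, $(Q_x)$ is the unique probability kernel solving $$Q_x=\frac{\lambda_{[\zeta(x),w(x)]}+\int_{\alpha(x)}^xQ_s\,\mathrm ds}{w(x)+k},$$ where $\lambda_{[r,s]}$ is Lebesgue measure restricted to $[r,s]$ and the integral of measures is weak. Dual functions. For $h\in C^3([-3,3])$ with $h'''\ge0$: $S_h(x)=\int h''\,\mathrm dQ_x$, $\theta(x)=-\int_{-1}^xS_h(s)\,\mathrm ds$. $\psi\in C^1([-2,2])$ is defined by $\psi(-1)=0$ and $\psi'(y)=h'(y-t)-\theta(t)$, where $t=(D|_{[-1,b]})^{-1}(y)$ for $-2\le y\le-1$ and $t=U^{-1}(y)$ for $-1\le y\le2$. Finally $\phi(x)=h(w(x))-\psi(U(x))-\theta(x)w(x)$. *)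

theory Defs
  imports "HOL-Probability.Probability"
begin

definition mu :: "real measure" where
  "mu = uniform_measure lborel {-1..1}"

definition nu :: "real measure" where
  "nu = uniform_measure lborel {-2..2}"

text \<open>The law of \<open>(X, Y)\<close> when \<open>X\<close> has law \<open>m\<close> and \<open>Y\<close> given \<open>X = x\<close> has law \<open>\<kappa> x\<close>,
  i.e. \<open>m(dx) \<kappa>\<^sub>x(dy)\<close>.\<close>

definition joint_law :: "real measure \<Rightarrow> (real \<Rightarrow> real measure) \<Rightarrow> (real \<times> real) measure" where
  "joint_law m \<kappa> = m \<bind> (\<lambda>x. \<kappa> x \<bind> (\<lambda>y. return borel (x, y)))"

text \<open>The conditional laws \<open>\<pi>\<^sub>x\<close> enter through a disintegration \<open>\<kappa>\<close> of \<open>\<pi>\<close> along the first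
  coordinate; it is unique up to \<open>mu\<close>-null sets, so it does not matter which one is used.\<close>

definition M_class :: "real \<Rightarrow> (real \<times> real) measure set" where
  "M_class k = {\<pi>. prob_space \<pi> \<and> sets \<pi> = sets borel
     \<and> distr \<pi> borel fst = mu \<and> distr \<pi> borel snd = nu
     \<and> (AE p in \<pi>. snd p \<ge> fst p - k)
     \<and> (\<exists>\<kappa> \<in> borel \<rightarrow>\<^sub>M prob_algebra borel. \<pi> = joint_law mu \<kappa>
          \<and> (AE x in mu. integrable (\<kappa> x) (\<lambda>y. y) \<and> (LINT y|\<kappa> x. y) = x))}"

text \<open>The cost \<open>h\<close> is a function on \<open>[-3,3]\<close> only; as \<open>y - x\<close> lies there \<open>\<pi>\<close>-almost surely, the
  integral is restricted accordingly and the values of \<open>h\<close> elsewhere are irrelevant.\<close>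

definition cost :: "(real \<Rightarrow> real) \<Rightarrow> (real \<times> real) measure \<Rightarrow> real" where
  "cost h \<pi> = (LINT p:{p. snd p - fst p \<in> {-3..3}}|\<pi>. h (snd p - fst p))"

definition V :: "real \<Rightarrow> (real \<Rightarrow> real) \<Rightarrow> real" where
  "V k h = (INF \<pi>\<in>M_class k. cost h \<pi>)"

definition b_of :: "real \<Rightarrow> real" where
  "b_of k = k - 2"

definition z_of :: "real \<Rightarrow> real \<Rightarrow> real" where
  "z_of k \<delta> = 2 - \<delta> + 2 * k * ln ((k - 1) / (k - \<delta>))"

definition y_of :: "real \<Rightarrow> real \<Rightarrow> real" where
  "y_of k \<delta> = z_of k \<delta> - k"

definition A_of :: "real \<Rightarrow> real \<Rightarrow> real" where
  "A_of k \<delta> = (2 - k) * \<delta> - \<delta>\<^sup>2 / 2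
     + 2 * k * (\<delta> * ln (k - 1) + (k - \<delta>) * ln (k - \<delta>) - (k - \<delta>))"

definition T_of :: "real \<Rightarrow> real \<Rightarrow> real" where
  "T_of k \<delta> = A_of k 1 - A_of k \<delta> - ((1 + \<delta>)\<^sup>2 / 4 - 1)"

definition calW_of :: "real \<Rightarrow> real \<Rightarrow> real" where
  "calW_of k \<delta> = (b_of k)\<^sup>2 - 2 * b_of k * (\<delta> - 1)
     + 2 * k * ((k - \<delta>) * ln ((k - \<delta>) / (k - 1)) + \<delta> - 1)"

definition W_of :: "real \<Rightarrow> real \<Rightarrow> real" where
  "W_of k \<delta> = sqrt (calW_of k \<delta>)"

definition delta_b :: "real \<Rightarrow> real" where
  "delta_b k = (THE \<delta>. 0 < \<delta> \<and> \<delta> < 1 \<and> z_of k \<delta> = b_of k)"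

definition delta_0 :: "real \<Rightarrow> real" where
  "delta_0 k = (THE \<delta>. delta_b k < \<delta> \<and> \<delta> < 1 \<and> T_of k \<delta> = 0)"

definition x_0 :: "real \<Rightarrow> real" where
  "x_0 k = - (1 + delta_0 k) / 2"

definition LR_of :: "real \<Rightarrow> real \<Rightarrow> real \<times> real" where
  "LR_of k x = (THE p. case p of (L, R) \<Rightarrow>
     R - L = 2 * (x + 1) \<and> A_of k R - A_of k L = x\<^sup>2 - 1 \<and> delta_b k \<le> L \<and> L < R \<and> R \<le> 1)"

text \<open>The value of the parameter \<open>\<delta>\<close> that belongs to \<open>x\<close>, for \<open>x\<^sub>0 \<le> x \<le> b\<close> and for
  \<open>b \<le> x \<le> 1\<close> respectively.\<close>

definition delta_mid :: "real \<Rightarrow> real \<Rightarrow> real" where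
  "delta_mid k x = (THE \<delta>. delta_b k \<le> \<delta> \<and> \<delta> \<le> delta_0 k \<and> x = b_of k - \<delta> + W_of k \<delta>)"

definition delta_right :: "real \<Rightarrow> real \<Rightarrow> real" where
  "delta_right k x = (THE \<delta>. delta_b k \<le> \<delta> \<and> \<delta> \<le> 1 \<and> x = z_of k \<delta>)"

text \<open>Only the values on \<open>[-1,1]\<close> matter. At the common end points \<open>x\<^sub>0\<close> and \<open>b\<close> the formulas for
  the adjacent intervals agree.\<close>

definition D_map :: "real \<Rightarrow> real \<Rightarrow> real" where
  "D_map k x =
     (if x \<le> -1 then -1
      else if x \<le> x_0 k then y_of k (fst (LR_of k x))
      else if x \<le> b_of k then z_of k (delta_mid k x) - k
      else x - k)"

definition U_map :: "real \<Rightarrow> real \<Rightarrow> real" where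
  "U_map k x =
     (if x \<le> -1 then -1
      else if x \<le> x_0 k then y_of k (snd (LR_of k x))
      else if x \<le> b_of k then b_of k - delta_mid k x + 2 * W_of k (delta_mid k x)
      else x + delta_right k x)"

definition q_of :: "real \<Rightarrow> real \<Rightarrow> real" where
  "q_of k x = (if x > -1 then (x - D_map k x) / (U_map k x - D_map k x) else 1 / 2)"

definition two_point_law :: "real \<Rightarrow> real \<Rightarrow> real \<Rightarrow> real measure" where
  "two_point_law q u v = distr (measure_pmf (bernoulli_pmf q)) borel (\<lambda>c. if c then v else u)"

definition pi_coupling :: "real \<Rightarrow> (real \<times> real) measure" where
  "pi_coupling k = joint_law mu (\<lambda>x. two_point_law (q_of k x) (D_map k x) (U_map k x))"

definition topological_support :: "'a::topological_space measure \<Rightarrow> 'a set" where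
  "topological_support M = {x. \<forall>G. open G \<and> x \<in> G \<longrightarrow> emeasure M G > 0}"

definition d_of :: "real \<Rightarrow> real \<Rightarrow> real" where
  "d_of k x = D_map k x - x"

definition w_of :: "real \<Rightarrow> real \<Rightarrow> real" where
  "w_of k x = U_map k x - x"

definition alpha_of :: "real \<Rightarrow> real \<Rightarrow> real" where
  "alpha_of k x =
     (if x \<le> k - 1 then inv_into {-1..b_of k} (D_map k) (x - k)
      else inv_into {-1..x_0 k} (U_map k) (x - k))"

definition zeta_of :: "real \<Rightarrow> real \<Rightarrow> real" where
  "zeta_of k x = x - k - alpha_of k x"

text \<open>The integral equation on \<open>[b,1]\<close> is an identity of measures, where the integral of measures
  is weak: it is tested against bounded continuous functions.\<close>

definition is_aux_kernel :: "real \<Rightarrow> (real \<Rightarrow> real measure) \<Rightarrow> bool" where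
  "is_aux_kernel k Q \<longleftrightarrow>
     Q \<in> restrict_space borel {-1..1} \<rightarrow>\<^sub>M prob_algebra borel
   \<and> Q (-1) = return borel 0
   \<and> (\<forall>x. -1 < x \<and> x \<le> b_of k \<longrightarrow> Q x = uniform_measure lborel {d_of k x..w_of k x})
   \<and> (\<forall>x\<in>{b_of k..1}. \<forall>f. continuous_on UNIV f \<and> bounded (range f) \<longrightarrow>
        (LINT u|Q x. f u) =
          ((LINT u:{zeta_of k x..w_of k x}|lborel. f u)
             + (LINT s:{alpha_of k x..x}|lborel. (LINT u|Q s. f u :: real))) / (w_of k x + k))"

text \<open>The kernel is uniquely determined on \<open>[-1,1]\<close>; the choice only concerns arguments outside
  this interval, which are never used.\<close>

definition Q_kernel :: "real \<Rightarrow> real \<Rightarrow> real measure" where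
  "Q_kernel k = (SOME Q. is_aux_kernel k Q)"

text \<open>Below, \<open>h1\<close> and \<open>h2\<close> stand for the first and second derivative of \<open>h\<close> on \<open>[-3,3]\<close>. The laws
  \<open>Q\<^sub>x\<close> are carried by \<open>[-3,3]\<close>, where \<open>h2\<close> is defined.\<close>

definition S_fun :: "real \<Rightarrow> (real \<Rightarrow> real) \<Rightarrow> real \<Rightarrow> real" where
  "S_fun k h2 x = (LINT u:{-3..3}|Q_kernel k x. h2 u)"

definition theta_fun :: "real \<Rightarrow> (real \<Rightarrow> real) \<Rightarrow> real \<Rightarrow> real" where
  "theta_fun k h2 x = - (LINT s:{-1..x}|lborel. S_fun k h2 s)"

definition t_of :: "real \<Rightarrow> real \<Rightarrow> real" where
  "t_of k y = (if y \<le> -1 then inv_into {-1..b_of k} (D_map k) y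
               else inv_into {-1..1} (U_map k) y)"

definition psi_deriv :: "real \<Rightarrow> (real \<Rightarrow> real) \<Rightarrow> (real \<Rightarrow> real) \<Rightarrow> real \<Rightarrow> real" where
  "psi_deriv k h1 h2 y = h1 (y - t_of k y) - theta_fun k h2 (t_of k y)"

text \<open>As for the kernel, the choice is unique up to values outside \<open>[-2,2]\<close>. Derivatives at the end
  points are one-sided.\<close>

definition psi_fun :: "real \<Rightarrow> (real \<Rightarrow> real) \<Rightarrow> (real \<Rightarrow> real) \<Rightarrow> real \<Rightarrow> real" where
  "psi_fun k h1 h2 = (SOME \<psi>. \<psi> (-1) = 0
     \<and> (\<forall>y\<in>{-2..2}. (\<psi> has_real_derivative psi_deriv k h1 h2 y) (at y within {-2..2}))
     \<and> continuous_on {-2..2} (psi_deriv k h1 h2))"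

definition phi_fun ::
  "real \<Rightarrow> (real \<Rightarrow> real) \<Rightarrow> (real \<Rightarrow> real) \<Rightarrow> (real \<Rightarrow> real) \<Rightarrow> real \<Rightarrow> real" where
  "phi_fun k h h1 h2 x =
     h (w_of k x) - psi_fun k h1 h2 (U_map k x) - theta_fun k h2 x * w_of k x"

end

theory Submission
  imports Defs
begin

text \<open>The inequality for the dual functions is linear in \<open>h\<close>, so it reduces to the costs
  \<open>max 0 (u - r)\<^sup>2 / 2\<close>, whose second derivative is the indicator of \<open>[r, \<infinity>)\<close>; then \<open>S x\<close> is the tail
  \<open>p x = Q\<^sub>x [r, \<infinity>)\<close>. The integral equation for \<open>Q\<close> says precisely that the gap
  \<open>G x v = h (v - x) - \<phi> x - \<psi> v - \<theta> x * (v - x)\<close> vanishes on the graphs of \<open>D\<close> and \<open>U\<close>. Outside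
  \<open>[D x, U x]\<close> the gap is monotone in \<open>v\<close>. Between the two graphs either the derivative in \<open>v\<close> changes
  sign at most once from plus to minus, or the derivative in \<open>x\<close> does so along a horizontal segment
  that ends on the graphs, and hence \<open>G \<ge> 0\<close>.

  A continuous nondecreasing \<open>h''\<close> is a uniform limit of nonnegative combinations of such steps and a
  constant, and a continuous convex \<open>h'\<close> is a uniform limit of convex piecewise linear functions.
  Optimality of \<open>\<pi>\<^sub>k\<close> is then weak duality: the term \<open>\<theta> x * (y - x)\<close> integrates to zero under every
  martingale coupling.\<close>

section \<open>The function \<open>z\<close>\<close>

text \<open>Two obstacles shape the argument. The maps \<open>D\<close> and \<open>U\<close> are
  given by different formulas on either side of \<open>x0\<close>. Continuing \<open>y\<close> past
  1 by the line \<open>s - k\<close>, and \<open>A\<close> by the corresponding antiderivative,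
  merges them into one implicit equation for a pair of parameters on all of \<open>[-1, b]\<close>,
  from which monotonicity and derivatives follow.

  The delicate region is \<open>x > b\<close> with \<open>v\<close> between the graphs. Where
  \<open>v - x < r\<close>, the \<open>v\<close>-derivative of the gap is negative exactly when
  \<open>P (t v) + v - t v\<close> exceeds \<open>P x + r\<close>. That expression increases in
  \<open>v\<close> except possibly on the image of \<open>[x0, b]\<close> under \<open>U\<close>,
  because \<open>w\<close> need not be monotone there. For \<open>r \<le> - d x0\<close> this does
  no harm. For larger \<open>r\<close> a single sign change is guaranteed once the level
  \<open>P x + r\<close> has reached the value of the expression at \<open>x0\<close>; before that,
  horizontal segments are used, whose sign analysis requires \<open>w (\<alpha> x) \<le> r\<close>.
  That the level is reached by the time this condition fails is a quantitative estimate, from which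
  most of the Pade bounds and odd rational constants come.\<close>

lemma ln_ge_pade:
  fixes x :: real
  assumes "1 \<le> x"
  shows "2 * (x - 1) / (x + 1) \<le> ln x"
proof -
  have "(\<lambda>x. ln x - 2 * (x - 1) / (x + 1)) 1 \<le> (\<lambda>x::real. ln x - 2 * (x - 1) / (x + 1)) x"
  proof (rule DERIV_nonneg_imp_nondecreasing[OF assms])
    fix u :: real assume u: "1 \<le> u" "u \<le> x"
    have "((\<lambda>x. ln x - 2 * (x - 1) / (x + 1)) has_real_derivative (1 / u - 4 / (u + 1)\<^sup>2)) (at u)"
      using u by (auto intro!: derivative_eq_intros simp: field_simps power2_eq_square)
    moreover have "1 / u - 4 / (u + 1)\<^sup>2 = (u - 1)\<^sup>2 / (u * (u + 1)\<^sup>2)"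
      using u by (simp add: divide_simps) (simp add: algebra_simps power2_eq_square)
    ultimately show "\<exists>y. ((\<lambda>x. ln x - 2 * (x - 1) / (x + 1)) has_real_derivative y) (at u) \<and> 0 \<le> y"
      using u by (intro exI[of _ "(u - 1)\<^sup>2 / (u * (u + 1)\<^sup>2)"]) auto
  qed
  then show ?thesis by simp
qed

text \<open>The right side is the [2/1] Pade approximant of \<open>ln (1 + x)\<close> at 0;
  agreement through third order leaves the single term \<open>4 * u ^ 3\<close> in the numerator of
  the derivative of the difference, whence the sign.\<close>

lemma ln_le_pade:
  fixes x :: real
  assumes "0 \<le> x"
  shows "ln (1 + x) \<le> x * (6 + x) / (6 + 4 * x)"
proof -
  define g where "g = (\<lambda>x::real. x * (6 + x) / (6 + 4 * x) - ln (1 + x))"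
  have "g 0 \<le> g x"
  proof (rule DERIV_nonneg_imp_nondecreasing[OF assms])
    fix u :: real assume u: "0 \<le> u" "u \<le> x"
    have "(g has_real_derivative ((6 + 2*u) * (6 + 4 * u) - u * (6 + u) * 4) / (6 + 4 * u)\<^sup>2 - 1 / (1 + u)) (at u)"
      unfolding g_def using u
      by (auto intro!: derivative_eq_intros simp: power2_eq_square) (simp add: field_simps)?
    moreover have "((6 + 2*u) * (6 + 4 * u) - u * (6 + u) * 4) / (6 + 4 * u)\<^sup>2 - 1 / (1 + u)
        = (4 * u ^ 3) / ((6 + 4 * u)\<^sup>2 * (1 + u))"
      using u by (simp add: divide_simps) (simp add: algebra_simps power2_eq_square power3_eq_cube)
    ultimately show "\<exists>y. (g has_real_derivative y) (at u) \<and> 0 \<le> y"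
      using u by (intro exI[of _ "(4 * u ^ 3) / ((6 + 4 * u)\<^sup>2 * (1 + u))"]) auto
  qed
  then show ?thesis by (simp add: g_def)
qed

lemma ln_le_half_diff_inverse:
  fixes x :: real
  assumes "1 \<le> x"
  shows "ln x \<le> (x - 1 / x) / 2"
proof -
  define g where "g = (\<lambda>x::real. (x - 1 / x) / 2 - ln x)"
  have "g 1 \<le> g x"
  proof (rule DERIV_nonneg_imp_nondecreasing[OF assms])
    fix u :: real assume u: "1 \<le> u" "u \<le> x"
    have "(g has_real_derivative ((1 + 1 / u\<^sup>2) / 2 - 1 / u)) (at u)"
      unfolding g_def using u
      by (auto intro!: derivative_eq_intros simp: power2_eq_square)
    moreover have "(1 + 1 / u\<^sup>2) / 2 - 1 / u = (1 - 1 / u)\<^sup>2 / 2"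
      using u by (simp add: field_simps power2_eq_square)
    ultimately show "\<exists>y. (g has_real_derivative y) (at u) \<and> 0 \<le> y"
      by (metis divide_nonneg_pos zero_le_power2 zero_less_numeral)
  qed
  then show ?thesis by (simp add: g_def)
qed

locale curtain =
  fixes k :: real
  assumes k1: "1 < k" and k2: "k < 2"
begin

abbreviation "z \<equiv> z_of k"
abbreviation "y \<equiv> y_of k"
abbreviation "b \<equiv> b_of k"
abbreviation "\<delta>b \<equiv> delta_b k"

lemma z_altdef: "\<delta> < k \<Longrightarrow> z \<delta> = 2 - \<delta> - 2 * k * ln ((k - \<delta>) / (k - 1))"
  using k1 by (simp add: z_of_def ln_div algebra_simps)

lemma z_deriv:
  assumes "\<delta> < k" "\<delta> \<in> S"
  shows "(z has_real_derivative (k + \<delta>) / (k - \<delta>)) (at \<delta> within S)"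
proof -
  have "((\<lambda>\<delta>. 2 - \<delta> - 2 * k * (ln (k - \<delta>) - ln (k - 1))) has_real_derivative (k + \<delta>) / (k - \<delta>)) (at \<delta> within S)"
    using assms by (auto intro!: derivative_eq_intros simp: field_simps)
  then show ?thesis
    by (rule has_field_derivative_transform_within[where d = "k - \<delta>"])
      (use assms k1 in \<open>auto simp: z_altdef ln_div dist_real_def\<close>)
qed


lemma z_1 [simp]: "z 1 = 1"
  using k1 by (simp add: z_of_def)

text \<open>The derivative \<open>(k + u) / (k - u)\<close> is at least 1 for
  \<open>u \<ge> 0\<close>. This one bound gives injectivity of \<open>z\<close>, the Lipschitz
  constant 1 of its inverse, and the convexity of \<open>Phi\<close> below.\<close>

lemma z_slope:
  assumes "0 \<le> s" "s \<le> t" "t < k"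
  shows "t - s \<le> z t - z s"
proof -
  have "(\<lambda>u. z u - u) s \<le> (\<lambda>u. z u - u) t"
  proof (rule DERIV_nonneg_imp_nondecreasing[OF assms(2)])
    fix u assume u: "s \<le> u" "u \<le> t"
    have "((\<lambda>u. z u - u) has_real_derivative (k + u) / (k - u) - 1) (at u)"
      using u assms by (intro derivative_intros z_deriv) auto
    moreover have "0 \<le> (k + u) / (k - u) - 1"
      using u assms by (simp add: field_simps)
    ultimately show "\<exists>y. ((\<lambda>u. z u - u) has_real_derivative y) (at u) \<and> 0 \<le> y" by blast
  qed
  then show ?thesis by simp
qed

lemma z_less: "0 \<le> s \<Longrightarrow> s < t \<Longrightarrow> t < k \<Longrightarrow> z s < z t"
  using z_slope[of s t] by simp

lemma z_le: "0 \<le> s \<Longrightarrow> s \<le> t \<Longrightarrow> t < k \<Longrightarrow> z s \<le> z t"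
  using z_slope[of s t] by simp

lemma z_less_iff: "0 \<le> s \<Longrightarrow> 0 \<le> t \<Longrightarrow> s < k \<Longrightarrow> t < k \<Longrightarrow> z s < z t \<longleftrightarrow> s < t"
  using z_less z_le by (meson not_le)

lemma z_le_iff: "0 \<le> s \<Longrightarrow> 0 \<le> t \<Longrightarrow> s < k \<Longrightarrow> t < k \<Longrightarrow> z s \<le> z t \<longleftrightarrow> s \<le> t"
  using z_less_iff by (meson not_le)

lemma z_continuous_on: "S \<subseteq> {..<k} \<Longrightarrow> continuous_on S z"
  by (rule DERIV_continuous_on, rule z_deriv) auto

lemma z_surj:
  assumes "z 0 \<le> x" "x \<le> 1"
  obtains \<delta> where "0 \<le> \<delta>" "\<delta> \<le> 1" "z \<delta> = x"
proof -
  have "{0..1} \<subseteq> {..<k}" using k1 by auto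
  then have "\<exists>d\<ge>0. d \<le> 1 \<and> z d = x"
    using assms k1 z_continuous_on[of "{0..1}"] by (intro IVT') auto
  then show thesis using that by blast
qed

text \<open>With \<open>u = (k - s) / (k - 1)\<close> the claim reads
  \<open>4 - k - s < 2 * k * ln u\<close>. The Pade lower bound for \<open>ln u\<close> turns it
  into a polynomial condition that can be tested at explicit points.\<close>

lemma z_less_b_of_ratio:
  assumes s: "0 \<le> s" "s \<le> 1"
    and ineq: "(4 - k - s) * ((k - s) + (k - 1)) < 4 * k * (1 - s)"
  shows "z s < b"
proof -
  define u where "u = (k - s) / (k - 1)"
  have u1: "1 \<le> u" using s k1 by (simp add: u_def field_simps)
  have "2 * (u - 1) / (u + 1) = 2 * (1 - s) / ((k - s) + (k - 1))"
    using s k1 by (simp add: u_def divide_simps)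
  then have "2 * (1 - s) / ((k - s) + (k - 1)) \<le> ln u"
    using ln_ge_pade[OF u1] by simp
  then have "2 * k * (2 * (1 - s) / ((k - s) + (k - 1))) \<le> 2 * k * ln u"
    by (rule mult_left_mono) (use k1 in simp)
  moreover have "4 - k - s < 2 * k * (2 * (1 - s) / ((k - s) + (k - 1)))"
    using ineq s k1 by (simp add: field_simps)
  moreover have "z s = 2 - s - 2 * k * ln u"
    using s k1 by (simp add: z_altdef u_def)
  ultimately show ?thesis by (simp add: b_of_def)
qed

lemma z_0_less: "z 0 < b"
proof (rule z_less_b_of_ratio)
  have "0 < 2 * (k - 5/4)\<^sup>2 + 7/8" by (intro add_nonneg_pos) auto
  then show "(4 - k - 0) * ((k - 0) + (k - 1)) < 4 * k * (1 - 0)"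
    by (simp add: power2_eq_square algebra_simps)
qed simp_all

lemma z_seventh_less: "z (k / 7) < b"
proof (rule z_less_b_of_ratio)
  have "0 < 76 * (k - 28/19)\<^sup>2 + (196 - 76 * (28/19)\<^sup>2)" by (intro add_nonneg_pos) (auto simp: power2_eq_square)
  then show "(4 - k - k / 7) * ((k - k / 7) + (k - 1)) < 4 * k * (1 - k / 7)"
    by (simp add: power2_eq_square algebra_simps)
qed (use k1 k2 in auto)

lemma z_3_minus_less:
  assumes "0 \<le> 3 - 2 * k" shows "z (3 - 2 * k) < b"
proof (rule z_less_b_of_ratio)
  have "0 < (k - 1) * (4 * (k - 1))" using k1 by (intro mult_pos_pos) auto
  then show "(4 - k - (3 - 2 * k)) * ((k - (3 - 2 * k)) + (k - 1)) < 4 * k * (1 - (3 - 2 * k))"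
    by (simp add: algebra_simps)
qed (use assms k1 k2 in auto)

lemma z_third_less:
  assumes "0 \<le> (2 * k - 3) / 3" shows "z ((2 * k - 3) / 3) < b"
proof (rule z_less_b_of_ratio)
  have "0 < 8 * k * (3 - k)" using k1 k2 by simp
  then show "(4 - k - (2 * k - 3) / 3) * ((k - (2 * k - 3) / 3) + (k - 1)) < 4 * k * (1 - (2 * k - 3) / 3)"
    by (simp add: field_simps)
qed (use assms k1 k2 in auto)

lemma \<delta>b_props: "0 < \<delta>b" "\<delta>b < 1" "z \<delta>b = b"
proof -
  have b1: "b < 1" using k2 by (simp add: b_of_def)
  obtain d where d: "0 \<le> d" "d \<le> 1" "z d = b"
    using z_surj[of b] z_0_less b1 by auto
  have d': "0 < d" "d < 1" using d z_0_less b1 by (auto simp: order_less_le)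
  have "\<exists>!\<delta>. 0 < \<delta> \<and> \<delta> < 1 \<and> z \<delta> = b"
  proof (rule ex1I[of _ d])
    fix e assume "0 < e \<and> e < 1 \<and> z e = b"
    then show "e = d" using z_less[of e d] z_less[of d e] d d' k1 by (cases e d rule: linorder_cases) auto
  qed (use d d' in auto)
  from theI'[OF this] show "0 < \<delta>b" "\<delta>b < 1" "z \<delta>b = b"
    unfolding delta_b_def by auto
qed

text \<open>Each point lies left of \<open>\<delta>b\<close> because the increasing function
  \<open>z\<close> is still below \<open>b\<close> there. The first bound gives
  \<open>k - \<delta>b < 6 * \<delta>b\<close>, used in \<open>cc_bound\<close>; the second says
  that the right parameter at \<open>b\<close>, which is \<open>2 * k - 2 + \<delta>b\<close>,
  exceeds 1, and that \<open>\<nu>b < 3\<close>.\<close>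

lemma \<delta>b_bounds: "k / 7 < \<delta>b" "3 - 2 * k < \<delta>b" "(2 * k - 3) / 3 < \<delta>b"
proof -
  have *: "s < \<delta>b" if "0 \<le> s \<Longrightarrow> z s < b" "s \<le> 1" for s
    using that \<delta>b_props z_less_iff[of s \<delta>b] k1 by (cases "0 \<le> s") auto
  show "k / 7 < \<delta>b" by (rule *) (use z_seventh_less k2 in auto)
  show "3 - 2 * k < \<delta>b" by (rule *) (use z_3_minus_less k1 in auto)
  show "(2 * k - 3) / 3 < \<delta>b" by (rule *) (use z_third_less k2 in auto)
qed

lemma ln_\<delta>b: "2 * k * ln ((k - \<delta>b) / (k - 1)) = 4 - k - \<delta>b"
  using \<delta>b_props z_altdef[of \<delta>b] k1 by (simp add: b_of_def)

abbreviation "zi \<equiv> delta_right k"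

lemma zi_z:
  assumes "\<delta>b \<le> \<delta>" "\<delta> \<le> 1" shows "zi (z \<delta>) = \<delta>"
  unfolding delta_right_def
proof (rule the_equality)
  fix e assume e: "\<delta>b \<le> e \<and> e \<le> 1 \<and> z \<delta> = z e"
  then show "e = \<delta>" using z_less[of e \<delta>] z_less[of \<delta> e] assms k1 \<delta>b_props
    by (cases e \<delta> rule: linorder_cases) auto
qed (use assms in auto)

lemma zi_props:
  assumes "b \<le> x" "x \<le> 1" shows "\<delta>b \<le> zi x" "zi x \<le> 1" "z (zi x) = x"
proof -
  obtain \<delta> where d: "0 \<le> \<delta>" "\<delta> \<le> 1" "z \<delta> = x" using z_surj[of x] z_0_less assms by auto
  have "\<delta>b \<le> \<delta>" using d z_le_iff[of \<delta>b \<delta>] \<delta>b_props assms k1 by auto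
  then show "\<delta>b \<le> zi x" "zi x \<le> 1" "z (zi x) = x" using d zi_z by auto
qed

text \<open>The parameter with \<open>y ds = -1\<close>: both branches leave the diagonal point
  \<open>(-1, -1)\<close> from here.\<close>

definition ds :: real where "ds = zi (k - 1)"

lemma ds_props: "\<delta>b < ds" "ds < 1" "z ds = k - 1"
proof -
  have *: "b < k - 1" "k - 1 < 1" using k2 by (auto simp: b_of_def)
  show 1: "z ds = k - 1" unfolding ds_def using * by (intro zi_props) auto
  have "\<delta>b \<le> ds" "ds \<le> 1" unfolding ds_def using * by (auto intro!: zi_props)
  then show "\<delta>b < ds" "ds < 1" using 1 * \<delta>b_props by (auto simp: order_less_le)
qed

end

section \<open>Construction of the two branches\<close>

lemma MVT_derivE:
  fixes f f' :: "real \<Rightarrow> real"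
  assumes "a < c" "continuous_on {a..c} f"
    and "\<And>s. a < s \<Longrightarrow> s < c \<Longrightarrow> (f has_real_derivative f' s) (at s)"
  obtains \<xi> where "a < \<xi>" "\<xi> < c" "f c - f a = (c - a) * f' \<xi>"
proof -
  have "\<exists>l \<xi>. a < \<xi> \<and> \<xi> < c \<and> DERIV f \<xi> :> l \<and> f c - f a = (c - a) * l"
  proof (rule MVT[OF assms(1,2)])
    show "f differentiable (at s)" if "a < s" "s < c" for s
      using assms(3)[OF that] by (auto simp: real_differentiable_def)
  qed
  then obtain l \<xi> where *: "a < \<xi>" "\<xi> < c" "DERIV f \<xi> :> l" "f c - f a = (c - a) * l" by blast
  have "l = f' \<xi>" using DERIV_unique[OF *(3) assms(3)] * by simp
  then show thesis using that[of \<xi>] * by simp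
qed

context curtain begin

section \<open>Continuation of \<open>y\<close> and \<open>A\<close> past the parameter 1\<close>

abbreviation "A \<equiv> A_of k"

text \<open>Past 1 the curve \<open>y\<close> is continued by the line \<open>s - k\<close>, on
  which \<open>U\<close> moves for \<open>x0 \<le> x \<le> b\<close>; \<open>Ah\<close> is its
  antiderivative. The pieces fit since \<open>y 1 = 1 - k\<close>. One implicit equation then covers
  both prescriptions of the maps on \<open>[-1, b]\<close>.\<close>

definition yh :: "real \<Rightarrow> real" where "yh s = (if s \<le> 1 then y s else s - k)"
definition Ah :: "real \<Rightarrow> real" where
  "Ah s = (if s \<le> 1 then A s else A 1 + (s\<^sup>2 - 1) / 2 - k * (s - 1))"

lemma A_deriv:
  assumes "\<delta> < k"
  shows "(A has_real_derivative y \<delta>) (at \<delta> within S)"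
proof -
  have *: "ln ((k - 1) / (k - \<delta>)) = ln (k - 1) - ln (k - \<delta>)" using assms k1 by (simp add: ln_div)
  define g where "g = (\<lambda>\<delta>. (k - \<delta>) * ln (k - \<delta>))"
  have "(g has_real_derivative - ln (k - \<delta>) - 1) (at \<delta> within S)"
    unfolding g_def using assms by (auto intro!: derivative_eq_intros)
  then have "((\<lambda>\<delta>. (2 - k) * \<delta> - \<delta>\<^sup>2 / 2 + 2 * k * (\<delta> * ln (k - 1) + g \<delta> - (k - \<delta>))) has_real_derivative
      (2 - k) - \<delta> + 2 * k * (ln (k - 1) + (- ln (k - \<delta>) - 1) + 1)) (at \<delta> within S)"
    by (auto intro!: derivative_eq_intros)
  then show ?thesis
    unfolding A_of_def[abs_def] y_of_def z_of_def * g_def by (simp add: algebra_simps)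
qed

lemma Ah_deriv:
  assumes "0 \<le> s"
  shows "(Ah has_real_derivative yh s) (at s)"
proof -
  have L: "(Ah has_real_derivative y s) (at_left s)" if "s \<le> 1"
  proof (rule DERIV_subset)
    show "(Ah has_real_derivative y s) (at s within {..s})"
      by (rule has_field_derivative_transform_within[OF A_deriv[of s], of 1])
        (use that k1 in \<open>auto simp: Ah_def\<close>)
  qed auto
  have R: "(Ah has_real_derivative (s - k)) (at_right s)" if "1 \<le> s"
  proof (rule DERIV_subset)
    have *: "((\<lambda>s. A 1 + (s\<^sup>2 - 1) / 2 - k * (s - 1)) has_real_derivative s - k) (at s within {s..})"
      by (auto intro!: derivative_eq_intros)
    show "(Ah has_real_derivative (s - k)) (at s within {s..})"
    proof (rule has_field_derivative_transform_within[OF *, of 1])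
      show "A 1 + (u\<^sup>2 - 1) / 2 - k * (u - 1) = Ah u" if "u \<in> {s..}" for u
        using that \<open>1 \<le> s\<close> by (cases "u = 1") (auto simp: Ah_def)
    qed auto
  qed auto
  consider "s < 1" | "s = 1" | "s > 1" by linarith
  then show ?thesis
  proof cases
    case 1
    then have "(A has_real_derivative yh s) (at s)" using A_deriv[of s UNIV] k1 by (simp add: yh_def)
    then show ?thesis
      using 1 by (intro has_field_derivative_transform_within[where f = A and d = "1 - s" and g = Ah])
        (auto simp: Ah_def dist_real_def)
  next
    case 2
    have "y 1 = 1 - k" by (simp add: y_of_def)
    with L R 2 show ?thesis
      by (simp add: has_field_derivative_iff yh_def filterlim_at_split)
  next
    case 3
    have "((\<lambda>s. A 1 + (s\<^sup>2 - 1) / 2 - k * (s - 1)) has_real_derivative s - k) (at s)"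
      by (auto intro!: derivative_eq_intros)
    then show ?thesis
      using 3 by (intro has_field_derivative_transform_within[where f = "\<lambda>s. A 1 + (s\<^sup>2 - 1) / 2 - k * (s - 1)" and d = "s - 1" and g = Ah])
        (auto simp: Ah_def yh_def dist_real_def)
  qed
qed

lemma yh_slope:
  assumes "0 \<le> s" "s \<le> t"
  shows "t - s \<le> yh t - yh s"
proof -
  have *: "v - u \<le> y v - y u" if "0 \<le> u" "u \<le> v" "v \<le> 1" for u v
    using z_slope[of u v] that k1 by (simp add: y_of_def)
  have "y 1 = 1 - k" by (simp add: y_of_def)
  then show ?thesis using *[of s t] *[of s 1] assms by (auto simp: yh_def)
qed

lemma yh_less: "0 \<le> s \<Longrightarrow> s < t \<Longrightarrow> yh s < yh t"
  using yh_slope[of s t] by simp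

lemma yh_le: "0 \<le> s \<Longrightarrow> s \<le> t \<Longrightarrow> yh s \<le> yh t"
  using yh_slope[of s t] by simp

lemma yh_continuous: "continuous_on {0..} yh"
proof -
  have "continuous_on {..1} y"
    unfolding y_of_def[abs_def] using k1 by (intro continuous_intros z_continuous_on) auto
  then have "continuous_on ({..1} \<union> {1..}) yh"
    unfolding yh_def[abs_def] by (intro continuous_on_cases) (auto intro!: continuous_intros simp: y_of_def)
  then show ?thesis by (rule continuous_on_subset) auto
qed

lemma Ah_continuous: "continuous_on {0..} Ah"
  using Ah_deriv by (auto intro!: DERIV_continuous_on[where D = yh] intro: has_field_derivative_at_within)

text \<open>With \<open>x = (R - L) / 2 - 1\<close> the quadratic part is \<open>x ^ 2 - 1\<close>,
  so \<open>Phi L R = 0\<close> is the defining equation of the pair \<open>(L, R)\<close> with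
  \<open>x\<close> eliminated.\<close>

definition Phi :: "real \<Rightarrow> real \<Rightarrow> real" where
  "Phi L R = Ah R - Ah L - (R - L)\<^sup>2 / 4 + (R - L)"

text \<open>The derivative of \<open>Phi L\<close> at \<open>s\<close>. For a solution pair, its
  value at \<open>s = R\<close> is \<open>U x - x\<close>.\<close>

definition gap :: "real \<Rightarrow> real \<Rightarrow> real" where
  "gap L s = yh s + 1 - (s - L) / 2"

lemma gap_mono: "0 \<le> s \<Longrightarrow> s < t \<Longrightarrow> gap L s < gap L t"
  using yh_slope[of s t] by (simp add: gap_def field_simps)

lemma Phi_self [simp]: "Phi L L = 0"
  by (simp add: Phi_def)

lemma Phi_MVT_right:
  assumes "0 \<le> S" "S < R"
  obtains \<xi> where "S < \<xi>" "\<xi> < R" "Phi L R - Phi L S = (R - S) * gap L \<xi>"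
proof (rule MVT_derivE[of S R "Phi L" "gap L"])
  show "continuous_on {S..R} (Phi L)" unfolding Phi_def[abs_def]
    using assms by (intro continuous_intros continuous_on_subset[OF Ah_continuous]) auto
  show "(Phi L has_real_derivative gap L s) (at s)" if "S < s" "s < R" for s
    unfolding Phi_def[abs_def] gap_def using assms that
    by (auto intro!: derivative_eq_intros Ah_deriv simp: field_simps)
qed (use assms that in auto)

lemma Phi_pos:
  assumes "0 \<le> L" "L < R" "- 1 \<le> yh L" shows "0 < Phi L R"
proof -
  obtain \<xi> where x: "L < \<xi>" "\<xi> < R" "Phi L R - Phi L L = (R - L) * gap L \<xi>"
    using Phi_MVT_right assms by blast
  have "0 \<le> gap L L" using assms by (simp add: gap_def)
  also have "\<dots> < gap L \<xi>" using gap_mono x assms by auto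
  finally show ?thesis using x assms by simp
qed

text \<open>\<open>Phi L\<close> is strictly convex, because its derivative \<open>gap L\<close>
  increases (slope at least 1 of \<open>yh\<close> against 1/2), and it vanishes at
  \<open>L\<close>. A second zero \<open>R\<close> therefore fixes all signs.\<close>

lemma Phi_zero:
  assumes "0 \<le> L" "L < R" "Phi L R = 0"
  shows "0 < gap L R" "gap L L < 0"
    and "\<And>S. L < S \<Longrightarrow> S < R \<Longrightarrow> Phi L S < 0" "\<And>S. R < S \<Longrightarrow> 0 < Phi L S"
proof -
  obtain \<xi> where x: "L < \<xi>" "\<xi> < R" "Phi L R - Phi L L = (R - L) * gap L \<xi>"
    using Phi_MVT_right assms by blast
  then have "gap L \<xi> = 0" using assms by simp
  then show gR: "0 < gap L R" and "gap L L < 0"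
    using gap_mono[of \<xi> R L] gap_mono[of L \<xi> L] x assms by auto
  fix S
  show "Phi L S < 0" if S: "L < S" "S < R"
  proof (rule ccontr)
    assume neg: "\<not> Phi L S < 0"
    obtain \<xi>1 where 1: "L < \<xi>1" "\<xi>1 < S" "Phi L S - Phi L L = (S - L) * gap L \<xi>1"
      using Phi_MVT_right[of L S L] assms(1) S(1) by metis
    obtain \<xi>2 where 2: "S < \<xi>2" "\<xi>2 < R" "Phi L R - Phi L S = (R - S) * gap L \<xi>2"
      using Phi_MVT_right[of S R L] assms(1) S by (metis less_imp_le order_trans)
    have "0 \<le> (S - L) * gap L \<xi>1" using 1 neg by simp
    then have "0 \<le> gap L \<xi>1" using S by (simp add: zero_le_mult_iff)
    moreover have "(R - S) * gap L \<xi>2 \<le> 0" using 2 assms neg by simp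
    then have "gap L \<xi>2 \<le> 0" using S by (simp add: mult_le_0_iff)
    moreover have "gap L \<xi>1 < gap L \<xi>2" using 1 2 assms by (intro gap_mono) auto
    ultimately show False by simp
  qed
  show "0 < Phi L S" if S: "R < S"
  proof -
    have "0 \<le> R" using assms by simp
    from Phi_MVT_right[OF this S, of L] obtain \<xi>2 where 2: "R < \<xi>2" "\<xi>2 < S" "Phi L S - Phi L R = (S - R) * gap L \<xi>2"
      by metis
    have "gap L R < gap L \<xi>2" using 2 assms by (intro gap_mono) auto
    with gR 2 assms S show ?thesis by simp
  qed
qed

lemma yh_ds: "yh ds = -1"
  using ds_props by (simp add: yh_def y_of_def)

lemma yh_less_ds: "0 \<le> s \<Longrightarrow> s < ds \<Longrightarrow> yh s < -1"
  using yh_less[of s ds] yh_ds by simp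

lemma yh_gt_ds: "ds < s \<Longrightarrow> -1 < yh s"
  using yh_less[of ds s] yh_ds ds_props \<delta>b_props by simp

text \<open>The derivative in the left argument is \<open>- yh l - 1 + (R - l) / 2\<close>, which is
  positive as long as \<open>l < ds\<close>, where \<open>yh\<close> stays below -1.\<close>

lemma Phi_left_mono:
  assumes "0 \<le> L" "L < L'" "L' \<le> ds" "L' < R"
  shows "Phi L R < Phi L' R"
proof -
  obtain \<xi> where x: "L < \<xi>" "\<xi> < L'" "Phi L' R - Phi L R = (L' - L) * (- yh \<xi> - 1 + (R - \<xi>) / 2)"
  proof (rule MVT_derivE[of L L' "\<lambda>l. Phi l R" "\<lambda>l. - yh l - 1 + (R - l) / 2"])
    show "continuous_on {L..L'} (\<lambda>l. Phi l R)" unfolding Phi_def[abs_def]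
      using assms by (intro continuous_intros continuous_on_subset[OF Ah_continuous]) auto
    show "((\<lambda>l. Phi l R) has_real_derivative - yh s - 1 + (R - s) / 2) (at s)" if "L < s" "s < L'" for s
      unfolding Phi_def[abs_def] using assms that
      by (auto intro!: derivative_eq_intros Ah_deriv simp: field_simps)
  qed (use assms in auto)
  have "0 < - yh \<xi> - 1 + (R - \<xi>) / 2"
    using yh_less_ds[of \<xi>] x assms(1,3,4) by (simp add: field_simps)
  then have "0 < (L' - L) * (- yh \<xi> - 1 + (R - \<xi>) / 2)" using x by (intro mult_pos_pos) auto
  then show ?thesis using x by simp
qed

section \<open>The parameters \<open>LL\<close> and \<open>RR\<close> as functions of
  \<open>x\<close>\<close>

definition Psi :: "real \<Rightarrow> real \<Rightarrow> real" where
  "Psi x l = Ah (l + 2 * (x + 1)) - Ah l - x\<^sup>2 + 1"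

lemma Psi_eq_Phi: "Psi x l = Phi l (l + 2 * (x + 1))"
  by (simp add: Psi_def Phi_def power2_eq_square algebra_simps)

lemma Psi_strict_mono:
  assumes "-1 < x" "0 \<le> l" "l < l'"
  shows "Psi x l < Psi x l'"
proof -
  obtain \<xi> where x: "l < \<xi>" "\<xi> < l'" "Psi x l' - Psi x l = (l' - l) * (yh (\<xi> + 2 * (x + 1)) - yh \<xi>)"
  proof (rule MVT_derivE[of l l' "Psi x" "\<lambda>l. yh (l + 2 * (x + 1)) - yh l"])
    show "continuous_on {l..l'} (Psi x)" unfolding Psi_def[abs_def]
      using assms by (intro continuous_intros continuous_on_subset[OF Ah_continuous]
        continuous_on_compose2[OF Ah_continuous]) auto
    show "(Psi x has_real_derivative yh (s + 2 * (x + 1)) - yh s) (at s)" if "l < s" "s < l'" for s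
      unfolding Psi_def[abs_def] using assms that
      by (auto intro!: derivative_eq_intros Ah_deriv DERIV_chain2[OF Ah_deriv])
  qed (use assms in auto)
  have "yh \<xi> < yh (\<xi> + 2 * (x + 1))" using x assms by (intro yh_less) auto
  then have "0 < (l' - l) * (yh (\<xi> + 2 * (x + 1)) - yh \<xi>)" using x by (intro mult_pos_pos) auto
  then show ?thesis using x by simp
qed

lemma Psi_inj: "-1 < x \<Longrightarrow> 0 \<le> l \<Longrightarrow> 0 \<le> l' \<Longrightarrow> Psi x l = Psi x l' \<Longrightarrow> l = l'"
  using Psi_strict_mono[of x l l'] Psi_strict_mono[of x l' l] by (cases l l' rule: linorder_cases) auto

lemma A_diff:
  assumes "\<delta> \<le> 1"
  shows "A 1 - A \<delta> = (2 - k) * (1 - \<delta>) - (1 - \<delta>\<^sup>2) / 2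
    - 2 * k * (k - \<delta>) * ln ((k - \<delta>) / (k - 1)) + 2 * k * (1 - \<delta>)"
proof -
  have "ln ((k - \<delta>) / (k - 1)) = ln (k - \<delta>) - ln (k - 1)" using assms k1 by (simp add: ln_div)
  then show ?thesis unfolding A_of_def by (simp only: ring_distribs power2_eq_square diff_divide_distrib)
qed

text \<open>Past the parameter 1 the function \<open>Ah\<close> is quadratic, so the equation can be
  completed to a square. Its solutions satisfy \<open>x = b - \<delta> + W\<close> up to the sign of
  the root, which is where \<open>calW_of\<close> comes from.\<close>

lemma Psi_mid:
  assumes "\<delta> \<le> 1" "1 \<le> \<delta> + 2 * (x + 1)"
  shows "Psi x \<delta> = (x - b + \<delta>)\<^sup>2 - calW_of k \<delta>"
proof -
  have "Ah (\<delta> + 2 * (x + 1)) = A 1 + ((\<delta> + 2 * (x + 1))\<^sup>2 - 1) / 2 - k * (\<delta> + 2 * (x + 1) - 1)"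
    using assms by (cases "\<delta> + 2 * (x + 1) = 1") (auto simp only: Ah_def, auto)
  moreover have "Ah \<delta> = A \<delta>" using assms by (simp add: Ah_def)
  ultimately have "Psi x \<delta> = (A 1 - A \<delta>) + ((\<delta> + 2 * (x + 1))\<^sup>2 - 1) / 2 - k * (\<delta> + 2 * (x + 1) - 1) - x\<^sup>2 + 1"
    by (simp add: Psi_def)
  then show ?thesis
    unfolding A_diff[OF assms(1)] calW_of_def b_of_def
    by (simp add: power2_eq_square algebra_simps add_divide_distrib diff_divide_distrib)
qed

lemma calW_\<delta>b: "calW_of k \<delta>b = \<delta>b\<^sup>2"
proof -
  have "2 * k * ((k - \<delta>b) * ln ((k - \<delta>b) / (k - 1))) = (k - \<delta>b) * (4 - k - \<delta>b)"
    using ln_\<delta>b by (metis mult.left_commute)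
  then show ?thesis
    unfolding calW_of_def b_of_def by (simp add: power2_eq_square algebra_simps)
qed

lemma Psi_b: "Psi b \<delta>b = 0"
  using Psi_mid[of \<delta>b b] \<delta>b_props \<delta>b_bounds(2) calW_\<delta>b by (simp add: b_of_def)

text \<open>The left parameter on all of \<open>[-1, b]\<close>, without regard to
  \<open>x0\<close>. At \<open>x = -1\<close> the equation is void, since every \<open>l\<close>
  solves \<open>Psi (-1) l = 0\<close>, so the continuous choice \<open>ds\<close> is
  imposed.\<close>

definition LL :: "real \<Rightarrow> real" where
  "LL x = (if x \<le> -1 then ds else (THE l. \<delta>b \<le> l \<and> l \<le> ds \<and> Psi x l = 0))"

definition RR :: "real \<Rightarrow> real" where "RR x = LL x + 2 * (x + 1)"

lemma b_bounds: "-1 < b" "b < 0"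
  using k1 k2 by (auto simp: b_of_def)

lemma LL_ex1:
  assumes "-1 < x" "x \<le> b"
  shows "\<exists>!l. \<delta>b \<le> l \<and> l \<le> ds \<and> Psi x l = 0"
proof -
  have "Psi x \<delta>b \<le> 0"
  proof (cases "x = b")
    case False
    then show ?thesis using Phi_zero(3)[of \<delta>b "\<delta>b + 2 * (b + 1)" "\<delta>b + 2 * (x + 1)"] Psi_b assms \<delta>b_props
      by (simp add: Psi_eq_Phi)
  qed (simp add: Psi_b)
  moreover have "0 \<le> Psi x ds"
    using Phi_pos[of ds "ds + 2 * (x + 1)"] assms ds_props \<delta>b_props yh_ds by (simp add: Psi_eq_Phi)
  moreover have "continuous_on {\<delta>b..ds} (Psi x)" unfolding Psi_def[abs_def]
    using assms \<delta>b_props by (intro continuous_intros continuous_on_subset[OF Ah_continuous]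
        continuous_on_compose2[OF Ah_continuous]) auto
  ultimately have "\<exists>l\<ge>\<delta>b. l \<le> ds \<and> Psi x l = 0"
    using ds_props by (intro IVT') auto
  then show ?thesis using Psi_inj[OF assms(1)] \<delta>b_props
    by (metis less_eq_real_def order_trans)
qed

lemma LL_props:
  assumes "-1 \<le> x" "x \<le> b"
  shows "\<delta>b \<le> LL x" "LL x \<le> ds" "Psi x (LL x) = 0"
proof -
  have "\<delta>b \<le> LL x \<and> LL x \<le> ds \<and> Psi x (LL x) = 0"
  proof (cases "x = -1")
    case True
    then show ?thesis using ds_props by (simp add: LL_def Psi_def)
  next
    case False
    then show ?thesis using theI'[OF LL_ex1[of x]] assms by (simp add: LL_def)
  qed
  then show "\<delta>b \<le> LL x" "LL x \<le> ds" "Psi x (LL x) = 0" by auto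
qed

lemma LL_pos: "-1 \<le> x \<Longrightarrow> x \<le> b \<Longrightarrow> 0 < LL x"
  using LL_props[of x] \<delta>b_props by linarith

lemma LL_eqI:
  assumes "-1 < x" "x \<le> b" "0 \<le> l" "Psi x l = 0" shows "LL x = l"
  using Psi_inj[of x "LL x" l] LL_props[of x] LL_pos[of x] assms by auto

lemma LL_b: "LL b = \<delta>b"
  using LL_eqI[of b \<delta>b] Psi_b b_bounds \<delta>b_props by auto

lemma LL_m1 [simp]: "LL (-1) = ds" and RR_m1 [simp]: "RR (-1) = ds"
  by (auto simp: LL_def RR_def)

lemma RR_b: "RR b = 2 * k - 2 + \<delta>b"
  using LL_b by (simp add: RR_def) (simp add: b_of_def)

lemma Phi_LR:
  assumes "-1 \<le> x" "x \<le> b" shows "Phi (LL x) (RR x) = 0"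
  using LL_props[OF assms] by (simp add: Psi_eq_Phi RR_def)

lemma LL_less_ds:
  assumes "-1 < x" "x \<le> b" shows "LL x < ds"
proof -
  have "Psi x ds > 0"
    using Phi_pos[of ds "ds + 2 * (x + 1)"] assms ds_props \<delta>b_props yh_ds by (simp add: Psi_eq_Phi)
  then show ?thesis using LL_props[of x] assms by (cases "LL x = ds") auto
qed

lemma LL_less_RR: "-1 < x \<Longrightarrow> LL x < RR x"
  by (simp add: RR_def)

lemma RR_gt_ds:
  assumes "-1 < x" "x \<le> b" shows "ds < RR x"
proof (rule ccontr)
  assume "\<not> ds < RR x"
  then have "yh (RR x) \<le> -1"
    using yh_le[of "RR x" ds] yh_ds LL_less_RR[of x] LL_pos[of x] assms by auto
  moreover have "0 < gap (LL x) (RR x)"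
    using Phi_zero(1)[of "LL x" "RR x"] Phi_LR LL_less_RR LL_pos[of x] assms by auto
  ultimately show False using LL_less_RR[of x] assms by (simp add: gap_def)
qed

text \<open>Otherwise both parameters would move right. Past its zero \<open>RR x\<close> the convex
  function \<open>Phi (LL x)\<close> is positive, and raising the left argument only increases
  \<open>Phi\<close>, so the equation could not hold at \<open>x'\<close>.\<close>

lemma LL_strict_antimono:
  assumes "-1 \<le> x" "x < x'" "x' \<le> b" shows "LL x' < LL x"
proof (cases "x = -1")
  case True
  then show ?thesis using LL_less_ds assms by simp
next
  case False
  then have x: "-1 < x" using assms by simp
  show ?thesis
  proof (rule ccontr)
    assume "\<not> LL x' < LL x"
    then have le: "LL x \<le> LL x'" by simp
    have "RR x < RR x'" using le assms by (simp add: RR_def)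
    then have "0 < Phi (LL x) (RR x')"
      using Phi_zero(4)[of "LL x" "RR x" "RR x'"] Phi_LR[of x] LL_less_RR[of x] LL_pos[of x] x assms by auto
    also have "\<dots> \<le> Phi (LL x') (RR x')"
      using Phi_left_mono[of "LL x" "LL x'" "RR x'"] le LL_pos[of x] LL_props[of x'] LL_less_RR[of x'] x assms
      by (cases "LL x = LL x'") auto
    finally show False using Phi_LR[of x'] assms by simp
  qed
qed

lemma RR_strict_mono:
  assumes "-1 \<le> x" "x < x'" "x' \<le> b" shows "RR x < RR x'"
proof (cases "x = -1")
  case True
  then show ?thesis using RR_gt_ds assms by simp
next
  case False
  then have x: "-1 < x" using assms by simp
  show ?thesis
  proof (rule ccontr)
    assume "\<not> RR x < RR x'"
    have le: "LL x' < LL x" using LL_strict_antimono assms by simp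
    have ds: "LL x < RR x'" using LL_less_ds[of x] RR_gt_ds[of x'] x assms by simp
    have "Phi (LL x') (RR x') < Phi (LL x) (RR x')"
      using le LL_pos[of x'] LL_props[of x] x assms ds by (intro Phi_left_mono) auto
    also have "\<dots> \<le> 0"
      using Phi_zero(3)[of "LL x" "RR x" "RR x'"] Phi_LR[of x] LL_less_RR[of x] LL_pos[of x] x assms ds
        \<open>\<not> RR x < RR x'\<close> by (cases "RR x = RR x'") auto
    finally show False using Phi_LR[of x'] assms by simp
  qed
qed

lemma LL_le: "-1 \<le> x \<Longrightarrow> x \<le> x' \<Longrightarrow> x' \<le> b \<Longrightarrow> LL x' \<le> LL x"
  using LL_strict_antimono[of x x'] by (cases "x = x'") auto

lemma RR_le: "-1 \<le> x \<Longrightarrow> x \<le> x' \<Longrightarrow> x' \<le> b \<Longrightarrow> RR x \<le> RR x'"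
  using RR_strict_mono[of x x'] by (cases "x = x'") auto

text \<open>\<open>LL\<close> decreases while \<open>LL x + 2 * (x + 1)\<close> increases, which
  caps the rate of decrease at 2.\<close>

lemma LL_lipschitz: "2-lipschitz_on {-1..b} LL"
proof (rule lipschitz_onI)
  have *: "\<bar>LL x - LL x'\<bar> \<le> 2 * \<bar>x - x'\<bar>" if "-1 \<le> x" "x \<le> x'" "x' \<le> b" for x x'
    using LL_le[OF that] RR_le[OF that] that by (simp add: RR_def abs_if)
  fix x x' assume "x \<in> {-1..b}" "x' \<in> {-1..b}"
  then show "dist (LL x) (LL x') \<le> 2 * dist x x'"
    using *[of x x'] *[of x' x] by (cases "x \<le> x'") (auto simp: dist_real_def abs_minus_commute)
qed simp

lemma LL_continuous: "continuous_on {-1..b} LL"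
  using LL_lipschitz by (rule lipschitz_on_continuous_on)

lemma RR_continuous: "continuous_on {-1..b} RR"
  unfolding RR_def[abs_def] by (intro continuous_intros LL_continuous)

lemma T_eq_Phi: "\<delta> \<le> 1 \<Longrightarrow> T_of k \<delta> = Phi \<delta> 1"
  by (simp add: T_of_def Phi_def Ah_def power2_eq_square field_simps)

abbreviation "\<delta>0 \<equiv> delta_0 k"
abbreviation "x0 \<equiv> x_0 k"

text \<open>The point is found by the intermediate value theorem as the one where the right
  parameter equals 1. It matches the description of \<open>delta_0\<close>: a zero of
  \<open>T\<close> at or right of \<open>ds\<close> is excluded by \<open>Phi_pos\<close>, and left
  of \<open>ds\<close> the strict monotonicity of \<open>Phi\<close> in its left argument leaves
  only one.\<close>

lemma x0_props: "-1 < x0" "x0 < b" "RR x0 = 1" "LL x0 = \<delta>0" "\<delta>b < \<delta>0" "\<delta>0 < ds" "Phi \<delta>0 1 = 0"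
proof -
  have "\<exists>x\<ge>-1. x \<le> b \<and> RR x = 1"
    using ds_props \<delta>b_bounds b_bounds RR_continuous by (intro IVT') (auto simp: RR_b)
  then obtain x where x: "-1 \<le> x" "x \<le> b" "RR x = 1" by blast
  have x1: "-1 < x" using x ds_props by (cases "x = -1") auto
  have xb: "x < b" using x \<delta>b_bounds RR_b by (cases "x = b") auto
  define l where "l = LL x"
  have l: "\<delta>b < l" "l < ds" "Phi l 1 = 0"
    using LL_less_ds[OF x1 x(2)] LL_strict_antimono[of x b] x xb LL_b Phi_LR[of x] by (auto simp: l_def)
  have "\<exists>!\<delta>. \<delta>b < \<delta> \<and> \<delta> < 1 \<and> T_of k \<delta> = 0"
  proof (rule ex1I[of _ l])
    show "\<delta>b < l \<and> l < 1 \<and> T_of k l = 0" using l ds_props by (simp add: T_eq_Phi)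
    fix e assume e: "\<delta>b < e \<and> e < 1 \<and> T_of k e = 0"
    then have Pe: "Phi e 1 = 0" using T_eq_Phi[of e] by simp
    have "e < ds"
    proof (rule ccontr)
      assume "\<not> e < ds"
      then have "-1 \<le> yh e" using yh_gt_ds[of e] yh_ds by (cases "e = ds") auto
      then show False using Phi_pos[of e 1] e Pe \<delta>b_props by simp
    qed
    then show "e = l"
      using Phi_left_mono[of e l 1] Phi_left_mono[of l e 1] Pe l e ds_props \<delta>b_props
      by (cases e l rule: linorder_cases) auto
  qed
  from the1_equality[OF this, of l] have "\<delta>0 = l"
    using l ds_props by (simp add: delta_0_def T_eq_Phi)
  moreover from this have "x0 = x" using x(3) by (simp add: x_0_def RR_def l_def)
  ultimately show "-1 < x0" "x0 < b" "RR x0 = 1" "LL x0 = \<delta>0" "\<delta>b < \<delta>0" "\<delta>0 < ds" "Phi \<delta>0 1 = 0"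
    using x x1 xb l by (auto simp: l_def)
qed

lemma LR_of_eq:
  assumes "-1 < x" "x \<le> x0" shows "LR_of k x = (LL x, RR x)"
  unfolding LR_of_def
proof (rule the_equality)
  have xb: "x \<le> b" using assms x0_props by simp
  have R: "RR x \<le> 1" using RR_le[of x x0] x0_props assms by simp
  have *: "A (RR x) - A (LL x) = x\<^sup>2 - 1"
    using LL_props[of x] R LL_less_RR[of x] assms xb by (simp add: Psi_def Ah_def RR_def)
  show "case (LL x, RR x) of (L, R) \<Rightarrow> R - L = 2 * (x + 1) \<and> A R - A L = x\<^sup>2 - 1 \<and> \<delta>b \<le> L \<and> L < R \<and> R \<le> 1"
    using * R LL_less_RR[of x] LL_props[of x] assms xb by (simp add: RR_def)
  fix p assume "case p of (L, R) \<Rightarrow> R - L = 2 * (x + 1) \<and> A R - A L = x\<^sup>2 - 1 \<and> \<delta>b \<le> L \<and> L < R \<and> R \<le> 1"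
  then obtain L R where p: "p = (L, R)" "R - L = 2 * (x + 1)" "A R - A L = x\<^sup>2 - 1" "\<delta>b \<le> L" "L < R" "R \<le> 1"
    by (cases p) auto
  have "R = L + 2 * (x + 1)" using p by simp
  then have "Psi x L = 0" using p by (simp add: Psi_def Ah_def)
  then have "LL x = L" using assms xb p \<delta>b_props by (intro LL_eqI) auto
  then show "p = (LL x, RR x)" using p by (simp add: RR_def)
qed

lemma mid_gap_pos:
  assumes "-1 < x" "x \<le> b" shows "x < yh (RR x)"
  using Phi_zero(1)[of "LL x" "RR x"] Phi_LR LL_less_RR LL_pos[of x] assms by (simp add: gap_def RR_def field_simps)

lemma W_LL:
  assumes "x0 \<le> x" "x \<le> b" shows "W_of k (LL x) = x - b + LL x"
proof -
  have R: "1 \<le> RR x" using RR_le[of x0 x] x0_props assms by simp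
  have x: "-1 < x" using assms x0_props by simp
  have L1: "LL x \<le> 1" using LL_props[of x] ds_props x assms by simp
  have "yh (RR x) = RR x - k" using R by (auto simp: yh_def y_of_def)
  then have "0 < x - b + LL x" using mid_gap_pos[of x] x assms by (simp add: RR_def b_of_def)
  moreover have "calW_of k (LL x) = (x - b + LL x)\<^sup>2"
    using Psi_mid[of "LL x" x] LL_props[of x] R x L1 assms by (simp add: RR_def)
  ultimately show ?thesis by (simp add: W_of_def)
qed

lemma delta_mid_eq:
  assumes "x0 \<le> x" "x \<le> b" shows "delta_mid k x = LL x"
  unfolding delta_mid_def
proof (rule the_equality)
  have x: "-1 < x" using assms x0_props by simp
  show "\<delta>b \<le> LL x \<and> LL x \<le> \<delta>0 \<and> x = b - LL x + W_of k (LL x)"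
    using LL_le[of x0 x] LL_props[of x] W_LL x0_props x assms by auto
  fix e assume e: "\<delta>b \<le> e \<and> e \<le> \<delta>0 \<and> x = b - e + W_of k e"
  have e1: "e \<le> 1" using e x0_props ds_props by simp
  \<comment> \<open>\<open>Psi_mid\<close> applies to the competitor \<open>e\<close> only if its
    right parameter \<open>e + 2 * (x + 1)\<close> is at least 1. The sign of
    \<open>Phi e 1\<close>, evaluated by \<open>Psi_mid\<close> at the \<open>x\<close> whose right
    parameter is exactly 1, yields this.\<close>
  have "Phi e 1 \<le> 0"
    using Phi_left_mono[of e \<delta>0 1] x0_props e ds_props \<delta>b_props by (cases "e = \<delta>0") auto
  moreover have "Phi e 1 = ((e - 1) / 2 - b)\<^sup>2 - calW_of k e"
  proof -
    have 1: "Psi (- (1 + e) / 2) e = Phi e 1" by (simp add: Psi_eq_Phi field_simps)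
    have 2: "- (1 + e) / 2 - b + e = (e - 1) / 2 - b" by (simp add: field_simps)
    have 3: "1 \<le> e + 2 * (- (1 + e) / 2 + 1)" by (simp add: field_simps)
    show ?thesis using Psi_mid[OF e1 3] unfolding 1 2 .
  qed
  ultimately have W: "((e - 1) / 2 - b)\<^sup>2 \<le> calW_of k e" by simp
  then have W0: "0 \<le> calW_of k e" by (meson order_trans zero_le_power2)
  have "\<bar>(e - 1) / 2 - b\<bar> \<le> W_of k e"
    unfolding W_of_def using W by (intro real_le_rsqrt) simp
  then have "(e - 1) / 2 - b \<le> W_of k e" by linarith
  then have "- (1 + e) / 2 \<le> x" using e by (simp add: field_simps)
  then have "1 \<le> e + 2 * (x + 1)" by (simp add: field_simps)
  moreover have "calW_of k e = (x - b + e)\<^sup>2"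
    using e W0 by (simp add: W_of_def) (metis add_diff_cancel_left' diff_add_cancel real_sqrt_pow2)?
  ultimately have "Psi x e = 0" using Psi_mid[of e x] e1 by simp
  then show "e = LL x" using LL_eqI[of x e] x assms e \<delta>b_props by auto
qed

section \<open>The maps \<open>D\<close> and \<open>U\<close> in terms of the parameters\<close>

abbreviation "D \<equiv> D_map k"
abbreviation "U \<equiv> U_map k"

lemma D_left: assumes "-1 \<le> x" "x \<le> b" shows "D x = yh (LL x)"
proof -
  have "LL x \<le> 1" using LL_props[OF assms] ds_props by simp
  then show ?thesis
    using assms yh_ds LR_of_eq[of x] delta_mid_eq[of x] by (auto simp: D_map_def yh_def y_of_def)
qed

lemma U_left: assumes "-1 \<le> x" "x \<le> b" shows "U x = yh (RR x)"
proof -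
  consider "x = -1" | "-1 < x" "x \<le> x0" | "x0 < x" using assms by linarith
  then show ?thesis
  proof cases
    case 1 then show ?thesis using yh_ds by (simp add: U_map_def)
  next
    case 2
    moreover have "RR x \<le> 1" using RR_le[of x x0] x0_props 2 by simp
    ultimately show ?thesis using LR_of_eq[of x] by (simp add: U_map_def yh_def)
  next
    case 3
    moreover have "1 < RR x" using RR_strict_mono[of x0 x] x0_props 3 assms by simp
    ultimately show ?thesis using delta_mid_eq[of x] W_LL[of x] x0_props assms
      by (simp add: U_map_def yh_def RR_def b_of_def)
  qed
qed

lemma D_right: "b \<le> x \<Longrightarrow> D x = x - k"
  using D_left[of b] LL_b \<delta>b_props b_bounds x0_props
  by (cases "x = b") (auto simp: D_map_def yh_def y_of_def)

lemma zi_b: "zi b = \<delta>b" and zi_1: "zi 1 = 1"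
  using zi_z[of \<delta>b] zi_z[of 1] \<delta>b_props by auto

lemma U_right: "b \<le> x \<Longrightarrow> U x = x + zi x"
  using U_left[of b] RR_b \<delta>b_props b_bounds x0_props zi_b \<delta>b_bounds
  by (cases "x = b") (auto simp: U_map_def yh_def b_of_def)

end

section \<open>Monotonicity and derivatives of the branches\<close>

lemma deriv_nonneg_imp_le:
  fixes f :: "real \<Rightarrow> real"
  assumes "a \<le> c" "continuous_on {a..c} f"
    and der: "\<And>s. a < s \<Longrightarrow> s < c \<Longrightarrow> \<exists>D. (f has_real_derivative D) (at s) \<and> 0 \<le> D"
  shows "f a \<le> f c"
proof (cases "a = c")
  case False
  obtain f' where f': "\<And>s. a < s \<Longrightarrow> s < c \<Longrightarrow> (f has_real_derivative f' s) (at s) \<and> 0 \<le> f' s"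
    using der by metis
  obtain \<xi> where \<xi>: "a < \<xi>" "\<xi> < c" "f c - f a = (c - a) * f' \<xi>"
    using assms False f' by (rule_tac MVT_derivE[of a c f f']) auto
  have "0 \<le> (c - a) * f' \<xi>" using f' \<xi> by simp
  then show ?thesis using \<xi> by simp
qed simp

context curtain begin

abbreviation "w \<equiv> w_of k"
abbreviation "d \<equiv> d_of k"
abbreviation "t \<equiv> t_of k"

lemma zi_mono:
  assumes "b \<le> x" "x \<le> x'" "x' \<le> 1" shows "zi x \<le> zi x'" "zi x' - zi x \<le> x' - x"
proof -
  have a: "\<delta>b \<le> zi x" "zi x \<le> 1" "z (zi x) = x" "\<delta>b \<le> zi x'" "zi x' \<le> 1" "z (zi x') = x'"
    using zi_props[of x] zi_props[of x'] assms by auto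
  then show 1: "zi x \<le> zi x'" using z_le_iff[of "zi x" "zi x'"] assms k1 \<delta>b_props by auto
  show "zi x' - zi x \<le> x' - x" using z_slope[of "zi x" "zi x'"] a 1 k1 \<delta>b_props by simp
qed

lemma zi_continuous: "continuous_on {b..1} zi"
proof (rule lipschitz_on_continuous_on, rule lipschitz_onI)
  fix x x' assume "x \<in> {b..1}" "x' \<in> {b..1}"
  then show "dist (zi x) (zi x') \<le> 1 * dist x x'"
    using zi_mono[of x x'] zi_mono[of x' x] by (cases "x \<le> x'") (auto simp: dist_real_def)
qed simp

lemma zi_deriv:
  assumes "b < x" "x < 1"
  shows "(zi has_real_derivative (k - zi x) / (k + zi x)) (at x)"
proof -
  have a: "\<delta>b \<le> zi x" "zi x \<le> 1" "z (zi x) = x" using zi_props[of x] assms by auto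
  have "(zi has_real_derivative inverse ((k + zi x) / (k - zi x))) (at x)"
  proof (rule DERIV_inverse_function[of z])
    show "(z has_real_derivative (k + zi x) / (k - zi x)) (at (zi x))"
      using a k1 by (intro z_deriv) auto
    show "isCont zi x" using zi_continuous assms by (auto intro: continuous_on_interior)
    show "z (zi u) = u" if "b < u" "u < 1" for u using zi_props[of u] that by simp
  qed (use a k1 assms \<delta>b_props in auto)
  then show ?thesis by simp
qed

lemma w_right: "b \<le> x \<Longrightarrow> w x = zi x" and d_right: "b \<le> x \<Longrightarrow> d x = - k"
  by (auto simp: w_of_def d_of_def U_right D_right)

lemma U_strict_mono_left: "-1 \<le> x \<Longrightarrow> x < x' \<Longrightarrow> x' \<le> b \<Longrightarrow> U x < U x'"
  using RR_strict_mono[of x x'] RR_le[of "-1" x] ds_props \<delta>b_props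
  by (simp add: U_left) (intro yh_less, auto)

lemma U_strict_mono_right: "b \<le> x \<Longrightarrow> x < x' \<Longrightarrow> x' \<le> 1 \<Longrightarrow> U x < U x'"
  using zi_mono[of x x'] by (simp add: U_right)

lemma U_strict_mono: "-1 \<le> x \<Longrightarrow> x < x' \<Longrightarrow> x' \<le> 1 \<Longrightarrow> U x < U x'"
  using U_strict_mono_left[of x x'] U_strict_mono_right[of x x'] U_strict_mono_left[of x b] U_strict_mono_right[of b x']
  by (cases "x' \<le> b"; cases "b \<le> x"; cases "x' = b") auto

lemma U_le_iff: "-1 \<le> x \<Longrightarrow> x \<le> 1 \<Longrightarrow> -1 \<le> x' \<Longrightarrow> x' \<le> 1 \<Longrightarrow> U x \<le> U x' \<longleftrightarrow> x \<le> x'"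
  using U_strict_mono[of x x'] U_strict_mono[of x' x] by (cases x x' rule: linorder_cases) auto

lemma U_less_iff: "-1 \<le> x \<Longrightarrow> x \<le> 1 \<Longrightarrow> -1 \<le> x' \<Longrightarrow> x' \<le> 1 \<Longrightarrow> U x < U x' \<longleftrightarrow> x < x'"
  using U_le_iff[of x' x] by auto

lemma D_strict_antimono: "-1 \<le> x \<Longrightarrow> x < x' \<Longrightarrow> x' \<le> b \<Longrightarrow> D x' < D x"
  using LL_strict_antimono[of x x'] LL_pos[of x'] by (simp add: D_left yh_less)

lemma D_le_iff: "-1 \<le> x \<Longrightarrow> x \<le> b \<Longrightarrow> -1 \<le> x' \<Longrightarrow> x' \<le> b \<Longrightarrow> D x \<le> D x' \<longleftrightarrow> x' \<le> x"
  using D_strict_antimono[of x x'] D_strict_antimono[of x' x] by (cases x x' rule: linorder_cases) auto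

lemma D_m1: "D (-1) = -1" and U_m1: "U (-1) = -1" and D_b: "D b = -2" and U_1: "U 1 = 2"
  and U_x0: "U x0 = 1 - k" and U_b: "U b = b + \<delta>b" and D_1: "D 1 = 1 - k"
  using U_right[of 1] D_right[of b] D_right[of 1] U_left[of x0] x0_props U_right[of b] b_bounds zi_1 zi_b
  by (auto simp: D_map_def U_map_def b_of_def yh_def y_of_def)

lemma D_continuous_left: "continuous_on {-1..b} D"
proof -
  have "continuous_on {-1..b} (\<lambda>x. yh (LL x))"
    by (rule continuous_on_compose2[OF yh_continuous LL_continuous]) (use LL_pos in \<open>auto intro: less_imp_le\<close>)
  then show ?thesis by (rule continuous_on_eq) (auto simp: D_left)
qed

lemma U_continuous_left: "continuous_on {-1..b} U"
proof -
  have "continuous_on {-1..b} (\<lambda>x. yh (RR x))"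
  proof (rule continuous_on_compose2[OF yh_continuous RR_continuous])
    show "RR ` {-1..b} \<subseteq> {0..}" using LL_pos by (fastforce simp: RR_def)
  qed
  then show ?thesis by (rule continuous_on_eq) (auto simp: U_left)
qed

lemma m1_b_1: "{-1..b} \<union> {b..1} = {-1..(1::real)}"
  using b_bounds by auto

lemma D_continuous: "continuous_on {-1..1} D"
proof -
  have "continuous_on {b..1} D"
    by (rule continuous_on_eq[of _ "\<lambda>x. x - k"]) (auto simp: D_right intro!: continuous_intros)
  then have "continuous_on ({-1..b} \<union> {b..1}) D"
    by (intro continuous_on_closed_Un D_continuous_left) auto
  then show ?thesis by (simp only: m1_b_1)
qed

lemma U_continuous: "continuous_on {-1..1} U"
proof -
  have "continuous_on {b..1} U"
    by (rule continuous_on_eq[of _ "\<lambda>x. x + zi x"]) (auto simp: U_right intro!: continuous_intros zi_continuous)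
  then have "continuous_on ({-1..b} \<union> {b..1}) U"
    by (intro continuous_on_closed_Un U_continuous_left) auto
  then show ?thesis by (simp only: m1_b_1)
qed

lemma w_continuous: "continuous_on {-1..1} w" and d_continuous: "continuous_on {-1..1} d"
  unfolding w_of_def[abs_def] d_of_def[abs_def] by (intro continuous_intros U_continuous D_continuous)+

lemma D_image: "D ` {-1..b} = {-2..-1}"
proof
  show "D ` {-1..b} \<subseteq> {-2..-1}"
  proof safe
    fix x assume "x \<in> {-1..b}"
    then show "D x \<in> {-2..-1}" using D_le_iff[of x "-1"] D_le_iff[of b x] D_m1 D_b b_bounds by simp
  qed
  show "{-2..-1} \<subseteq> D ` {-1..b}"
  proof
    fix y :: real assume "y \<in> {-2..-1}"
    then have "\<exists>x\<ge>-1. x \<le> b \<and> D x = y"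
      using D_m1 D_b b_bounds D_continuous_left by (intro IVT2') auto
    then show "y \<in> D ` {-1..b}" by auto
  qed
qed

lemma U_surj:
  assumes "-1 \<le> c" "c \<le> 1" shows "U ` {-1..c} = {-1..U c}"
proof
  show "U ` {-1..c} \<subseteq> {-1..U c}"
  proof safe
    fix x assume "x \<in> {-1..c}"
    then show "U x \<in> {-1..U c}" using U_le_iff[of "-1" x] U_le_iff[of x c] U_m1 assms by simp
  qed
  show "{-1..U c} \<subseteq> U ` {-1..c}"
  proof
    fix y :: real assume "y \<in> {-1..U c}"
    then have "\<exists>x\<ge>-1. x \<le> c \<and> U x = y"
      using U_m1 assms continuous_on_subset[OF U_continuous] by (intro IVT') auto
    then show "y \<in> U ` {-1..c}" by auto
  qed
qed

lemma D_inj: "inj_on D {-1..b}"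
proof (rule inj_onI)
  fix x y assume "x \<in> {-1..b}" "y \<in> {-1..b}" "D x = D y"
  then show "x = y" using D_le_iff[of x y] D_le_iff[of y x] by auto
qed

lemma U_inj: "c \<le> 1 \<Longrightarrow> inj_on U {-1..c}"
proof (rule inj_onI)
  fix x y assume "c \<le> 1" "x \<in> {-1..c}" "y \<in> {-1..c}" "U x = U y"
  then show "x = y" using U_le_iff[of x y] U_le_iff[of y x] by auto
qed

lemma t_D: "-1 \<le> x \<Longrightarrow> x \<le> b \<Longrightarrow> t (D x) = x"
  using D_image D_inj by (auto simp: t_of_def)

lemma t_U: "-1 \<le> x \<Longrightarrow> x \<le> 1 \<Longrightarrow> t (U x) = x"
proof (cases "x = -1")
  case True
  then show ?thesis using t_D[of "-1"] D_m1 U_m1 b_bounds by simp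
next
  case False
  assume "-1 \<le> x" "x \<le> 1"
  then show ?thesis using U_strict_mono[of "-1" x] U_m1 U_inj[of 1] False
    by (auto simp: t_of_def)
qed

lemma t_lower: assumes "-2 \<le> v" "v \<le> -1" shows "-1 \<le> t v" "t v \<le> b" "D (t v) = v"
proof -
  from assms D_image have "v \<in> D ` {-1..b}" by simp
  then obtain x where "v = D x" "-1 \<le> x" "x \<le> b" by auto
  then show "-1 \<le> t v" "t v \<le> b" "D (t v) = v" using t_D by auto
qed

lemma t_upper: assumes "-1 \<le> v" "v \<le> 2" shows "-1 \<le> t v" "t v \<le> 1" "U (t v) = v"
proof -
  from assms U_surj[of 1] U_1 have "v \<in> U ` {-1..1}" by simp
  then obtain x where "v = U x" "-1 \<le> x" "x \<le> 1" by auto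
  then show "-1 \<le> t v" "t v \<le> 1" "U (t v) = v" using t_U by auto
qed

lemma t_range: assumes "-2 \<le> v" "v \<le> 2" shows "-1 \<le> t v" "t v \<le> 1"
  using t_lower[of v] t_upper[of v] assms b_bounds by (cases "v \<le> -1", auto)+

lemma t_continuous: "continuous_on {-2..2} t"
proof -
  have "continuous_on (D ` {-1..b}) t"
    by (rule continuous_on_inv[OF D_continuous_left]) (auto simp: t_D)
  moreover have "continuous_on (U ` {-1..1}) t"
    by (rule continuous_on_inv[OF U_continuous]) (auto simp: t_U)
  ultimately have "continuous_on ({-2..-1} \<union> {-1..2}) t"
    using D_image U_surj[of 1] U_1 by (intro continuous_on_closed_Un) auto
  moreover have "{-2..-1} \<union> {-1..2} = {-2..(2::real)}" by auto
  ultimately show ?thesis by simp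
qed

lemma t_antimono: "-2 \<le> u \<Longrightarrow> u \<le> v \<Longrightarrow> v \<le> -1 \<Longrightarrow> t v \<le> t u"
  using t_lower[of u] t_lower[of v] D_le_iff[of "t u" "t v"] by auto

lemma t_mono: "-1 \<le> u \<Longrightarrow> u \<le> v \<Longrightarrow> v \<le> 2 \<Longrightarrow> t u \<le> t v"
  using t_upper[of u] t_upper[of v] U_le_iff[of "t u" "t v"] by auto

lemma w_pos: assumes "-1 < x" "x \<le> 1" shows "0 < w x"
  using mid_gap_pos[of x] U_left[of x] w_right[of x] zi_props[of x] \<delta>b_props assms
  by (cases "x \<le> b") (auto simp: w_of_def)

lemma d_neg: assumes "-1 < x" "x \<le> 1" shows "d x < 0"
  using D_strict_antimono[of "-1" x] D_m1 d_right[of x] k1 assms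
  by (cases "x \<le> b") (auto simp: d_of_def)

lemma w_m1: "w (-1) = 0" and d_m1: "d (-1) = 0" by (auto simp: w_of_def d_of_def D_m1 U_m1)

lemma w_nonneg: "-1 \<le> x \<Longrightarrow> x \<le> 1 \<Longrightarrow> 0 \<le> w x" and d_nonpos: "-1 \<le> x \<Longrightarrow> x \<le> 1 \<Longrightarrow> d x \<le> 0"
  using w_pos[of x] d_neg[of x] w_m1 d_m1 by (cases "x = -1", auto)+

lemma d_antimono: "-1 \<le> x \<Longrightarrow> x \<le> x' \<Longrightarrow> x' \<le> b \<Longrightarrow> d x' \<le> d x"
  using D_le_iff[of x' x] by (auto simp: d_of_def)

lemma d_ge: "-1 \<le> x \<Longrightarrow> x \<le> 1 \<Longrightarrow> - k \<le> d x"
  using d_antimono[of x b] d_right[of b] d_right[of x] by (cases "x \<le> b") auto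

text \<open>The slope bound of \<open>yh\<close> between \<open>RR x\<close> and
  \<open>RR b\<close>. Since \<open>LL (\<alpha> x) = zi x\<close> on the lower part of
  \<open>[b, 1]\<close>, it later compares \<open>w (\<alpha> x)\<close> with
  \<open>w x\<close>.\<close>

lemma w_le_LL:
  assumes "-1 \<le> x" "x \<le> b" shows "w x \<le> LL x - (b - x)"
proof -
  have "RR b - RR x \<le> yh (RR b) - yh (RR x)"
    using RR_le[of x b] RR_le[of "-1" x] ds_props \<delta>b_props assms by (intro yh_slope) auto
  moreover have "yh (RR b) = b + \<delta>b" using U_b U_left[of b] b_bounds by simp
  ultimately show ?thesis using U_left[of x] assms LL_b by (simp add: w_of_def RR_def)
qed

lemma w_le_1: "-1 \<le> x \<Longrightarrow> x \<le> 1 \<Longrightarrow> w x \<le> 1"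
  using w_le_LL[of x] LL_props[of x] ds_props w_right[of x] zi_props[of x] by (cases "x \<le> b") auto

lemma U_minus_D: "U x - D x = w x - d x"
  by (simp add: w_of_def d_of_def)

text \<open>Implicit differentiation of \<open>Ah (RR x) - Ah (LL x) = x ^ 2 - 1\<close> with
  \<open>RR' = LL' + 2\<close>. The Caratheodory slopes \<open>gR\<close> and \<open>gL\<close>
  allow the difference quotient of \<open>LL\<close> to be solved for exactly, so continuity of
  \<open>LL\<close> suffices to pass to the limit.\<close>

lemma LL_deriv:
  assumes x: "-1 < x" "x < b"
  shows "(LL has_real_derivative - 2 * w x / (w x - d x)) (at x)"
proof -
  have x': "-1 \<le> x" "x \<le> b" "x \<le> 1" using x b_bounds by auto
  have pos: "0 < LL x" "0 < RR x" using LL_pos[OF x'(1,2)] LL_less_RR[of x] x by auto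
  obtain gR where gR: "\<And>v. Ah v - Ah (RR x) = gR v * (v - RR x)" "isCont gR (RR x)" "gR (RR x) = U x"
    using Ah_deriv[of "RR x"] pos U_left[OF x'(1,2)] by (auto simp: CARAT_DERIV)
  obtain gL where gL: "\<And>v. Ah v - Ah (LL x) = gL v * (v - LL x)" "isCont gL (LL x)" "gL (LL x) = D x"
    using Ah_deriv[of "LL x"] pos D_left[OF x'(1,2)] by (auto simp: CARAT_DERIV)
  have cont: "isCont LL x" "isCont RR x"
    using continuous_on_interior[OF LL_continuous] continuous_on_interior[OF RR_continuous] x by auto
  have lim: "((\<lambda>v. gR (RR v) - gL (LL v)) \<longlongrightarrow> U x - D x) (at x)" "((\<lambda>v. x + v - 2 * gR (RR v)) \<longlongrightarrow> x + x - 2 * U x) (at x)"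
  proof -
    have R: "((\<lambda>v. gR (RR v)) \<longlongrightarrow> U x) (at x)" and L: "((\<lambda>v. gL (LL v)) \<longlongrightarrow> D x) (at x)"
      using isCont_o2[OF cont(2) gR(2)] isCont_o2[OF cont(1) gL(2)] gR(3) gL(3) by (auto simp: isCont_def)
    show "((\<lambda>v. gR (RR v) - gL (LL v)) \<longlongrightarrow> U x - D x) (at x)"
      by (intro tendsto_intros R L)
    show "((\<lambda>v. x + v - 2 * gR (RR v)) \<longlongrightarrow> x + x - 2 * U x) (at x)"
      by (intro tendsto_intros R)
  qed
  have UD: "0 < U x - D x" using w_pos[of x] d_neg[of x] x x' by (simp add: U_minus_D)
  have "((\<lambda>v. (x + v - 2 * gR (RR v)) / (gR (RR v) - gL (LL v))) \<longlongrightarrow> (x + x - 2 * U x) / (U x - D x)) (at x)"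
    using lim UD by (intro tendsto_divide) auto
  moreover have "\<forall>\<^sub>F v in at x. (x + v - 2 * gR (RR v)) / (gR (RR v) - gL (LL v)) = (LL v - LL x) / (v - x)"
  proof -
    have "\<forall>\<^sub>F v in at x. gR (RR v) - gL (LL v) > 0"
      using order_tendstoD(1)[OF lim(1) UD] .
    moreover have "\<forall>\<^sub>F v in at x. v \<in> {-1<..<b}" using x by (intro eventually_at_in_open') auto
    moreover have "\<forall>\<^sub>F v in at x. v \<noteq> x" by (simp add: eventually_at_filter)
    ultimately show ?thesis
    proof eventually_elim
      case (elim v)
      have 1: "Ah (RR v) - Ah (LL v) - v\<^sup>2 + 1 = 0" "Ah (RR x) - Ah (LL x) - x\<^sup>2 + 1 = 0"
        using LL_props(3)[of v] LL_props(3)[of x] elim x' by (auto simp: Psi_def RR_def)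
      have 2: "RR v - RR x = (LL v - LL x) + 2 * (v - x)" by (simp add: RR_def)
      have "gR (RR v) * (RR v - RR x) - gL (LL v) * (LL v - LL x) = v\<^sup>2 - x\<^sup>2"
        using 1 gR(1)[of "RR v"] gL(1)[of "LL v"] by simp
      then have "(LL v - LL x) * (gR (RR v) - gL (LL v)) = (x + v - 2 * gR (RR v)) * (v - x)"
        unfolding 2 by (simp add: power2_eq_square algebra_simps)
      then show ?case using elim by (simp add: frac_eq_eq mult.commute)
    qed
  qed
  ultimately have "((\<lambda>v. (LL v - LL x) / (v - x)) \<longlongrightarrow> (x + x - 2 * U x) / (U x - D x)) (at x)"
    by (rule Lim_transform_eventually)
  moreover have "(x + x - 2 * U x) / (U x - D x) = - 2 * w x / (w x - d x)"
    by (simp add: w_of_def d_of_def)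
  ultimately show ?thesis by (simp add: has_field_derivative_iff)
qed

lemma RR_deriv:
  assumes x: "-1 < x" "x < b"
  shows "(RR has_real_derivative - 2 * d x / (w x - d x)) (at x)"
proof -
  have "0 < w x - d x" using w_pos[of x] d_neg[of x] x b_bounds by auto
  then have "- 2 * w x / (w x - d x) + 2 * 1 = - 2 * d x / (w x - d x)" by (simp add: field_simps)
  then show ?thesis unfolding RR_def[abs_def]
    using LL_deriv[OF x] by (auto intro!: derivative_eq_intros)
qed

text \<open>The graph of \<open>y\<close> lies above its tangent at the right end point, which bounds \<open>w\<close> from above.\<close>

lemma w_le_tangent:
  assumes "-1 < x" "x \<le> x0"
  shows "w x \<le> ((k + RR x) / (k - RR x) - 1 / 2) * (RR x - LL x) / 2"
proof -
  define L R c where "L = LL x" and "R = RR x" and "c = (k + R) / (k - R)"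
  have xb: "x \<le> b" using assms x0_props by simp
  have R1: "R \<le> 1" using RR_le[of x x0] x0_props assms by (simp add: R_def)
  have L0: "0 < L" "L < R" using LL_pos[of x] LL_less_RR[of x] assms xb by (auto simp: L_def R_def)
  have wR: "gap L R = w x" using U_left[of x] assms xb by (simp add: gap_def w_of_def R_def L_def RR_def field_simps)
  have tan: "yh R - yh s \<le> c * (R - s)" if s: "L \<le> s" "s < R" for s
  proof -
    obtain \<xi> where \<xi>: "s < \<xi>" "\<xi> < R" "z R - z s = (R - s) * ((k + \<xi>) / (k - \<xi>))"
    proof (rule MVT_derivE[of s R z "\<lambda>\<xi>. (k + \<xi>) / (k - \<xi>)"])
      show "continuous_on {s..R} z" using R1 k1 by (intro z_continuous_on) auto
      show "(z has_real_derivative (k + \<xi>) / (k - \<xi>)) (at \<xi>)" if "\<xi> < R" for \<xi>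
        using that R1 k1 by (intro z_deriv) auto
    qed (use s in auto)
    have "(k + \<xi>) / (k - \<xi>) \<le> c" unfolding c_def using \<xi> s R1 L0 k1 by (intro frac_le) auto
    then have "(R - s) * ((k + \<xi>) / (k - \<xi>)) \<le> (R - s) * c" using s by (intro mult_left_mono) auto
    then show ?thesis using \<xi> s R1 by (simp add: yh_def y_of_def mult.commute)
  qed
  \<comment> \<open>This integrates \<open>gap L s \<ge> gap L R - (c - 1 / 2) * (R - s)\<close>
    over \<open>[L, R]\<close>; the left side integrates to \<open>Phi L R = 0\<close>.\<close>
  define F where "F = (\<lambda>S. Phi L S - (gap L R * (S - L) - (c - 1 / 2) * ((R - L)\<^sup>2 - (R - S)\<^sup>2) / 2))"
  have "F L \<le> F R"
  proof (rule DERIV_nonneg_imp_nondecreasing[where f = F])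
    fix s assume s: "L \<le> s" "s \<le> R"
    have "(F has_real_derivative gap L s - (gap L R - (c - 1 / 2) * (R - s))) (at s)"
      unfolding F_def Phi_def[abs_def] gap_def using L0 s
      by (auto intro!: derivative_eq_intros Ah_deriv simp: field_simps)
    moreover have "0 \<le> gap L s - (gap L R - (c - 1 / 2) * (R - s))"
      using tan[of s] s by (cases "s = R") (auto simp: gap_def field_simps)
    ultimately show "\<exists>y. (F has_real_derivative y) (at s) \<and> 0 \<le> y" by blast
  qed (use L0 in simp)
  moreover have "Phi L R = 0" using Phi_LR[of x] assms xb by (simp add: L_def R_def)
  moreover have "F L = 0" by (simp add: F_def)
  moreover have "F R = Phi L R - (gap L R * (R - L) - (c - 1 / 2) * (R - L)\<^sup>2 / 2)" by (simp add: F_def)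
  ultimately have "gap L R * (R - L) \<le> (c - 1 / 2) * (R - L)\<^sup>2 / 2" by linarith
  then have "gap L R * (R - L) \<le> (c - 1 / 2) * (R - L) / 2 * (R - L)"
    by (simp add: power2_eq_square mult.assoc)
  then have "gap L R \<le> (c - 1 / 2) * (R - L) / 2"
    by (rule mult_right_le_imp_le) (use L0 in simp)
  then show ?thesis using wR by (simp add: c_def R_def L_def)
qed

text \<open>Here \<open>w' = c * RR' - 1\<close> with \<open>c\<close> the slope of
  \<open>yh\<close> at \<open>RR\<close>, and the sign condition is
  \<open>w \<le> (2 * c - 1) * (- d)\<close>. The tangent bound gives it with a factor 2 to spare,
  because \<open>(RR - LL) / 2 = x + 1 \<le> - d\<close>.\<close>

lemma w_mono_left:
  assumes "-1 \<le> x" "x \<le> x'" "x' \<le> x0" shows "w x \<le> w x'"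
proof -
  show ?thesis
  proof (rule deriv_nonneg_imp_le[where f = w and a = x and c = x'])
    fix s assume s: "x < s" "s < x'"
    then have s': "-1 < s" "s < x0" "s < b" "s \<le> b" "-1 \<le> s" "s \<le> 1"
      using assms x0_props b_bounds by auto
    have R: "0 < RR s" "RR s < 1"
      using RR_strict_mono[of s x0] x0_props LL_pos[of s] LL_less_RR[of s] s' by auto
    define c where "c = (k + RR s) / (k - RR s)"
    have yh: "(yh has_real_derivative c) (at (RR s))"
    proof (rule has_field_derivative_transform_within[of "\<lambda>s. z s - k" _ _ _ "1 - RR s"])
      show "((\<lambda>s. z s - k) has_real_derivative c) (at (RR s))" unfolding c_def
        using R k1 by (auto intro!: derivative_eq_intros z_deriv)
    qed (use R in \<open>auto simp: yh_def y_of_def dist_real_def\<close>)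
    have "((\<lambda>x. yh (RR x) - x) has_real_derivative c * (- 2 * d s / (w s - d s)) - 1) (at s)"
      using DERIV_chain2[OF yh RR_deriv[of s]] s' by (auto intro!: derivative_eq_intros)
    then have "(w has_real_derivative c * (- 2 * d s / (w s - d s)) - 1) (at s)"
      by (rule has_field_derivative_transform_within_open[of _ _ _ "{-1<..<b}"])
        (use s' in \<open>auto simp: w_of_def U_left\<close>)
    moreover have "0 \<le> c * (- 2 * d s / (w s - d s)) - 1"
    proof -
      have wd: "0 < w s - d s" using w_pos[of s] d_neg[of s] s' by auto
      have "w s \<le> (c - 1 / 2) * (RR s - LL s) / 2"
        using w_le_tangent[of s] s' by (simp add: c_def)
      moreover have "(RR s - LL s) / 2 \<le> - d s"
        using D_strict_antimono[of "-1" s] D_m1 s' by (simp add: d_of_def RR_def)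
      moreover have c1: "1 \<le> c" using R k1 by (simp add: c_def field_simps)
      then have "(c - 1 / 2) * ((RR s - LL s) / 2) \<le> (c - 1 / 2) * (- d s)"
        using calculation(2) by (intro mult_left_mono) auto
      ultimately have "w s \<le> (c - 1 / 2) * (- d s)" by simp
      also have "\<dots> \<le> (2 * c - 1) * (- d s)"
        using c1 d_neg[of s] s' by (intro mult_right_mono) auto
      finally have "w s - d s \<le> c * (- 2 * d s)" by (simp add: algebra_simps)
      then show ?thesis using wd by (simp add: field_simps)
    qed
    ultimately show "\<exists>y. (w has_real_derivative y) (at s) \<and> 0 \<le> y" by blast
  next
    show "continuous_on {x..x'} w"
      by (rule continuous_on_subset[OF w_continuous]) (use assms x0_props b_bounds in auto)
  qed (use assms in simp)
qed

lemma w_deriv_mid: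
  assumes "x0 < x" "x < b"
  shows "(w has_real_derivative (- d x - w x) / (w x - d x)) (at x)"
proof -
  have x: "-1 < x" "x \<le> 1" using assms x0_props b_bounds by auto
  have wd: "0 < w x - d x" using w_pos[of x] d_neg[of x] x by auto
  have "((\<lambda>x. RR x - k - x) has_real_derivative - 2 * d x / (w x - d x) - 1) (at x)"
    using RR_deriv[of x] x assms by (auto intro!: derivative_eq_intros)
  then have "(w has_real_derivative - 2 * d x / (w x - d x) - 1) (at x)"
  proof (rule has_field_derivative_transform_within_open[of _ _ _ "{x0<..<b}"])
    fix v assume v: "v \<in> {x0<..<b}"
    then have "1 < RR v" using RR_strict_mono[of x0 v] x0_props by simp
    then show "RR v - k - v = w v" using U_left[of v] v x0_props by (simp add: w_of_def yh_def)
  qed (use assms in auto)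
  moreover have "- 2 * d x / (w x - d x) - 1 = (- d x - w x) / (w x - d x)"
    using wd by (simp add: field_simps)
  ultimately show ?thesis by simp
qed

lemma dw_mid:
  assumes "x0 \<le> x" "x \<le> b"
  shows "- d x - w x = b - LL x - yh (LL x)"
proof -
  have "1 \<le> RR x" using RR_le[of x0 x] x0_props assms by simp
  then have "yh (RR x) = RR x - k" by (auto simp: yh_def y_of_def)
  then show ?thesis using assms x0_props U_left[of x] D_left[of x]
    by (simp add: w_of_def d_of_def RR_def b_of_def)
qed

text \<open>By \<open>dw_mid\<close> the expression depends on \<open>x\<close> only through the
  decreasing \<open>LL\<close>. It is the numerator of \<open>w'\<close>, so on
  \<open>[x0, b]\<close> the function \<open>w\<close> can decrease only on an initial
  stretch.\<close>

lemma dw_mid_mono: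
  assumes "x0 \<le> x" "x \<le> x'" "x' \<le> b"
  shows "- d x - w x \<le> - d x' - w x'"
  using LL_le[of x x'] LL_pos[of x'] yh_le[of "LL x'" "LL x"] dw_mid[of x] dw_mid[of x'] assms x0_props by auto

section \<open>The window \<open>[\<alpha> x, x]\<close> of the integral equation\<close>

abbreviation "\<alpha> \<equiv> alpha_of k"
abbreviation "\<zeta> \<equiv> zeta_of k"

text \<open>Both branches of \<open>alpha_of\<close> invert the same curve: they find the point from
  which \<open>x - k\<close> is reached, by \<open>D\<close> below the height -1 and by
  \<open>U\<close> above it.\<close>

lemma \<alpha>_eq_t: assumes "b \<le> x" "x \<le> 1" shows "\<alpha> x = t (x - k)"
proof (cases "x \<le> k - 1")
  case True
  then show ?thesis by (simp add: alpha_of_def t_of_def)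
next
  case False
  have "x - k \<in> U ` {-1..x0}" using U_surj[of x0] U_x0 x0_props b_bounds False assms by auto
  then obtain s where s: "-1 \<le> s" "s \<le> x0" "x - k = U s" by auto
  have "\<alpha> x = s" using s False U_inj[of x0] x0_props b_bounds by (auto simp: alpha_of_def)
  moreover have "t (x - k) = s" using s t_U[of s] x0_props b_bounds by simp
  ultimately show ?thesis by simp
qed

lemma \<alpha>_continuous: "continuous_on {b..1} \<alpha>"
proof -
  have "continuous_on {b..1} (\<lambda>x. t (x - k))"
    by (rule continuous_on_compose2[OF t_continuous])
      (use k1 k2 in \<open>auto intro!: continuous_intros simp: b_of_def\<close>)
  then show ?thesis by (rule continuous_on_eq) (auto simp: \<alpha>_eq_t)
qed

lemma \<zeta>_continuous: "continuous_on {b..1} \<zeta>"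
  unfolding zeta_of_def[abs_def] by (intro continuous_intros \<alpha>_continuous)

lemma \<alpha>_lower:
  assumes "b \<le> x" "x \<le> k - 1"
  shows "-1 \<le> \<alpha> x" "\<alpha> x \<le> b" "D (\<alpha> x) = x - k" "\<zeta> x = d (\<alpha> x)" "LL (\<alpha> x) = zi x"
proof -
  have x: "-2 \<le> x - k" "x - k \<le> -1" "x \<le> 1" using assms k2 by (auto simp: b_of_def)
  show 1: "-1 \<le> \<alpha> x" "\<alpha> x \<le> b" "D (\<alpha> x) = x - k"
    using t_lower[of "x - k"] x \<alpha>_eq_t assms by auto
  then show "\<zeta> x = d (\<alpha> x)" by (simp add: zeta_of_def d_of_def)
  have "yh (LL (\<alpha> x)) = yh (zi x)"
    using 1 D_left[of "\<alpha> x"] zi_props[of x] x assms by (simp add: yh_def y_of_def)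
  then show "LL (\<alpha> x) = zi x"
    using yh_less[of "LL (\<alpha> x)" "zi x"] yh_less[of "zi x" "LL (\<alpha> x)"] LL_pos[of "\<alpha> x"] 1
      zi_props[of x] \<delta>b_props x assms
    by (cases "LL (\<alpha> x)" "zi x" rule: linorder_cases) auto
qed

lemma \<alpha>_upper:
  assumes "k - 1 \<le> x" "x \<le> 1"
  shows "-1 \<le> \<alpha> x" "\<alpha> x \<le> x0" "U (\<alpha> x) = x - k" "\<zeta> x = w (\<alpha> x)"
proof -
  have x: "-1 \<le> x - k" "x - k \<le> 1 - k" "x - k \<le> 2" "b \<le> x" using assms k1 by (auto simp: b_of_def)
  show 1: "-1 \<le> \<alpha> x" "U (\<alpha> x) = x - k"
    using t_upper[of "x - k"] x \<alpha>_eq_t[of x] assms by auto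
  show "\<alpha> x \<le> x0" using t_mono[of "x - k" "1 - k"] t_U[of x0] U_x0 x0_props b_bounds x \<alpha>_eq_t[of x] assms k1 by auto
  show "\<zeta> x = w (\<alpha> x)" using 1 by (simp add: zeta_of_def w_of_def)
qed

lemma \<alpha>_bounds:
  assumes "b \<le> x" "x \<le> 1"
  shows "-1 \<le> \<alpha> x" "\<alpha> x \<le> b" "\<alpha> x \<le> x" "- k \<le> \<zeta> x" "\<zeta> x \<le> 1" "\<zeta> x \<le> w x"
proof -
  show 1: "-1 \<le> \<alpha> x" "\<alpha> x \<le> b"
    using \<alpha>_lower[of x] \<alpha>_upper[of x] assms x0_props by (cases "x \<le> k - 1", auto)+
  then show "\<alpha> x \<le> x" using assms by simp
  show "- k \<le> \<zeta> x" using \<alpha>_lower[of x] \<alpha>_upper[of x] d_ge[of "\<alpha> x"] w_nonneg[of "\<alpha> x"] 1 b_bounds k1 assms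
    by (cases "x \<le> k - 1") auto
  show "\<zeta> x \<le> 1" using \<alpha>_lower[of x] \<alpha>_upper[of x] d_nonpos[of "\<alpha> x"] w_le_1[of "\<alpha> x"] 1 b_bounds k1 assms
    by (cases "x \<le> k - 1") auto
  show "\<zeta> x \<le> w x"
  proof (cases "x \<le> k - 1")
    case True
    then show ?thesis using \<alpha>_lower[of x] d_nonpos[of "\<alpha> x"] w_nonneg[of x] 1 b_bounds assms by auto
  next
    case False
    then have "\<zeta> x \<le> ds" using \<alpha>_upper[of x] w_le_LL[of "\<alpha> x"] LL_props[of "\<alpha> x"] 1 assms by auto
    also have "ds \<le> w x" using False zi_mono(1)[of "k - 1" x] w_right[of x] assms by (auto simp: ds_def b_of_def)
    finally show ?thesis .
  qed
qed

text \<open>Makes \<open>{s. w s \<le> r}\<close> contain the whole window of each of its points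
  \<open>x \<ge> b\<close>, so that the integral equation closes on this set; \<open>p_zero\<close>
  rests on it.\<close>

lemma w_max:
  assumes x: "b \<le> x" "x \<le> 1" and s: "\<alpha> x \<le> s" "s \<le> x" shows "w s \<le> w x"
proof (cases "b \<le> s")
  case True
  then show ?thesis using zi_mono(1)[of s x] w_right assms by simp
next
  case False
  have a: "-1 \<le> \<alpha> x" using \<alpha>_bounds x by simp
  have ws: "w s \<le> LL s" using w_le_LL[of s] a s False by simp
  show ?thesis
  proof (cases "x \<le> k - 1")
    case True
    have "LL s \<le> LL (\<alpha> x)" using LL_le[of "\<alpha> x" s] a s False by simp
    then show ?thesis using ws \<alpha>_lower[of x] w_right[of x] True x by simp
  next
    case F: False
    have "LL s \<le> ds" using LL_props[of s] a s False by simp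
    also have "ds \<le> w x" using F zi_mono(1)[of "k - 1" x] w_right[of x] x by (auto simp: ds_def b_of_def)
    finally show ?thesis using ws by simp
  qed
qed

text \<open>Left of \<open>b\<close> the kernel is explicit, so only the part \<open>[b, x]\<close>
  of the window is unknown. Its length is at most the fraction \<open>(3 - k) / (1 + k) < 1\<close>
  of the normaliser, with equality at \<open>x = 1\<close>. This drives the vanishing arguments
  \<open>p_zero\<close> and \<open>QC_support\<close> and the mass bound
  \<open>II_mass_ge\<close>.\<close>

lemma contraction:
  assumes "b \<le> x" "x \<le> 1"
  shows "x - b \<le> (3 - k) / (1 + k) * (w x + k)"
proof -
  have 1: "1 - zi x \<le> 1 - x" using zi_mono(2)[of x 1] zi_1 assms by simp
  have 2: "w x = zi x" "zi x \<le> 1" using w_right[of x] zi_props[of x] assms by auto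
  have "x - b = (zi x + k) - (2 * k - 2) - (zi x - x)" by (simp add: b_of_def)
  also have "\<dots> \<le> (zi x + k) - (2 * k - 2) * ((zi x + k) / (1 + k))"
  proof -
    have "(2 * k - 2) * ((zi x + k) / (1 + k)) \<le> (2 * k - 2) * 1"
      using 2 k1 by (intro mult_left_mono) auto
    then show ?thesis using 1 by simp
  qed
  also have "\<dots> = (3 - k) / (1 + k) * (w x + k)"
    using k1 2 by (simp add: field_simps)
  finally show ?thesis .
qed

end

section \<open>Quantitative bounds on the tail areas\<close>

text \<open>The [3/2] Pade approximant at 0. The [2/1] bound would only give
  \<open>n > 0.56...\<close> in the elimination of \<open>small_k_bounds\<close>, short of the
  required \<open>63 / 100\<close>.\<close>

lemma ln_le_pade_3:
  fixes x :: real
  assumes "0 \<le> x"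
  shows "ln (1 + x) \<le> x * (30 + 21 * x + x\<^sup>2) / (30 + 36 * x + 9 * x\<^sup>2)"
proof -
  define N where "N = (\<lambda>x::real. x * (30 + 21 * x + x\<^sup>2))"
  define M where "M = (\<lambda>x::real. 30 + 36 * x + 9 * x\<^sup>2)"
  define g where "g = (\<lambda>x::real. N x / M x - ln (1 + x))"
  have "g 0 \<le> g x"
  proof (rule DERIV_nonneg_imp_nondecreasing[OF assms, where f = g])
    fix u :: real assume u: "0 \<le> u" "u \<le> x"
    have M: "0 < M u" using u by (simp add: M_def add_pos_nonneg)
    have N': "(N has_real_derivative 30 + 42 * u + 3 * u\<^sup>2) (at u)"
      unfolding N_def by (auto intro!: derivative_eq_intros simp: power2_eq_square algebra_simps)
    have M': "(M has_real_derivative 36 + 18 * u) (at u)"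
      unfolding M_def by (auto intro!: derivative_eq_intros)
    have "(g has_real_derivative ((30 + 42 * u + 3 * u\<^sup>2) * M u - N u * (36 + 18 * u)) / (M u * M u) - 1 / (1 + u)) (at u)"
      unfolding g_def using u M by (auto intro!: derivative_eq_intros N' M')
    moreover have "((30 + 42 * u + 3 * u\<^sup>2) * M u - N u * (36 + 18 * u)) / (M u * M u) - 1 / (1 + u)
        = 9 * u ^ 5 / (M u * M u * (1 + u))"
    proof -
      have "((30 + 42 * u + 3 * u\<^sup>2) * M u - N u * (36 + 18 * u)) * (1 + u) - M u * M u = 9 * u ^ 5"
        unfolding M_def N_def by (simp add: algebra_simps power2_eq_square power_numeral_reduce)
      then have "9 * u ^ 5 / (M u * M u * (1 + u)) =
          (((30 + 42 * u + 3 * u\<^sup>2) * M u - N u * (36 + 18 * u)) * (1 + u) - M u * M u) / (M u * M u * (1 + u))"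
        by simp
      also have "\<dots> = ((30 + 42 * u + 3 * u\<^sup>2) * M u - N u * (36 + 18 * u)) / (M u * M u) - 1 / (1 + u)"
        using M u by (simp add: diff_divide_distrib)
      finally show ?thesis by simp
    qed
    ultimately show "\<exists>y. (g has_real_derivative y) (at u) \<and> 0 \<le> y"
      using u M by (intro exI[of _ "9 * u ^ 5 / (M u * M u * (1 + u))"]) auto
  qed
  then show ?thesis by (simp add: g_def N_def M_def)
qed

lemma frac_le_cross: "0 < b \<Longrightarrow> 0 < d \<Longrightarrow> a * d \<le> c * b \<Longrightarrow> a / b \<le> c / (d::real)"
  by (simp add: field_simps)

context curtain begin

text \<open>In the scaled variable \<open>(k - \<delta>) / (k - 1)\<close> the logarithms in
  \<open>z\<close> and \<open>Phi\<close> have a single argument, and the parameter 1 becomes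
  1.\<close>

abbreviation "\<nu>b \<equiv> (k - \<delta>b) / (k - 1)"
abbreviation "\<tau>0 \<equiv> (k - \<delta>0) / (k - 1)"

lemma ln_v: "2 * k * ln \<nu>b = 4 - 2 * k + (k - 1) * \<nu>b"
proof -
  have "(k - 1) * \<nu>b = k - \<delta>b" using k1 by simp
  then show ?thesis using ln_\<delta>b by simp
qed

lemma v_le_3: "\<nu>b \<le> 3"
  using \<delta>b_bounds k1 by (simp add: field_simps)

lemma \<tau>0_bounds: "1 < \<tau>0" "\<tau>0 < \<nu>b"
proof -
  show "1 < \<tau>0" using x0_props ds_props k1 by simp
  show "\<tau>0 < \<nu>b" using x0_props k1 by (intro divide_strict_right_mono) auto
qed

lemma Phi_tau:
  assumes "0 \<le> n"
  shows "Phi (k - (k - 1) * (1 + n)) 1 =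
    (k - 1) * ((2 - k) * n + (k - 1) * n\<^sup>2 / 4 - 2 * k * ((1 + n) * ln (1 + n) - n))"
proof -
  define \<delta> where "\<delta> = k - (k - 1) * (1 + n)"
  have \<delta>: "\<delta> \<le> 1" "1 - \<delta> = (k - 1) * n" "k - \<delta> = (k - 1) * (1 + n)" "(k - \<delta>) / (k - 1) = 1 + n"
  proof -
    have "0 \<le> (k - 1) * n" using assms k1 by simp
    then show "\<delta> \<le> 1" by (simp add: \<delta>_def algebra_simps)
    show 1: "k - \<delta> = (k - 1) * (1 + n)" by (simp add: \<delta>_def)
    show "1 - \<delta> = (k - 1) * n" by (simp add: \<delta>_def algebra_simps)
    show "(k - \<delta>) / (k - 1) = 1 + n" unfolding 1 using k1 by simp
  qed
  have "Phi \<delta> 1 = (A 1 - A \<delta>) - (1 - \<delta>)\<^sup>2 / 4 + (1 - \<delta>)"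
    using \<delta> by (simp add: Phi_def Ah_def)
  also have "\<dots> = (2 - k) * (1 - \<delta>) - (1 - \<delta>) * (2 - (1 - \<delta>)) / 2
    - 2 * k * (k - \<delta>) * ln ((k - \<delta>) / (k - 1)) + 2 * k * (1 - \<delta>) - (1 - \<delta>)\<^sup>2 / 4 + (1 - \<delta>)"
    unfolding A_diff[OF \<delta>(1)] by (simp add: power2_eq_square algebra_simps)
  also have "\<dots> = (k - 1) * ((2 - k) * n + (k - 1) * n\<^sup>2 / 4 - 2 * k * ((1 + n) * ln (1 + n) - n))"
    unfolding \<delta>(4) unfolding \<delta>(2,3) by (simp add: power2_eq_square field_simps)
  finally show ?thesis by (simp add: \<delta>_def)
qed

text \<open>The claim amounts to \<open>\<delta>0 \<le> \<delta>b + (k - 1)\<close>, hence to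
  \<open>Phi \<ge> 0\<close> at the latter parameter. By \<open>ln_v\<close>, \<open>k\<close> is
  determined by \<open>\<nu>b\<close>, and an inequality in \<open>n = \<nu>b - 2\<close> on
  \<open>[0, 1]\<close> remains.\<close>

lemma \<tau>0_ge: "\<nu>b - 1 \<le> \<tau>0"
proof (cases "\<nu>b \<le> 2")
  case True
  then show ?thesis using \<tau>0_bounds by simp
next
  case False
  define n where "n = \<nu>b - 2"
  have n: "0 \<le> n" "n \<le> 1" using False v_le_3 by (auto simp: n_def)
  define l where "l = ln (2 + n)"
  have "2 * (2 + n - 1) / (2 + n + 1) \<le> l" unfolding l_def using n by (intro ln_ge_pade) auto
  moreover have "(2 + 5 / 2 * n - n\<^sup>2) / (4 - n / 2) \<le> 2 * (2 + n - 1) / (2 + n + 1)"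
  proof -
    have "0 \<le> (1 - n) * (2 - n / 2 - n * n)"
      using n mult_left_le[of n n] by (intro mult_nonneg_nonneg) auto
    moreover have "2 * (1 + n) * (4 - n / 2) - (2 + 5 / 2 * n - n\<^sup>2) * (3 + n) = (1 - n) * (2 - n / 2 - n * n)"
      by (simp add: field_simps power2_eq_square)
    ultimately have "(2 + 5 / 2 * n - n\<^sup>2) * (3 + n) \<le> 2 * (1 + n) * (4 - n / 2)" by linarith
    then show ?thesis using n by (intro frac_le_cross) (auto simp: algebra_simps)
  qed
  ultimately have "(2 + 5 / 2 * n - n\<^sup>2) / (4 - n / 2) \<le> l" by simp
  then have l: "2 + 5 / 2 * n - n\<^sup>2 \<le> l * (4 - n / 2)" using n by (simp add: pos_divide_le_eq)
  have kl: "k * (2 * l - n) = 2 - 2 * l + (2 * l - n)"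
  proof -
    have "2 * k * l = 4 - 2 * k + (k - 1) * (n + 2)"
      using ln_v by (simp add: l_def n_def)
    then show ?thesis by (simp add: algebra_simps)
  qed
  have pos: "0 < 2 * l - n"
  proof -
    have "2 * (2 + n - 1) / (2 + n + 1) \<le> l" unfolding l_def using n by (intro ln_ge_pade) auto
    then have "2 * (1 + n) \<le> l * (3 + n)" using n by (simp add: pos_divide_le_eq)
    moreover have "n * n \<le> n" using n by (simp add: mult_left_le)
    ultimately have "0 < (2 * l - n) * (3 + n)" using n by (simp add: algebra_simps)
    then show ?thesis using n by (simp add: zero_less_mult_iff)
  qed
  \<comment> \<open>This is the nonnegativity of \<open>Phi\<close> once
    \<open>(1 + n) * ln (1 + n) - n\<close> is replaced by its bound \<open>n ^ 2 / 2\<close>.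
    Multiplying by \<open>2 * l - n\<close> and inserting \<open>kl\<close> eliminates
    \<open>k\<close> and leaves the inequality \<open>l\<close>.\<close>
  have main: "n * (1 + 3 / 4 * (k - 1)) \<le> 2 - k"
  proof -
    have "(k - 1) * (1 + 3 / 4 * n) * (2 * l - n) = (2 - 2 * l) * (1 + 3 / 4 * n)"
    proof -
      have "(k - 1) * (2 * l - n) = 2 - 2 * l" using kl by (simp add: algebra_simps)
      then have "(k - 1) * (2 * l - n) * (1 + 3 / 4 * n) = (2 - 2 * l) * (1 + 3 / 4 * n)" by simp
      then show ?thesis by (simp only: mult.assoc mult.commute mult.left_commute)
    qed
    also have "\<dots> \<le> (1 - n) * (2 * l - n)"
      using l by (simp add: field_simps power2_eq_square)
    finally have "(k - 1) * (1 + 3 / 4 * n) \<le> 1 - n" using pos by simp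
    then show ?thesis by (simp add: algebra_simps)
  qed
  have "(1 + n) * ln (1 + n) \<le> (1 + n) * (n * (6 + n) / (6 + 4 * n))"
    using n ln_le_pade[of n] by (intro mult_left_mono) auto
  also have "\<dots> \<le> n + n\<^sup>2 / 2"
    using n by (simp add: field_simps power2_eq_square)
  finally have "2 * k * ((1 + n) * ln (1 + n) - n) \<le> 2 * k * (n\<^sup>2 / 2)"
    using k1 by (intro mult_left_mono) auto
  moreover have "0 \<le> n * ((2 - k) - n * (1 + 3 / 4 * (k - 1)))"
    using n main by (intro mult_nonneg_nonneg) auto
  moreover have "n * ((2 - k) - n * (1 + 3 / 4 * (k - 1))) = (2 - k) * n + (k - 1) * n\<^sup>2 / 4 - 2 * k * (n\<^sup>2 / 2)"
    by (simp add: field_simps power2_eq_square)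
  ultimately have "0 \<le> (2 - k) * n + (k - 1) * n\<^sup>2 / 4 - 2 * k * ((1 + n) * ln (1 + n) - n)"
    by linarith
  then have Phi: "0 \<le> Phi (k - (k - 1) * (1 + n)) 1"
    unfolding Phi_tau[OF n(1)] using k1 by simp
  define \<delta>1 where "\<delta>1 = k - (k - 1) * (1 + n)"
  have \<delta>1: "\<delta>1 = \<delta>b + (k - 1)" using k1 by (simp add: \<delta>1_def n_def field_simps)
  have "\<delta>0 \<le> \<delta>1"
    using Phi_left_mono[of \<delta>1 \<delta>0 1] Phi x0_props ds_props \<delta>b_props k1 \<delta>1
    by (cases "\<delta>1 < \<delta>0") (auto simp: \<delta>1_def[symmetric])
  then have "(k - \<delta>b - (k - 1)) / (k - 1) \<le> \<tau>0" using \<delta>1 k1 by (intro divide_right_mono) auto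
  moreover have "(k - \<delta>b - (k - 1)) / (k - 1) = \<nu>b - 1"
    by (subst diff_divide_distrib) (use k1 in simp)
  ultimately show ?thesis by simp
qed

text \<open>The condition below says that the mean of \<open>D\<close> and \<open>U\<close> at \<open>x0\<close> exceeds \<open>x0\<close>; it only occurs for
  \<open>k\<close> close to 1.\<close>

lemma small_k_bounds:
  assumes dw: "- d x0 < w x0" and n1: "\<tau>0 < 2"
  shows "2 \<le> \<nu>b" "2 * k * ln (2 / \<tau>0) \<le> (k - 1) * (3 / 2 + \<nu>b / 2 - \<tau>0 / 2)"
proof -
  define n l where "n = \<tau>0 - 1" and "l = ln (1 + n)"
  have n: "0 < n" "n < 1" using \<tau>0_bounds n1 by (auto simp: n_def)
  have d0: "\<delta>0 = k - (k - 1) * (1 + n)" using k1 by (simp add: n_def)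
  have l: "l = ln \<tau>0" by (simp add: l_def n_def)
  have Dx0: "D x0 = 2 - \<delta>0 - 2 * k * l - k"
    using D_left[of x0] x0_props ds_props z_altdef[of \<delta>0] k1 by (simp add: yh_def y_of_def l)
  have "x0 - D x0 < 1 - k - x0" using dw U_x0 by (simp add: w_of_def d_of_def)
  then have "2 * x0 - (2 - \<delta>0 - 2 * k * l - k) < 1 - k" unfolding Dx0 by simp
  moreover have "2 * x0 = - 1 - \<delta>0" by (simp add: x_0_def)
  ultimately have "2 * (k * l) < 2 * (2 - k)" by simp
  then have kl: "k * l < 2 - k" by simp
  have Phi: "2 * k * ((1 + n) * l - n) = (2 - k) * n + (k - 1) * n\<^sup>2 / 4"
    using Phi_tau[of n] n x0_props k1 by (simp add: d0[symmetric] l_def)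
  have key: "k * ((1 + n) * l * 2 - 2 * n + n - n\<^sup>2 / 4) = 2 * n - n\<^sup>2 / 4"
    using Phi by (simp add: field_simps power2_eq_square)
  have kpos: "0 < k" using k1 by simp
  \<comment> \<open>eliminating \<open>k\<close> between \<open>kl\<close> and \<open>key\<close>\<close>
  have "n * (16 + n) < l * (n + 4)\<^sup>2"
  proof -
    define m where "m = 2 * n - n\<^sup>2 / 4"
    have "0 < m" using n mult_left_le[of n n] by (simp add: m_def power2_eq_square)
    have "k * (l * m) < (2 - k) * m" using kl \<open>0 < m\<close> by (simp add: mult.assoc[symmetric])
    also have "\<dots> = 2 * m - k * m" by (simp add: algebra_simps)
    also have "\<dots> = k * (2 * ((1 + n) * l * 2 - 2 * n + n - n\<^sup>2 / 4) - m)"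
      using key by (simp add: m_def algebra_simps)
    finally have "l * m < 2 * ((1 + n) * l * 2 - 2 * n + n - n\<^sup>2 / 4) - m" using kpos by simp
    then show ?thesis by (simp add: m_def power2_eq_square algebra_simps)
  qed
  moreover have "l \<le> n * (30 + 21 * n + n\<^sup>2) / (30 + 36 * n + 9 * n\<^sup>2)"
    unfolding l_def using n by (intro ln_le_pade_3) auto
  ultimately have "n * (16 + n) < n * (30 + 21 * n + n\<^sup>2) / (30 + 36 * n + 9 * n\<^sup>2) * (n + 4)\<^sup>2"
    by (smt (verit) mult_right_mono zero_le_power2)
  moreover have "0 < 30 + 36 * n + 9 * n\<^sup>2" using n by (simp add: add_pos_nonneg)
  ultimately have "n * (16 + n) * (30 + 36 * n + 9 * n\<^sup>2) < n * (30 + 21 * n + n\<^sup>2) * (n + 4)\<^sup>2"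
    by (simp add: field_simps)
  then have "n * ((16 + n) * (30 + 36 * n + 9 * n\<^sup>2)) < n * ((30 + 21 * n + n\<^sup>2) * (n + 4)\<^sup>2)"
    by (simp add: mult.assoc)
  then have "(16 + n) * (30 + 36 * n + 9 * n\<^sup>2) < (30 + 21 * n + n\<^sup>2) * (n + 4)\<^sup>2"
    using n by simp
  then have "30 * n < n * (n ^ 2 * n + 20 * n\<^sup>2 + 34 * n)"
    by (simp add: algebra_simps power2_eq_square)
  then have cub: "30 < n ^ 2 * n + 20 * n\<^sup>2 + 34 * n" using n by (simp add: mult.commute)
  \<comment> \<open>63/100 lies just below the positive root of
    \<open>n ^ 3 + 20 * n ^ 2 + 34 * n = 30\<close>.\<close>
  have n63: "63 / 100 < n"
  proof (rule ccontr)
    assume "\<not> 63 / 100 < n"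
    then have *: "n \<le> 63 / 100" by simp
    then have "n\<^sup>2 \<le> (63 / 100)\<^sup>2" using n by (intro power_mono) auto
    moreover from this have "n\<^sup>2 * n \<le> (63 / 100)\<^sup>2 * (63 / 100)" using n * by (intro mult_mono) auto
    ultimately show False using cub * by (simp add: power2_eq_square)
  qed
  define Lam where "Lam = (1 + n) * l / n - 1"
  \<comment> \<open>The equation of \<open>\<delta>0\<close> divided by \<open>n\<close>: it
    expresses \<open>(k - 1) / k\<close> through \<open>n\<close> alone.\<close>
  have ratio: "(k - 1) * (2 - n / 4) = k * (1 - 2 * Lam)"
  proof -
    have "n * ((k - 1) * (2 - n / 4)) = n * (k * (1 - 2 * Lam))"
    proof -
      have "n * Lam = (1 + n) * l - n" using n by (simp add: Lam_def right_diff_distrib)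
      then have "n * (k * (1 - 2 * Lam)) = k * (n - 2 * ((1 + n) * l - n))"
        by (metis mult.left_commute right_diff_distrib mult.right_neutral)
      then show ?thesis using Phi by (simp add: field_simps power2_eq_square)
    qed
    then show ?thesis using n by simp
  qed
  have ln_half: "ln (c / 2) = - ln (2 / c)" if "0 < c" for c :: real using that by (simp add: ln_div)
  \<comment> \<open>If \<open>V < 2\<close>, a linear bound for \<open>ln (2 / V)\<close> together
    with \<open>ln 2 \<le> 7 / 10\<close> gives \<open>k > 10 / 7\<close>, whereas
    \<open>ratio\<close> with \<open>n > 63 / 100\<close> gives \<open>k \<le> 1750 / 1229\<close>,
    which is smaller.\<close>
  have "2 \<le> V" if "V = \<nu>b" for V
  proof (rule ccontr)
    assume "\<not> 2 \<le> V"
    then have V: "1 < V" "V < 2" using less_trans[OF \<tau>0_bounds, folded that] by auto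
    have "ln 2 - ln V = ln (2 / V)" 
    proof -
      have "ln (2 / c) = ln 2 - ln c" if "0 < c" for c :: real using that by (simp add: ln_div)
      then show ?thesis using less_trans[OF zero_less_one V(1)] by metis
    qed
    moreover have "1 - V / 2 \<le> ln (2 / V)"
    proof -
      have "0 < V" using V(1) by (rule less_trans[OF zero_less_one])
      then have "0 < V / 2" by (rule half_gt_zero)
      then have "ln (V / 2) \<le> V / 2 - 1" by (rule ln_le_minus_one)
      moreover have "ln (V / 2) = - ln (2 / V)" by (rule ln_half) (rule less_trans[OF zero_less_one V(1)])
      ultimately show ?thesis by simp
    qed
    ultimately have "2 * k * (1 - V / 2) \<le> 2 * k * (ln 2 - ln V)" using k1 by (intro mult_left_mono) auto
    then have "2 * k - k * V + 4 - 2 * k + (k - 1) * V \<le> 2 * k * ln 2"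
      using ln_v[folded that] by (simp add: algebra_simps)
    then have "2 < 2 * k * ln 2" using V by (simp add: algebra_simps)
    moreover have "ln 2 \<le> (7 / 10 :: real)" using ln_le_pade[of 1] by simp
    then have "2 * k * ln 2 \<le> 2 * k * (7 / 10)" using k1 by (intro mult_left_mono) auto
    ultimately have k: "10 / 7 < k" by simp
    have "2 * n / (2 + n) \<le> l"
      using ln_ge_pade[of "1 + n"] n by (simp add: l_def)
    then have "2 * n \<le> l * (2 + n)" using n by (simp add: pos_divide_le_eq)
    then have "(1 + n) * (2 * n) \<le> (1 + n) * (l * (2 + n))" using n by (intro mult_left_mono) auto
    then have "2 * (1 + n) / (2 + n) \<le> (1 + n) * l / n" using n by (intro frac_le_cross) (auto simp: ac_simps)
    then have "2 * (1 + n) / (2 + n) \<le> Lam + 1" by (simp add: Lam_def)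
    moreover have "4 * (1 + n) / (2 + n) = 2 * (2 * (1 + n) / (2 + n))" by simp
    ultimately have "1 - 2 * Lam \<le> 3 - 4 * (1 + n) / (2 + n)" by linarith
    also have "\<dots> = (2 - n) / (2 + n)" using n by (simp add: field_simps)
    also have "\<dots> \<le> 521 / 1000" using n63 by (simp add: field_simps)
    finally have "k * (1 - 2 * Lam) \<le> k * (521 / 1000)" using k1 by (intro mult_left_mono) auto
    moreover have "(k - 1) * (7 / 4) \<le> (k - 1) * (2 - n / 4)" using n k1 by (intro mult_left_mono) auto
    ultimately have "(k - 1) * (7 / 4) \<le> k * (521 / 1000)" using ratio by simp
    then have "k * 1229 \<le> 1750" by (simp add: field_simps)
    then show False using k by (simp add: field_simps)
  qed
  then show v2: "2 \<le> \<nu>b" by blast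
  show "2 * k * ln (2 / \<tau>0) \<le> (k - 1) * (3 / 2 + \<nu>b / 2 - \<tau>0 / 2)"
  proof -
    have 1: "(3 - n - n\<^sup>2) / (3 + 2 * n) \<le> 1 - 2 * Lam"
    proof -
      have "(1 + n) * l / n \<le> (1 + n) * (n * (6 + n) / (6 + 4 * n)) / n"
        unfolding l_def using n ln_le_pade[of n] by (intro divide_right_mono mult_left_mono) auto
      also have "\<dots> = (1 + n) * (6 + n) / (6 + 4 * n)" using n by simp
      finally have "3 - 2 * ((1 + n) * (6 + n) / (6 + 4 * n)) \<le> 1 - 2 * Lam" by (simp add: Lam_def)
      moreover have "3 - 2 * ((1 + n) * (6 + n) / (6 + 4 * n)) = (3 - n - n\<^sup>2) / (3 + 2 * n)"
        using n by (simp add: divide_simps power2_eq_square) (simp add: algebra_simps)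
      ultimately show ?thesis by simp
    qed
    have 2: "2 * ln (2 / \<tau>0) \<le> (1 - n) * (3 + n) / (2 * (1 + n))"
    proof -
      have t: "\<tau>0 = 1 + n" by (simp add: n_def)
      have "ln (2 / (1 + n)) \<le> (2 / (1 + n) - 1 / (2 / (1 + n))) / 2"
        using n by (intro ln_le_half_diff_inverse) (simp add: field_simps)
      also have "\<dots> = (1 - n) * (3 + n) / (4 * (1 + n))"
        using n by (simp add: divide_simps) (simp add: algebra_simps)
      finally have "2 * ln (2 / (1 + n)) \<le> 2 * ((1 - n) * (3 + n) / (4 * (1 + n)))" by simp
      also have "\<dots> = (1 - n) * (3 + n) / (2 * (1 + n))" using n by (simp add: divide_simps)
      finally show ?thesis unfolding t .
    qed
    \<comment> \<open>After clearing denominators a quartic in \<open>n\<close> remains, and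
      \<open>n > 63 / 100\<close> is just enough to make it nonnegative.\<close>
    have 3: "(1 - n) * (3 + n) / (2 * (1 + n)) * (2 - n / 4) \<le> (3 - n - n\<^sup>2) / (3 + 2 * n) * (2 - n / 2)"
    proof -
      have "(63 / 100) * (63 / 100) \<le> n * n" using n63 by (intro mult_mono) auto
      moreover have "0 \<le> n * (n * n)" "0 \<le> n * (n * (n * n))" using n by auto
      moreover have "4 * (3 - n - n\<^sup>2) * (4 - n) * (1 + n) - (1 - n) * (3 + n) * (8 - n) * (3 + 2 * n)
          = 2 * (n * (n * (n * n))) + n * (n * n) + 16 * (n * n) + 29 * n - 24"
        by (simp add: algebra_simps power2_eq_square)
      ultimately have "(1 - n) * (3 + n) * (8 - n) * (3 + 2 * n) \<le> 4 * (3 - n - n\<^sup>2) * (4 - n) * (1 + n)"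
        using n63 by linarith
      then show ?thesis using n by (simp add: divide_simps) (simp add: algebra_simps)
    qed
    have "2 * k * ln (2 / \<tau>0) * (2 - n / 4) = k * (2 * ln (2 / \<tau>0) * (2 - n / 4))" by simp
    also have "\<dots> \<le> k * ((1 - n) * (3 + n) / (2 * (1 + n)) * (2 - n / 4))"
      using 2 n k1 by (intro mult_left_mono mult_right_mono) auto
    also have "\<dots> \<le> k * ((3 - n - n\<^sup>2) / (3 + 2 * n) * (2 - n / 2))"
      using 3 k1 by (intro mult_left_mono) auto
    also have "\<dots> \<le> k * ((1 - 2 * Lam) * (2 - n / 2))"
      using 1 n k1 by (intro mult_left_mono mult_right_mono) auto
    also have "\<dots> = (k - 1) * (2 - n / 2) * (2 - n / 4)"
      using ratio by (metis mult.assoc mult.commute)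
    finally have "2 * k * ln (2 / \<tau>0) \<le> (k - 1) * (2 - n / 2)"
      by (rule mult_right_le_imp_le) (use n in simp)
    also have "\<dots> \<le> (k - 1) * (3 / 2 + \<nu>b / 2 - \<tau>0 / 2)"
    proof (rule mult_left_mono)
      have "2 - (T - 1) / 2 \<le> 3 / 2 + V / 2 - T / 2" if "2 \<le> V" for V T :: real
        using that by (simp add: field_simps)
      from this[OF v2, of \<tau>0] show "2 - n / 2 \<le> 3 / 2 + \<nu>b / 2 - \<tau>0 / 2" by (simp only: n_def)
    qed (use k1 in simp)
    finally show ?thesis .
  qed
qed

text \<open>Together with \<open>P_growth\<close> this yields
  \<open>w x0 - r \<le> P xr - P b\<close> at the point \<open>xr\<close> with
  \<open>zi xr = RR a\<close>, the estimate that \<open>G_main\<close> needs for intermediate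
  \<open>r\<close>. In the scaled parameters everything follows from
  \<open>2 * \<tau> \<le> V\<close> and the bounds on \<open>T0\<close> and
  \<open>V\<close>.\<close>

lemma tail_area:
  assumes a: "-1 \<le> a" "a \<le> x0" and r: "r = w a" "- d x0 < r"
  shows "2 * (k - RR a) * (w x0 - r) \<le> (max 0 (RR a - r))\<^sup>2 - (max 0 (\<delta>b - r))\<^sup>2"
proof -
  define \<kappa> \<delta> \<tau> \<omega> where "\<kappa> = k - 1" and "\<delta> = RR a" and "\<tau> = (k - \<delta>) / \<kappa>" and "\<omega> = w x0 - r"
  have \<kappa>: "0 < \<kappa>" using k1 by (simp add: \<kappa>_def)
  obtain V T0 where VT: "V = \<nu>b" "T0 = \<tau>0" by blast
  note facts = \<tau>0_bounds[folded VT] \<tau>0_ge[folded VT] v_le_3[folded VT] small_k_bounds[folded VT] ln_v[folded VT]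
  have \<omega>0: "0 \<le> \<omega>" using w_mono_left[of a x0] a r by (simp add: \<omega>_def)
  have \<delta>1: "\<delta> \<le> 1" using RR_le[of a x0] x0_props a by (simp add: \<delta>_def)
  have \<delta>ds: "ds \<le> \<delta>" using RR_le[of "-1" a] x0_props a by (simp add: \<delta>_def)
  have \<delta>: "\<delta> = k - \<kappa> * \<tau>" using \<kappa> by (simp add: \<tau>_def)
  have \<delta>b: "\<delta>b = k - \<kappa> * V" and \<delta>0: "\<delta>0 = k - \<kappa> * T0" using k1 by (auto simp: \<kappa>_def VT)
  have \<tau>1: "1 \<le> \<tau>" using \<delta>1 \<kappa> by (simp add: \<tau>_def \<kappa>_def field_simps)
  have wx0: "w x0 = 1 - k + (1 + \<delta>0) / 2" 
  proof -
    have "x0 = - (1 + \<delta>0) / 2" by (simp add: x_0_def)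
    then show ?thesis unfolding w_of_def U_x0 by linarith
  qed
  \<comment> \<open>If this failed, \<open>- d x0 < w a\<close> would bound
    \<open>ln \<tau> + ln T0\<close> from above. Since
    \<open>2 * k * ln \<tau> - \<kappa> * \<tau>\<close> increases in this range,
    \<open>\<tau>\<close> may be lowered to \<open>V / 2\<close>, where \<open>ln_v\<close>
    evaluates the logarithm. The outcome contradicts \<open>small_k_bounds\<close>, or, for
    \<open>T0 \<ge> 2\<close>, simply has the wrong sign.\<close>
  have \<tau>v: "2 * \<tau> \<le> V"
  proof (rule ccontr)
    assume "\<not> 2 * \<tau> \<le> V"
    then have lt: "V / 2 < \<tau>" by simp
    have v0: "0 < V" using facts(1,2) by linarith
    have dw: "- d x0 < w x0" using w_mono_left[of a x0] a r by simp
    have "U a = 2 - \<delta> - 2 * k * ln \<tau> - k"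
      using U_left[of a] x0_props a \<delta>1 z_altdef[of \<delta>] k1 by (simp add: yh_def y_of_def \<delta>_def \<tau>_def \<kappa>_def)
    moreover have "D x0 = 2 - \<delta>0 - 2 * k * ln T0 - k"
      using VT D_left[of x0] x0_props ds_props z_altdef[of \<delta>0] k1 by (simp add: yh_def y_of_def)
    moreover have "x0 - D x0 < U a - a" using r by (simp add: w_of_def d_of_def)
    ultimately have "2 * k * ln \<tau> + 2 * k * ln T0 < 4 - \<delta> - \<delta>0 - 2 * k - x0 - a" by simp
    also have "\<dots> \<le> 5 - \<delta> - \<delta>0 - 2 * k - x0" using a by simp
    also have "\<dots> = 11 / 2 - 2 * k - \<delta> - \<delta>0 / 2" by (simp add: x_0_def field_simps)
    also have "\<dots> = 11 / 2 - 7 / 2 * k + \<kappa> * \<tau> + \<kappa> * T0 / 2"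
      using \<delta> \<delta>0 by linarith
    finally have 1: "2 * k * ln \<tau> - \<kappa> * \<tau> + 2 * k * ln T0 < 11 / 2 - 7 / 2 * k + \<kappa> * T0 / 2" by simp
    have "2 * k * ln (V / 2) - \<kappa> * (V / 2) \<le> 2 * k * ln \<tau> - \<kappa> * \<tau>"
    proof -
      have "ln (V / 2 / \<tau>) \<le> V / 2 / \<tau> - 1"
        using v0 \<tau>1 by (intro ln_le_minus_one) auto
      moreover have "ln (V / 2 / \<tau>) = ln (V / 2) - ln \<tau>" using v0 \<tau>1 by (subst ln_div) auto
      ultimately have "(\<tau> - V / 2) / \<tau> \<le> ln \<tau> - ln (V / 2)" using \<tau>1 by (simp add: diff_divide_distrib)
      then have "2 * k * ((\<tau> - V / 2) / \<tau>) \<le> 2 * k * (ln \<tau> - ln (V / 2))" using k1 by (intro mult_left_mono) auto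
      moreover have "\<kappa> * (\<tau> - V / 2) \<le> 2 * k * ((\<tau> - V / 2) / \<tau>)"
      proof -
        have "\<kappa> * \<tau> \<le> 2 * k" using \<delta> \<delta>ds ds_props \<delta>b_props k1 by linarith
        then have "\<kappa> \<le> 2 * k / \<tau>" using \<tau>1 by (simp add: field_simps)
        then have "\<kappa> * (\<tau> - V / 2) \<le> 2 * k / \<tau> * (\<tau> - V / 2)" using lt by (intro mult_right_mono) auto
        then show ?thesis by simp
      qed
      ultimately show ?thesis by (simp add: algebra_simps)
    qed
    moreover have "2 * k * ln (V / 2) = 4 - 2 * k + \<kappa> * V - 2 * k * ln 2"
      using facts(7) v0 by (simp add: ln_div right_diff_distrib \<kappa>_def)
    ultimately have "4 - 2 * k + \<kappa> * V / 2 - 2 * k * ln 2 + 2 * k * ln T0 < 11 / 2 - 7 / 2 * k + \<kappa> * T0 / 2"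
      using 1 by (smt (verit) field_sum_of_halves mult.commute times_divide_eq_right)
    moreover have "2 * k * ln (2 / T0) = 2 * k * ln 2 - 2 * k * ln T0"
      using facts(1,2) by (simp add: ln_div right_diff_distrib)
    moreover have "\<kappa> * (3 / 2 + V / 2 - T0 / 2) = 3 / 2 * k - 3 / 2 + \<kappa> * V / 2 - \<kappa> * T0 / 2"
      by (simp add: field_simps \<kappa>_def)
    ultimately have "\<kappa> * (3 / 2 + V / 2 - T0 / 2) < 2 * k * ln (2 / T0)" by linarith
    then show False
    proof (cases "T0 < 2")
      case True
      then show False using facts(6)[OF dw] \<open>\<kappa> * (3 / 2 + V / 2 - T0 / 2) < 2 * k * ln (2 / T0)\<close>
        by (simp add: \<kappa>_def)
    next
      case False
      then have "ln (2 / T0) \<le> ln 1" by (subst ln_le_cancel_iff) (auto simp: field_simps)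
      then have "2 * k * ln (2 / T0) \<le> 0" using k1 by (simp add: mult_nonneg_nonpos)
      moreover have "0 \<le> \<kappa> * (3 / 2 + V / 2 - T0 / 2)" using facts(1,2) \<kappa> by (intro mult_nonneg_nonneg) auto
      ultimately show False using \<open>\<kappa> * (3 / 2 + V / 2 - T0 / 2) < 2 * k * ln (2 / T0)\<close> by simp
    qed
  qed
  have \<tau>32: "\<tau> \<le> 3 / 2" using \<tau>v facts(4) by simp
  have wr: "r = w x0 - \<omega>" by (simp add: \<omega>_def)
  have goal_lhs: "2 * (k - RR a) * (w x0 - r) = 2 * \<kappa> * \<tau> * \<omega>"
    using \<kappa> by (simp add: \<tau>_def \<omega>_def \<delta>_def)
  have e: "\<delta> - w x0 = \<kappa> * (3 / 2 + T0 / 2 - \<tau>)"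
  proof -
    have "\<kappa> * (3 / 2 + T0 / 2 - \<tau>) = (3 * (k - 1) + \<kappa> * T0) / 2 - \<kappa> * \<tau>" by (simp add: \<kappa>_def field_simps)
    moreover have "\<delta> - (1 - k + (1 + \<delta>0) / 2) = (3 * (k - 1) + (k - \<delta>0)) / 2 - (k - \<delta>)" by (simp add: field_simps)
    moreover have "k - \<delta>0 = \<kappa> * T0" "k - \<delta> = \<kappa> * \<tau>" using \<delta> \<delta>0 by auto
    ultimately show ?thesis unfolding wx0 by simp
  qed
  have e_ge: "\<kappa> * \<tau> / 2 \<le> \<delta> - w x0"
    unfolding e using facts(3) \<tau>v \<tau>32 \<kappa> by (subst times_divide_eq_right[symmetric], intro mult_left_mono) auto
  have ar: "0 \<le> \<delta> - r" using e_ge \<omega>0 \<kappa> \<tau>1 by (smt (verit) wr divide_nonneg_pos mult_nonneg_nonneg)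
  show ?thesis
  proof (cases "r \<le> \<delta>b")
    case True
    have \<sigma>: "\<delta> + \<delta>b - 2 * w x0 = \<kappa> * (3 + T0 - \<tau> - V)"
      proof -
      have "\<kappa> * (3 + T0 - \<tau> - V) = 3 * (k - 1) + \<kappa> * T0 - \<kappa> * \<tau> - \<kappa> * V" by (simp add: \<kappa>_def algebra_simps)
      moreover have "\<delta> + \<delta>b - 2 * (1 - k + (1 + \<delta>0) / 2) = 3 * (k - 1) + (k - \<delta>0) - (k - \<delta>) - (k - \<delta>b)"
        by (simp add: field_simps)
      moreover have "k - \<delta>0 = \<kappa> * T0" "k - \<delta> = \<kappa> * \<tau>" "k - \<delta>b = \<kappa> * V" using \<delta> \<delta>0 \<delta>b by auto
      ultimately show ?thesis unfolding wx0 by simp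
    qed
    have "0 \<le> \<kappa> * (3 + T0 - \<tau> - V)" using \<kappa> facts(3) \<tau>32 by (intro mult_nonneg_nonneg) auto
    then have s: "2 * \<omega> \<le> \<delta> + \<delta>b - 2 * r" using \<sigma> wr by simp
    \<comment> \<open>A difference of squares: its factors are
      \<open>\<delta> - \<delta>b = \<kappa> * (V - \<tau>)\<close>, at least
      \<open>\<kappa> * \<tau>\<close>, and \<open>\<delta> + \<delta>b - 2 * r\<close>, at least
      \<open>2 * \<omega>\<close>.\<close>
    have "2 * \<kappa> * \<tau> * \<omega> = (\<kappa> * \<tau>) * (2 * \<omega>)" by simp
    also have "\<dots> \<le> (\<kappa> * (V - \<tau>)) * (\<delta> + \<delta>b - 2 * r)"
      using s \<tau>v \<kappa> \<omega>0 \<tau>1 by (intro mult_mono mult_left_mono mult_nonneg_nonneg) auto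
    also have "\<kappa> * (V - \<tau>) = \<delta> - \<delta>b" by (subst \<delta>, subst \<delta>b) (simp add: algebra_simps)
    finally show ?thesis unfolding goal_lhs using True ar
      by (simp add: \<delta>_def[symmetric] max_def power2_eq_square algebra_simps)
  next
    case False
    \<comment> \<open>The second square is absent here, and the inequality of arithmetic and
      geometric means suffices, as
      \<open>\<omega> + (\<delta> - w x0) = \<delta> - r\<close>.\<close>
    have "2 * \<kappa> * \<tau> * \<omega> \<le> 4 * (\<delta> - w x0) * \<omega>" using e_ge \<omega>0 by (intro mult_right_mono) auto
    also have "\<dots> \<le> (\<omega> + (\<delta> - w x0))\<^sup>2"
    proof -
      have "0 \<le> (\<omega> - (\<delta> - w x0))\<^sup>2" by simp
      then show ?thesis by (simp add: power2_eq_square algebra_simps)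
    qed
    finally show ?thesis unfolding goal_lhs using False ar by (simp add: \<delta>_def[symmetric] \<omega>_def max_def)
  qed
qed

end

section \<open>The dual gap for a single level\<close>

text \<open>Once the derivative is negative it never becomes positive again, so \<open>f\<close>
  rises first and falls afterwards, and its minimum sits at an end.\<close>

lemma sign_crossing_nonneg:
  fixes f f' :: "real \<Rightarrow> real"
  assumes cont: "continuous_on {a..c} f"
    and der: "\<And>s. a < s \<Longrightarrow> s < c \<Longrightarrow> (f has_real_derivative f' s) (at s)"
    and ends: "0 \<le> f a" "0 \<le> f c"
    and cross: "\<And>s s'. a < s \<Longrightarrow> s < s' \<Longrightarrow> s' < c \<Longrightarrow> f' s < 0 \<Longrightarrow> f' s' \<le> 0"
    and u: "a \<le> u" "u \<le> c"
  shows "0 \<le> f u"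
proof (rule ccontr)
  assume neg: "\<not> 0 \<le> f u"
  then have u': "a < u" "u < c" using ends u by (auto simp: order_less_le)
  obtain s where s: "a < s" "s < u" "f u - f a = (u - a) * f' s"
  proof (rule MVT_derivE[of a u f f'])
    show "continuous_on {a..u} f" by (rule continuous_on_subset[OF cont]) (use u in auto)
  qed (use der u' in auto)
  obtain s' where s': "u < s'" "s' < c" "f c - f u = (c - u) * f' s'"
  proof (rule MVT_derivE[of u c f f'])
    show "continuous_on {u..c} f" by (rule continuous_on_subset[OF cont]) (use u in auto)
  qed (use der u' in auto)
  have "(u - a) * f' s < 0" using s neg ends by linarith
  then have "f' s < 0" using u' by (simp add: mult_less_0_iff)
  then have "f' s' \<le> 0" using cross[of s s'] s s' by simp
  then have "(c - u) * f' s' \<le> 0" using u' by (simp add: mult_le_0_iff)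
  then show False using s' neg ends by linarith
qed

lemma half_square_pos_part_deriv:
  "((\<lambda>u::real. (max 0 u)\<^sup>2 / 2) has_real_derivative max 0 u) (at u within S)"
proof -
  have "((\<lambda>u::real. (max 0 u)\<^sup>2 / 2) has_real_derivative max 0 u) (at u)"
  proof (cases u "0::real" rule: linorder_cases)
    case less
    have "((\<lambda>u::real. 0) has_real_derivative max 0 u) (at u)" using less by simp
    then show ?thesis
      by (rule has_field_derivative_transform_within_open[of _ _ _ "{..<0}"]) (use less in auto)
  next
    case greater
    have "((\<lambda>u::real. u\<^sup>2 / 2) has_real_derivative max 0 u) (at u)"
      using greater by (auto intro!: derivative_eq_intros)
    then show ?thesis
      by (rule has_field_derivative_transform_within_open[of _ _ _ "{0<..}"]) (use greater in auto)
  next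
    case equal
    have "((\<lambda>v::real. max 0 v / 2) \<longlongrightarrow> max 0 0 / 2) (at 0)"
      by (intro tendsto_intros) auto
    moreover have "\<forall>\<^sub>F v::real in at 0. max 0 v / 2 = ((max 0 v)\<^sup>2 / 2 - (max 0 0)\<^sup>2 / 2) / (v - 0)"
      by (auto simp: eventually_at_filter max_def power2_eq_square)
    ultimately show ?thesis unfolding equal has_field_derivative_iff
      by (auto intro: Lim_transform_eventually)
  qed
  then show ?thesis by (rule has_field_derivative_at_within)
qed

context curtain begin

lemma U_range: "-1 \<le> x \<Longrightarrow> x \<le> 1 \<Longrightarrow> U x \<in> {-1..2}"
  using U_le_iff[of "-1" x] U_le_iff[of x 1] U_m1 U_1 by auto

lemma D_range: "-1 \<le> x \<Longrightarrow> x \<le> 1 \<Longrightarrow> D x \<in> {-2..1 - k}"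
  using D_le_iff[of b x] D_le_iff[of x "-1"] D_b D_m1 D_right[of x] k1 k2 b_bounds
  by (cases "x \<le> b") (auto simp: b_of_def)

end

text \<open>\<open>p\<close> plays the role of the tail probability \<open>Q\<^sub>x [r, \<infinity>)\<close>, so that everything below concerns
  the cost \<open>u \<mapsto> max 0 (u - r)\<^sup>2 / 2\<close>, with \<open>\<theta> = - P\<close> and \<open>\<psi> = psi\<close>.\<close>

locale level = curtain +
  fixes r :: real and p P psi :: "real \<Rightarrow> real"
  assumes P_cont: "continuous_on {-1..1} P"
    and P_deriv: "\<And>x. -1 < x \<Longrightarrow> x < 1 \<Longrightarrow> (P has_real_derivative p x) (at x)"
    and p_bounds: "\<And>x. -1 < x \<Longrightarrow> x \<le> 1 \<Longrightarrow> 0 \<le> p x \<and> p x \<le> 1"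
    and p_left: "\<And>x. -1 < x \<Longrightarrow> x \<le> b \<Longrightarrow> p x * (w x - d x) = max 0 (w x - r) - max 0 (d x - r)"
    and p_right: "\<And>x. b \<le> x \<Longrightarrow> x \<le> 1 \<Longrightarrow>
      p x * (w x + k) = max 0 (w x - r) - max 0 (\<zeta> x - r) + P x - P (\<alpha> x)"
    and psi_deriv: "\<And>v. -2 \<le> v \<Longrightarrow> v \<le> 2 \<Longrightarrow>
      (psi has_real_derivative max 0 (v - t v - r) + P (t v)) (at v within {-2..2})"
begin

abbreviation h1 :: "real \<Rightarrow> real" where "h1 u \<equiv> max 0 (u - r)"

definition hr :: "real \<Rightarrow> real" where "hr u = (max 0 (u - r))\<^sup>2 / 2"

lemma hr_deriv: "(hr has_real_derivative h1 u) (at u within S)"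
proof -
  have "((\<lambda>u. (max 0 (u - r))\<^sup>2 / 2) has_real_derivative h1 u * 1) (at u within S)"
    by (rule DERIV_chain2[OF half_square_pos_part_deriv]) (auto intro!: derivative_eq_intros)
  then show ?thesis by (simp add: hr_def[abs_def])
qed

lemma hr_continuous: "continuous_on S hr"
  by (rule DERIV_continuous_on, rule hr_deriv)

lemma h1_lip: "\<bar>h1 u - h1 v\<bar> \<le> \<bar>u - v\<bar>"
  by (auto simp: max_def abs_if)

lemma P_MVT:
  assumes "-1 \<le> x" "x < x'" "x' \<le> 1"
  obtains s where "x < s" "s < x'" "P x' - P x = (x' - x) * p s"
proof (rule MVT_derivE[of x x' P p])
  show "continuous_on {x..x'} P" by (rule continuous_on_subset[OF P_cont]) (use assms in auto)
  show "(P has_real_derivative p s) (at s)" if "x < s" "s < x'" for s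
    using P_deriv[of s] that assms by simp
qed (use assms that in auto)

lemma P_incr:
  assumes "-1 \<le> x" "x \<le> x'" "x' \<le> 1" shows "P x \<le> P x'" "P x' - P x \<le> x' - x"
proof -
  have "P x \<le> P x' \<and> P x' - P x \<le> x' - x"
  proof (cases "x = x'")
    case False
    then obtain s where s: "x < s" "s < x'" "P x' - P x = (x' - x) * p s"
      using P_MVT[of x x'] assms by auto
    have "0 \<le> p s" "p s \<le> 1" using p_bounds[of s] s assms by auto
    then have "0 \<le> (x' - x) * p s" "(x' - x) * p s \<le> x' - x"
      using assms by (auto intro: mult_left_le)
    then show ?thesis using s by simp
  qed simp
  then show "P x \<le> P x'" "P x' - P x \<le> x' - x" by auto
qed

lemma P_lip: "-1 \<le> x \<Longrightarrow> x \<le> 1 \<Longrightarrow> -1 \<le> x' \<Longrightarrow> x' \<le> 1 \<Longrightarrow> \<bar>P x - P x'\<bar> \<le> \<bar>x - x'\<bar>"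
  using P_incr[of x x'] P_incr[of x' x] by (cases "x \<le> x'") (auto simp: abs_if)

lemma P_const:
  assumes "-1 \<le> x" "x \<le> x'" "x' \<le> 1" "\<And>s. x < s \<Longrightarrow> s < x' \<Longrightarrow> p s = 0" shows "P x' = P x"
proof (cases "x = x'")
  case False
  then obtain s where "x < s" "s < x'" "P x' - P x = (x' - x) * p s"
    using P_MVT[of x x'] assms(1-3) by auto
  then show ?thesis using assms by simp
qed simp

lemma P_full:
  assumes "-1 \<le> x" "x \<le> x'" "x' \<le> 1" "\<And>s. x < s \<Longrightarrow> s < x' \<Longrightarrow> p s = 1" shows "P x' - P x = x' - x"
proof (cases "x = x'")
  case False
  then obtain s where "x < s" "s < x'" "P x' - P x = (x' - x) * p s"
    using P_MVT[of x x'] assms(1-3) by auto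
  then show ?thesis using assms by simp
qed simp

lemma wd_pos: "-1 < x \<Longrightarrow> x \<le> 1 \<Longrightarrow> 0 < w x - d x"
  using w_pos[of x] d_neg[of x] by simp

lemma p_zero_left: assumes "-1 < x" "x \<le> b" "w x \<le> r" shows "p x = 0"
proof -
  have "d x \<le> r" using wd_pos[of x] b_bounds assms by simp
  then have "p x * (w x - d x) = 0" using p_left[of x] assms by simp
  then show ?thesis using wd_pos[of x] b_bounds assms by auto
qed

lemma p_one_left: assumes "-1 < x" "x \<le> b" "r \<le> d x" shows "p x = 1"
proof -
  have "0 < w x - d x" using wd_pos[of x] b_bounds assms by simp
  moreover from this have "p x * (w x - d x) = w x - d x" using p_left[of x] assms by simp
  ultimately show ?thesis by simp
qed

text \<open>The tail vanishes on \<open>{w \<le> r}\<close> because its supremum there is contracted by the integral equation.\<close>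

lemma p_zero:
  assumes x: "-1 < x" "x \<le> 1" "w x \<le> r" shows "p x = 0"
proof (cases "x \<le> b")
  case True then show ?thesis using p_zero_left assms by simp
next
  case xb: False
  define B where "B = {s. b \<le> s \<and> s \<le> 1 \<and> w s \<le> r}"
  define M where "M = (SUP s\<in>B. p s)"
  have B: "x \<in> B" using xb x by (simp add: B_def)
  have bdd: "bdd_above (p ` B)" using p_bounds b_bounds by (intro bdd_aboveI[of _ 1]) (auto simp: B_def)
  have le: "p s \<le> M" if "s \<in> B" for s unfolding M_def using that bdd by (intro cSUP_upper)
  define \<rho> where "\<rho> = (3 - k) / (1 + k)"
  have \<rho>: "\<rho> < 1" "0 < \<rho>" using k1 k2 by (auto simp: \<rho>_def)
  have M0: "0 \<le> M" using le[OF B] p_bounds[of x] x by simp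
  have "p s \<le> \<rho> * M" if s: "s \<in> B" for s
  proof -
    have sb: "b \<le> s" "s \<le> 1" "w s \<le> r" using s by (auto simp: B_def)
    have \<alpha>: "-1 \<le> \<alpha> s" "\<alpha> s \<le> b" "\<zeta> s \<le> w s" using \<alpha>_bounds[of s] sb by auto
    have "p s * (w s + k) = P s - P (\<alpha> s)" using p_right[of s] sb \<alpha> by simp
    also have "P (\<alpha> s) = P b"
    proof (rule P_const[symmetric])
      fix q assume q: "\<alpha> s < q" "q < b"
      then have "w q \<le> w s" using w_max[of s q] sb by simp
      then show "p q = 0" using p_zero_left[of q] q \<alpha> sb by simp
    qed (use \<alpha> b_bounds in auto)
    also have "P s - P b \<le> (s - b) * M"
    proof (cases "s = b")
      case False
      then obtain u where u: "b < u" "u < s" "P s - P b = (s - b) * p u"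
        using P_MVT[of b s] b_bounds sb by auto
      have "w u \<le> w s" using w_max[of s u] \<alpha> u sb by simp
      then have "p u \<le> M" using u sb by (intro le) (auto simp: B_def)
      then show ?thesis using u by simp
    qed simp
    also have "\<dots> \<le> \<rho> * (w s + k) * M"
      using contraction[of s] sb M0 by (intro mult_right_mono) (auto simp: \<rho>_def)
    finally have "p s * (w s + k) \<le> (\<rho> * M) * (w s + k)" by (simp add: ac_simps)
    moreover have "0 < w s + k" using w_pos[of s] b_bounds sb k1 by simp
    ultimately show ?thesis by simp
  qed
  then have "M \<le> \<rho> * M" unfolding M_def using B by (intro cSUP_least) auto
  then have "M * (1 - \<rho>) \<le> 0" by (simp add: algebra_simps)
  then have "M \<le> 0" using \<rho> by (simp add: mult_le_0_iff)
  then show ?thesis using le[OF B] p_bounds[of x] x by simp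
qed

section \<open>The gap \<open>G\<close> and its derivatives along the graphs\<close>

definition H :: "real \<Rightarrow> real \<Rightarrow> real" where "H x v = hr (v - x) - psi v + P x * (v - x)"
definition G :: "real \<Rightarrow> real \<Rightarrow> real" where "G x v = H x v - H x (U x)"
definition gy :: "real \<Rightarrow> real \<Rightarrow> real" where "gy x v = h1 (v - x) - h1 (v - t v) + P x - P (t v)"

lemma psi_cont: "continuous_on {-2..2} psi"
  by (rule DERIV_continuous_on[of _ _ "\<lambda>v. max 0 (v - t v - r) + P (t v)"]) (use psi_deriv in auto)

lemma psi_deriv_at:
  assumes "-2 < v" "v < 2" shows "(psi has_real_derivative h1 (v - t v) + P (t v)) (at v)"
  using psi_deriv[of v] assms at_within_Icc_at[of "-2" v 2] by simp

lemma H_deriv_v: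
  assumes "-2 < v" "v < 2" shows "(H x has_real_derivative gy x v) (at v)"
proof -
  have "((\<lambda>v. hr (v - x)) has_real_derivative h1 (v - x) * 1) (at v)"
    by (rule DERIV_chain2[OF hr_deriv]) (auto intro!: derivative_eq_intros)
  then show ?thesis unfolding H_def[abs_def] gy_def
    using psi_deriv_at[OF assms] by (auto intro!: derivative_eq_intros)
qed

lemma H_cont_v: "continuous_on {-2..2} (H x)"
  unfolding H_def[abs_def]
  by (intro continuous_intros psi_cont continuous_on_compose2[OF hr_continuous[of UNIV]]) auto

lemma G_deriv_v: "-2 < v \<Longrightarrow> v < 2 \<Longrightarrow> (G x has_real_derivative gy x v) (at v)"
  unfolding G_def[abs_def] using H_deriv_v[of v x] by (auto intro!: derivative_eq_intros)

lemma G_cont_v: "continuous_on {-2..2} (G x)"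
  unfolding G_def[abs_def] by (intro continuous_intros H_cont_v)

lemma H_deriv_x:
  assumes "-1 < x" "x < 1"
  shows "((\<lambda>s. H s v) has_real_derivative - h1 (v - x) + p x * (v - x) - P x) (at x)"
proof -
  have "((\<lambda>s. hr (v - s)) has_real_derivative h1 (v - x) * (- 1)) (at x)"
    by (rule DERIV_chain2[OF hr_deriv]) (auto intro!: derivative_eq_intros)
  then show ?thesis unfolding H_def[abs_def]
    using P_deriv[OF assms] by (auto intro!: derivative_eq_intros simp: algebra_simps)
qed

text \<open>Since \<open>t (C s) = s\<close>, the derivative \<open>gy s\<close> vanishes at height
  \<open>C s\<close>, and \<open>gy\<close> is Lipschitz in the base point. The increment between
  two heights of the curve is therefore of second order.\<close>

lemma H_diff_bound:
  assumes a: "-1 \<le> a" "c \<le> 1" and C: "continuous_on {a..c} C" "\<And>s. s \<in> {a..c} \<Longrightarrow> t (C s) = s \<and> C s \<in> {-2..2}"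
    and s: "s \<in> {a..c}" and x: "x \<in> {a..c}"
  shows "\<bar>H s (C s) - H s (C x)\<bar> \<le> 2 * \<bar>s - x\<bar> * \<bar>C s - C x\<bar>"
proof (cases "C s = C x")
  case False
  define lo hi where "lo = min (C s) (C x)" and "hi = max (C s) (C x)"
  have lohi: "lo < hi" "-2 \<le> lo" "hi \<le> 2" using False C(2)[OF s] C(2)[OF x] by (auto simp: lo_def hi_def)
  obtain \<xi> where \<xi>: "lo < \<xi>" "\<xi> < hi" "H s hi - H s lo = (hi - lo) * gy s \<xi>"
  proof (rule MVT_derivE[of lo hi "H s" "gy s"])
    show "continuous_on {lo..hi} (H s)" by (rule continuous_on_subset[OF H_cont_v]) (use lohi in auto)
    show "(H s has_real_derivative gy s u) (at u)" if "lo < u" "u < hi" for u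
      using that lohi by (intro H_deriv_v) auto
  qed (use lohi in auto)
  define S where "S = {min s x..max s x}"
  have S: "S \<subseteq> {a..c}" "s \<in> S" "x \<in> S" using s x by (auto simp: S_def)
  have "connected (C ` S)"
    using continuous_on_subset[OF C(1) S(1)] by (intro connected_continuous_image) (auto simp: S_def)
  moreover have "lo \<in> C ` S" "hi \<in> C ` S" using S by (auto simp: lo_def hi_def min_def max_def)
  ultimately have "\<xi> \<in> C ` S" using \<xi> by (meson connected_iff_interval less_imp_le)
  then obtain s' where s': "s' \<in> S" "\<xi> = C s'" by auto
  have ts': "t \<xi> = s'" using C(2) s' S by auto
  have s'': "\<bar>s - s'\<bar> \<le> \<bar>s - x\<bar>" using s' by (auto simp: S_def abs_if min_def max_def split: if_splits)
  have "\<bar>gy s \<xi>\<bar> \<le> \<bar>h1 (\<xi> - s) - h1 (\<xi> - s')\<bar> + \<bar>P s - P s'\<bar>"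
    unfolding gy_def ts' by linarith
  also have "\<dots> \<le> \<bar>s - s'\<bar> + \<bar>s - s'\<bar>"
    using h1_lip[of "\<xi> - s" "\<xi> - s'"] P_lip[of s s'] s s' S a by (intro add_mono) auto
  finally have "\<bar>gy s \<xi>\<bar> \<le> 2 * \<bar>s - x\<bar>" using s'' by simp
  moreover have "\<bar>H s (C s) - H s (C x)\<bar> = \<bar>H s hi - H s lo\<bar>"
    by (auto simp: lo_def hi_def min_def max_def abs_minus_commute)
  moreover have "hi - lo = \<bar>C s - C x\<bar>" by (auto simp: lo_def hi_def)
  moreover have "\<bar>H s hi - H s lo\<bar> = (hi - lo) * \<bar>gy s \<xi>\<bar>" using \<xi>(3) lohi by (simp add: abs_mult)
  moreover have "(hi - lo) * \<bar>gy s \<xi>\<bar> \<le> (hi - lo) * (2 * \<bar>s - x\<bar>)"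
    using calculation(1) lohi by (intro mult_left_mono) auto
  ultimately show ?thesis by (simp add: mult.commute)
qed simp

text \<open>An envelope argument: motion along the curve contributes nothing to first order, so only
  the explicit dependence on \<open>s\<close> is differentiated. By \<open>H_diff_bound\<close> the
  curve need only be continuous, which avoids derivatives of \<open>D\<close> and
  \<open>U\<close>.\<close>

lemma envelope:
  assumes a: "-1 \<le> a" "c \<le> 1" and C: "continuous_on {a..c} C" "\<And>s. s \<in> {a..c} \<Longrightarrow> t (C s) = s \<and> C s \<in> {-2..2}"
    and x: "a < x" "x < c"
  shows "((\<lambda>s. H s (C s)) has_real_derivative - h1 (C x - x) + p x * (C x - x) - P x) (at x)"
proof -
  have "((\<lambda>s. (H s (C x) - H x (C x)) / (s - x)) \<longlongrightarrow> - h1 (C x - x) + p x * (C x - x) - P x) (at x)"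
    using H_deriv_x[of x "C x"] a x by (simp add: has_field_derivative_iff)
  moreover have "((\<lambda>s. (H s (C s) - H s (C x)) / (s - x)) \<longlongrightarrow> 0) (at x)"
  proof (rule Lim_null_comparison)
    have "isCont C x" using C(1) x by (auto intro: continuous_on_interior)
    then have "((\<lambda>s. 2 * \<bar>C s - C x\<bar>) \<longlongrightarrow> 2 * \<bar>C x - C x\<bar>) (at x)"
      by (intro tendsto_intros) (auto simp: isCont_def)
    then show "((\<lambda>s. 2 * \<bar>C s - C x\<bar>) \<longlongrightarrow> 0) (at x)" by simp
    have "\<forall>\<^sub>F s in at x. s \<in> {a<..<c}" using x by (intro eventually_at_in_open') auto
    moreover have "\<forall>\<^sub>F s in at x. s \<noteq> x" by (simp add: eventually_at_filter)
    ultimately show "\<forall>\<^sub>F s in at x. norm ((H s (C s) - H s (C x)) / (s - x)) \<le> 2 * \<bar>C s - C x\<bar>"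
    proof eventually_elim
      case (elim s)
      then show ?case using H_diff_bound[OF a C, of s x] x
        by (simp add: pos_divide_le_eq mult.assoc mult.left_commute mult.commute)
    qed
  qed
  ultimately have "((\<lambda>s. (H s (C x) - H x (C x)) / (s - x) + (H s (C s) - H s (C x)) / (s - x))
      \<longlongrightarrow> (- h1 (C x - x) + p x * (C x - x) - P x) + 0) (at x)"
    by (rule tendsto_add)
  moreover have "(H s (C x) - H x (C x)) / (s - x) + (H s (C s) - H s (C x)) / (s - x) = (H s (C s) - H x (C x)) / (s - x)" for s
    by (simp add: add_divide_distrib[symmetric])
  ultimately show ?thesis by (simp add: has_field_derivative_iff)
qed

lemma envelope_U:
  assumes "-1 < x" "x < 1"
  shows "((\<lambda>s. H s (U s)) has_real_derivative - h1 (w x) + p x * w x - P x) (at x)"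
proof -
  have "t (U s) = s \<and> U s \<in> {-2..2}" if "s \<in> {-1..1}" for s using t_U[of s] U_range[of s] that by auto
  then show ?thesis using envelope[OF _ _ U_continuous _ assms] by (simp add: w_of_def)
qed

lemma envelope_D:
  assumes "-1 < x" "x < b"
  shows "((\<lambda>s. H s (D s)) has_real_derivative - h1 (d x) + p x * d x - P x) (at x)"
proof -
  have "t (D s) = s \<and> D s \<in> {-2..2}" if "s \<in> {-1..b}" for s
    using t_D[of s] D_range[of s] that b_bounds k1 by auto
  then show ?thesis using envelope[OF _ _ D_continuous_left _ assms] b_bounds by (simp add: d_of_def)
qed

lemma H_comp_cont:
  assumes "X \<subseteq> {-1..1}" "continuous_on X C" "C ` X \<subseteq> {-2..2}"
  shows "continuous_on X (\<lambda>s. H s (C s))"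
  unfolding H_def
  by (intro continuous_intros assms continuous_on_compose2[OF hr_continuous[of UNIV]]
      continuous_on_compose2[OF psi_cont] continuous_on_subset[OF P_cont]) (use assms in auto)

lemma HU_cont: "continuous_on {-1..1} (\<lambda>s. H s (U s))"
  using U_range by (intro H_comp_cont U_continuous) force+

lemma G_deriv_x:
  assumes "-1 < x" "x < 1"
  shows "((\<lambda>s. G s v) has_real_derivative h1 (w x) - h1 (v - x) - p x * (U x - v)) (at x)"
proof -
  have "((\<lambda>s. G s v) has_real_derivative
      (- h1 (v - x) + p x * (v - x) - P x) - (- h1 (w x) + p x * w x - P x)) (at x)"
    unfolding G_def by (intro DERIV_diff H_deriv_x envelope_U assms)
  moreover have "(- h1 (v - x) + p x * (v - x) - P x) - (- h1 (w x) + p x * w x - P x)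
      = h1 (w x) - h1 (v - x) - p x * (U x - v)"
    by (simp add: w_of_def algebra_simps)
  ultimately show ?thesis by (rule DERIV_cong)
qed

lemma G_cont_x: "v \<in> {-2..2} \<Longrightarrow> continuous_on {-1..1} (\<lambda>s. G s v)"
  unfolding G_def by (intro continuous_intros HU_cont H_comp_cont) auto

lemma G_U [simp]: "G x (U x) = 0" by (simp add: G_def)

lemma G_D_left:
  assumes "-1 \<le> x" "x \<le> b" shows "G x (D x) = 0"
proof (cases "x = -1")
  case True then show ?thesis using D_m1 U_m1 by (simp add: G_def)
next
  case False
  have "G x (D x) = G (-1) (D (-1))"
  proof (rule DERIV_isconst_end[where f = "\<lambda>s. G s (D s)"])
    have "continuous_on {-1..x} (\<lambda>s. H s (D s))"
      by (rule H_comp_cont) (use assms b_bounds D_range k1 in \<open>force intro: continuous_on_subset[OF D_continuous]\<close>)+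
    then show "continuous_on {-1..x} (\<lambda>s. G s (D s))" unfolding G_def
      using assms b_bounds by (intro continuous_intros continuous_on_subset[OF HU_cont]) auto
    fix s assume s: "-1 < s" "s < x"
    have "((\<lambda>s. G s (D s)) has_real_derivative
        (- h1 (d s) + p s * d s - P s) - (- h1 (w s) + p s * w s - P s)) (at s)"
      unfolding G_def using s assms b_bounds by (intro DERIV_diff envelope_U envelope_D) auto
    moreover have "(- h1 (d s) + p s * d s - P s) - (- h1 (w s) + p s * w s - P s) = 0"
      using p_left[of s] s assms by (simp add: algebra_simps)
    ultimately show "((\<lambda>s. G s (D s)) has_real_derivative 0) (at s)" by simp
  qed (use False assms in auto)
  then show ?thesis using D_m1 U_m1 by (simp add: G_def)
qed

lemma G_D_right:
  assumes "b \<le> x" "x \<le> 1" shows "G x (x - k) = 0"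
proof (cases "x = b")
  case True then show ?thesis using G_D_left[of b] D_right[of b] b_bounds by simp
next
  case False
  have "G x (x - k) = G b (b - k)"
  proof (rule DERIV_isconst_end[where f = "\<lambda>s. G s (s - k)"])
    have "continuous_on {b..x} (\<lambda>s. H s (s - k))"
      by (rule H_comp_cont) (use assms b_bounds k1 k2 in \<open>auto simp: b_of_def intro!: continuous_intros\<close>)
    then show "continuous_on {b..x} (\<lambda>s. G s (s - k))" unfolding G_def
      using assms b_bounds by (intro continuous_intros continuous_on_subset[OF HU_cont]) auto
    fix s assume s: "b < s" "s < x"
    have s': "-2 < s - k" "s - k < 2" using s assms k1 by (auto simp: b_of_def)
    have "((\<lambda>s. psi (s - k)) has_real_derivative (h1 (\<zeta> s) + P (\<alpha> s)) * 1) (at s)"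
      using psi_deriv_at[OF s'] \<alpha>_eq_t[of s] s assms
      by (intro DERIV_chain2[where f = psi]) (auto intro!: derivative_eq_intros simp: zeta_of_def)
    then have "((\<lambda>s. H s (s - k)) has_real_derivative - (h1 (\<zeta> s) + P (\<alpha> s)) - k * p s) (at s)"
      unfolding H_def using P_deriv[of s] s assms b_bounds by (auto intro!: derivative_eq_intros)
    then have "((\<lambda>s. G s (s - k)) has_real_derivative
        (- (h1 (\<zeta> s) + P (\<alpha> s)) - k * p s) - (- h1 (w s) + p s * w s - P s)) (at s)"
      unfolding G_def using s assms b_bounds by (intro DERIV_diff envelope_U) auto
    moreover have "(- (h1 (\<zeta> s) + P (\<alpha> s)) - k * p s) - (- h1 (w s) + p s * w s - P s) = 0"
      using p_right[of s] s assms by (simp add: algebra_simps)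
    ultimately show "((\<lambda>s. G s (s - k)) has_real_derivative 0) (at s)" by simp
  qed (use False assms in auto)
  then show ?thesis using G_D_left[of b] D_right[of b] b_bounds by simp
qed

lemma G_D: "-1 \<le> x \<Longrightarrow> x \<le> 1 \<Longrightarrow> G x (D x) = 0"
  using G_D_left[of x] G_D_right[of x] D_right[of x] by (cases "x \<le> b") auto

lemma G_above_U:
  assumes x: "-1 \<le> x" "x \<le> 1" and v: "U x \<le> v" "v \<le> 2" shows "0 \<le> G x v"
proof -
  have "G x (U x) \<le> G x v"
  proof (rule deriv_nonneg_imp_le[where f = "G x"])
    show "continuous_on {U x..v} (G x)"
      by (rule continuous_on_subset[OF G_cont_v]) (use U_range[of x] x v in auto)
    fix u assume u: "U x < u" "u < v"
    have u': "-1 \<le> u" "u < 2" using U_range[of x] x u v by auto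
    define s where "s = t u"
    have s: "U s = u" "-1 \<le> s" "s \<le> 1" using t_upper[of u] u' by (auto simp: s_def)
    have xs: "x \<le> s" using U_le_iff[of x s] s x u by simp
    have sup: "w \<sigma> \<le> u - \<sigma>" if "\<sigma> \<le> s" "-1 \<le> \<sigma>" for \<sigma>
      using U_le_iff[of \<sigma> s] s that by (simp add: w_of_def)
    \<comment> \<open>The point where \<open>u - \<sigma> = r\<close>, clamped to
      \<open>[x, s]\<close>. The increment of \<open>h1\<close> is exactly
      \<open>\<sigma> - x\<close>; right of \<open>\<sigma>\<close> one has \<open>w \<le> r\<close>
      and \<open>P\<close> is constant, left of it \<open>P\<close> grows at rate at most 1.\<close>
    define \<sigma> where "\<sigma> = max x (min s (u - r))"
    have \<sigma>: "x \<le> \<sigma>" "\<sigma> \<le> s" using xs by (auto simp: \<sigma>_def)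
    have "P s = P \<sigma>"
    proof (rule P_const)
      fix q assume q: "\<sigma> < q" "q < s"
      then have "u - q \<le> r" by (auto simp: \<sigma>_def)
      then have "w q \<le> r" using sup[of q] q \<sigma> x by simp
      then show "p q = 0" using p_zero[of q] q \<sigma> x s by simp
    qed (use \<sigma> x s in auto)
    moreover have "P \<sigma> - P x \<le> \<sigma> - x" using P_incr(2)[of x \<sigma>] \<sigma> x s by simp
    moreover have "h1 (u - x) - h1 (u - s) = \<sigma> - x"
      using xs by (auto simp: \<sigma>_def max_def min_def)
    ultimately have "0 \<le> gy x u" by (simp add: gy_def s_def[symmetric])
    then show "\<exists>D. (G x has_real_derivative D) (at u) \<and> 0 \<le> D"
      using G_deriv_v[of u x] u' by auto
  qed (use v in simp)
  then show ?thesis by simp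
qed

lemma G_below_D:
  assumes x: "-1 \<le> x" "x \<le> b" and v: "-2 \<le> v" "v \<le> D x" shows "0 \<le> G x v"
proof -
  have "- G x v \<le> - G x (D x)"
  proof (rule deriv_nonneg_imp_le[where f = "\<lambda>v. - G x v"])
    have Dx: "D x \<le> -1" using D_le_iff[of x "-1"] D_m1 x b_bounds by simp
    show "continuous_on {v..D x} (\<lambda>v. - G x v)"
      by (intro continuous_intros continuous_on_subset[OF G_cont_v]) (use Dx v in auto)
    fix u assume u: "v < u" "u < D x"
    have u': "-2 < u" "u \<le> -1" using Dx u v by auto
    define s where "s = t u"
    have s: "D s = u" "-1 \<le> s" "s \<le> b" using t_lower[of u] u' by (auto simp: s_def)
    have xs: "x \<le> s" using D_le_iff[of s x] s x u by simp
    have sup: "u - \<sigma> \<le> d \<sigma>" if "\<sigma> \<le> s" "-1 \<le> \<sigma>" for \<sigma>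
      using D_le_iff[of s \<sigma>] s that by (simp add: d_of_def)
    \<comment> \<open>The mirror image of the upper case: left of \<open>\<sigma>\<close> one has
      \<open>r \<le> d\<close>, so that \<open>p = 1\<close> and \<open>P\<close> grows at full
      rate, and right of it monotonicity of \<open>P\<close> is enough.\<close>
    define \<sigma> where "\<sigma> = max x (min s (u - r))"
    have \<sigma>: "x \<le> \<sigma>" "\<sigma> \<le> s" using xs by (auto simp: \<sigma>_def)
    have "P \<sigma> - P x = \<sigma> - x"
    proof (rule P_full)
      fix q assume q: "x < q" "q < \<sigma>"
      then have "r \<le> u - q" by (auto simp: \<sigma>_def)
      then have "r \<le> d q" using sup[of q] q \<sigma> x by simp
      then show "p q = 1" using p_one_left[of q] q \<sigma> x s by simp
    qed (use \<sigma> x s b_bounds in auto)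
    moreover have "P \<sigma> \<le> P s" using P_incr(1)[of \<sigma> s] \<sigma> x s b_bounds by simp
    moreover have "h1 (u - x) - h1 (u - s) = \<sigma> - x"
      using xs by (auto simp: \<sigma>_def max_def min_def)
    ultimately have "0 \<le> - gy x u" by (simp add: gy_def s_def[symmetric])
    moreover have "((\<lambda>v. - G x v) has_real_derivative - gy x u) (at u)"
      using G_deriv_v[of u x] u' by (auto intro!: derivative_eq_intros)
    ultimately show "\<exists>D. ((\<lambda>v. - G x v) has_real_derivative D) (at u) \<and> 0 \<le> D" by blast
  qed (use v in simp)
  then show ?thesis using G_D_left x by simp
qed

lemma G_start:
  assumes "-2 \<le> v" "v \<le> 2" shows "G (t v) v = 0"
  using t_lower[of v] t_upper[of v] G_D_left[of "t v"] G_U[of "t v"] assms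
  by (cases "v \<le> -1") auto

lemma t_le: assumes "-1 \<le> x" "x \<le> 1" "D x \<le> v" "v \<le> U x" "-2 \<le> v" shows "t v \<le> x"
proof (cases "v \<le> -1")
  case True
  then have t: "-1 \<le> t v" "t v \<le> b" "D (t v) = v" using t_lower[of v] assms by auto
  show ?thesis
  proof (cases "x \<le> b")
    case True
    then show ?thesis using D_le_iff[of x "t v"] t assms by simp
  qed (use t in simp)
next
  case False
  have "v \<le> 2" using U_range[of x] assms by auto
  then show ?thesis using t_upper[of v] U_le_iff[of "t v" x] assms False by simp
qed

text \<open>For \<open>x \<le> b\<close> the tail \<open>p s\<close> is the slope of the chord of
  the convex \<open>h1\<close> over \<open>[d s, w s]\<close>, hence at most the slope from any
  intermediate point to \<open>w s\<close>. So the gap grows along the horizontal segment that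
  starts on a graph at \<open>t v\<close>, where it is 0.\<close>

lemma G_between_left:
  assumes x: "-1 \<le> x" "x \<le> b" and v: "D x \<le> v" "v \<le> U x" shows "0 \<le> G x v"
proof -
  have xx: "x \<le> 1" using x b_bounds by simp
  have v2: "-2 \<le> v" "v \<le> 2" using D_range[of x] U_range[of x] x v xx by auto
  have tx: "t v \<le> x" "-1 \<le> t v" using t_le[of x v] t_range[of v] x v xx v2 by auto
  have "G (t v) v \<le> G x v"
  proof (rule deriv_nonneg_imp_le[where f = "\<lambda>s. G s v"])
    show "continuous_on {t v..x} (\<lambda>s. G s v)"
      by (rule continuous_on_subset[OF G_cont_x]) (use v2 tx xx in auto)
    fix s assume s: "t v < s" "s < x"
    have s': "-1 < s" "s \<le> b" "s < 1" using s tx x xx b_bounds by auto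
    have vs: "D s \<le> v" "v \<le> U s"
    proof -
      have "D s \<le> D (t v) \<and> U (t v) \<le> U s"
        using D_le_iff[of s "t v"] U_le_iff[of "t v" s] s' s tx by auto
      moreover have "D (t v) \<le> v \<and> v \<le> U (t v)"
        using t_lower[of v] t_upper[of v] v2 D_le_iff[of "t v" "-1"] U_le_iff[of "-1" "t v"] D_m1 U_m1 tx x xx
        by (cases "v \<le> -1") auto
      ultimately show "D s \<le> v" "v \<le> U s" by auto
    qed
    define u where "u = v - s"
    have u: "d s \<le> u" "u \<le> w s" using vs by (auto simp: u_def d_of_def w_of_def)
    have wd: "0 < w s - d s" using wd_pos[of s] s' by simp
    have "0 \<le> (h1 (w s) - h1 u - p s * (w s - u)) * (w s - d s)"
    proof -
      have "(p s * (w s - u)) * (w s - d s) = (h1 (w s) - h1 (d s)) * (w s - u)"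
        using p_left[of s] s' by (simp add: mult.commute mult.left_commute)
      also have "\<dots> \<le> (h1 (w s) - h1 u) * (w s - d s)"
      proof (cases "u \<le> r")
        case True
        then have "h1 u = 0" "h1 (d s) = 0" using u by auto
        then show ?thesis using u by (auto intro: mult_left_mono)
      next
        case False
        then have "h1 (w s) - h1 u = w s - u" using u by auto
        moreover have "h1 (w s) - h1 (d s) \<le> w s - d s" using h1_lip[of "w s" "d s"] wd by simp
        ultimately show ?thesis using u by (auto simp: mult.commute intro: mult_left_mono)
      qed
      finally show ?thesis by (simp add: left_diff_distrib)
    qed
    then have pos: "0 \<le> h1 (w s) - h1 u - p s * (w s - u)" using wd by (simp add: zero_le_mult_iff)
    have "w s - u = U s - v" by (simp add: u_def w_of_def)
    from pos[unfolded this, unfolded u_def] show "\<exists>D. ((\<lambda>s. G s v) has_real_derivative D) (at s) \<and> 0 \<le> D"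
      using G_deriv_x[of s v] s' by blast
  qed (use tx in simp)
  then show ?thesis using G_start v2 by simp
qed

end

section \<open>Nonnegativity of the gap\<close>

context curtain begin

lemma \<alpha>_b: "\<alpha> b = b"
  using \<alpha>_eq_t[of b] t_D[of b] D_right[of b] b_bounds by simp

lemma \<alpha>_upper_RR:
  assumes "k - 1 \<le> x" "x \<le> 1" shows "RR (\<alpha> x) = zi x"
proof -
  note a = \<alpha>_upper[OF assms]
  have bx: "b \<le> x" using assms k1 by (simp add: b_of_def)
  have "RR (\<alpha> x) \<le> 1" using RR_le[of "\<alpha> x" x0] x0_props a by simp
  have "yh (RR (\<alpha> x)) = yh (zi x)"
    using a U_left[of "\<alpha> x"] x0_props zi_props[of x] bx assms by (simp add: yh_def y_of_def)
  moreover have "0 < RR (\<alpha> x)" using RR_le[of "-1" "\<alpha> x"] a x0_props ds_props \<delta>b_props by simp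
  ultimately show ?thesis
    using yh_less[of "RR (\<alpha> x)" "zi x"] yh_less[of "zi x" "RR (\<alpha> x)"] zi_props[of x] \<delta>b_props bx assms
    by (cases "RR (\<alpha> x)" "zi x" rule: linorder_cases) auto
qed

lemma D_deriv:
  assumes "-1 < x" "x < b"
  shows "(D has_real_derivative (k + LL x) / (k - LL x) * (- 2 * w x / (w x - d x))) (at x)"
proof -
  have L: "LL x < k" using LL_props[of x] ds_props k1 assms by simp
  have "((\<lambda>x. z (LL x) - k) has_real_derivative (k + LL x) / (k - LL x) * (- 2 * w x / (w x - d x)) - 0) (at x)"
    by (intro DERIV_diff DERIV_chain2[OF z_deriv LL_deriv] assms L DERIV_const) auto
  then have "((\<lambda>x. z (LL x) - k) has_real_derivative (k + LL x) / (k - LL x) * (- 2 * w x / (w x - d x))) (at x)"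
    by simp
  then show ?thesis
  proof (rule has_field_derivative_transform_within_open[of _ _ _ "{-1<..<b}"])
    fix s assume s: "s \<in> {-1<..<b}"
    then have "LL s \<le> 1" using LL_props[of s] ds_props by simp
    then show "z (LL s) - k = D s" using D_left[of s] s by (simp add: yh_def y_of_def)
  qed (use assms in auto)
qed

lemma \<alpha>_deriv:
  assumes x: "b < x" "x < k - 1"
  shows "(\<alpha> has_real_derivative
    - ((k - zi x) / (k + zi x) * ((w (\<alpha> x) - d (\<alpha> x)) / (2 * w (\<alpha> x))))) (at x)"
    and "-1 < \<alpha> x" "\<alpha> x < b"
proof -
  have x1: "x \<le> 1" using x k2 by simp
  note a = \<alpha>_lower[of x]
  show a1: "-1 < \<alpha> x" using a D_m1 x by (cases "\<alpha> x = -1") auto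
  show a2: "\<alpha> x < b" using a D_b x by (cases "\<alpha> x = b") (auto simp: b_of_def)
  have wd: "0 < w (\<alpha> x)" "0 < w (\<alpha> x) - d (\<alpha> x)" using w_pos[of "\<alpha> x"] d_neg[of "\<alpha> x"] a1 a2 b_bounds by auto
  have z: "0 < zi x" "zi x < k" using zi_props[of x] \<delta>b_props x x1 k1 by auto
  define E where "E = (k + zi x) / (k - zi x) * (- 2 * w (\<alpha> x) / (w (\<alpha> x) - d (\<alpha> x)))"
  have "(\<alpha> has_real_derivative inverse E) (at x)"
  proof (rule DERIV_inverse_function[where f = "\<lambda>s. D s + k" and a = b and b = "k - 1"])
    have "(D has_real_derivative E) (at (\<alpha> x))" using D_deriv[OF a1 a2] a x by (simp add: E_def)
    then show "((\<lambda>s. D s + k) has_real_derivative E) (at (\<alpha> x))"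
      by (auto intro!: derivative_eq_intros)
    show "E \<noteq> 0" using wd z k1 by (simp add: E_def)
    show "D (\<alpha> u) + k = u" if "b < u" "u < k - 1" for u using \<alpha>_lower[of u] that by simp
    show "isCont \<alpha> x" using \<alpha>_continuous x k2 by (auto intro: continuous_on_interior)
  qed (use x in auto)
  moreover have "inverse E = - ((k - zi x) / (k + zi x) * ((w (\<alpha> x) - d (\<alpha> x)) / (2 * w (\<alpha> x))))"
    by (simp add: E_def inverse_eq_divide)
  ultimately show "(\<alpha> has_real_derivative
    - ((k - zi x) / (k + zi x) * ((w (\<alpha> x) - d (\<alpha> x)) / (2 * w (\<alpha> x))))) (at x)" by simp
qed

lemma t_m1: "t (-1) = -1"
  using t_D[of "-1"] D_m1 b_bounds by simp

end

context level begin

text \<open>Between the graphs and for \<open>v - x < r\<close>, the derivative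
  \<open>gy x v\<close> is negative exactly when \<open>kk v\<close> exceeds \<open>P x + r\<close>.
  Counting its sign changes means counting crossings of one level by a function that does not
  involve \<open>x\<close>.\<close>

definition kk :: "real \<Rightarrow> real" where "kk v = P (t v) + v - t v"

definition kap :: "real \<Rightarrow> real" where "kap s = P s + w s"

lemma kk_eq_kap: "-1 \<le> v \<Longrightarrow> v \<le> 2 \<Longrightarrow> kk v = kap (t v)"
  using t_upper[of v] by (simp add: kk_def kap_def w_of_def)

text \<open>For \<open>v' - x \<ge> r\<close> the derivative is nonpositive outright, because
  \<open>P\<close> has slope at most 1. Below that height its sign is read off from
  \<open>kk\<close>.\<close>

lemma gy_cross:
  assumes x: "-1 \<le> x" "x \<le> 1" and v: "D x \<le> v" "v < v'" "v' \<le> U x"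
    and neg: "gy x v < 0" and kk: "P x + r < kk v \<Longrightarrow> P x + r \<le> kk v'"
  shows "gy x v' \<le> 0"
proof -
  have v2: "-2 \<le> v" "v' \<le> 2" using D_range[of x] U_range[of x] x v by auto
  have tv: "t v \<le> x" "-1 \<le> t v" "t v' \<le> x" "-1 \<le> t v'"
    using t_le[of x v] t_le[of x v'] t_range[of v] t_range[of v'] x v v2 by auto
  have Pv: "P (t v) \<le> P x" "P (t v') \<le> P x" "P x - P (t v') \<le> x - t v'"
    using P_incr[of "t v" x] P_incr[of "t v'" x] tv x by auto
  show ?thesis
  proof (cases "r \<le> v' - x")
    case True
    then have "h1 (v' - x) - h1 (v' - t v') = t v' - x" using tv by (simp add: max_def)
    then show ?thesis using Pv by (simp add: gy_def)
  next
    case False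
    then have "h1 (v - x) = 0" "h1 (v' - x) = 0" using v by auto
    then have "P x - P (t v) < h1 (v - t v)" using neg by (simp add: gy_def)
    then have "P x + r < kk v" using Pv by (auto simp: kk_def max_def split: if_splits)
    from kk[OF this] have "P x - P (t v') \<le> h1 (v' - t v')" by (simp add: kk_def)
    then show ?thesis using \<open>h1 (v' - x) = 0\<close> by (simp add: gy_def)
  qed
qed

lemma G_between_of_cross:
  assumes x: "b \<le> x" "x \<le> 1"
    and kk: "\<And>v v'. D x \<le> v \<Longrightarrow> v < v' \<Longrightarrow> v' \<le> U x \<Longrightarrow> P x + r < kk v \<Longrightarrow> P x + r \<le> kk v'"
    and v: "D x \<le> v" "v \<le> U x"
  shows "0 \<le> G x v"
proof (rule sign_crossing_nonneg[where f = "G x" and f' = "gy x" and a = "D x" and c = "U x"])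
  have xx: "-1 \<le> x" using x b_bounds by simp
  have rng: "-2 \<le> D x" "U x \<le> 2" using D_range[of x] U_range[of x] x xx by auto
  show "continuous_on {D x..U x} (G x)" by (rule continuous_on_subset[OF G_cont_v]) (use rng in auto)
  show "(G x has_real_derivative gy x s) (at s)" if "D x < s" "s < U x" for s
    using that rng by (intro G_deriv_v) auto
  show "gy x s' \<le> 0" if "D x < s" "s < s'" "s' < U x" "gy x s < 0" for s s'
    using gy_cross[of x s s'] kk[of s s'] that x xx by simp
qed (use v G_D[of x] x b_bounds in auto)

lemma kk_low: assumes "-2 \<le> v" "v \<le> v'" "v' \<le> -1" shows "kk v \<le> kk v'"
  using P_incr(2)[of "t v'" "t v"] t_antimono[of v v'] t_lower[of v] t_lower[of v'] assms b_bounds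
  by (simp add: kk_def)

lemma kap_left: "-1 \<le> s \<Longrightarrow> s \<le> s' \<Longrightarrow> s' \<le> x0 \<Longrightarrow> kap s \<le> kap s'"
  using w_mono_left[of s s'] P_incr(1)[of s s'] x0_props b_bounds by (simp add: kap_def)

lemma kap_right: "b \<le> s \<Longrightarrow> s \<le> s' \<Longrightarrow> s' \<le> 1 \<Longrightarrow> kap s \<le> kap s'"
  using zi_mono(1)[of s s'] w_right[of s] w_right[of s'] P_incr(1)[of s s'] b_bounds by (simp add: kap_def)

definition slope :: "real \<Rightarrow> real" where "slope s = h1 (w s) - h1 (d s) - d s - w s"

lemma kap_deriv:
  assumes "x0 < s" "s < b"
  shows "(kap has_real_derivative slope s / (w s - d s)) (at s)"
proof -
  have s: "-1 < s" "s \<le> b" "s < 1" using assms x0_props b_bounds by auto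
  have wd: "0 < w s - d s" using wd_pos[of s] s by simp
  have "p s = (h1 (w s) - h1 (d s)) / (w s - d s)" using p_left[of s] s wd by (simp add: eq_divide_eq)
  then have "p s + (- d s - w s) / (w s - d s) = slope s / (w s - d s)"
    by (simp add: slope_def add_divide_distrib[symmetric])
  moreover have "(kap has_real_derivative p s + (- d s - w s) / (w s - d s)) (at s)"
    unfolding kap_def[abs_def] using assms s by (intro DERIV_add P_deriv w_deriv_mid) auto
  ultimately show ?thesis by simp
qed

lemma kap_cont: "continuous_on {-1..1} kap"
  unfolding kap_def[abs_def] by (intro continuous_intros P_cont w_continuous)

lemma kap_MVT:
  assumes "x0 \<le> s" "s < s'" "s' \<le> b"
  obtains q where "s < q" "q < s'" "kap s' - kap s = (s' - s) * (slope q / (w q - d q))"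
proof (rule MVT_derivE[of s s' kap "\<lambda>q. slope q / (w q - d q)"])
  show "continuous_on {s..s'} kap"
    by (rule continuous_on_subset[OF kap_cont]) (use assms x0_props b_bounds in auto)
  show "(kap has_real_derivative slope q / (w q - d q)) (at q)" if "s < q" "q < s'" for q
    using that assms by (intro kap_deriv) auto
qed (use assms that in auto)

text \<open>The only stretch where \<open>kk\<close> could decrease is the image of
  \<open>(x0, b)\<close> under \<open>U\<close>. There \<open>slope s\<close> is at least
  \<open>- d s - r\<close>, or equals \<open>- 2 * d s\<close> when \<open>r \<le> d s\<close>;
  since \<open>- d\<close> increases, both are nonnegative for
  \<open>r \<le> - d x0\<close>.\<close>

lemma kk_mono_flat:
  assumes r: "r \<le> - d x0" and v: "-2 \<le> v" "v \<le> v'" "v' \<le> 2"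
  shows "kk v \<le> kk v'"
proof -
  have mid: "kap s \<le> kap s'" if s: "x0 \<le> s" "s \<le> s'" "s' \<le> b" for s s'
  proof (cases "s = s'")
    case False
    then obtain q where q: "s < q" "q < s'" "kap s' - kap s = (s' - s) * (slope q / (w q - d q))"
      using kap_MVT[of s s'] s by auto
    have q1: "-1 < q" "q \<le> 1" "q \<le> b" using q s x0_props b_bounds by auto
    have rd: "r \<le> - d q" using d_antimono[of x0 q] r q s x0_props by simp
    have "d q < 0" "0 < w q" using d_neg w_pos q1 by auto
    then have "0 \<le> slope q" using rd by (auto simp: slope_def max_def)
    then have "0 \<le> (s' - s) * (slope q / (w q - d q))" using wd_pos[of q] q1 s by simp
    then show ?thesis using q by simp
  qed simp
  have kap: "kap s \<le> kap s'" if s: "-1 \<le> s" "s \<le> s'" "s' \<le> 1" for s s'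
  proof -
    have 1: "kap s \<le> kap s'" if "-1 \<le> s" "s \<le> s'" "s' \<le> b" for s s'
      using kap_left[of s s'] mid[of s s'] kap_left[of s x0] mid[of x0 s'] that x0_props
      by (cases "s' \<le> x0"; cases "x0 \<le> s") auto
    show ?thesis using 1[of s s'] kap_right[of s s'] 1[of s b] kap_right[of b s'] s
      by (cases "s' \<le> b"; cases "b \<le> s") auto
  qed
  have up: "kk u \<le> kk u'" if "-1 \<le> u" "u \<le> u'" "u' \<le> 2" for u u'
    using kap[of "t u" "t u'"] t_mono[of u u'] t_upper[of u] t_upper[of u'] that by (simp add: kk_eq_kap)
  show ?thesis using kk_low[of v v'] up[of v v'] kk_low[of v "-1"] up[of "-1" v'] v
    by (cases "v' \<le> -1"; cases "-1 \<le> v") auto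
qed

text \<open>For positive \<open>r\<close> the term \<open>h1 (d s)\<close> vanishes and
  \<open>slope = max (- d - r) (- d - w)\<close>, a maximum of two increasing functions.\<close>

lemma slope_cross:
  assumes r: "- d x0 < r" and s: "x0 < s" "s < s'" "s' < b" and pos: "0 < slope s"
  shows "0 \<le> slope s'"
proof -
  have s1: "-1 < s" "s \<le> 1" "s \<le> b" "-1 < s'" "s' \<le> 1" "s' \<le> b" using s x0_props b_bounds by auto
  have r0: "0 < r" using r d_neg[of x0] x0_props b_bounds by simp
  have dn: "d s < 0" "d s' < 0" using d_neg s1 by auto
  have h: "h1 (d s) = 0" "h1 (d s') = 0" using r0 dn by auto
  have dm: "- d s \<le> - d s'" using d_antimono[of s s'] s s1 by simp
  have dwm: "- d s - w s \<le> - d s' - w s'" using dw_mid_mono[of s s'] s by simp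
  show ?thesis using pos h dm dwm by (auto simp: slope_def max_def split: if_splits)
qed

text \<open>By \<open>slope_cross\<close> any decrease of \<open>kap\<close> precedes its increase.
  Having risen above a level that is at least its initial value, it cannot drop below that level
  again.\<close>

lemma kap_quasiconvex:
  assumes r: "- d x0 < r" and c: "kap x0 \<le> c" and s: "x0 < s" "s < s'" "s' \<le> b" and gt: "c < kap s"
  shows "c \<le> kap s'"
proof (rule ccontr)
  assume lt: "\<not> c \<le> kap s'"
  obtain q where q: "x0 < q" "q < s" "kap s - kap x0 = (s - x0) * (slope q / (w q - d q))"
    using kap_MVT[of x0 s] s by auto
  obtain q' where q': "s < q'" "q' < s'" "kap s' - kap s = (s' - s) * (slope q' / (w q' - d q'))"
    using kap_MVT[of s s'] s by auto
  have wd: "0 < w q - d q" "0 < w q' - d q'" using wd_pos q q' s x0_props b_bounds by auto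
  have "0 < (s - x0) * (slope q / (w q - d q))" using q c gt by linarith
  then have "0 < slope q" using s wd by (simp add: zero_less_mult_iff zero_less_divide_iff)
  then have "0 \<le> slope q'" using slope_cross[OF r, of q q'] q q' s by simp
  then have "0 \<le> (s' - s) * (slope q' / (w q' - d q'))" using s wd by simp
  then show False using q' lt gt by simp
qed

text \<open>The assumption on \<open>kap x0\<close> keeps \<open>kk\<close> at or below the level up
  to the height \<open>U x0 = 1 - k\<close>. Afterwards quasiconvexity up to \<open>U b\<close> and
  monotonicity beyond allow one crossing only.\<close>

lemma G_between_steep:
  assumes r: "- d x0 < r" and x: "b \<le> x" "x \<le> 1" and c: "kap x0 \<le> P x + r"
    and v: "D x \<le> v" "v \<le> U x"
  shows "0 \<le> G x v"
proof (rule G_between_of_cross[OF x _ v])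
  fix u u' assume u: "D x \<le> u" "u < u'" "u' \<le> U x" and gt: "P x + r < kk u"
  have u2: "-2 \<le> u" "u' \<le> 2" using D_range[of x] U_range[of x] x u b_bounds by auto
  have tx0: "t (1 - k) = x0" using t_U[of x0] U_x0 x0_props b_bounds by simp
  have "1 - k < u"
  proof (rule ccontr)
    assume le: "\<not> 1 - k < u"
    have "kk u \<le> kap x0"
    proof (cases "u \<le> -1")
      case True
      then have "kk u \<le> kk (-1)" using kk_low[of u "-1"] u2 by simp
      also have "\<dots> = kap (-1)" using kk_eq_kap[of "-1"] t_m1 by simp
      also have "\<dots> \<le> kap x0" using kap_left[of "-1" x0] x0_props by simp
      finally show ?thesis .
    next
      case False
      then show ?thesis using kap_left[of "t u" x0] kk_eq_kap[of u] t_mono[of u "1 - k"] tx0 t_upper[of u] le u u2 k1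
        by simp
    qed
    then show False using c gt by simp
  qed
  then have s: "x0 < t u" "t u < t u'" "t u' \<le> 1" "U (t u) = u" "U (t u') = u'"
    using t_upper[of u] t_upper[of u'] U_less_iff[of x0 "t u"] U_less_iff[of "t u" "t u'"] U_x0 u u2 k1 k2 x0_props b_bounds
    by auto
  have ks: "kk u = kap (t u)" "kk u' = kap (t u')" using kk_eq_kap[of u] kk_eq_kap[of u'] u u2 \<open>1 - k < u\<close> k2 by auto
  show "P x + r \<le> kk u'"
  proof (cases "b \<le> t u")
    case True
    then show ?thesis using kap_right[of "t u" "t u'"] s ks gt by simp
  next
    case F: False
    show ?thesis
    proof (cases "t u' \<le> b")
      case True
      then show ?thesis using kap_quasiconvex[OF r c, of "t u" "t u'"] s ks gt by simp
    next
      case False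
      then show ?thesis using kap_quasiconvex[OF r c, of "t u" b] kap_right[of b "t u'"] s ks gt F by simp
    qed
  qed
qed

section \<open>Horizontal segments over \<open>[b, xe]\<close>, where \<open>flat\<close> controls
  the window\<close>

context
  fixes xe
  assumes r0: "0 < r" and xe: "b \<le> xe" "xe \<le> 1"
    and flat: "\<And>x. k - 1 \<le> x \<Longrightarrow> x \<le> xe \<Longrightarrow> w (\<alpha> x) \<le> r"
begin

lemma h1_zeta: assumes "b \<le> x" "x \<le> xe" shows "h1 (\<zeta> x) = 0"
proof (cases "x \<le> k - 1")
  case True
  then show ?thesis using \<alpha>_lower[of x] d_nonpos[of "\<alpha> x"] b_bounds assms r0 by auto
next
  case False
  then show ?thesis using \<alpha>_upper[of x] flat[of x] assms xe by auto
qed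

abbreviation cc :: "real \<Rightarrow> real" where "cc x \<equiv> P x - P (\<alpha> x)"

text \<open>\<open>flat\<close> removes the term \<open>h1 (\<zeta> x)\<close> from the integral
  equation, so \<open>p\<close> is coupled only to the area \<open>cc\<close> over the
  window.\<close>

lemma p_eq: assumes "b \<le> x" "x \<le> xe" shows "p x * (k + zi x) = h1 (zi x) + cc x"
  using p_right[of x] h1_zeta[of x] w_right[of x] assms xe by (simp add: add.commute)

lemma cc_nonneg: assumes "b \<le> x" "x \<le> xe" shows "0 \<le> cc x" "P x - P b \<le> cc x"
  using P_incr(1)[of "\<alpha> x" x] P_incr(1)[of "\<alpha> x" b] \<alpha>_bounds[of x] assms xe b_bounds by auto

lemma zi_range: assumes "b \<le> x" "x \<le> xe" shows "\<delta>b \<le> zi x" "zi x \<le> 1" "0 < zi x" "0 < k - zi x" "0 < k + zi x"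
  using zi_props[of x] \<delta>b_props k1 assms xe by auto

lemma P\<alpha>_cont: "continuous_on {b..xe} (\<lambda>x. P (\<alpha> x))"
  by (rule continuous_on_compose2[OF P_cont continuous_on_subset[OF \<alpha>_continuous]])
    (use \<alpha>_bounds xe b_bounds in force)+

text \<open>Left of \<open>k - 1\<close> the map \<open>\<alpha>\<close> decreases at a rate known
  from \<open>D'\<close>; \<open>w (\<alpha> x)\<close> may be replaced by the larger
  \<open>zi x\<close> because \<open>h1 u / u\<close> is nondecreasing for \<open>u > 0\<close>.
  Right of \<open>k - 1\<close> the points \<open>\<alpha> x\<close> stay where
  \<open>w \<le> r\<close>, so \<open>P\<close> is constant there. At \<open>k - 1\<close> itself
  \<open>\<alpha>\<close> turns around, hence the exclusion.\<close>

lemma P\<alpha>_deriv: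
  assumes x: "b < x" "x < xe" "x \<noteq> k - 1"
  obtains e where "((\<lambda>x. P (\<alpha> x)) has_real_derivative e) (at x)" "e \<le> 0"
    "- ((k - zi x) / (k + zi x) * (h1 (zi x) / (2 * zi x))) \<le> e"
proof (cases "x < k - 1")
  case True
  note a = \<alpha>_deriv[OF x(1) True] and a' = \<alpha>_lower[of x]
  define q where "q = (k - zi x) / (k + zi x)"
  have z: "\<delta>b \<le> zi x" "zi x \<le> 1" "0 < zi x" "0 < k - zi x" "0 < k + zi x" using zi_range[of x] x by auto
  have q: "0 < q" using z by (simp add: q_def)
  have wd: "0 < w (\<alpha> x)" "d (\<alpha> x) < 0" using w_pos[of "\<alpha> x"] d_neg[of "\<alpha> x"] a(2,3) b_bounds by auto
  have le: "w (\<alpha> x) \<le> zi x" using w_le_LL[of "\<alpha> x"] a' a(2,3) x True by simp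
  have "((\<lambda>x. P (\<alpha> x)) has_real_derivative p (\<alpha> x) * (- (q * ((w (\<alpha> x) - d (\<alpha> x)) / (2 * w (\<alpha> x)))))) (at x)"
    unfolding q_def by (intro DERIV_chain2[OF P_deriv a(1)]) (use a b_bounds in auto)
  moreover have "p (\<alpha> x) * (- (q * ((w (\<alpha> x) - d (\<alpha> x)) / (2 * w (\<alpha> x))))) = - (q * (h1 (w (\<alpha> x)) / (2 * w (\<alpha> x))))"
  proof -
    have "h1 (d (\<alpha> x)) = 0" using wd r0 by simp
    then have "p (\<alpha> x) * (w (\<alpha> x) - d (\<alpha> x)) = h1 (w (\<alpha> x))" using p_left[of "\<alpha> x"] a by simp
    then show ?thesis by (metis (no_types) mult.left_commute mult_minus_right times_divide_eq_right)
  qed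
  ultimately have der: "((\<lambda>x. P (\<alpha> x)) has_real_derivative - (q * (h1 (w (\<alpha> x)) / (2 * w (\<alpha> x))))) (at x)"
    by (rule DERIV_cong)
  have "h1 (w (\<alpha> x)) / (2 * w (\<alpha> x)) \<le> h1 (zi x) / (2 * zi x)"
  proof (cases "w (\<alpha> x) \<le> r")
    case True then show ?thesis using z by simp
  next
    case False
    then have "h1 (w (\<alpha> x)) = w (\<alpha> x) - r" "h1 (zi x) = zi x - r" using le by auto
    moreover have "(w (\<alpha> x) - r) * (2 * zi x) \<le> (zi x - r) * (2 * w (\<alpha> x))"
      using mult_left_mono[OF le, of r] r0 by (simp add: algebra_simps)
    ultimately show ?thesis using wd z by (intro frac_le_cross) auto
  qed
  then have "q * (h1 (w (\<alpha> x)) / (2 * w (\<alpha> x))) \<le> q * (h1 (zi x) / (2 * zi x))" using q by (intro mult_left_mono) auto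
  moreover have "0 \<le> q * (h1 (w (\<alpha> x)) / (2 * w (\<alpha> x)))" using q wd by simp
  ultimately show ?thesis using that[OF der] by (simp add: q_def)
next
  case False
  then have x1: "k - 1 < x" using x by simp
  have "((\<lambda>_. P (-1)) has_real_derivative 0) (at x)" by simp
  then have "((\<lambda>x. P (\<alpha> x)) has_real_derivative 0) (at x)"
  proof (rule has_field_derivative_transform_within_open[of _ _ _ "{k - 1<..<xe}"])
    fix u assume u: "u \<in> {k - 1<..<xe}"
    then have a: "-1 \<le> \<alpha> u" "\<alpha> u \<le> x0" "w (\<alpha> u) \<le> r" using \<alpha>_upper[of u] flat[of u] xe by auto
    show "P (-1) = P (\<alpha> u)"
    proof (rule P_const[symmetric])
      fix s assume s: "-1 < s" "s < \<alpha> u"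
      then have "w s \<le> r" using w_mono_left[of s "\<alpha> u"] a by simp
      then show "p s = 0" using p_zero_left[of s] s a x0_props by simp
    qed (use a x0_props b_bounds in auto)
  qed (use x x1 in auto)
  moreover have "0 \<le> (k - zi x) / (k + zi x) * (h1 (zi x) / (2 * zi x))"
    using zi_range[of x] x by simp
  ultimately show ?thesis using that by auto
qed

lemma zi_deriv': "b < x \<Longrightarrow> x < xe \<Longrightarrow> (zi has_real_derivative (k - zi x) / (k + zi x)) (at x)"
  using zi_deriv[of x] xe by simp

lemma split_mono:
  fixes f :: "real \<Rightarrow> real"
  assumes a: "b \<le> a" "a \<le> c" "c \<le> xe" and cont: "continuous_on {a..c} f"
    and der: "\<And>s. a < s \<Longrightarrow> s < c \<Longrightarrow> s \<noteq> k - 1 \<Longrightarrow> \<exists>D. (f has_real_derivative D) (at s) \<and> 0 \<le> D"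
  shows "f a \<le> f c"
proof -
  have *: "f u \<le> f u'" if "a \<le> u" "u \<le> u'" "u' \<le> c" "u' \<le> k - 1 \<or> k - 1 \<le> u" for u u'
    by (rule deriv_nonneg_imp_le[where f = f])
      (use that der in \<open>auto intro: continuous_on_subset[OF cont]\<close>)
  show ?thesis using *[of a c] *[of a "k - 1"] *[of "k - 1" c] a
    by (cases "c \<le> k - 1"; cases "k - 1 \<le> a") auto
qed

lemma zi_cont: "S \<subseteq> {b..xe} \<Longrightarrow> continuous_on S zi"
  by (rule continuous_on_subset[OF zi_continuous]) (use xe in auto)

text \<open>In the derivative of \<open>f\<close> the terms with \<open>cc\<close> cancel and
  \<open>3 * h1 (zi s) * q + (k - zi s) * e\<close> remains. The lower bound on \<open>e\<close> and
  \<open>k - zi s \<le> 6 * zi s\<close> make it nonnegative; this is the purpose of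
  \<open>k / 7 < \<delta>b\<close>.\<close>

lemma cc_bound:
  assumes x: "b \<le> x" "x \<le> xe" shows "(k - zi x) * cc x \<le> 2 * (h1 (zi x))\<^sup>2"
proof -
  define f where "f = (\<lambda>x. 4 * hr (zi x) - (k - zi x) * cc x)"
  have "f b \<le> f x"
  proof (rule split_mono[where f = f])
    show "continuous_on {b..x} f" unfolding f_def
      by (intro continuous_intros zi_cont continuous_on_compose2[OF hr_continuous[of UNIV]]
          continuous_on_subset[OF P_cont] continuous_on_subset[OF P\<alpha>_cont]) (use x xe b_bounds in auto)
    fix s assume s: "b < s" "s < x" "s \<noteq> k - 1"
    have s': "b \<le> s" "s \<le> xe" "s < xe" "-1 < s" "s < 1" using s x xe b_bounds by auto
    note z = zi_range[OF s'(1,2)]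
    define q where "q = (k - zi s) / (k + zi s)"
    have q: "0 < q" "q * (k + zi s) = k - zi s" using z by (auto simp: q_def)
    obtain e where e: "((\<lambda>x. P (\<alpha> x)) has_real_derivative e) (at s)" "- (q * (h1 (zi s) / (2 * zi s))) \<le> e"
      using P\<alpha>_deriv[of s] s s' unfolding q_def by metis
    have zd: "(zi has_real_derivative q) (at s)" using zi_deriv'[of s] s s' by (simp add: q_def)
    have "(f has_real_derivative 4 * (h1 (zi s) * q) - ((k - zi s) * (p s - e) - q * cc s)) (at s)"
      unfolding f_def
      by (auto intro!: derivative_eq_intros DERIV_chain2[OF hr_deriv] zd e P_deriv s' simp: algebra_simps)
    moreover have "(k - zi s) * p s = q * (h1 (zi s) + cc s)"
      using p_eq[of s] s' q by (metis mult.assoc mult.commute)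
    moreover have "- (3 * (h1 (zi s) * q)) \<le> (k - zi s) * e"
    proof -
      have "k - zi s \<le> 6 * zi s" using \<delta>b_bounds(1) z by simp
      then have "(k - zi s) / (2 * zi s) \<le> 3" using z by (simp add: pos_divide_le_eq)
      then have "(h1 (zi s) * q) * ((k - zi s) / (2 * zi s)) \<le> (h1 (zi s) * q) * 3" using q by (intro mult_left_mono) auto
      moreover have "(k - zi s) * - (q * (h1 (zi s) / (2 * zi s))) \<le> (k - zi s) * e"
        using e z by (intro mult_left_mono) auto
      moreover have "(k - zi s) * - (q * (h1 (zi s) / (2 * zi s))) = - ((h1 (zi s) * q) * ((k - zi s) / (2 * zi s)))"
        by (simp add: ac_simps)
      ultimately show ?thesis by linarith
    qed
    moreover have "(k - zi s) * (p s - e) = (k - zi s) * p s - (k - zi s) * e" by (simp add: algebra_simps)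
    ultimately show "\<exists>D. (f has_real_derivative D) (at s) \<and> 0 \<le> D"
      by (intro exI[of _ "4 * (h1 (zi s) * q) - ((k - zi s) * (p s - e) - q * cc s)"]) (auto simp: algebra_simps)
  qed (use x in auto)
  moreover have "0 \<le> f b" by (simp add: f_def \<alpha>_b hr_def)
  ultimately show ?thesis by (simp add: f_def hr_def)
qed

text \<open>With \<open>p_eq\<close> inserted, the derivative of the difference of the two sides is
  a positive multiple of \<open>cc s - (P s - P b)\<close>, and the window reaches at least as far
  left as \<open>b\<close>.\<close>

lemma P_growth:
  assumes x: "b \<le> x" "x \<le> xe"
  shows "(h1 (zi x))\<^sup>2 - (h1 \<delta>b)\<^sup>2 \<le> 2 * (k - zi x) * (P x - P b)"
proof -
  define f where "f = (\<lambda>x. (k - zi x) * (P x - P b) - hr (zi x))"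
  have "f b \<le> f x"
  proof (rule deriv_nonneg_imp_le[where f = f])
    show "continuous_on {b..x} f" unfolding f_def
      by (intro continuous_intros zi_cont continuous_on_compose2[OF hr_continuous[of UNIV]]
          continuous_on_subset[OF P_cont]) (use x xe b_bounds in auto)
    fix s assume s: "b < s" "s < x"
    have s': "b \<le> s" "s \<le> xe" "s < xe" "-1 < s" "s < 1" using s x xe b_bounds by auto
    note z = zi_range[OF s'(1,2)]
    define q where "q = (k - zi s) / (k + zi s)"
    have q: "0 < q" "q * (k + zi s) = k - zi s" using z by (auto simp: q_def)
    have zd: "(zi has_real_derivative q) (at s)" using zi_deriv'[of s] s s' by (simp add: q_def)
    have "(f has_real_derivative (k - zi s) * p s - q * (P s - P b) - h1 (zi s) * q) (at s)"
      unfolding f_def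
      by (auto intro!: derivative_eq_intros DERIV_chain2[OF hr_deriv] zd P_deriv s' simp: algebra_simps)
    moreover have "(k - zi s) * p s = q * (h1 (zi s) + cc s)"
      using p_eq[of s] s' q by (metis mult.assoc mult.commute)
    moreover have "0 \<le> q * (cc s - (P s - P b))" using q cc_nonneg(2)[of s] s' by (intro mult_nonneg_nonneg) auto
    ultimately show "\<exists>D. (f has_real_derivative D) (at s) \<and> 0 \<le> D"
      by (intro exI[of _ "(k - zi s) * p s - q * (P s - P b) - h1 (zi s) * q"]) (auto simp: algebra_simps)
  qed (use x in auto)
  then show ?thesis by (simp add: f_def hr_def zi_b algebra_simps)
qed

text \<open>The quotient rule leaves \<open>2 * (zi s - r)\<^sup>2 - (k - zi s) * cc s\<close> times
  a positive factor, plus nonnegative terms; \<open>cc_bound\<close> is calibrated to precisely this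
  expression.\<close>

lemma ratio_mono:
  assumes x: "b \<le> x" "x \<le> x'" "x' \<le> xe" and a: "r < zi x"
  shows "(zi x - r + cc x) / ((zi x - r) * (k - zi x)) \<le> (zi x' - r + cc x') / ((zi x' - r) * (k - zi x'))"
proof (rule split_mono[where f = "\<lambda>x. (zi x - r + cc x) / ((zi x - r) * (k - zi x))"])
  have pos: "r < zi s" if "x \<le> s" "s \<le> x'" for s using zi_mono(1)[of x s] that x xe a by simp
  have nz: "(zi s - r) * (k - zi s) \<noteq> 0" if "x \<le> s" "s \<le> x'" for s
    using pos[OF that] zi_range[of s] that x by simp
  show "continuous_on {x..x'} (\<lambda>x. (zi x - r + cc x) / ((zi x - r) * (k - zi x)))"
    by (intro continuous_intros zi_cont continuous_on_subset[OF P_cont] continuous_on_subset[OF P\<alpha>_cont])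
      (use x xe b_bounds nz in auto)
  fix s assume s: "x < s" "s < x'" "s \<noteq> k - 1"
  have s': "b \<le> s" "s \<le> xe" "b < s" "s < xe" "-1 < s" "s < 1" using s x xe b_bounds by auto
  note z = zi_range[OF s'(1,2)]
  have as: "0 < zi s - r" using pos[of s] s by simp
  define q where "q = (k - zi s) / (k + zi s)"
  have q: "0 < q" "q * (k + zi s) = k - zi s" using z by (auto simp: q_def)
  obtain e where e: "((\<lambda>x. P (\<alpha> x)) has_real_derivative e) (at s)" "e \<le> 0"
    using P\<alpha>_deriv[of s] s s' by metis
  have zd: "(zi has_real_derivative q) (at s)" using zi_deriv'[of s] s' by (simp add: q_def)
  define N M where "N = zi s - r + cc s" and "M = (zi s - r) * (k - zi s)"
  have M: "0 < M" using as z by (simp add: M_def)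
  have num: "((\<lambda>x. zi x - r + cc x) has_real_derivative q + (p s - e)) (at s)"
    by (auto intro!: derivative_eq_intros zd e P_deriv s')
  have den: "((\<lambda>x. (zi x - r) * (k - zi x)) has_real_derivative q * (k - zi s) - q * (zi s - r)) (at s)"
    by (auto intro!: derivative_eq_intros zd simp: algebra_simps)
  have "((\<lambda>x. (zi x - r + cc x) / ((zi x - r) * (k - zi x))) has_real_derivative
      ((q + (p s - e)) * M - N * (q * (k - zi s) - q * (zi s - r))) / (M * M)) (at s)"
    unfolding N_def M_def by (rule DERIV_divide[OF num den]) (use nz s in auto)
  moreover have "0 \<le> (q + (p s - e)) * M - N * (q * (k - zi s) - q * (zi s - r))"
  proof -
    have ps: "(k - zi s) * p s = q * N"
      using p_eq[of s] s' q as unfolding N_def by (metis max.absorb2 less_imp_le mult.assoc mult.commute)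
    have cb: "(k - zi s) * cc s \<le> 2 * (zi s - r)\<^sup>2" using cc_bound[of s] s' as by simp
    have "p s * M = (zi s - r) * (q * N)" unfolding M_def ps[symmetric] by (simp add: ac_simps)
    then have "(q + (p s - e)) * M - N * (q * (k - zi s) - q * (zi s - r))
        = q * (2 * (zi s - r)\<^sup>2 - (k - zi s) * cc s) + 2 * (q * ((zi s - r) * cc s)) - e * M"
      unfolding ring_distribs(2) left_diff_distrib by (simp add: N_def M_def algebra_simps power2_eq_square)
    moreover have "0 \<le> q * (2 * (zi s - r)\<^sup>2 - (k - zi s) * cc s)" using q cb by simp
    moreover have "0 \<le> q * ((zi s - r) * cc s)" using q as cc_nonneg(1)[of s] s' by simp
    moreover have "0 \<le> - e * M" using e M by (simp add: mult_nonpos_nonneg)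
    ultimately show ?thesis by simp
  qed
  ultimately show "\<exists>D. ((\<lambda>x. (zi x - r + cc x) / ((zi x - r) * (k - zi x))) has_real_derivative D) (at s) \<and> 0 \<le> D"
    using M by (meson divide_nonneg_pos mult_pos_pos)
qed (use x in auto)

text \<open>With \<open>B = k + zi s\<close> and \<open>q = zi'\<close> one has
  \<open>1 + q = 2 * k / B\<close>. The derivative is then a positive multiple of
  \<open>1 - (s + zi s - v) / B\<close>, nonnegative because \<open>v \<ge> s - k\<close>.\<close>

lemma factor_mono:
  assumes x: "b \<le> x" "x \<le> x'" "x' \<le> xe" and v: "x' - k \<le> v" "v \<le> U x"
  shows "(U x - v) * ((k - zi x) / (k + zi x)) \<le> (U x' - v) * ((k - zi x') / (k + zi x'))"
proof -
  have eq: "U s = s + zi s" if "x \<le> s" "s \<le> x'" for s using U_right[of s] that x by simp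
  have "(x + zi x - v) * ((k - zi x) / (k + zi x)) \<le> (x' + zi x' - v) * ((k - zi x') / (k + zi x'))"
  proof (rule deriv_nonneg_imp_le[where f = "\<lambda>s. (s + zi s - v) * ((k - zi s) / (k + zi s))"])
    have nz: "k + zi s \<noteq> 0" if "x \<le> s" "s \<le> x'" for s using zi_range[of s] that x by simp
    show "continuous_on {x..x'} (\<lambda>s. (s + zi s - v) * ((k - zi s) / (k + zi s)))"
      by (intro continuous_intros zi_cont) (use x nz in auto)
    fix s assume s: "x < s" "s < x'"
    have s': "b \<le> s" "s \<le> xe" "b < s" "s < xe" using s x by auto
    note z = zi_range[OF s'(1,2)]
    define q where "q = (k - zi s) / (k + zi s)"
    define B where "B = k + zi s"
    have q: "0 < q" using z unfolding q_def by (intro divide_pos_pos) auto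
    have B: "0 < B" using z by (simp add: B_def)
    have zd: "(zi has_real_derivative q) (at s)" using zi_deriv'[of s] s' by (simp add: q_def)
    have quo: "((\<lambda>s. (k - zi s) / (k + zi s)) has_real_derivative ((- q) * B - (k - zi s) * q) / (B * B)) (at s)"
      unfolding B_def by (rule DERIV_divide) (use z in \<open>auto intro!: derivative_eq_intros zd\<close>)
    have qe: "((- q) * B - (k - zi s) * q) / (B * B) = - (q * (2 * k / (B * B)))"
      by (simp add: B_def algebra_simps add_divide_distrib[symmetric] diff_divide_distrib[symmetric])
    have "((\<lambda>s. (s + zi s - v) * ((k - zi s) / (k + zi s))) has_real_derivative
        (1 + q) * q + - (q * (2 * k / (B * B))) * (s + zi s - v)) (at s)"
    proof -
      have "((\<lambda>s. s + zi s - v) has_real_derivative 1 + q) (at s)"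
        by (auto intro!: derivative_eq_intros zd)
      from DERIV_mult[OF this quo] show ?thesis
        unfolding qe by (simp only: q_def[symmetric])
    qed
    moreover have "0 \<le> (1 + q) * q + - (q * (2 * k / (B * B))) * (s + zi s - v)"
    proof -
      have "1 + q = 2 * k / B" using z by (simp add: q_def B_def field_simps)
      moreover have "(s + zi s - v) / B \<le> 1" using v s B by (simp add: B_def)
      then have "0 \<le> q * (2 * k / B) * (1 - (s + zi s - v) / B)" using q B k1 by (intro mult_nonneg_nonneg) auto
      moreover have "q * (2 * k / B) * (1 - (s + zi s - v) / B) = (2 * k / B) * q + - (q * (2 * k / (B * B))) * (s + zi s - v)"
        by (simp add: right_diff_distrib ac_simps)
      ultimately show ?thesis by simp
    qed
    ultimately show "\<exists>D. ((\<lambda>s. (s + zi s - v) * ((k - zi s) / (k + zi s))) has_real_derivative D) (at s) \<and> 0 \<le> D" by blast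
  qed (use x in auto)
  then show ?thesis using eq[of x] eq[of x'] x by simp
qed

text \<open>While \<open>v - x < r\<close>, the horizontal derivative is
  \<open>(zi x - r) * (1 - F x)\<close>. A factor \<open>k - zi x\<close> is inserted and divided
  out so that \<open>F\<close> becomes a product of the increasing quantities of
  \<open>ratio_mono\<close> and \<open>factor_mono\<close>; once \<open>F\<close> exceeds 1 it stays
  there.\<close>

lemma J_cross:
  assumes x: "b \<le> x" "x < x'" "x' \<le> xe" and v: "x' - k \<le> v" "v \<le> U x"
    and neg: "h1 (w x) - h1 (v - x) - p x * (U x - v) < 0"
  shows "h1 (w x') - h1 (v - x') - p x' * (U x' - v) \<le> 0"
proof -
  have x1: "x \<le> xe" "x \<le> 1" "b \<le> x'" "x' \<le> 1" "-1 < x" using x xe b_bounds by auto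
  note z = zi_range[OF x(1) x1(1)] and z' = zi_range[OF x1(3) x(3)]
  have w: "w x = zi x" "w x' = zi x'" using w_right x x1 by auto
  have vx: "v - x < r"
  proof (rule ccontr)
    assume "\<not> v - x < r"
    then have "h1 (w x) - h1 (v - x) = U x - v" using v by (auto simp: w_of_def)
    then have "(1 - p x) * (U x - v) < 0" using neg by (simp add: algebra_simps)
    moreover have "0 \<le> (1 - p x) * (U x - v)" using p_bounds[of x] x1 v by (intro mult_nonneg_nonneg) auto
    ultimately show False by simp
  qed
  then have h: "h1 (v - x) = 0" "h1 (v - x') = 0" using x by auto
  have a: "r < zi x"
  proof (rule ccontr)
    assume "\<not> r < zi x"
    then show False using neg h p_zero[of x] x1 w by simp
  qed
  have a': "r < zi x'" using a zi_mono(1)[of x x'] x x1 by simp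
  have key: "p s * (U s - v) = (zi s - r) *
      ((zi s - r + cc s) / ((zi s - r) * (k - zi s)) * ((U s - v) * ((k - zi s) / (k + zi s))))"
    if s: "b \<le> s" "s \<le> xe" "r < zi s" for s
  proof -
    note zs = zi_range[OF s(1,2)]
    have "p s = (zi s - r + cc s) / (k + zi s)" using p_eq[OF s(1,2)] s zs by (simp add: eq_divide_eq)
    moreover have "N / B * V = a * (N / (a * C) * (V * (C / B)))" if "a \<noteq> 0" "C \<noteq> 0" for N B V a C :: real
      using that by (simp add: field_simps)
    ultimately show ?thesis using s zs by simp
  qed
  define F where "F = (\<lambda>s. (zi s - r + cc s) / ((zi s - r) * (k - zi s)) * ((U s - v) * ((k - zi s) / (k + zi s))))"
  have F: "p s * (U s - v) = (zi s - r) * F s" if "b \<le> s" "s \<le> xe" "r < zi s" for s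
    using key[OF that] by (simp add: F_def)
  have "F x \<le> F x'" unfolding F_def
  proof (rule mult_mono)
    show "0 \<le> (U x - v) * ((k - zi x) / (k + zi x))" using v z by simp
    show "0 \<le> (zi x' - r + cc x') / ((zi x' - r) * (k - zi x'))"
      using a' z' cc_nonneg(1)[of x'] x x1 by simp
  qed (use ratio_mono[of x x'] factor_mono[of x x' v] x a v in auto)
  have "zi x - r < (zi x - r) * F x" using neg h a w F[of x] x x1 by simp
  then have "1 < F x" using a by simp
  then have "zi x' - r \<le> (zi x' - r) * F x'" using \<open>F x \<le> F x'\<close> a' by simp
  then show ?thesis using h a' w F[of x'] x x1 by simp
qed

lemma G_between_moving:
  assumes end_nonneg: "\<And>v. D xe \<le> v \<Longrightarrow> v \<le> U xe \<Longrightarrow> 0 \<le> G xe v"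
    and x: "b \<le> x" "x \<le> xe" and v: "D x \<le> v" "v \<le> U x"
  shows "0 \<le> G x v"
proof -
  have x1: "-1 \<le> x" "x \<le> 1" using x xe b_bounds by auto
  have v2: "-2 \<le> v" "v \<le> 2" using D_range[of x] U_range[of x] x1 v by auto
  have vk: "x - k \<le> v" using D_right[of x] x v by simp
  \<comment> \<open>The segment at height \<open>v\<close> ends on the left on a graph, at
    \<open>t v\<close>, or at \<open>b\<close>, where \<open>G_between_left\<close> applies. On the
    right it ends on the line \<open>v = s - k\<close>, where the gap is 0, or at \<open>xe\<close>,
    where \<open>end_nonneg\<close> applies.\<close>
  define a c where "a = max b (t v)" and "c = min xe (v + k)"
  have tx: "t v \<le> x" using t_le[of x v] x1 v v2 by simp
  have ac: "a \<le> x" "x \<le> c" "b \<le> a" "c \<le> xe" using tx vk x by (auto simp: a_def c_def)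
  have va: "v \<le> U s" if "a \<le> s" "s \<le> 1" for s
  proof (cases "v \<le> -1")
    case True
    then show ?thesis using U_range[of s] that ac b_bounds by auto
  next
    case False
    then show ?thesis using t_upper[of v] U_le_iff[of "t v" s] that v2 by (auto simp: a_def)
  qed
  show ?thesis
  proof (rule sign_crossing_nonneg[where f = "\<lambda>s. G s v" and a = a and c = c
        and f' = "\<lambda>s. h1 (w s) - h1 (v - s) - p s * (U s - v)"])
    show "continuous_on {a..c} (\<lambda>s. G s v)"
      by (rule continuous_on_subset[OF G_cont_x]) (use v2 ac xe b_bounds in auto)
    show "((\<lambda>s. G s v) has_real_derivative h1 (w s) - h1 (v - s) - p s * (U s - v)) (at s)" if "a < s" "s < c" for s
      using that ac xe b_bounds by (intro G_deriv_x) auto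
    show "0 \<le> G a v"
    proof (cases "b \<le> t v")
      case True
      then show ?thesis using G_start v2 by (simp add: a_def max_def)
    next
      case False
      then have "a = b" by (simp add: a_def)
      then show ?thesis using G_between_left[of b v] va[of b] D_b v2 b_bounds by simp
    qed
    show "0 \<le> G c v"
    proof (cases "xe \<le> v + k")
      case True
      then have "c = xe" by (simp add: c_def)
      then show ?thesis using end_nonneg[of v] va[of xe] D_right[of xe] True ac xe by simp
    next
      case False
      then have "c = v + k" by (simp add: c_def)
      then show ?thesis using G_D_right[of c] ac x xe by simp
    qed
    show "h1 (w s') - h1 (v - s') - p s' * (U s' - v) \<le> 0"
      if "a < s" "s < s'" "s' < c" "h1 (w s) - h1 (v - s) - p s * (U s - v) < 0" for s s'
      using J_cross[of s s' v] that ac va[of s] xe by (auto simp: c_def)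
  qed (use ac in auto)
qed

end

text \<open>The thresholds for \<open>r\<close> are \<open>- d x0\<close> and \<open>w x0\<close>.
  Below the first, \<open>kk\<close> is monotone. Above both, the horizontal argument covers all of
  \<open>[b, 1]\<close>, with the vertical one at its end \<open>xe = 1\<close>. In between, the two
  arguments meet at a point \<open>xr\<close>.\<close>

lemma G_main:
  assumes x: "b \<le> x" "x \<le> 1" and v: "D x \<le> v" "v \<le> U x"
  shows "0 \<le> G x v"
proof (cases "r \<le> - d x0")
  case True
  have "P x + r \<le> kk u'" if u: "D x \<le> u" "u < u'" "u' \<le> U x" "P x + r < kk u" for u u'
  proof -
    have "-2 \<le> u" "u' \<le> 2" using D_range[of x] U_range[of x] x u b_bounds by auto
    then show ?thesis using kk_mono_flat[OF True, of u u'] u by simp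
  qed
  then show ?thesis using G_between_of_cross[OF x _ v] by blast
next
  case False
  then have r: "- d x0 < r" by simp
  have r0: "0 < r" using r d_neg[of x0] x0_props b_bounds by simp
  show ?thesis
  proof (cases "w x0 \<le> r")
    case True
    have flat: "w (\<alpha> u) \<le> r" if "k - 1 \<le> u" "u \<le> 1" for u
      using w_mono_left[of "\<alpha> u" x0] \<alpha>_upper[of u] that True by simp
    have "kap x0 \<le> P 1 + r" using P_incr(1)[of x0 1] True x0_props b_bounds by (simp add: kap_def)
    then show ?thesis
      using G_between_moving[of 1 x v] G_between_steep[OF r, of 1] flat r0 x v b_bounds by simp
  next
    case False
    \<comment> \<open>\<open>flat\<close> is guaranteed up to the point \<open>xr\<close> with
      \<open>\<alpha> xr = a\<close>, that is \<open>xr = U a + k\<close>. It remains to see that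
      the level \<open>P xr + r\<close> has reached \<open>kap x0\<close> there.\<close>
    have "\<exists>a\<ge>-1. a \<le> x0 \<and> w a = r"
      using w_m1 r0 False x0_props b_bounds
      by (intro IVT' continuous_on_subset[OF w_continuous]) auto
    then obtain a where a: "-1 \<le> a" "a \<le> x0" "w a = r" by auto
    define xr where "xr = U a + k"
    have ab: "a \<le> 1" using a x0_props b_bounds by simp
    have xr: "k - 1 \<le> xr" "xr \<le> 1"
      using U_le_iff[of "-1" a] U_le_iff[of a x0] U_m1 U_x0 a x0_props b_bounds by (auto simp: xr_def)
    have bxr: "b \<le> xr" using xr k1 by (simp add: b_of_def)
    have \<alpha>r: "\<alpha> xr = a" using \<alpha>_eq_t[of xr] t_U[of a] a xr bxr ab by (simp add: xr_def)
    have flat: "w (\<alpha> u) \<le> r" if u: "k - 1 \<le> u" "u \<le> xr" for u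
    proof -
      have "\<alpha> u \<le> a" using U_le_iff[of "\<alpha> u" a] \<alpha>_upper[of u] \<alpha>_upper[of xr] \<alpha>r u xr ab a x0_props b_bounds by simp
      then show ?thesis using w_mono_left[of "\<alpha> u" a] \<alpha>_upper[of u] a u xr by simp
    qed
    have "2 * (k - zi xr) * (w x0 - r) \<le> (h1 (zi xr))\<^sup>2 - (h1 \<delta>b)\<^sup>2"
      using tail_area[of a r] a r \<alpha>_upper_RR[OF xr] \<alpha>r by simp
    also have "\<dots> \<le> 2 * (k - zi xr) * (P xr - P b)"
      using P_growth[of xr xr] r0 bxr xr flat by simp
    finally have "2 * (k - zi xr) * (w x0 - r) \<le> 2 * (k - zi xr) * (P xr - P b)" .
    moreover have "0 < 2 * (k - zi xr)" using zi_props[of xr] bxr xr k1 by simp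
    ultimately have "w x0 - r \<le> P xr - P b" by (simp only: mult_le_cancel_left_pos)
    moreover have "P x0 \<le> P b" using P_incr(1)[of x0 b] x0_props b_bounds by simp
    ultimately have kx: "kap x0 \<le> P xr + r" by (simp add: kap_def)
    show ?thesis
    proof (cases "x \<le> xr")
      case True
      then show ?thesis
        using G_between_moving[of xr x v] G_between_steep[OF r bxr xr(2) kx] flat r0 x v bxr xr by simp
    next
      case False
      then have "P xr \<le> P x" using P_incr(1)[of xr x] bxr b_bounds x by simp
      then show ?thesis using G_between_steep[OF r x _ v] kx by simp
    qed
  qed
qed

theorem G_nonneg:
  assumes x: "-1 \<le> x" "x \<le> 1" and v: "-2 \<le> v" "v \<le> 2" "x - k \<le> v"
  shows "0 \<le> G x v"
proof (cases "v \<le> U x")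
  case False
  then show ?thesis using G_above_U[of x v] x v by simp
next
  case vU: True
  show ?thesis
  proof (cases "x \<le> b")
    case True
    then show ?thesis using G_below_D[of x v] G_between_left[of x v] x v vU by (cases "v \<le> D x") auto
  next
    case False
    then show ?thesis using G_main[of x v] D_right[of x] x v vU by simp
  qed
qed

end

section \<open>Existence of the auxiliary kernel\<close>

lemma integral_uniform_measure_Icc:
  fixes f :: "real \<Rightarrow> real"
  assumes "a < c" and [measurable]: "f \<in> borel_measurable borel"
  shows "(LINT u|uniform_measure lborel {a..c}. f u) = (LINT u:{a..c}|lborel. f u) / (c - a)"
proof -
  have "uniform_measure lborel {a..c} = density lborel (\<lambda>u. ennreal (indicator {a..c} u / (c - a)))"
    unfolding uniform_measure_def using assms(1)
    by (intro density_cong) (auto simp: ennreal_indicator[symmetric] divide_ennreal simp del: ennreal_indicator)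
  then have "(LINT u|uniform_measure lborel {a..c}. f u) = (LINT u|lborel. (indicator {a..c} u / (c - a)) *\<^sub>R f u)"
    using assms(1) by (simp add: integral_density)
  also have "\<dots> = (LINT u|lborel. (indicator {a..c} u *\<^sub>R f u) / (c - a))" by simp
  also have "\<dots> = (LINT u:{a..c}|lborel. f u) / (c - a)"
    unfolding set_lebesgue_integral_def by (rule integral_divide_zero)
  finally show ?thesis .
qed

lemma set_integrable_bounded_Icc:
  fixes f :: "real \<Rightarrow> real"
  assumes [measurable]: "f \<in> borel_measurable borel" and "\<And>u. u \<in> {a..c} \<Longrightarrow> \<bar>f u\<bar> \<le> B"
  shows "set_integrable lborel {a..c} f"
  unfolding set_integrable_def
  by (rule integrableI_bounded_set_indicator[where B = B])
    (use assms in \<open>auto simp: emeasure_lborel_Icc_eq\<close>)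

lemma nn_integral_Icc:
  fixes f :: "real \<Rightarrow> real"
  assumes [measurable]: "f \<in> borel_measurable borel" and f: "\<And>u. u \<in> {a..c} \<Longrightarrow> 0 \<le> f u \<and> f u \<le> B"
  shows "(\<integral>\<^sup>+u. ennreal (f u) * indicator {a..c} u \<partial>lborel) = ennreal (LINT u:{a..c}|lborel. f u)"
proof -
  have "set_integrable lborel {a..c} f"
    using f by (intro set_integrable_bounded_Icc[where B = B]) auto
  then have "(\<integral>\<^sup>+u. ennreal (indicator {a..c} u *\<^sub>R f u) \<partial>lborel) = ennreal (LINT u:{a..c}|lborel. f u)"
    unfolding set_integrable_def set_lebesgue_integral_def
    using f by (intro nn_integral_eq_integral) (auto simp: indicator_def)
  moreover have "(\<integral>\<^sup>+u. ennreal (f u) * indicator {a..c} u \<partial>lborel) = (\<integral>\<^sup>+u. ennreal (indicator {a..c} u *\<^sub>R f u) \<partial>lborel)"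
    by (intro nn_integral_cong) (auto simp: indicator_def)
  ultimately show ?thesis by simp
qed

context curtain begin

abbreviation cl :: "real \<Rightarrow> real" where "cl x \<equiv> max (-1) (min 1 x)"
abbreviation cb :: "real \<Rightarrow> real" where "cb x \<equiv> max b (min 1 x)"

lemma clamped_measurable [measurable]:
  "(\<lambda>x. w (cl x)) \<in> borel_measurable borel" "(\<lambda>x. d (cl x)) \<in> borel_measurable borel"
  "(\<lambda>x. \<zeta> (cb x)) \<in> borel_measurable borel" "(\<lambda>x. \<alpha> (cb x)) \<in> borel_measurable borel"
  "(\<lambda>x. D (cl x)) \<in> borel_measurable borel" "(\<lambda>x. U (cl x)) \<in> borel_measurable borel"
proof -
  have c: "continuous_on UNIV (\<lambda>x. cl x)" "continuous_on UNIV (\<lambda>x. cb x)"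
    by (auto intro!: continuous_on_max continuous_on_min continuous_on_const continuous_on_id)
  show "(\<lambda>x. w (cl x)) \<in> borel_measurable borel"
    by (intro borel_measurable_continuous_onI continuous_on_compose2[OF w_continuous c(1)]) auto
  show "(\<lambda>x. d (cl x)) \<in> borel_measurable borel"
    by (intro borel_measurable_continuous_onI continuous_on_compose2[OF d_continuous c(1)]) auto
  show "(\<lambda>x. D (cl x)) \<in> borel_measurable borel"
    by (intro borel_measurable_continuous_onI continuous_on_compose2[OF D_continuous c(1)]) auto
  show "(\<lambda>x. U (cl x)) \<in> borel_measurable borel"
    by (intro borel_measurable_continuous_onI continuous_on_compose2[OF U_continuous c(1)]) auto
  show "(\<lambda>x. \<zeta> (cb x)) \<in> borel_measurable borel"
    by (intro borel_measurable_continuous_onI continuous_on_compose2[OF \<zeta>_continuous c(2)]) (use b_bounds in auto)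
  show "(\<lambda>x. \<alpha> (cb x)) \<in> borel_measurable borel"
    by (intro borel_measurable_continuous_onI continuous_on_compose2[OF \<alpha>_continuous c(2)]) (use b_bounds in auto)
qed

text \<open>Densities of the Picard iterates of the integral equation, started from the zero measure. The
  arguments are clamped so that everything is measurable on the whole line.\<close>

fun rho :: "nat \<Rightarrow> real \<Rightarrow> real \<Rightarrow> ennreal" where
  "rho 0 x u = 0"
| "rho (Suc n) x u = (if x \<le> b
     then (if d (cl x) \<le> u \<and> u \<le> w (cl x) then 1 else 0) / ennreal (w (cl x) - d (cl x))
     else ((if \<zeta> (cb x) \<le> u \<and> u \<le> w (cl x) then 1 else 0)
        + (\<integral>\<^sup>+s. rho n s u * (if \<alpha> (cb x) \<le> s \<and> s \<le> x then 1 else 0) \<partial>lborel)) / ennreal (w (cl x) + k))"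

lemma rho_measurable [measurable]: "(\<lambda>p. rho n (fst p) (snd p)) \<in> borel_measurable (borel \<Otimes>\<^sub>M borel)"
proof (induction n)
  case (Suc n)
  have [measurable]: "(\<lambda>q. rho n (snd q) (snd (fst q))) \<in> borel_measurable ((borel \<Otimes>\<^sub>M borel) \<Otimes>\<^sub>M borel)"
    using measurable_compose[OF _ Suc.IH, of "\<lambda>q. (snd q, snd (fst q))" "(borel \<Otimes>\<^sub>M borel) \<Otimes>\<^sub>M borel"] by simp
  have [measurable]: "(\<lambda>p. \<integral>\<^sup>+s. rho n s (snd p) * (if \<alpha> (cb (fst p)) \<le> s \<and> s \<le> fst p then 1 else 0) \<partial>lborel)
      \<in> borel_measurable (borel \<Otimes>\<^sub>M borel)"
    by (rule lborel.borel_measurable_nn_integral) (simp add: split_beta, measurable)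
  show ?case by simp
qed simp

lemma rho_measurable1 [measurable]: "rho n x \<in> borel_measurable borel"
  using measurable_compose[OF _ rho_measurable[of n], of "\<lambda>u. (x, u)" borel] by simp

lemma rho_mono: "rho n x u \<le> rho (Suc n) x u"
proof (induction n arbitrary: x u)
  case (Suc n)
  show ?case unfolding rho.simps(2)[of "Suc n"] rho.simps(2)[of n x u]
    by (cases "x \<le> b") (auto intro!: divide_right_mono_ennreal add_left_mono nn_integral_mono mult_right_mono Suc.IH simp del: rho.simps)
qed simp

definition II :: "nat \<Rightarrow> (real \<Rightarrow> ennreal) \<Rightarrow> real \<Rightarrow> ennreal" where
  "II n F x = (\<integral>\<^sup>+u. rho n x u * F u \<partial>lborel)"

lemma II_measurable [measurable]: "F \<in> borel_measurable borel \<Longrightarrow> II n F \<in> borel_measurable borel"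
proof -
  assume [measurable]: "F \<in> borel_measurable borel"
  show ?thesis unfolding II_def[abs_def]
    by (rule lborel.borel_measurable_nn_integral) (simp add: split_beta)
qed

lemma II_left:
  assumes "-1 < x" "x \<le> b" and [measurable]: "F \<in> borel_measurable borel"
  shows "II (Suc n) F x = (\<integral>\<^sup>+u. F u * indicator {d x..w x} u \<partial>lborel) / ennreal (w x - d x)"
proof -
  have c: "cl x = x" using assms b_bounds by simp
  have "II (Suc n) F x = (\<integral>\<^sup>+u. F u * indicator {d x..w x} u / ennreal (w x - d x) \<partial>lborel)"
    unfolding II_def using assms(2) unfolding rho.simps c
    by (intro nn_integral_cong) (auto simp: indicator_def ennreal_times_divide mult.commute)
  then show ?thesis by (simp add: nn_integral_divide)
qed

text \<open>Tonelli moves the test function inside, so the recursion for densities becomes one for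
  integrals.\<close>

lemma II_right:
  assumes "b < x" "x \<le> 1" and [measurable]: "F \<in> borel_measurable borel"
  shows "II (Suc n) F x = ((\<integral>\<^sup>+u. F u * indicator {\<zeta> x..w x} u \<partial>lborel)
    + (\<integral>\<^sup>+s. II n F s * indicator {\<alpha> x..x} s \<partial>lborel)) / ennreal (w x + k)"
proof -
  have c: "cl x = x" "cb x = x" using assms b_bounds by auto
  have i: "(if a \<le> u \<and> u \<le> e then 1 else 0) = (indicator {a..e} u :: ennreal)" for a e u :: real by simp
  have [measurable]: "(\<lambda>q. rho n (snd q) (fst q)) \<in> borel_measurable (lborel \<Otimes>\<^sub>M lborel)"
    using measurable_compose[OF _ rho_measurable[of n], of "\<lambda>q. (snd q, fst q)" "borel \<Otimes>\<^sub>M borel"] by simp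
  have [measurable]: "(\<lambda>u. \<integral>\<^sup>+s. rho n s u * indicator {\<alpha> x..x} s \<partial>lborel) \<in> borel_measurable lborel"
    by (rule lborel.borel_measurable_nn_integral) (simp add: split_beta)
  have "II (Suc n) F x = (\<integral>\<^sup>+u. (F u * indicator {\<zeta> x..w x} u
      + F u * (\<integral>\<^sup>+s. rho n s u * indicator {\<alpha> x..x} s \<partial>lborel)) / ennreal (w x + k) \<partial>lborel)"
    unfolding II_def using assms(1) unfolding rho.simps c i
    by (intro nn_integral_cong) (simp add: ennreal_times_divide mult.commute distrib_left)
  also have "\<dots> = ((\<integral>\<^sup>+u. F u * indicator {\<zeta> x..w x} u \<partial>lborel)
      + (\<integral>\<^sup>+u. F u * (\<integral>\<^sup>+s. rho n s u * indicator {\<alpha> x..x} s \<partial>lborel) \<partial>lborel)) / ennreal (w x + k)"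
    by (simp add: nn_integral_divide nn_integral_add)
  also have "(\<integral>\<^sup>+u. F u * (\<integral>\<^sup>+s. rho n s u * indicator {\<alpha> x..x} s \<partial>lborel) \<partial>lborel)
      = (\<integral>\<^sup>+u. \<integral>\<^sup>+s. F u * (rho n s u * indicator {\<alpha> x..x} s) \<partial>lborel \<partial>lborel)"
  proof (intro nn_integral_cong nn_integral_cmult[symmetric])
    fix u :: real
    have "(\<lambda>s. rho n s u) \<in> borel_measurable lborel"
      using measurable_compose[OF _ rho_measurable[of n], of "\<lambda>s. (s, u)" borel] by simp
    then show "(\<lambda>s. rho n s u * indicator {\<alpha> x..x} s) \<in> borel_measurable lborel" by simp
  qed
  also have "\<dots> = (\<integral>\<^sup>+s. \<integral>\<^sup>+u. F u * (rho n s u * indicator {\<alpha> x..x} s) \<partial>lborel \<partial>lborel)"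
    by (rule lborel_pair.Fubini'[symmetric]) (simp add: split_beta)
  also have "\<dots> = (\<integral>\<^sup>+s. II n F s * indicator {\<alpha> x..x} s \<partial>lborel)"
  proof (intro nn_integral_cong)
    fix s :: real
    have "(\<integral>\<^sup>+u. F u * (rho n s u * indicator {\<alpha> x..x} s) \<partial>lborel) = (\<integral>\<^sup>+u. (rho n s u * F u) * indicator {\<alpha> x..x} s \<partial>lborel)"
      by (intro nn_integral_cong) (simp add: ac_simps)
    also have "\<dots> = II n F s * indicator {\<alpha> x..x} s"
      unfolding II_def by (rule nn_integral_multc) simp
    finally show "(\<integral>\<^sup>+u. F u * (rho n s u * indicator {\<alpha> x..x} s) \<partial>lborel) = II n F s * indicator {\<alpha> x..x} s" .
  qed
  finally show ?thesis .
qed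

lemma wk_pos: "b \<le> x \<Longrightarrow> x \<le> 1 \<Longrightarrow> 0 < w x + k"
  using w_nonneg[of x] b_bounds k1 by simp

lemma wd_pos': "-1 < x \<Longrightarrow> x \<le> 1 \<Longrightarrow> 0 < w x - d x"
  using w_pos[of x] d_neg[of x] by simp

text \<open>The normaliser is the length of the Lebesgue part plus the length of the window, which
  is why the integral equation is consistent with total mass 1.\<close>

lemma mass_split: "w x + k = (w x - \<zeta> x) + (x - \<alpha> x)"
  by (simp add: zeta_of_def)

lemma II_mass_left: "-1 < x \<Longrightarrow> x \<le> b \<Longrightarrow> II (Suc n) (\<lambda>_. 1) x = 1"
  using wd_pos'[of x] b_bounds by (simp add: II_left divide_ennreal)

lemma II_mass_le: "-1 < x \<Longrightarrow> x \<le> 1 \<Longrightarrow> II n (\<lambda>_. 1) x \<le> 1"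
proof (induction n arbitrary: x)
  case 0
  then show ?case by (simp add: II_def)
next
  case (Suc n)
  show ?case
  proof (cases "x \<le> b")
    case True
    then show ?thesis using II_mass_left Suc by simp
  next
    case False
    then have x: "b < x" "x \<le> 1" using Suc by auto
    note a = \<alpha>_bounds[of x]
    have "(\<integral>\<^sup>+s. II n (\<lambda>_. 1) s * indicator {\<alpha> x..x} s \<partial>lborel) \<le> (\<integral>\<^sup>+s. indicator {\<alpha> x..x} s \<partial>lborel)"
    proof (rule nn_integral_mono_AE)
      \<comment> \<open>The induction hypothesis covers \<open>s > -1\<close> only, while the window
        may start at -1; a single point is negligible.\<close>
      have "AE s in lborel. s \<noteq> (-1::real)" by (rule AE_lborel_singleton)
      then show "AE s in lborel. II n (\<lambda>_. 1) s * indicator {\<alpha> x..x} s \<le> indicator {\<alpha> x..x} s"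
      proof eventually_elim
        case (elim s)
        then show ?case using Suc.IH[of s] a x by (auto simp: indicator_def)
      qed
    qed
    also have "\<dots> = ennreal (x - \<alpha> x)" using a x by simp
    finally have "II (Suc n) (\<lambda>_. 1) x \<le> (ennreal (w x - \<zeta> x) + ennreal (x - \<alpha> x)) / ennreal (w x + k)"
      using a x by (simp add: II_right) (intro divide_right_mono_ennreal add_left_mono, simp)
    also have "\<dots> = 1"
      using a x wk_pos[of x] by (simp add: mass_split ennreal_plus[symmetric] divide_ennreal del: ennreal_plus)
    finally show ?thesis .
  qed
qed

abbreviation "\<rho> \<equiv> (3 - k) / (1 + k)"

lemma \<rho>_bounds: "0 < \<rho>" "\<rho> < 1"
  using k1 k2 by auto

text \<open>Left of \<open>b\<close> no mass is missing after the first iteration, and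
  \<open>contraction\<close> bounds the weight of \<open>[b, x]\<close>. The missing mass thus
  shrinks by the factor \<open>\<rho>\<close> in each step.\<close>

lemma II_mass_ge: "b < x \<Longrightarrow> x \<le> 1 \<Longrightarrow> ennreal (1 - \<rho> ^ n) \<le> II (Suc n) (\<lambda>_. 1) x"
proof (induction n arbitrary: x)
  case 0
  then show ?case by simp
next
  case (Suc n)
  note x = Suc.prems and a = \<alpha>_bounds[of x]
  define e where "e = \<rho> ^ n"
  have e: "0 \<le> e" "e \<le> 1" using \<rho>_bounds by (auto simp: e_def intro: power_le_one)
  have "ennreal ((b - \<alpha> x) + (1 - e) * (x - b)) = ennreal (b - \<alpha> x) + ennreal (1 - e) * ennreal (x - b)"
    using a x e by (simp add: ennreal_plus[symmetric] ennreal_mult[symmetric] del: ennreal_plus)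
  also have "\<dots> = (\<integral>\<^sup>+s. indicator {\<alpha> x..b} s + ennreal (1 - e) * indicator {b<..x} s \<partial>lborel)"
    using a x by (subst nn_integral_add) (auto simp: nn_integral_cmult)
  also have "\<dots> \<le> (\<integral>\<^sup>+s. II (Suc n) (\<lambda>_. 1) s * indicator {\<alpha> x..x} s \<partial>lborel)"
  proof (rule nn_integral_mono_AE)
    have "AE s in lborel. s \<noteq> (-1::real)" by (rule AE_lborel_singleton)
    then show "AE s in lborel. indicator {\<alpha> x..b} s + ennreal (1 - e) * indicator {b<..x} s
        \<le> II (Suc n) (\<lambda>_. 1) s * indicator {\<alpha> x..x} s"
    proof eventually_elim
      case (elim s)
      show ?case
        using Suc.IH[of s] II_mass_left[of s n] a x elim
        by (cases "s \<le> b") (auto simp: indicator_def e_def simp del: rho.simps)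
    qed
  qed
  finally have "ennreal (w x - \<zeta> x) + ennreal ((b - \<alpha> x) + (1 - e) * (x - b))
      \<le> ennreal (w x - \<zeta> x) + (\<integral>\<^sup>+s. II (Suc n) (\<lambda>_. 1) s * indicator {\<alpha> x..x} s \<partial>lborel)"
    by (rule add_left_mono)
  then have "(ennreal (w x - \<zeta> x) + ennreal ((b - \<alpha> x) + (1 - e) * (x - b))) / ennreal (w x + k)
      \<le> II (Suc (Suc n)) (\<lambda>_. 1) x"
    using a x by (subst II_right) (auto intro!: divide_right_mono_ennreal)
  moreover have "ennreal (1 - \<rho> ^ Suc n) \<le> (ennreal (w x - \<zeta> x) + ennreal ((b - \<alpha> x) + (1 - e) * (x - b))) / ennreal (w x + k)"
  proof -
    have "e * (x - b) \<le> e * (\<rho> * (w x + k))" using contraction[of x] x e by (intro mult_left_mono) auto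
    moreover have gen: "(1 - q * e) * K = K - e * (q * K)" for q K by (simp add: algebra_simps)
    moreover have "(w x - \<zeta> x) + ((b - \<alpha> x) + (1 - e) * (x - b)) = (w x + k) - e * (x - b)"
      unfolding mass_split by (simp add: algebra_simps)
    ultimately have "(1 - \<rho> * e) * (w x + k) \<le> (w x - \<zeta> x) + ((b - \<alpha> x) + (1 - e) * (x - b))"
      unfolding gen by (simp only:)
    then have "1 - \<rho> * e \<le> ((w x - \<zeta> x) + ((b - \<alpha> x) + (1 - e) * (x - b))) / (w x + k)"
      using wk_pos[of x] x by (simp add: pos_le_divide_eq)
    moreover have "0 \<le> (1 - e) * (x - b)" using e x by simp
    ultimately show ?thesis
      using a x wk_pos[of x] e
      by (simp add: ennreal_plus[symmetric] divide_ennreal e_def ennreal_leI del: ennreal_plus)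
  qed
  ultimately show ?case by (rule order_trans[rotated])
qed

text \<open>The limit of the increasing iterates. The point mass outside \<open>(-1, 1]\<close>
  provides the prescribed law at -1 and keeps \<open>Qd\<close> a probability kernel on the whole
  line.\<close>

definition Qd :: "real \<Rightarrow> real measure" where
  "Qd x = (if -1 < x \<and> x \<le> 1 then density lborel (\<lambda>u. SUP n. rho n x u) else return borel 0)"

lemma Qd_nn:
  assumes x: "-1 < x" "x \<le> 1" and [measurable]: "F \<in> borel_measurable borel"
  shows "(\<integral>\<^sup>+u. F u \<partial>Qd x) = (SUP n. II n F x)"
proof -
  have "(\<integral>\<^sup>+u. F u \<partial>Qd x) = (\<integral>\<^sup>+u. (SUP n. rho n x u) * F u \<partial>lborel)"
    using x by (simp add: Qd_def nn_integral_density)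
  also have "\<dots> = (\<integral>\<^sup>+u. (SUP n. rho n x u * F u) \<partial>lborel)"
    by (simp add: SUP_mult_right_ennreal)
  also have "\<dots> = (SUP n. II n F x)" unfolding II_def
    by (rule nn_integral_monotone_convergence_SUP)
      (auto intro!: incseq_SucI le_funI mult_right_mono rho_mono simp del: rho.simps)
  finally show ?thesis .
qed

lemma II_incseq: "incseq (\<lambda>n. II n F x)"
  unfolding II_def by (rule incseq_SucI) (auto intro!: nn_integral_mono mult_right_mono rho_mono simp del: rho.simps)

lemma SUP_II_Suc: "(SUP n. II n F x) = (SUP n. II (Suc n) F x)"
proof (rule antisym)
  show "(SUP n. II n F x) \<le> (SUP n. II (Suc n) F x)"
    by (rule SUP_mono) (use incseq_SucD[OF II_incseq] in blast)
  show "(SUP n. II (Suc n) F x) \<le> (SUP n. II n F x)"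
    by (rule SUP_mono) blast
qed

lemma sets_Qd [simp, measurable_cong]: "sets (Qd x) = sets borel" and space_Qd [simp]: "space (Qd x) = UNIV"
  by (auto simp: Qd_def)

lemma Qd_prob: "prob_space (Qd x)"
proof (cases "-1 < x \<and> x \<le> 1")
  case True
  then have x: "-1 < x" "x \<le> 1" by auto
  have "(\<integral>\<^sup>+u. 1 \<partial>Qd x) = 1"
  proof (rule antisym)
    show "(\<integral>\<^sup>+u. 1 \<partial>Qd x) \<le> 1"
      unfolding Qd_nn[OF x borel_measurable_const] using II_mass_le[OF x] by (intro SUP_least)
    show "1 \<le> (\<integral>\<^sup>+u. 1 \<partial>Qd x)" unfolding Qd_nn[OF x borel_measurable_const]
    proof (cases "x \<le> b")
      case True
      then show "1 \<le> (SUP n. II n (\<lambda>_. 1) x)" using II_mass_left[of x 0] x by (metis SUP_upper UNIV_I)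
    next
      case False
      have "(\<lambda>n. ennreal (1 - \<rho> ^ n)) \<longlonglongrightarrow> ennreal (1 - 0)"
        using \<rho>_bounds by (intro tendsto_ennrealI tendsto_intros LIMSEQ_realpow_zero) auto
      moreover have "ennreal (1 - \<rho> ^ n) \<le> (SUP n. II n (\<lambda>_. 1) x)" for n
        using II_mass_ge[of x n] False x by (meson SUP_upper UNIV_I not_le order_trans)
      ultimately show "1 \<le> (SUP n. II n (\<lambda>_. 1) x)"
        using LIMSEQ_le_const2 by fastforce
    qed
  qed
  then show ?thesis by (intro prob_spaceI) simp
next
  case False
  then show ?thesis unfolding Qd_def by (auto intro!: prob_space_return)
qed

lemma Qd_integrable:
  fixes f :: "real \<Rightarrow> real"
  assumes "f \<in> borel_measurable borel" "\<And>u. \<bar>f u\<bar> \<le> B"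
  shows "integrable (Qd s) f"
proof -
  have "f \<in> borel_measurable (Qd s)" using assms(1) by (simp cong: measurable_cong_sets)
  then show ?thesis using assms(2)
    by (intro finite_measure.integrable_const_bound[where B = B] AE_I2
        prob_space.finite_measure[OF Qd_prob]) auto
qed

lemma Qd_measurable: "Qd \<in> borel \<rightarrow>\<^sub>M prob_algebra borel"
proof (intro measurable_prob_algebraI Qd_prob measurable_subprob_algebra)
  show "subprob_space (Qd x)" for x using Qd_prob by (rule prob_space_imp_subprob_space)
  fix A :: "real set" assume [measurable]: "A \<in> sets borel"
  have "emeasure (Qd x) A = (if -1 < x \<and> x \<le> 1 then (SUP n. II n (indicator A) x) else indicator A 0)" for x
  proof (cases "-1 < x \<and> x \<le> 1")
    case True
    then show ?thesis using Qd_nn[of x "indicator A"] by (simp add: nn_integral_indicator)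
  qed (auto simp: Qd_def)
  then show "(\<lambda>x. emeasure (Qd x) A) \<in> borel_measurable borel" by simp
qed simp

lemma Qd_uniform:
  assumes "-1 < x" "x \<le> b" shows "Qd x = uniform_measure lborel {d x..w x}"
proof -
  have x1: "x \<le> 1" and c: "cl x = x" using assms b_bounds by auto
  define c' where "c' u = (if d x \<le> u \<and> u \<le> w x then 1 else 0) / ennreal (w x - d x)" for u
  have "(SUP n. rho n x u) = c' u" for u
  proof (rule antisym)
    show "(SUP n. rho n x u) \<le> c' u"
    proof (rule SUP_least)
      fix n show "rho n x u \<le> c' u" using assms by (cases n) (auto simp: c'_def c)
    qed
    have "rho (Suc 0) x u = c' u" using assms by (simp add: c'_def c)
    then show "c' u \<le> (SUP n. rho n x u)" by (metis SUP_upper UNIV_I)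
  qed
  then have "Qd x = density lborel c'" using assms x1 by (simp add: Qd_def)
  also have "\<dots> = uniform_measure lborel {d x..w x}"
    unfolding uniform_measure_def c'_def using wd_pos'[of x] assms x1
    by (intro density_cong) (auto simp: indicator_def)
  finally show ?thesis .
qed

lemma Qd_integral_measurable [measurable]:
  fixes f :: "real \<Rightarrow> real"
  assumes [measurable]: "f \<in> borel_measurable borel"
  shows "(\<lambda>x. LINT u|Qd x. f u) \<in> borel_measurable borel"
  using measurable_compose[OF measurable_prob_algebraD[OF Qd_measurable] integral_measurable_subprob_algebra[of f borel]]
  by simp

text \<open>Monotone convergence in the recursion \<open>II_right\<close>, first in
  \<open>ennreal\<close>; the bound on \<open>f\<close> makes both sides finite and allows the
  return to \<open>real\<close>.\<close>

lemma Qd_equation_nonneg: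
  fixes f :: "real \<Rightarrow> real"
  assumes x: "b < x" "x \<le> 1" and [measurable]: "f \<in> borel_measurable borel" and f: "\<And>u. 0 \<le> f u \<and> f u \<le> B"
  shows "(LINT u|Qd x. f u) * (w x + k)
    = (LINT u:{\<zeta> x..w x}|lborel. f u) + (LINT s:{\<alpha> x..x}|lborel. (LINT u|Qd s. f u))"
proof -
  define g where "g s = (LINT u|Qd s. f u)" for s
  have [measurable]: "g \<in> borel_measurable borel" unfolding g_def by measurable
  have int: "integrable (Qd s) f" for s
    using f by (intro Qd_integrable[where B = B]) auto
  have g: "0 \<le> g s \<and> g s \<le> B" for s
  proof -
    have "g s \<le> (LINT u|Qd s. B)" unfolding g_def
      using f int prob_space.finite_measure[OF Qd_prob, of s]
      by (intro integral_mono) (auto simp: finite_measure.integrable_const)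
    also have "\<dots> = B" using prob_space.prob_space[OF Qd_prob, of s] by simp
    finally show ?thesis using f by (simp add: g_def)
  qed
  have gI: "ennreal (g s) = (SUP n. II n (\<lambda>u. ennreal (f u)) s)" if "-1 < s" "s \<le> 1" for s
    using Qd_nn[OF that, of "\<lambda>u. ennreal (f u)"] nn_integral_eq_integral[OF int, of s] f by (simp add: g_def)
  note a = \<alpha>_bounds[of x]
  have "ennreal (g x) = (SUP n. II (Suc n) (\<lambda>u. ennreal (f u)) x)"
    using gI[of x] x b_bounds by (simp add: SUP_II_Suc)
  also have "\<dots> = (SUP n. ((\<integral>\<^sup>+u. ennreal (f u) * indicator {\<zeta> x..w x} u \<partial>lborel)
    + (\<integral>\<^sup>+s. II n (\<lambda>u. ennreal (f u)) s * indicator {\<alpha> x..x} s \<partial>lborel)) / ennreal (w x + k))"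
    using x by (simp add: II_right)
  also have "\<dots> = ((\<integral>\<^sup>+u. ennreal (f u) * indicator {\<zeta> x..w x} u \<partial>lborel)
    + (SUP n. \<integral>\<^sup>+s. II n (\<lambda>u. ennreal (f u)) s * indicator {\<alpha> x..x} s \<partial>lborel)) / ennreal (w x + k)"
    by (simp add: SUP_divide_ennreal[symmetric] ennreal_SUP_add_right)
  also have "(SUP n. \<integral>\<^sup>+s. II n (\<lambda>u. ennreal (f u)) s * indicator {\<alpha> x..x} s \<partial>lborel)
      = (\<integral>\<^sup>+s. (SUP n. II n (\<lambda>u. ennreal (f u)) s * indicator {\<alpha> x..x} s) \<partial>lborel)"
    by (rule nn_integral_monotone_convergence_SUP[symmetric])
      (auto intro!: incseq_SucI le_funI mult_right_mono intro: incseq_SucD[OF II_incseq])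
  also have "\<dots> = (\<integral>\<^sup>+s. ennreal (g s) * indicator {\<alpha> x..x} s \<partial>lborel)"
  proof (rule nn_integral_cong_AE)
    have "AE s in lborel. s \<noteq> (-1::real)" by (rule AE_lborel_singleton)
    then show "AE s in lborel. (SUP n. II n (\<lambda>u. ennreal (f u)) s * indicator {\<alpha> x..x} s) = ennreal (g s) * indicator {\<alpha> x..x} s"
    proof eventually_elim
      case (elim s)
      then show ?case using gI[of s] a x by (auto simp: indicator_def)
    qed
  qed
  also have "\<dots> = ennreal (LINT s:{\<alpha> x..x}|lborel. g s)"
    using g by (intro nn_integral_Icc[where B = B]) auto
  also have "(\<integral>\<^sup>+u. ennreal (f u) * indicator {\<zeta> x..w x} u \<partial>lborel) = ennreal (LINT u:{\<zeta> x..w x}|lborel. f u)"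
    using f by (intro nn_integral_Icc[where B = B]) auto
  finally have "ennreal (g x) = (ennreal (LINT u:{\<zeta> x..w x}|lborel. f u) + ennreal (LINT s:{\<alpha> x..x}|lborel. g s)) / ennreal (w x + k)" .
  moreover have nn: "0 \<le> (LINT u:{\<zeta> x..w x}|lborel. f u)" "0 \<le> (LINT s:{\<alpha> x..x}|lborel. g s)"
    using f g by (auto simp: set_lebesgue_integral_def intro!: integral_nonneg_AE)
  ultimately have "g x = ((LINT u:{\<zeta> x..w x}|lborel. f u) + (LINT s:{\<alpha> x..x}|lborel. g s)) / (w x + k)"
    using wk_pos[of x] x g[of x]
    by (simp add: ennreal_plus[symmetric] divide_ennreal ennreal_inj del: ennreal_plus)
  then show ?thesis using wk_pos[of x] x by (simp add: g_def)
qed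

text \<open>Adding the constant \<open>B\<close> makes \<open>f\<close> nonnegative, and constants
  satisfy the equation by \<open>mass_split\<close>. At \<open>x = b\<close> the window is a single
  point, and the equation reproduces the uniform law on \<open>[- k, w b]\<close>.\<close>

lemma Qd_equation:
  fixes f :: "real \<Rightarrow> real"
  assumes x: "b \<le> x" "x \<le> 1" and [measurable]: "f \<in> borel_measurable borel" and f: "\<And>u. \<bar>f u\<bar> \<le> B"
  shows "(LINT u|Qd x. f u) * (w x + k)
    = (LINT u:{\<zeta> x..w x}|lborel. f u) + (LINT s:{\<alpha> x..x}|lborel. (LINT u|Qd s. f u))"
proof (cases "x = b")
  case True
  have z: "\<zeta> b = - k" by (simp add: zeta_of_def \<alpha>_b)
  have "(LINT u|Qd b. f u) = (LINT u:{-k..w b}|lborel. f u) / (w b + k)"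
    using integral_uniform_measure_Icc[of "d b" "w b" f] wd_pos'[of b] Qd_uniform[of b] b_bounds d_right[of b] by simp
  moreover have "(LINT s:{b..b}|lborel. (LINT u|Qd s. f u)) = 0"
  proof -
    have "(LINT s|lborel. indicator {b..b} s *\<^sub>R (LINT u|Qd s. f u)) = 0"
    proof (rule integral_eq_zero_AE)
      have "AE s in lborel. s \<noteq> b" by (rule AE_lborel_singleton)
      then show "AE s in lborel. indicator {b..b} s *\<^sub>R (LINT u|Qd s. f u) = 0" by eventually_elim simp
    qed
    then show ?thesis by (simp add: set_lebesgue_integral_def)
  qed
  ultimately show ?thesis using True wk_pos[of b] b_bounds z by (simp add: \<alpha>_b)
next
  case False
  then have xb: "b < x" using x by simp
  note a = \<alpha>_bounds[OF x]
  have B: "0 \<le> B" using f[of 0] by linarith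
  have int: "integrable (Qd s) f" for s
    using f by (intro Qd_integrable[where B = B]) auto
  have cst: "integrable (Qd s) (\<lambda>_. B)" for s
    using prob_space.finite_measure[OF Qd_prob, of s] by (simp add: finite_measure.integrable_const)
  have shift: "(LINT u|Qd s. f u + B) = (LINT u|Qd s. f u) + B" for s
    using int cst prob_space.prob_space[OF Qd_prob, of s] by simp
  have bd: "\<bar>LINT u|Qd s. f u\<bar> \<le> B" for s
  proof -
    have "\<bar>LINT u|Qd s. f u\<bar> \<le> (LINT u|Qd s. \<bar>f u\<bar>)" by (rule integral_abs_bound)
    also have "\<dots> \<le> (LINT u|Qd s. B)" using f int cst by (intro integral_mono) auto
    also have "\<dots> = B" using prob_space.prob_space[OF Qd_prob, of s] by simp
    finally show ?thesis .
  qed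
  have Icc: "(LINT u:{p..q}|lborel. h u + B) = (LINT u:{p..q}|lborel. h u) + B * (q - p)"
    if "p \<le> q" "h \<in> borel_measurable borel" "\<And>u. \<bar>h u\<bar> \<le> B" for p q h
  proof -
    have "(LINT u:{p..q}|lborel. h u + B) = (LINT u:{p..q}|lborel. h u) + (LINT u:{p..q}|lborel. B)"
      by (rule set_integral_add) (use that B in \<open>auto intro!: set_integrable_bounded_Icc[where B = B]\<close>)
    then show ?thesis using that by (simp add: set_lebesgue_integral_def)
  qed
  have eq: "(LINT u|Qd x. f u + B) * (w x + k)
    = (LINT u:{\<zeta> x..w x}|lborel. f u + B) + (LINT s:{\<alpha> x..x}|lborel. (LINT u|Qd s. f u + B))"
    by (rule Qd_equation_nonneg[OF xb x(2), where B = "2 * B"]) (use f in \<open>auto simp: abs_le_iff algebra_simps\<close>, smt (verit) f)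
  have "(LINT u:{\<zeta> x..w x}|lborel. f u + B) = (LINT u:{\<zeta> x..w x}|lborel. f u) + B * (w x - \<zeta> x)"
    using a f by (intro Icc) auto
  moreover have "(LINT s:{\<alpha> x..x}|lborel. (LINT u|Qd s. f u) + B) = (LINT s:{\<alpha> x..x}|lborel. (LINT u|Qd s. f u)) + B * (x - \<alpha> x)"
    using a bd by (intro Icc) auto
  moreover have "B * (w x + k) = B * (w x - \<zeta> x) + B * (x - \<alpha> x)"
    unfolding mass_split by (simp add: algebra_simps)
  ultimately show ?thesis using eq unfolding shift by (simp add: distrib_right)
qed

lemma aux_kernel_exists: "is_aux_kernel k Qd"
  unfolding is_aux_kernel_def
proof (intro conjI allI impI ballI)
  show "Qd \<in> restrict_space borel {-1..1} \<rightarrow>\<^sub>M prob_algebra borel"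
    by (rule measurable_restrict_space1[OF Qd_measurable])
  show "Qd (-1) = return borel 0" by (simp add: Qd_def)
  show "Qd x = uniform_measure lborel {d x..w x}" if "-1 < x \<and> x \<le> b" for x
    using that Qd_uniform by simp
  fix x and f :: "real \<Rightarrow> real"
  assume x: "x \<in> {b..1}" and "continuous_on UNIV f \<and> bounded (range f)"
  then have f: "f \<in> borel_measurable borel" "bounded (range f)" by (auto intro: borel_measurable_continuous_onI)
  then obtain B where "\<And>u. \<bar>f u\<bar> \<le> B" by (auto simp: bounded_iff)
  from Qd_equation[of x f B, OF _ _ f(1) this] x wk_pos[of x]
  show "(LINT u|Qd x. f u) = ((LINT u:{\<zeta> x..w x}|lborel. f u)
      + (LINT s:{\<alpha> x..x}|lborel. (LINT u|Qd s. f u))) / (w x + k)"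
    by (simp add: eq_divide_eq)
qed

lemma Q_kernel_aux: "is_aux_kernel k (Q_kernel k)"
  unfolding Q_kernel_def by (rule someI[where P = "is_aux_kernel k", OF aux_kernel_exists])

end

section \<open>Test functions against the kernel\<close>

lemma LINT_Icc_eq_integral:
  fixes g :: "real \<Rightarrow> real"
  assumes "g \<in> borel_measurable borel" "\<And>u. \<bar>g u\<bar> \<le> B"
  shows "g integrable_on {a..c}" "(LINT u:{a..c}|lborel. g u) = integral {a..c} g"
  using set_borel_integral_eq_integral[OF set_integrable_bounded_Icc[of g a c B]] assms by auto

lemma LINT_Icc_combine:
  fixes g :: "real \<Rightarrow> real"
  assumes g: "g \<in> borel_measurable borel" "\<And>u. \<bar>g u\<bar> \<le> B" and "a \<le> e" "e \<le> c"
  shows "(LINT u:{a..c}|lborel. g u) = (LINT u:{a..e}|lborel. g u) + (LINT u:{e..c}|lborel. g u)"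
  using assms Henstock_Kurzweil_Integration.integral_combine[of a e c g] LINT_Icc_eq_integral[OF g] by simp

lemma LINT_Icc_bound:
  fixes g :: "real \<Rightarrow> real"
  assumes g: "g \<in> borel_measurable borel" "\<And>u. \<bar>g u\<bar> \<le> B" and "a \<le> c"
  shows "\<bar>LINT u:{a..c}|lborel. g u\<bar> \<le> B * (c - a)"
proof -
  have "norm (integral (cbox a c) g) \<le> B * measure lborel (cbox a c)"
    by (rule integrable_bound) (use assms LINT_Icc_eq_integral(1)[OF g, of a c] order_trans[OF abs_ge_zero g(2)] in auto)
  then show ?thesis using assms LINT_Icc_eq_integral(2)[OF g] by simp
qed

lemma LINT_Icc_tail:
  fixes r :: real
  assumes "a \<le> c"
  shows "(LINT u:{a..c}|lborel. indicator {r..} u) = max 0 (c - r) - max 0 (a - r)"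
proof -
  have "(LINT u:{a..c}|lborel. indicator {r..} u) = (LINT u|lborel. indicator {max a r..c} u)"
    unfolding set_lebesgue_integral_def by (rule Bochner_Integration.integral_cong) (auto simp: indicator_def)
  also have "\<dots> = measure lborel {max a r..c}" by simp
  also have "\<dots> = max 0 (c - r) - max 0 (a - r)" using assms by (auto simp: max_def)
  finally show ?thesis .
qed

context curtain begin

abbreviation "Qk \<equiv> Q_kernel k"

text \<open>The chosen kernel is measurable on \<open>[-1, 1]\<close> only; clamping its argument
  extends measurability to the line.\<close>

definition QC :: "real \<Rightarrow> real measure" where "QC x = Qk (cl x)"

lemma QC_measurable [measurable]: "QC \<in> borel \<rightarrow>\<^sub>M prob_algebra borel"
proof -
  have "(\<lambda>x. cl x) \<in> borel \<rightarrow>\<^sub>M restrict_space borel {-1..1}"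
    by (rule measurable_restrict_space2) auto
  moreover have "Qk \<in> restrict_space borel {-1..1} \<rightarrow>\<^sub>M prob_algebra borel"
    using Q_kernel_aux by (simp add: is_aux_kernel_def)
  ultimately show ?thesis unfolding QC_def[abs_def] by (rule measurable_compose)
qed

lemma QC_prob: "prob_space (QC x)" and sets_QC [simp, measurable_cong]: "sets (QC x) = sets borel"
  using measurable_space[OF QC_measurable, of x] by (auto simp: space_prob_algebra)

lemma space_QC [simp]: "space (QC x) = UNIV"
  using sets_eq_imp_space_eq[OF sets_QC[of x]] by simp

lemma QC_integrable:
  fixes f :: "real \<Rightarrow> real"
  assumes "f \<in> borel_measurable borel" "\<And>u. \<bar>f u\<bar> \<le> B"
  shows "integrable (QC x) f"
proof -
  have "f \<in> borel_measurable (QC x)" using assms(1) by (simp cong: measurable_cong_sets)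
  then show ?thesis using assms(2)
    by (intro finite_measure.integrable_const_bound[where B = B] AE_I2
        prob_space.finite_measure[OF QC_prob]) auto
qed

definition SS :: "(real \<Rightarrow> real) \<Rightarrow> real \<Rightarrow> real" where "SS f x = (LINT u|QC x. f u)"

definition TT :: "(real \<Rightarrow> real) \<Rightarrow> real \<Rightarrow> real" where "TT f x = (LINT s:{-1..x}|lborel. SS f s)"

lemma SS_measurable [measurable]:
  assumes [measurable]: "f \<in> borel_measurable borel" shows "SS f \<in> borel_measurable borel"
  unfolding SS_def[abs_def]
  using measurable_compose[OF measurable_prob_algebraD[OF QC_measurable] integral_measurable_subprob_algebra[of f borel]]
  by simp

lemma SS_bound:
  assumes f: "f \<in> borel_measurable borel" "\<And>u. \<bar>f u\<bar> \<le> B" shows "\<bar>SS f x\<bar> \<le> B"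
proof -
  have "\<bar>SS f x\<bar> \<le> (LINT u|QC x. \<bar>f u\<bar>)" unfolding SS_def by (rule integral_abs_bound)
  also have "\<dots> \<le> (LINT u|QC x. B)"
    using QC_integrable[OF f, of x] prob_space.finite_measure[OF QC_prob, of x] f(2)
    by (intro integral_mono) (auto simp: finite_measure.integrable_const)
  also have "\<dots> = B" using prob_space.prob_space[OF QC_prob, of x] by simp
  finally show ?thesis .
qed

lemma SS_left:
  assumes "-1 < x" "x \<le> b" "f \<in> borel_measurable borel"
  shows "SS f x * (w x - d x) = (LINT u:{d x..w x}|lborel. f u)"
proof -
  have x: "cl x = x" "x \<le> 1" using assms b_bounds by auto
  have "QC x = uniform_measure lborel {d x..w x}"
    using Q_kernel_aux assms x unfolding is_aux_kernel_def QC_def by simp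
  then show ?thesis using integral_uniform_measure_Icc[of "d x" "w x" f] wd_pos'[of x] assms x
    by (simp add: SS_def)
qed

text \<open>The kernel satisfies its equation for bounded continuous functions by definition,
  whereas tails require indicators. This class is closed under bounded pointwise limits and thereby
  reaches them.\<close>

definition good :: "(real \<Rightarrow> real) \<Rightarrow> bool" where
  "good f \<longleftrightarrow> f \<in> borel_measurable borel \<and> bounded (range f) \<and>
    (\<forall>x\<in>{b..1}. SS f x * (w x + k) = (LINT u:{\<zeta> x..w x}|lborel. f u) + (LINT s:{\<alpha> x..x}|lborel. SS f s))"

lemma good_cont:
  assumes "continuous_on UNIV f" "bounded (range f)" shows "good f"
  unfolding good_def
proof (intro conjI ballI)
  show "f \<in> borel_measurable borel" "bounded (range f)"
    using assms by (auto intro: borel_measurable_continuous_onI)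
  fix x assume x: "x \<in> {b..1}"
  have SSk: "SS f s = (LINT u|Qk s. f u)" if "-1 \<le> s" "s \<le> 1" for s using that by (simp add: SS_def QC_def)
  have "(LINT u|Qk x. f u) = ((LINT u:{\<zeta> x..w x}|lborel. f u) + (LINT s:{\<alpha> x..x}|lborel. (LINT u|Qk s. f u))) / (w x + k)"
    using Q_kernel_aux x assms unfolding is_aux_kernel_def by blast
  moreover have "(LINT s:{\<alpha> x..x}|lborel. (LINT u|Qk s. f u)) = (LINT s:{\<alpha> x..x}|lborel. SS f s)"
    using \<alpha>_bounds[of x] x SSk by (intro set_lebesgue_integral_cong) auto
  ultimately show "SS f x * (w x + k) = (LINT u:{\<zeta> x..w x}|lborel. f u) + (LINT s:{\<alpha> x..x}|lborel. SS f s)"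
    using SSk[of x] x b_bounds wk_pos[of x] by simp
qed

lemma good_limit:
  assumes good: "\<And>n. good (F n)" and B: "\<And>n u. \<bar>F n u\<bar> \<le> B"
    and lim: "\<And>u. (\<lambda>n. F n u) \<longlonglongrightarrow> f u"
  shows "good f"
proof -
  have Fm [measurable]: "F n \<in> borel_measurable borel" for n using good by (simp add: good_def)
  have fm [measurable]: "f \<in> borel_measurable borel"
    using lim by (rule borel_measurable_LIMSEQ_real) simp
  have fB: "\<bar>f u\<bar> \<le> B" for u
    using lim[of u] B by (intro LIMSEQ_le_const2[OF tendsto_rabs[OF lim]]) auto
  have SSlim: "(\<lambda>n. SS (F n) x) \<longlonglongrightarrow> SS f x" for x unfolding SS_def
  proof (rule integral_dominated_convergence[where w = "\<lambda>_. B"])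
    show "integrable (QC x) (\<lambda>_. B)"
      using prob_space.finite_measure[OF QC_prob, of x] by (simp add: finite_measure.integrable_const)
  qed (use lim B in \<open>auto cong: measurable_cong_sets\<close>)
  have set_lim: "(\<lambda>n. LINT u:{p..q}|lborel. G n u) \<longlonglongrightarrow> (LINT u:{p..q}|lborel. g u)"
    if [measurable]: "\<And>n. G n \<in> borel_measurable borel" "g \<in> borel_measurable borel"
      and "\<And>n u. \<bar>G n u\<bar> \<le> B" "\<And>u. (\<lambda>n. G n u) \<longlonglongrightarrow> g u" for G :: "nat \<Rightarrow> real \<Rightarrow> real" and g p q
    unfolding set_lebesgue_integral_def
  proof (rule integral_dominated_convergence[where w = "\<lambda>u. indicator {p..q} u *\<^sub>R B"])
    have "set_integrable lborel {p..q} (\<lambda>_. B)" by (rule set_integrable_bounded_Icc[where B = "\<bar>B\<bar>"]) auto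
    then show "integrable lborel (\<lambda>u. indicator {p..q} u *\<^sub>R B)" by (simp add: set_integrable_def)
    show "AE u in lborel. (\<lambda>n. indicator {p..q} u *\<^sub>R G n u) \<longlonglongrightarrow> indicator {p..q} u *\<^sub>R g u"
      using that by (intro AE_I2 tendsto_intros) auto
    show "AE u in lborel. norm (indicator {p..q} u *\<^sub>R G n u) \<le> indicator {p..q} u *\<^sub>R B" for n
      using that by (intro AE_I2) (auto simp: indicator_def)
  qed simp_all
  show ?thesis unfolding good_def
  proof (intro conjI ballI)
    show "bounded (range f)" using fB by (auto simp: bounded_iff)
    fix x assume x: "x \<in> {b..1}"
    have "(\<lambda>n. SS (F n) x * (w x + k)) \<longlonglongrightarrow> SS f x * (w x + k)" by (intro tendsto_intros SSlim)
    moreover have "(\<lambda>n. (LINT u:{\<zeta> x..w x}|lborel. F n u) + (LINT s:{\<alpha> x..x}|lborel. SS (F n) s))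
        \<longlonglongrightarrow> (LINT u:{\<zeta> x..w x}|lborel. f u) + (LINT s:{\<alpha> x..x}|lborel. SS f s)"
      using B lim SS_bound[OF Fm B] SSlim by (intro tendsto_add set_lim) auto
    moreover have "SS (F n) x * (w x + k) = (LINT u:{\<zeta> x..w x}|lborel. F n u) + (LINT s:{\<alpha> x..x}|lborel. SS (F n) s)" for n
      using good x by (simp add: good_def)
    ultimately show "SS f x * (w x + k) = (LINT u:{\<zeta> x..w x}|lborel. f u) + (LINT s:{\<alpha> x..x}|lborel. SS f s)"
      by (simp add: LIMSEQ_unique)
  qed simp
qed

lemma good_tail: "good (indicator {r..})"
proof (rule good_limit)
  \<comment> \<open>Ramps that are already 1 at \<open>r\<close> and descend to its left; this side
    is needed to obtain the closed half-line in the limit.\<close>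
  define F where "F = (\<lambda>n::nat. \<lambda>u::real. min 1 (max 0 (1 + real n * (u - r))))"
  show "good (F n)" for n
  proof (rule good_cont)
    show "continuous_on UNIV (F n)" unfolding F_def
      by (intro continuous_on_min continuous_on_max continuous_intros)
    show "bounded (range (F n))" by (auto simp: F_def bounded_iff intro!: exI[of _ 1])
  qed
  show "\<bar>F n u\<bar> \<le> 1" for n u by (auto simp: F_def)
  show "(\<lambda>n. F n u) \<longlonglongrightarrow> indicator {r..} u" for u
  proof (cases "r \<le> u")
    case True
    then have "F n u = 1" for n by (simp add: F_def)
    then show ?thesis using True by simp
  next
    case False
    obtain N :: nat where N: "1 / (r - u) \<le> real N" using real_arch_simple by blast
    have "F n u = 0" if "N \<le> n" for n
    proof -
      have "1 / (r - u) \<le> real n" using N that by linarith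
      then have "1 \<le> real n * (r - u)" using False by (simp add: field_simps)
      then show ?thesis by (simp add: F_def algebra_simps)
    qed
    then have "\<forall>\<^sub>F n in sequentially. F n u = indicator {r..} u"
      using False by (auto simp: eventually_sequentially intro!: exI[of _ N])
    then show ?thesis by (rule tendsto_eventually)
  qed
qed

lemma goodD:
  assumes "good f"
  obtains B where "f \<in> borel_measurable borel" "\<And>u. \<bar>f u\<bar> \<le> B" "0 \<le> B"
proof -
  obtain B where B: "\<And>u. \<bar>f u\<bar> \<le> B" using assms by (auto simp: good_def bounded_iff)
  moreover have "0 \<le> B" using B[of 0] by linarith
  moreover have "f \<in> borel_measurable borel" using assms by (simp add: good_def)
  ultimately show thesis using that[of B] by blast
qed

lemma TT_diff:
  assumes f: "f \<in> borel_measurable borel" "\<And>u. \<bar>f u\<bar> \<le> B" and "-1 \<le> x" "x \<le> x'"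
  shows "TT f x' - TT f x = (LINT s:{x..x'}|lborel. SS f s)"
  unfolding TT_def using LINT_Icc_combine[OF SS_measurable[OF f(1)] SS_bound[OF f], of "-1" x x'] assms by simp

lemma TT_lipschitz:
  assumes f: "f \<in> borel_measurable borel" "\<And>u. \<bar>f u\<bar> \<le> B" and "-1 \<le> x" "-1 \<le> x'"
  shows "\<bar>TT f x - TT f x'\<bar> \<le> B * \<bar>x - x'\<bar>"
proof -
  have *: "\<bar>TT f x' - TT f x\<bar> \<le> B * (x' - x)" if "-1 \<le> x" "x \<le> x'" for x x'
    using TT_diff[OF f that] LINT_Icc_bound[OF SS_measurable[OF f(1)] SS_bound[OF f], of x x'] that by simp
  show ?thesis using *[of x x'] *[of x' x] assms by (cases "x \<le> x'") (auto simp: abs_minus_commute)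
qed

lemma TT_continuous:
  assumes f: "f \<in> borel_measurable borel" "\<And>u. \<bar>f u\<bar> \<le> B" "0 \<le> B" shows "continuous_on {-1..1} (TT f)"
proof (rule lipschitz_on_continuous_on, rule lipschitz_onI)
  show "dist (TT f x) (TT f x') \<le> B * dist x x'" if "x \<in> {-1..1}" "x' \<in> {-1..1}" for x x'
    using TT_lipschitz[OF f(1,2), of x x'] that by (simp add: dist_real_def)
qed (rule f)

lemma SS_right:
  assumes "good f" "b \<le> x" "x \<le> 1"
  shows "SS f x * (w x + k) = (LINT u:{\<zeta> x..w x}|lborel. f u) + TT f x - TT f (\<alpha> x)"
proof -
  obtain B where B: "f \<in> borel_measurable borel" "\<And>u. \<bar>f u\<bar> \<le> B"
    using goodD[OF assms(1)] by metis
  show ?thesis using assms TT_diff[OF B, of "\<alpha> x" x] \<alpha>_bounds[of x] by (simp add: good_def)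
qed

lemma tail_left: "-1 < x \<Longrightarrow> x \<le> b \<Longrightarrow>
    SS (indicator {r..}) x * (w x - d x) = max 0 (w x - r) - max 0 (d x - r)"
  using SS_left[of x "indicator {r..}"] LINT_Icc_tail[of "d x" "w x" r] wd_pos'[of x] b_bounds by simp

lemma tail_right: "b \<le> x \<Longrightarrow> x \<le> 1 \<Longrightarrow> SS (indicator {r..}) x * (w x + k) =
    max 0 (w x - r) - max 0 (\<zeta> x - r) + TT (indicator {r..}) x - TT (indicator {r..}) (\<alpha> x)"
  using SS_right[OF good_tail, of x r] LINT_Icc_tail[of "\<zeta> x" "w x" r] \<alpha>_bounds[of x] by simp

text \<open>The two equations are solved for \<open>SS\<close>. The denominator \<open>w - d\<close>
  vanishes at -1, which is why the interval starts at some \<open>c > -1\<close>.\<close>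

lemma tail_continuous:
  assumes c: "-1 < c" "c \<le> b" shows "continuous_on {c..1} (SS (indicator {r..}))"
proof -
  let ?f = "indicator {r..} :: real \<Rightarrow> real"
  have T: "continuous_on {-1..1} (TT ?f)" by (rule TT_continuous[where B = 1]) auto
  have L: "continuous_on {c..b} (SS ?f)"
  proof (rule continuous_on_eq)
    have nz: "w x - d x \<noteq> 0" if "x \<in> {c..b}" for x using wd_pos'[of x] that c b_bounds by auto
    show "continuous_on {c..b} (\<lambda>x. (max 0 (w x - r) - max 0 (d x - r)) / (w x - d x))"
      by (intro continuous_intros continuous_on_max continuous_on_subset[OF w_continuous] continuous_on_subset[OF d_continuous])
        (use c b_bounds nz in auto)
    show "(max 0 (w x - r) - max 0 (d x - r)) / (w x - d x) = SS ?f x" if "x \<in> {c..b}" for x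
      using tail_left[of x r] nz[OF that] that c by (simp add: divide_eq_eq)
  qed
  have R: "continuous_on {b..1} (SS ?f)"
  proof (rule continuous_on_eq)
    have nz: "w x + k \<noteq> 0" if "x \<in> {b..1}" for x using wk_pos[of x] that by auto
    have "continuous_on {b..1} (\<lambda>x. TT ?f (\<alpha> x))"
      by (rule continuous_on_compose2[OF T \<alpha>_continuous]) (use \<alpha>_bounds b_bounds in force)
    then show "continuous_on {b..1} (\<lambda>x. (max 0 (w x - r) - max 0 (\<zeta> x - r) + TT ?f x - TT ?f (\<alpha> x)) / (w x + k))"
      by (intro continuous_intros continuous_on_max continuous_on_subset[OF w_continuous] continuous_on_subset[OF T] \<zeta>_continuous)
        (use b_bounds nz in auto)
    show "(max 0 (w x - r) - max 0 (\<zeta> x - r) + TT ?f x - TT ?f (\<alpha> x)) / (w x + k) = SS ?f x" if "x \<in> {b..1}" for x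
      using tail_right[of x r] nz[OF that] that by (simp add: divide_eq_eq)
  qed
  have "continuous_on ({c..b} \<union> {b..1}) (SS ?f)"
    by (intro continuous_on_closed_Un L R) auto
  moreover have "{c..b} \<union> {b..1} = {c..1}" using c b_bounds by auto
  ultimately show ?thesis by simp
qed

lemma TT_tail_deriv:
  assumes x: "-1 < x" "x < 1"
  shows "(TT (indicator {r..}) has_real_derivative SS (indicator {r..}) x) (at x)"
proof -
  let ?f = "indicator {r..} :: real \<Rightarrow> real"
  define c where "c = (min x b - 1) / 2"
  have c: "-1 < c" "c < x" "c \<le> b" using x b_bounds by (auto simp: c_def min_def field_simps)
  have "((\<lambda>u. TT ?f c + integral {c..u} (SS ?f)) has_real_derivative 0 + SS ?f x) (at x within {c..1})"
    by (intro DERIV_add DERIV_const integral_has_real_derivative tail_continuous) (use c x in auto)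
  moreover have "at x within {c..1} = at x" using c x by (intro at_within_Icc_at) auto
  ultimately have "((\<lambda>u. TT ?f c + integral {c..u} (SS ?f)) has_real_derivative SS ?f x) (at x)" by simp
  then show ?thesis
  proof (rule has_field_derivative_transform_within_open[of _ _ _ "{c<..<1}"])
    fix u assume u: "u \<in> {c<..<1}"
    have f: "?f \<in> borel_measurable borel" "\<And>u. \<bar>?f u\<bar> \<le> 1" by auto
    show "TT ?f c + integral {c..u} (SS ?f) = TT ?f u"
      using TT_diff[OF f, of c u] LINT_Icc_eq_integral(2)[OF SS_measurable[OF f(1)] SS_bound[OF f], of c u] u c by simp
  qed (use c x in auto)
qed

lemma tail_bounds: "0 \<le> SS (indicator {r..}) x \<and> SS (indicator {r..}) x \<le> 1"
proof -
  have "\<bar>SS (indicator {r..}) x\<bar> \<le> 1" by (rule SS_bound) auto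
  moreover have "0 \<le> SS (indicator {r..}) x" unfolding SS_def by (intro integral_nonneg_AE) simp
  ultimately show ?thesis by simp
qed

lemma level_tail:
  assumes "\<And>v. -2 \<le> v \<Longrightarrow> v \<le> 2 \<Longrightarrow>
    (psi has_real_derivative max 0 (v - t v - r) + TT (indicator {r..}) (t v)) (at v within {-2..2})"
  shows "level k r (SS (indicator {r..})) (TT (indicator {r..})) psi"
proof
  show "continuous_on {-1..1} (TT (indicator {r..}))" by (rule TT_continuous[where B = 1]) auto
qed (use assms TT_tail_deriv tail_bounds tail_left tail_right in auto)

text \<open>A continuous function bounding the indicator of the complement of \<open>[-3, 3]\<close> from below solves
  the homogeneous integral equation, hence vanishes.\<close>

lemma QC_support: "AE u in QC x. u \<in> {-3..3}"
proof -
  define f where "f = (\<lambda>u::real. min 1 (max 0 (\<bar>u\<bar> - 3)))"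
  have f: "f \<in> borel_measurable borel" "\<And>u. \<bar>f u\<bar> \<le> 1" by (auto simp: f_def)
  have "good f"
  proof (rule good_cont)
    show "continuous_on UNIV f" unfolding f_def by (intro continuous_on_min continuous_on_max continuous_intros)
    show "bounded (range f)" using f(2) by (auto simp: bounded_iff)
  qed
  note S = SS_right[OF this]
  have z: "(LINT u:{p..q}|lborel. f u) = 0" if "-3 \<le> p" "q \<le> 3" for p q
  proof -
    have "(\<lambda>u. indicator {p..q} u *\<^sub>R f u) = (\<lambda>u. 0)" using that by (auto simp: f_def indicator_def)
    then show ?thesis by (simp add: set_lebesgue_integral_def)
  qed
  have SSn: "0 \<le> SS f s" for s unfolding SS_def by (intro integral_nonneg_AE) (simp add: f_def)
  have left: "SS f s = 0" if "-1 \<le> s" "s \<le> b" for s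
  proof (cases "s = -1")
    case True
    have "QC (-1) = return borel 0" using Q_kernel_aux by (simp add: is_aux_kernel_def QC_def)
    then show ?thesis using True f(1) by (simp add: SS_def integral_return) (simp add: f_def)
  next
    case False
    have s: "-1 < s" "s \<le> 1" using False that b_bounds by auto
    have "SS f s * (w s - d s) = 0"
      using SS_left[of s f] z[of "d s" "w s"] f s that d_ge[of s] w_le_1[of s] k2 by simp
    then show ?thesis using wd_pos'[of s] s by auto
  qed
  define M where "M = (SUP s\<in>{b..1}. SS f s)"
  have bdd: "bdd_above (SS f ` {b..1})" using SS_bound[OF f] by (intro bdd_aboveI[of _ 1]) (auto simp: abs_le_iff)
  have le: "SS f s \<le> M" if "s \<in> {b..1}" for s unfolding M_def using that bdd by (intro cSUP_upper)
  have M0: "0 \<le> M" using le[of b] SSn[of b] b_bounds by simp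
  have "SS f s \<le> \<rho> * M" if s: "s \<in> {b..1}" for s
  proof -
    note a = \<alpha>_bounds[of s]
    have sb: "-1 \<le> b" "b \<le> s" "s \<le> 1" using s b_bounds by auto
    have "SS f s * (w s + k) = TT f s - TT f (\<alpha> s)"
      using S[of s] z[of "\<zeta> s" "w s"] a w_le_1[of s] sb k2 by simp
    also have "\<dots> = (LINT u:{\<alpha> s..b}|lborel. SS f u) + (LINT u:{b..s}|lborel. SS f u)"
      using TT_diff[OF f, of "\<alpha> s" s] LINT_Icc_combine[OF SS_measurable[OF f(1)] SS_bound[OF f], of "\<alpha> s" b s] a sb by simp
    finally have sum: "SS f s * (w s + k) = (LINT u:{\<alpha> s..b}|lborel. SS f u) + (LINT u:{b..s}|lborel. SS f u)" .
    have "(LINT u:{\<alpha> s..b}|lborel. SS f u) = 0"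
    proof -
      have "(\<lambda>u. indicator {\<alpha> s..b} u *\<^sub>R SS f u) = (\<lambda>u. 0)" using left a sb by (auto simp: indicator_def)
      then show ?thesis by (simp add: set_lebesgue_integral_def)
    qed
    with sum have "SS f s * (w s + k) = (LINT u:{b..s}|lborel. SS f u)" by simp
    also have "\<dots> \<le> (LINT u:{b..s}|lborel. M)"
    proof (rule set_integral_mono)
      show "set_integrable lborel {b..s} (SS f)"
        by (rule set_integrable_bounded_Icc[OF SS_measurable[OF f(1)] SS_bound[OF f]])
      show "set_integrable lborel {b..s} (\<lambda>_. M)" by (rule set_integrable_bounded_Icc[where B = M]) (use M0 in auto)
    qed (use le sb in auto)
    also have "(LINT u:{b..s}|lborel. M) = (s - b) * M" using sb by (simp add: set_lebesgue_integral_def)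
    also have "\<dots> \<le> \<rho> * (w s + k) * M" using contraction[of s] sb M0 by (intro mult_right_mono) auto
    finally have "SS f s * (w s + k) \<le> (\<rho> * M) * (w s + k)" by (simp only: ac_simps)
    then show ?thesis using mult_right_le_imp_le[of "SS f s" "w s + k" "\<rho> * M"] wk_pos[of s] sb by blast
  qed
  then have "M \<le> \<rho> * M" unfolding M_def using b_bounds by (intro cSUP_least) auto
  then have "M * (1 - \<rho>) \<le> 0" by (simp only: right_diff_distrib mult_1_right mult.commute)
  then have "M \<le> 0" using \<rho>_bounds by (simp add: mult_le_0_iff)
  have "SS f (cl x) = 0"
  proof (cases "cl x \<le> b")
    case True then show ?thesis by (intro left) auto
  next
    case False
    then have "SS f (cl x) \<le> M" by (intro le) auto
    then show ?thesis using SSn[of "cl x"] \<open>M \<le> 0\<close> by linarith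
  qed
  then have "(LINT u|QC x. f u) = 0" by (simp add: SS_def QC_def)
  moreover have "integrable (QC x) f" by (rule QC_integrable[OF f])
  ultimately have "AE u in QC x. f u = 0"
    by (subst (asm) integral_nonneg_eq_0_iff_AE) (auto simp: f_def)
  then show ?thesis by eventually_elim (auto simp: f_def min_def max_def split: if_splits)
qed

lemma SS_cong:
  assumes "\<And>u. u \<in> {-3..3} \<Longrightarrow> f u = g u" "f \<in> borel_measurable borel" "g \<in> borel_measurable borel"
  shows "SS f x = SS g x"
  unfolding SS_def
proof (rule integral_cong_AE)
  show "AE u in QC x. f u = g u" using QC_support[of x] by eventually_elim (use assms in auto)
qed (use assms in \<open>auto cong: measurable_cong_sets\<close>)

text \<open>By \<open>QC_support\<close> values outside \<open>[-3, 3]\<close> do not matter, so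
  \<open>h\<close> may be replaced by any Borel function that agrees with it there.\<close>

lemma S_fun_eq:
  assumes h: "\<And>u. u \<in> {-3..3} \<Longrightarrow> h u = f u" and [measurable]: "f \<in> borel_measurable borel"
    and x: "-1 \<le> x" "x \<le> 1"
  shows "S_fun k h x = SS f x"
proof -
  have "S_fun k h x = (LINT u|QC x. indicator {-3..3} u *\<^sub>R f u)"
    unfolding S_fun_def set_lebesgue_integral_def using x h
    by (auto simp: QC_def indicator_def intro!: Bochner_Integration.integral_cong)
  also have "\<dots> = SS (\<lambda>u. indicator {-3..3} u *\<^sub>R f u) x" by (simp add: SS_def)
  also have "\<dots> = SS f x" by (rule SS_cong) auto
  finally show ?thesis .
qed

lemma theta_fun_eq:
  assumes h: "\<And>u. u \<in> {-3..3} \<Longrightarrow> h u = f u" and f: "f \<in> borel_measurable borel"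
    and x: "-1 \<le> x" "x \<le> 1"
  shows "theta_fun k h x = - TT f x"
proof -
  have "(LINT s:{-1..x}|lborel. S_fun k h s) = (LINT s:{-1..x}|lborel. SS f s)"
    using S_fun_eq[OF h f] x by (intro set_lebesgue_integral_cong) auto
  then show ?thesis by (simp add: theta_fun_def TT_def)
qed

end

section \<open>The dual inequality\<close>

lemma floor_cell:
  fixes u a l :: real
  assumes "a \<le> u" "u < a + l" "0 < l" "0 < N"
  obtains j where "j < N" "a + l * real j / real N \<le> u" "u < a + l * real (Suc j) / real N"
proof -
  define m where "m = \<lfloor>(u - a) * real N / l\<rfloor>"
  have m: "of_int m \<le> (u - a) * real N / l" "(u - a) * real N / l < of_int m + 1"
    unfolding m_def by linarith+
  have "0 \<le> (u - a) * real N / l" using assms by simp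
  then have m0: "0 \<le> m" unfolding m_def by simp
  have "(u - a) * real N < l * real N" using assms by simp
  then have "(u - a) * real N / l < real N" using assms by (simp add: divide_less_eq mult.commute)
  then have "of_int m < real N" using m(1) by linarith
  then have mN: "nat m < N" using m0 by linarith
  have j: "real (nat m) = of_int m" using m0 by simp
  show thesis
  proof (rule that[OF mN])
    show "a + l * real (nat m) / real N \<le> u" "u < a + l * real (Suc (nat m)) / real N"
      using m assms j by (auto simp: field_simps)
  qed
qed

lemma grid_modulus:
  fixes f :: "real \<Rightarrow> real"
  assumes "continuous_on {a..a + l} f" "0 < l" "0 < e"
  obtains N :: nat where "0 < N"
    "\<And>u v. u \<in> {a..a + l} \<Longrightarrow> v \<in> {a..a + l} \<Longrightarrow> \<bar>u - v\<bar> \<le> l / real N \<Longrightarrow> \<bar>f u - f v\<bar> < e"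
proof -
  have "uniformly_continuous_on {a..a + l} f"
    using assms(1) by (rule compact_uniformly_continuous) simp
  then obtain s where s: "0 < s" "\<And>u v. u \<in> {a..a + l} \<Longrightarrow> v \<in> {a..a + l} \<Longrightarrow> dist v u < s \<Longrightarrow> dist (f v) (f u) < e"
    unfolding uniformly_continuous_on_def using assms(3) by metis
  obtain N :: nat where N: "l / s < real N" using reals_Archimedean2 by blast
  have "0 < real N" using N s(1) assms(2) by (metis divide_pos_pos less_trans)
  moreover have "l / real N < s" using N s(1) \<open>0 < real N\<close> by (simp add: field_simps)
  ultimately show thesis using that[of N] s(2) by (force simp: dist_real_def)
qed

text \<open>The steps are placed at the right ends of the cells, so that on the cell starting at
  \<open>s j\<close> the sum telescopes to \<open>f (s j) - f a\<close>.\<close>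

lemma mono_step_approx:
  fixes f :: "real \<Rightarrow> real"
  assumes f: "mono f" "continuous_on {a..a + l} f" and "0 < l" "0 < e"
    and out: "\<And>u. u \<le> a \<Longrightarrow> f u = f a" "\<And>u. a + l \<le> u \<Longrightarrow> f u = f (a + l)"
  obtains N :: nat and m :: real and c r :: "nat \<Rightarrow> real" where
    "\<And>i. 0 \<le> c i" "\<And>u. \<bar>f u - m - (\<Sum>i<N. c i * indicator {r i..} u)\<bar> \<le> e"
proof -
  obtain N :: nat where N: "0 < N"
    "\<And>u v. u \<in> {a..a + l} \<Longrightarrow> v \<in> {a..a + l} \<Longrightarrow> \<bar>u - v\<bar> \<le> l / real N \<Longrightarrow> \<bar>f u - f v\<bar> < e"
    using grid_modulus[OF f(2) assms(3,4)] by blast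
  define s where "s = (\<lambda>j. a + l * real j / real N)"
  have s_mono: "s i \<le> s j \<longleftrightarrow> i \<le> j" for i j using assms N(1) by (simp add: s_def divide_le_cancel)
  have s_ends: "s 0 = a" "s N = a + l" using N(1) by (auto simp: s_def)
  have s_Suc: "s (Suc j) - s j = l / real N" for j by (simp add: s_def add_divide_distrib algebra_simps)
  define c where "c = (\<lambda>i. f (s (Suc i)) - f (s i))"
  have c0: "0 \<le> c i" for i using monoD[OF f(1)] s_mono[of i "Suc i"] by (simp add: c_def)
  have val: "(\<Sum>i<N. c i * indicator {s (Suc i)..} u) = f (s j) - f a"
    if "j \<le> N" "s j \<le> u \<or> j = 0" "u < s (Suc j) \<or> j = N" for u j
  proof -
    have "(\<Sum>i<N. c i * indicator {s (Suc i)..} u) = (\<Sum>i<N. if i < j then c i else 0)"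
    proof (rule sum.cong)
      fix i assume i: "i \<in> {..<N}"
      have "s (Suc i) \<le> u \<longleftrightarrow> i < j"
      proof
        assume "s (Suc i) \<le> u"
        then show "i < j" using that(3) i s_mono[of "Suc j" "Suc i"] by force
      next
        assume "i < j"
        then show "s (Suc i) \<le> u" using that(2) s_mono[of "Suc i" j] by auto
      qed
      then show "c i * indicator {s (Suc i)..} u = (if i < j then c i else 0)" by (simp add: indicator_def)
    qed simp
    also have "\<dots> = (\<Sum>i<j. c i)"
      using that(1) by (subst sum.mono_neutral_cong_right[of "{..<N}" "{..<j}" _ c]) auto
    also have "\<dots> = f (s j) - f a" unfolding c_def using sum_lessThan_telescope[of "\<lambda>n. f (s n)" j] s_ends by simp
    finally show ?thesis .
  qed
  have "\<bar>f u - f a - (\<Sum>i<N. c i * indicator {s (Suc i)..} u)\<bar> \<le> e" for u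
  proof -
    consider "u < a" | "a \<le> u" "u < a + l" | "a + l \<le> u" by linarith
    then show ?thesis
    proof cases
      case 1
      have "s 0 \<le> s (Suc 0)" using s_mono by blast
      then have "(\<Sum>i<N. c i * indicator {s (Suc i)..} u) = 0" using val[of 0 u] s_ends 1 by simp
      moreover have "f u = f a" using out(1)[of u] 1 by simp
      ultimately show ?thesis using assms(4) by simp
    next
      case 2
      obtain j where j: "j < N" "s j \<le> u" "u < s (Suc j)"
        using floor_cell[OF 2 assms(3) N(1)] unfolding s_def by blast
      have "s 0 \<le> s j" using s_mono by blast
      then have "\<bar>f u - f (s j)\<bar> < e" using N(2)[of u "s j"] s_Suc[of j] j 2 s_ends by auto
      then show ?thesis using val[of j u] j by simp
    next
      case 3
      then have "(\<Sum>i<N. c i * indicator {s (Suc i)..} u) = f (a + l) - f a"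
        using val[of N u] s_ends by simp
      moreover have "f u = f (a + l)" using out(2)[of u] 3 by simp
      ultimately show ?thesis using assms(4) by simp
    qed
  qed
  then show thesis by (rule that[OF c0])
qed

text \<open>The approximant is the interpolating polygon. Its kinks sit at the \<open>N - 1\<close>
  interior nodes; their weights are slope increments, nonnegative by midpoint convexity since the
  nodes are equally spaced.\<close>

lemma convex_piecewise_linear_approx:
  fixes g :: "real \<Rightarrow> real"
  assumes g: "convex_on {a..a + l} g" "continuous_on {a..a + l} g" and "0 < l" "0 < e"
  obtains N :: nat and p q :: real and c r :: "nat \<Rightarrow> real" where
    "\<And>i. i < N \<Longrightarrow> 0 \<le> c i"
    "\<And>u. u \<in> {a..a + l} \<Longrightarrow> \<bar>g u - p - q * u - (\<Sum>i<N. c i * max 0 (u - r i))\<bar> \<le> e"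
proof -
  obtain N :: nat where N: "0 < N"
    "\<And>u v. u \<in> {a..a + l} \<Longrightarrow> v \<in> {a..a + l} \<Longrightarrow> \<bar>u - v\<bar> \<le> l / real N \<Longrightarrow> \<bar>g u - g v\<bar> < e / 2"
    using grid_modulus[OF g(2) assms(3), of "e / 2"] assms(4) by auto
  define s where "s = (\<lambda>j. a + l * real j / real N)"
  have s_mono: "s i \<le> s j \<longleftrightarrow> i \<le> j" for i j using assms N(1) by (simp add: s_def divide_le_cancel)
  have s_ends: "s 0 = a" "s N = a + l" using N(1) by (auto simp: s_def)
  have s_Suc: "s (Suc j) = s j + l / real N" for j by (simp add: s_def add_divide_distrib algebra_simps)
  have l: "0 < l / real N" using assms(3) N(1) by simp
  define m where "m = (\<lambda>j. (g (s (Suc j)) - g (s j)) / (l / real N))"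
  have m: "g (s (Suc j)) = g (s j) + m j * (s (Suc j) - s j)" for j
    using l by (simp add: m_def s_Suc)
  define c where "c = (\<lambda>i. m (Suc i) - m i)"
  have s_in: "s j \<in> {a..a + l}" if "j \<le> N" for j using s_mono[of 0 j] s_mono[of j N] s_ends that by auto
  have c0: "0 \<le> c i" if "i < N - 1" for i
  proof -
    have i: "s i \<in> {a..a + l}" "s (Suc (Suc i)) \<in> {a..a + l}" using s_in[of i] s_in[of "Suc (Suc i)"] that by auto
    have "g ((1 - 1 / 2) *\<^sub>R s i + (1 / 2) *\<^sub>R s (Suc (Suc i))) \<le> (1 - 1 / 2) * g (s i) + (1 / 2) * g (s (Suc (Suc i)))"
      using i by (intro convex_onD[OF g(1)]) auto
    moreover have "(1 - 1 / 2) *\<^sub>R s i + (1 / 2) *\<^sub>R s (Suc (Suc i)) = s (Suc i)" using l by (simp add: s_Suc field_simps)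
    ultimately have "2 * g (s (Suc i)) \<le> g (s i) + g (s (Suc (Suc i)))" by simp
    then have "g (s (Suc i)) - g (s i) \<le> g (s (Suc (Suc i))) - g (s (Suc i))" by simp
    then have "m i \<le> m (Suc i)" unfolding m_def using l by (intro divide_right_mono) auto
    then show ?thesis by (simp add: c_def)
  qed
  have val: "g a + m 0 * (u - a) + (\<Sum>i<j. c i * (u - s (Suc i))) = g (s j) + m j * (u - s j)" for u j
  proof (induction j)
    case 0 then show ?case by (simp add: s_ends)
  next
    case (Suc j) then show ?case using m[of j] by (simp add: c_def algebra_simps)
  qed
  have "\<bar>g u - (g a - m 0 * a) - m 0 * u - (\<Sum>i<N - 1. c i * max 0 (u - s (Suc i)))\<bar> \<le> e"
    if u: "u \<in> {a..a + l}" for u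
  proof -
    obtain j where j: "j < N" "s j \<le> u" "u \<le> s (Suc j)"
    proof (cases "u = a + l")
      case True
      have "s (N - 1) \<le> s N" using s_mono by simp
      then show thesis using True s_ends N(1) by (intro that[of "N - 1"]) auto
    next
      case False
      then have "a \<le> u" "u < a + l" using u by auto
      from floor_cell[OF this assms(3) N(1)] obtain j where "j < N" "s j \<le> u" "u < s (Suc j)"
        unfolding s_def by blast
      then show thesis by (intro that[of j]) auto
    qed
    have "(\<Sum>i<N - 1. c i * max 0 (u - s (Suc i))) = (\<Sum>i<N - 1. if i < j then c i * (u - s (Suc i)) else 0)"
    proof (rule sum.cong)
      fix i
      show "c i * max 0 (u - s (Suc i)) = (if i < j then c i * (u - s (Suc i)) else 0)"
      proof (cases "i < j")
        case True then show ?thesis using s_mono[of "Suc i" j] j by auto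
      next
        case False then show ?thesis using s_mono[of "Suc j" "Suc i"] j by auto
      qed
    qed simp
    also have "\<dots> = (\<Sum>i<j. c i * (u - s (Suc i)))"
      using j(1) by (subst sum.mono_neutral_cong_right[of "{..<N - 1}" "{..<j}" _ "\<lambda>i. c i * (u - s (Suc i))"]) auto
    finally have eq: "g u - (g a - m 0 * a) - m 0 * u - (\<Sum>i<N - 1. c i * max 0 (u - s (Suc i)))
        = g u - g (s j) - m j * (u - s j)" using val[of u j] by (simp add: algebra_simps)
    have "\<bar>g u - g (s j)\<bar> < e / 2"
      using N(2)[of u "s j"] u s_in[of j] j s_Suc[of j] by auto
    moreover have "\<bar>m j * (u - s j)\<bar> \<le> e / 2"
    proof -
      have "\<bar>m j * (u - s j)\<bar> \<le> \<bar>m j\<bar> * (l / real N)"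
        using mult_left_mono[of "u - s j" "l / real N" "\<bar>m j\<bar>"] j s_Suc[of j] by (simp add: abs_mult)
      also have "\<dots> = \<bar>m j * (l / real N)\<bar>" using l assms(3) by (simp add: abs_mult)
      also have "\<dots> = \<bar>g (s (Suc j)) - g (s j)\<bar>" using m[of j] s_Suc[of j] by simp
      also have "\<dots> \<le> e / 2" using N(2)[of "s (Suc j)" "s j"] s_in[of "Suc j"] s_in[of j] j(1) s_Suc[of j] l by auto
      finally show ?thesis .
    qed
    ultimately show ?thesis unfolding eq by linarith
  qed
  note approx = this
  show thesis by (rule that[OF c0 approx])
qed

context curtain begin

abbreviation "tail r \<equiv> indicator {r..} :: real \<Rightarrow> real"

lemma tail_good: "tail r \<in> borel_measurable borel" "\<And>u. \<bar>tail r u\<bar> \<le> 1"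
  by auto

lemma TT_t_continuous:
  assumes "f \<in> borel_measurable borel" "\<And>u. \<bar>f u\<bar> \<le> B" "0 \<le> B"
  shows "continuous_on {-2..2} (\<lambda>v. TT f (t v))"
  by (rule continuous_on_compose2[OF TT_continuous[OF assms] t_continuous]) (use t_range in auto)

text \<open>Normalised at -2 instead of -1; the constant cancels in every difference of
  \<open>Htail\<close> at the same \<open>x\<close>.\<close>

definition psi_tail :: "real \<Rightarrow> real \<Rightarrow> real" where
  "psi_tail r v = integral {-2..v} (\<lambda>v. max 0 (v - t v - r) + TT (tail r) (t v))"

lemma psi_tail_deriv:
  assumes "-2 \<le> v" "v \<le> 2"
  shows "(psi_tail r has_real_derivative max 0 (v - t v - r) + TT (tail r) (t v)) (at v within {-2..2})"
  unfolding psi_tail_def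
proof (rule integral_has_real_derivative)
  show "continuous_on {-2..2} (\<lambda>v. max 0 (v - t v - r) + TT (tail r) (t v))"
    by (intro continuous_intros continuous_on_max TT_t_continuous[OF tail_good] t_continuous) simp
qed (use assms in auto)

text \<open>The cost \<open>u \<mapsto> max 0 (u - r)\<^sup>2 / 2\<close> has the indicator of \<open>[r, \<infinity>)\<close> as second derivative.\<close>

definition Htail :: "real \<Rightarrow> real \<Rightarrow> real \<Rightarrow> real" where
  "Htail r x v = (max 0 (v - x - r))\<^sup>2 / 2 - psi_tail r v + TT (tail r) x * (v - x)"

lemma tail_dual:
  shows "\<And>x. -1 \<le> x \<Longrightarrow> x \<le> 1 \<Longrightarrow> Htail r x (D x) = Htail r x (U x)"
    and "\<And>x v. -1 \<le> x \<Longrightarrow> x \<le> 1 \<Longrightarrow> -2 \<le> v \<Longrightarrow> v \<le> 2 \<Longrightarrow> x - k \<le> v \<Longrightarrow> Htail r x (U x) \<le> Htail r x v"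
proof -
  interpret level k r "SS (tail r)" "TT (tail r)" "psi_tail r"
    by (rule level_tail) (rule psi_tail_deriv)
  have H: "H x v = Htail r x v" for x v by (simp add: H_def Htail_def hr_def)
  show "\<And>x. -1 \<le> x \<Longrightarrow> x \<le> 1 \<Longrightarrow> Htail r x (D x) = Htail r x (U x)"
    using G_D by (simp add: G_def H)
  show "\<And>x v. -1 \<le> x \<Longrightarrow> x \<le> 1 \<Longrightarrow> -2 \<le> v \<Longrightarrow> v \<le> 2 \<Longrightarrow> x - k \<le> v \<Longrightarrow> Htail r x (U x) \<le> Htail r x v"
    using G_nonneg by (simp add: G_def H)
qed

lemma LINT_step:
  fixes f :: "real \<Rightarrow> real" and g :: "nat \<Rightarrow> real \<Rightarrow> real"
  assumes f: "f \<in> borel_measurable borel" "\<And>u. \<bar>f u\<bar> \<le> B"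
    and g: "\<And>i. g i \<in> borel_measurable borel" "\<And>i u. \<bar>g i u\<bar> \<le> C" and "p \<le> q"
  shows "(LINT u:{p..q}|lborel. f u - m - (\<Sum>i<N. c i * g i u))
    = (LINT u:{p..q}|lborel. f u) - m * (q - p) - (\<Sum>i<N. c i * (LINT u:{p..q}|lborel. g i u))"
proof -
  have i: "set_integrable lborel {p..q} f" "set_integrable lborel {p..q} (\<lambda>_. m)"
    "set_integrable lborel {p..q} (g j)" for j
    by (rule set_integrable_bounded_Icc[where B = B] set_integrable_bounded_Icc[where B = "\<bar>m\<bar>"]
      set_integrable_bounded_Icc[where B = C]; use f g in simp)+
  have "(LINT u:{p..q}|lborel. f u - m - (\<Sum>i<N. c i * g i u)) = (LINT u|lborel.
      indicator {p..q} u *\<^sub>R f u - indicator {p..q} u *\<^sub>R m - (\<Sum>i<N. c i * (indicator {p..q} u *\<^sub>R g i u)))"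
    unfolding set_lebesgue_integral_def
    by (rule Bochner_Integration.integral_cong) (auto simp: indicator_def)
  also have "\<dots> = (LINT u:{p..q}|lborel. f u) - (LINT u:{p..q}|lborel. m)
      - (\<Sum>i<N. c i * (LINT u:{p..q}|lborel. g i u))"
    using i unfolding set_integrable_def set_lebesgue_integral_def by (simp add: integral_sum)
  finally show ?thesis using assms(5) by (simp add: set_lebesgue_integral_def)
qed

lemma SS_step:
  fixes f :: "real \<Rightarrow> real" and g :: "nat \<Rightarrow> real \<Rightarrow> real"
  assumes f: "f \<in> borel_measurable borel" "\<And>u. \<bar>f u\<bar> \<le> B"
    and g: "\<And>i. g i \<in> borel_measurable borel" "\<And>i u. \<bar>g i u\<bar> \<le> C"
  shows "SS (\<lambda>u. f u - m - (\<Sum>i<N. c i * g i u)) x = SS f x - m - (\<Sum>i<N. c i * SS (g i) x)"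
proof -
  have "integrable (QC x) (\<lambda>_. m)" by (rule QC_integrable[where B = "\<bar>m\<bar>"]) auto
  then show ?thesis
    using QC_integrable[OF f, of x] QC_integrable[OF g, of x] prob_space.prob_space[OF QC_prob, of x]
    unfolding SS_def by (simp add: integral_sum)
qed

lemma TT_step:
  fixes f :: "real \<Rightarrow> real" and g :: "nat \<Rightarrow> real \<Rightarrow> real"
  assumes f: "f \<in> borel_measurable borel" "\<And>u. \<bar>f u\<bar> \<le> B"
    and g: "\<And>i. g i \<in> borel_measurable borel" "\<And>i u. \<bar>g i u\<bar> \<le> C" and x: "-1 \<le> x"
  shows "TT (\<lambda>u. f u - m - (\<Sum>i<N. c i * g i u)) x
    = TT f x - m * (x + 1) - (\<Sum>i<N. c i * TT (g i) x)"
  unfolding TT_def SS_step[OF f g]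
  by (subst LINT_step[where f = "SS f" and B = B and g = "\<lambda>i. SS (g i)" and C = C])
    (use f g x SS_bound[OF f] SS_bound[OF g] SS_measurable in auto)

lemma dual_inequality:
  fixes f h h1 psi :: "real \<Rightarrow> real"
  assumes f: "mono f" "continuous_on UNIV f" "\<And>u. u \<le> -3 \<Longrightarrow> f u = f (-3)" "\<And>u. 3 \<le> u \<Longrightarrow> f u = f 3"
    and h: "\<And>u. u \<in> {-3..3} \<Longrightarrow> (h has_real_derivative h1 u) (at u within {-3..3})"
    and h1: "\<And>u. u \<in> {-3..3} \<Longrightarrow> (h1 has_real_derivative f u) (at u within {-3..3})"
    and psi: "\<And>v. v \<in> {-2..2} \<Longrightarrow> (psi has_real_derivative h1 (v - t v) + TT f (t v)) (at v within {-2..2})"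
    and x: "-1 \<le> x" "x \<le> 1"
  defines "H \<equiv> (\<lambda>v. h (v - x) - psi v + TT f x * (v - x))"
  shows "H (D x) = H (U x)" "\<And>v. -2 \<le> v \<Longrightarrow> v \<le> 2 \<Longrightarrow> x - k \<le> v \<Longrightarrow> H (U x) \<le> H v"
proof -
  have fm: "f \<in> borel_measurable borel" using f(2) by (rule borel_measurable_continuous_onI)
  define B where "B = max \<bar>f (-3)\<bar> \<bar>f 3\<bar>"
  have fB: "\<bar>f u\<bar> \<le> B" for u
  proof -
    have "f (-3) \<le> f u" using f(3)[of u] monoD[OF f(1), of "-3" u] by (cases "u \<le> -3") auto
    moreover have "f u \<le> f 3" using f(4)[of u] monoD[OF f(1), of u 3] by (cases "3 \<le> u") auto
    ultimately show ?thesis unfolding B_def by linarith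
  qed
  have approx: "\<exists>(N::nat) c r. (\<forall>i. 0 \<le> c i) \<and> (\<forall>v\<in>{-2..2}.
      \<bar>(H v - H (U x)) - (\<Sum>i<N. c i * (Htail (r i) x v - Htail (r i) x (U x)))\<bar> \<le> e)" if "0 < e" for e
  proof -
    \<comment> \<open>The error has \<open>v\<close>-derivative at most \<open>4 * e'\<close>,
      accumulated over a distance of at most 4.\<close>
    define e' where "e' = e / 16"
    have e': "0 < e'" using \<open>0 < e\<close> by (simp add: e'_def)
    obtain N :: nat and m :: real and c r :: "nat \<Rightarrow> real" where c: "\<And>i. 0 \<le> c i"
      and cr: "\<And>u. \<bar>f u - m - (\<Sum>i<N. c i * tail (r i) u)\<bar> \<le> e'"
    proof (rule mono_step_approx[of f "-3" 6 e'])
      show "continuous_on {-3..-3 + 6} f" by (rule continuous_on_subset[OF f(2) subset_UNIV])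
      show "f u = f (-3)" if "u \<le> -3" for u using f(3) that .
      show "f u = f (-3 + 6)" if "-3 + 6 \<le> u" for u using f(4)[of u] that by simp
      fix N m and c r :: "nat \<Rightarrow> real"
      assume "\<And>i. 0 \<le> c i" "\<And>u. \<bar>f u - m - (\<Sum>i<N. c i * tail (r i) u)\<bar> \<le> e'"
      then show thesis by (rule that)
    qed (use f(1) e' in simp_all)
    define g where "g = (\<lambda>u. f u - m - (\<Sum>i<N. c i * tail (r i) u))"
    have g: "g \<in> borel_measurable borel" "\<And>u. \<bar>g u\<bar> \<le> e'"
      unfolding g_def using fm by measurable (rule cr)
    define k1 where "k1 = (\<lambda>u. h1 u - m * u - (\<Sum>i<N. c i * max 0 (u - r i)))"
    have k1: "\<bar>k1 q - k1 p\<bar> \<le> e' * \<bar>q - p\<bar>" if "p \<in> {-3..3}" "q \<in> {-3..3}" for p q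
    proof -
      have *: "\<bar>k1 q - k1 p\<bar> \<le> e' * (q - p)" if "-3 \<le> p" "p \<le> q" "q \<le> 3" for p q
      proof -
        have "(f has_integral h1 q - h1 p) {p..q}"
        proof (rule fundamental_theorem_of_calculus)
          fix u assume "u \<in> {p..q}"
          then have "(h1 has_real_derivative f u) (at u within {p..q})"
            using that by (intro DERIV_subset[OF h1]) auto
          then show "(h1 has_vector_derivative f u) (at u within {p..q})"
            by (simp add: has_real_derivative_iff_has_vector_derivative)
        qed (rule that)
        then have "(LINT u:{p..q}|lborel. f u) = h1 q - h1 p"
          using LINT_Icc_eq_integral(2)[OF fm fB] by (simp add: integral_unique)
        then have "(LINT u:{p..q}|lborel. g u) = k1 q - k1 p"
          unfolding g_def k1_def using LINT_step[where g = "\<lambda>i. tail (r i)" and C = 1, OF fm fB tail_good that(2)]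
          by (simp add: LINT_Icc_tail[OF that(2)] sum_subtractf algebra_simps)
        then show ?thesis using LINT_Icc_bound[OF g that(2)] by simp
      qed
      show ?thesis using *[of p q] *[of q p] that by (cases "p \<le> q") (auto simp: abs_minus_commute)
    qed
    define F where "F = (\<lambda>v. H v - (\<Sum>i<N. c i * Htail (r i) x v))"
    have Fd: "(F has_real_derivative k1 (v - x) - k1 (v - t v) + (TT g x - TT g (t v))) (at v within {-2..2})"
      if v: "v \<in> {-2..2}" for v
    proof -
      have tv: "-1 \<le> t v" using t_range[of v] v by auto
      have "((\<lambda>v. h (v - x)) has_real_derivative h1 (v - x) * 1) (at v within {-2..2})"
      proof (rule DERIV_image_chain[unfolded o_def, where f = h and g = "\<lambda>v. v - x"])
        show "(h has_real_derivative h1 (v - x)) (at (v - x) within (\<lambda>v. v - x) ` {-2..2})"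
          by (rule DERIV_subset[OF h]) (use v x in auto)
      qed (auto intro!: derivative_eq_intros)
      then have 1: "(H has_real_derivative h1 (v - x) * 1 - (h1 (v - t v) + TT f (t v)) + TT f x * 1) (at v within {-2..2})"
        unfolding H_def by (intro DERIV_add DERIV_diff psi v DERIV_cmult) (auto intro!: derivative_eq_intros)
      have 2: "(Htail (r i) x has_real_derivative max 0 (v - x - r i) * 1 - (max 0 (v - t v - r i) + TT (tail (r i)) (t v))
          + TT (tail (r i)) x * 1) (at v within {-2..2})" for i
      proof -
        have "((\<lambda>v. (max 0 (v - x - r i))\<^sup>2 / 2) has_real_derivative max 0 (v - x - r i) * 1) (at v within {-2..2})"
          by (rule DERIV_chain2[OF half_square_pos_part_deriv]) (auto intro!: derivative_eq_intros)
        then show ?thesis unfolding Htail_def[abs_def]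
          using v by (intro DERIV_add DERIV_diff psi_tail_deriv DERIV_cmult) (auto intro!: derivative_eq_intros)
      qed
      have "(F has_real_derivative (h1 (v - x) * 1 - (h1 (v - t v) + TT f (t v)) + TT f x * 1) -
          (\<Sum>i<N. c i * (max 0 (v - x - r i) * 1 - (max 0 (v - t v - r i) + TT (tail (r i)) (t v))
          + TT (tail (r i)) x * 1))) (at v within {-2..2})"
        unfolding F_def by (intro DERIV_diff DERIV_sum DERIV_cmult 1 2)
      \<comment> \<open>The constant \<open>m\<close> cancels: it enters with
        \<open>m * ((v - x) - (v - t v))\<close> through \<open>k1\<close> and with
        \<open>m * (x - t v)\<close> through \<open>TT\<close>. A quadratic cost leaves no gap in a
        martingale problem, so \<open>m\<close> may have either sign.\<close>
      moreover have "(h1 (v - x) * 1 - (h1 (v - t v) + TT f (t v)) + TT f x * 1) -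
          (\<Sum>i<N. c i * (max 0 (v - x - r i) * 1 - (max 0 (v - t v - r i) + TT (tail (r i)) (t v))
          + TT (tail (r i)) x * 1)) = k1 (v - x) - k1 (v - t v) + (TT g x - TT g (t v))"
        unfolding g_def k1_def TT_step[where g = "\<lambda>i. tail (r i)" and C = 1, OF fm fB tail_good x(1)]
          TT_step[where g = "\<lambda>i. tail (r i)" and C = 1, OF fm fB tail_good tv]
        by (simp add: algebra_simps sum.distrib sum_subtractf)
      ultimately show ?thesis by simp
    qed
    have "\<bar>F v - F (U x)\<bar> \<le> e" if v: "v \<in> {-2..2}" for v
    proof -
      have Ux: "U x \<in> {-2..2}" using U_range[OF x] by auto
      have "norm (F v - F (U x)) \<le> 4 * e' * norm (v - U x)"
      proof (rule field_differentiable_bound[OF _ Fd])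
        fix s assume s: "s \<in> {-2..2::real}"
        note ts = t_range[of s]
        have "\<bar>k1 (s - x) - k1 (s - t s)\<bar> \<le> e' * \<bar>(s - x) - (s - t s)\<bar>"
          using s ts x by (intro k1) auto
        moreover have "\<bar>TT g x - TT g (t s)\<bar> \<le> e' * \<bar>x - t s\<bar>"
          using s ts x by (intro TT_lipschitz[OF g]) auto
        moreover have "e' * \<bar>x - t s\<bar> \<le> e' * 2" using s ts x e' by (intro mult_left_mono) auto
        moreover have "\<bar>(s - x) - (s - t s)\<bar> = \<bar>x - t s\<bar>" by simp
        ultimately show "norm (k1 (s - x) - k1 (s - t s) + (TT g x - TT g (t s))) \<le> 4 * e'"
          by (simp only: real_norm_def)
      qed (use v Ux in auto)
      also have "\<dots> \<le> 4 * e' * 4" using v Ux e' by (intro mult_left_mono) auto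
      finally show ?thesis by (simp add: e'_def)
    qed
    then have "\<forall>v\<in>{-2..2}. \<bar>(H v - H (U x)) - (\<Sum>i<N. c i * (Htail (r i) x v - Htail (r i) x (U x)))\<bar> \<le> e"
      by (simp add: F_def right_diff_distrib sum_subtractf algebra_simps)
    note appr = this
    show ?thesis
    proof (rule exI[of _ N], rule exI[of _ c], rule exI[of _ r], intro conjI allI)
      show "0 \<le> c i" for i by (rule c)
    qed (rule appr)
  qed
  show "H (U x) \<le> H v" if v: "-2 \<le> v" "v \<le> 2" "x - k \<le> v" for v
  proof (rule field_le_epsilon)
    fix e :: real assume "0 < e"
    from approx[OF this] obtain N :: nat and c r where c: "\<forall>i. 0 \<le> (c i :: real)" and
      "\<forall>v\<in>{-2..2}. \<bar>(H v - H (U x)) - (\<Sum>i<N. c i * (Htail (r i) x v - Htail (r i) x (U x)))\<bar> \<le> e"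
      by blast
    then have *: "\<bar>(H v - H (U x)) - (\<Sum>i<N. c i * (Htail (r i) x v - Htail (r i) x (U x)))\<bar> \<le> e"
      using v by simp
    have "0 \<le> (\<Sum>i<N. c i * (Htail (r i) x v - Htail (r i) x (U x)))"
      using c tail_dual(2)[OF x v] by (intro sum_nonneg mult_nonneg_nonneg) auto
    then show "H (U x) \<le> H v + e" using * by linarith
  qed
  have "\<bar>H (D x) - H (U x)\<bar> \<le> 0 + e" if "0 < e" for e
  proof -
    from approx[OF that] obtain N :: nat and c r where
      "\<forall>v\<in>{-2..2}. \<bar>(H v - H (U x)) - (\<Sum>i<N. (c i :: real) * (Htail (r i) x v - Htail (r i) x (U x)))\<bar> \<le> e"
      by blast
    then have "\<bar>(H (D x) - H (U x)) - (\<Sum>i<N. c i * (Htail (r i) x (D x) - Htail (r i) x (U x)))\<bar> \<le> e"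
      using D_range[OF x] k1 by simp
    then show ?thesis using tail_dual(1)[OF x] by simp
  qed
  then have "\<bar>H (D x) - H (U x)\<bar> \<le> 0" by (rule field_le_epsilon)
  then show "H (D x) = H (U x)" by simp
qed

lemma dual_functions:
  fixes h h1 h2 :: "real \<Rightarrow> real"
  assumes h: "\<And>u. u \<in> {-3..3} \<Longrightarrow> (h has_real_derivative h1 u) (at u within {-3..3})"
    and h1: "\<And>u. u \<in> {-3..3} \<Longrightarrow> (h1 has_real_derivative h2 u) (at u within {-3..3})"
    and h2: "continuous_on {-3..3} h2" "\<And>u v. -3 \<le> u \<Longrightarrow> u \<le> v \<Longrightarrow> v \<le> 3 \<Longrightarrow> h2 u \<le> h2 v"
    and x: "-1 \<le> x" "x \<le> 1"
  defines "E \<equiv> (\<lambda>v. phi_fun k h h1 h2 x + psi_fun k h1 h2 v + theta_fun k h2 x * (v - x))"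
  shows "E (D x) = h (D x - x)" "E (U x) = h (U x - x)"
    "\<And>v. -2 \<le> v \<Longrightarrow> v \<le> 2 \<Longrightarrow> x - k \<le> v \<Longrightarrow> E v \<le> h (v - x)"
proof -
  \<comment> \<open>Constant continuation of \<open>h2\<close> gives a bounded, continuous and
    monotone function on the line.\<close>
  define f where "f = (\<lambda>u. h2 (max (-3) (min 3 u)))"
  have f: "mono f" "continuous_on UNIV f" "\<And>u. u \<le> -3 \<Longrightarrow> f u = f (-3)" "\<And>u. 3 \<le> u \<Longrightarrow> f u = f 3"
  proof -
    show "mono f" unfolding f_def by (intro monoI h2(2)) (auto simp: max_def min_def)
    show "continuous_on UNIV f" unfolding f_def
      by (rule continuous_on_compose2[OF h2(1)]) (auto intro!: continuous_on_max continuous_on_min continuous_intros)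
  qed (auto simp: f_def)
  have hf: "h2 u = f u" if "u \<in> {-3..3}" for u using that by (auto simp: f_def)
  have fm: "f \<in> borel_measurable borel" using f(2) by (rule borel_measurable_continuous_onI)
  have "compact (f ` {-3..3})" by (intro compact_continuous_image continuous_on_subset[OF f(2)]) auto
  then have "bounded (f ` {-3..3})" by (rule compact_imp_bounded)
  then obtain B where B: "\<And>u. u \<in> {-3..3} \<Longrightarrow> \<bar>f u\<bar> \<le> B"
    unfolding bounded_iff real_norm_def by blast
  have fB: "\<bar>f u\<bar> \<le> B" for u
    using B[of "max (-3) (min 3 u)"] by (simp add: f_def)
  have B0: "0 \<le> B" using fB[of 0] by linarith
  have th: "theta_fun k h2 s = - TT f s" if "-1 \<le> s" "s \<le> 1" for s
    by (rule theta_fun_eq[OF hf fm that]) auto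
  have pd: "psi_deriv k h1 h2 v = h1 (v - t v) + TT f (t v)" if "v \<in> {-2..2}" for v
    using th[of "t v"] t_range[of v] that by (simp add: psi_deriv_def)
  have "continuous_on {-2..2} (\<lambda>v. h1 (v - t v) + TT f (t v))"
  proof (intro continuous_on_add TT_t_continuous[OF fm fB B0])
    have "continuous_on {-3..3} h1" using h1 by (rule DERIV_continuous_on)
    then show "continuous_on {-2..2} (\<lambda>v. h1 (v - t v))"
      by (rule continuous_on_compose2) (use t_range in \<open>force intro!: continuous_intros t_continuous\<close>)+
  qed
  then have c: "continuous_on {-2..2} (psi_deriv k h1 h2)"
    by (rule continuous_on_eq) (simp add: pd)
  define p where "p = (\<lambda>v. integral {-2..v} (psi_deriv k h1 h2))"
  have "(p has_real_derivative psi_deriv k h1 h2 v) (at v within {-2..2})" if "v \<in> {-2..2}" for v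
    unfolding p_def by (rule integral_has_real_derivative[OF c that])
  then have "\<exists>\<psi>. \<psi> (-1) = 0 \<and> (\<forall>y\<in>{-2..2}. (\<psi> has_real_derivative psi_deriv k h1 h2 y) (at y within {-2..2}))
     \<and> continuous_on {-2..2} (psi_deriv k h1 h2)"
    using c by (intro exI[of _ "\<lambda>v. p v - p (-1)"]) (auto intro!: derivative_eq_intros)
  from someI_ex[OF this] have psi':
    "\<forall>v\<in>{-2..2}. (psi_fun k h1 h2 has_real_derivative psi_deriv k h1 h2 v) (at v within {-2..2})"
    unfolding psi_fun_def by blast
  have "(psi_fun k h1 h2 has_real_derivative h1 (v - t v) + TT f (t v)) (at v within {-2..2})"
    if "v \<in> {-2..2}" for v using bspec[OF psi' that] unfolding pd[OF that] .
  note psi = this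
  have "\<And>u. u \<in> {-3..3} \<Longrightarrow> (h1 has_real_derivative f u) (at u within {-3..3})" using h1 hf by simp
  note dual = dual_inequality[OF f h this psi x]
  show "E (D x) = h (D x - x)" "E (U x) = h (U x - x)"
    using dual(1) th[OF x] by (simp_all add: E_def phi_fun_def w_of_def algebra_simps)
  show "E v \<le> h (v - x)" if "-2 \<le> v" "v \<le> 2" "x - k \<le> v" for v
    using dual(2)[of v] that th[OF x] by (simp add: E_def phi_fun_def w_of_def algebra_simps)
qed

end

section \<open>The coupling\<close>

lemma borel_pair: "borel = (borel \<Otimes>\<^sub>M borel :: (real \<times> real) measure)"
  by (simp add: borel_prod)

lemma fst_snd_borel [measurable]:
  "fst \<in> borel_measurable (borel :: (real \<times> real) measure)" "snd \<in> borel_measurable (borel :: (real \<times> real) measure)"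
  by (intro borel_measurable_continuous_onI continuous_intros)+

lemma Pair_borel [measurable]: "Pair x \<in> borel \<rightarrow>\<^sub>M (borel :: (real \<times> real) measure)"
  by (intro borel_measurable_continuous_onI continuous_intros)

lemma prob_algebra_borelD:
  assumes "\<kappa> \<in> borel \<rightarrow>\<^sub>M prob_algebra (borel :: real measure)"
  shows "prob_space (\<kappa> x)" "sets (\<kappa> x) = sets borel" "space (\<kappa> x) = UNIV"
proof -
  show "prob_space (\<kappa> x)" "sets (\<kappa> x) = sets borel"
    using measurable_space[OF assms, of x] by (auto simp: space_prob_algebra)
  then show "space (\<kappa> x) = UNIV" by (metis sets_eq_imp_space_eq space_borel)
qed

lemma fiber_measurable:
  assumes [measurable]: "\<kappa> \<in> borel \<rightarrow>\<^sub>M prob_algebra (borel :: real measure)"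
  shows "(\<lambda>x :: real. \<kappa> x \<bind> (\<lambda>y. return borel (x, y))) \<in> borel \<rightarrow>\<^sub>M prob_algebra borel"
proof (rule measurable_bind_prob_space2[OF assms])
  have "return borel \<in> borel \<Otimes>\<^sub>M borel \<rightarrow>\<^sub>M prob_algebra (borel :: (real \<times> real) measure)"
    unfolding borel_pair by (rule measurable_return_prob_space)
  then show "(\<lambda>(x :: real, y :: real). return borel (x, y)) \<in> borel \<Otimes>\<^sub>M borel \<rightarrow>\<^sub>M prob_algebra borel"
    by (simp add: case_prod_unfold)
qed

lemma fiber_eq:
  assumes "\<kappa> \<in> borel \<rightarrow>\<^sub>M prob_algebra (borel :: real measure)"
  shows "\<kappa> x \<bind> (\<lambda>y. return borel (x :: real, y)) = distr (\<kappa> x) borel (Pair x)"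
  by (rule bind_return_distr') (auto simp: prob_algebra_borelD[OF assms] cong: measurable_cong_sets)

context
  fixes m :: "real measure" and \<kappa> :: "real \<Rightarrow> real measure"
  assumes m: "prob_space m" "sets m = sets borel"
    and kernel: "\<kappa> \<in> borel \<rightarrow>\<^sub>M prob_algebra borel"
begin

lemma fiber_measurable': "(\<lambda>x. \<kappa> x \<bind> (\<lambda>y. return borel (x, y))) \<in> m \<rightarrow>\<^sub>M subprob_algebra borel"
  using measurable_prob_algebraD[OF fiber_measurable[OF kernel]] m(2) by (simp cong: measurable_cong_sets)

lemma joint_space_nonempty: "space m \<noteq> {}"
  using m(1) by (rule prob_space.not_empty)

lemma sets_joint_law: "sets (joint_law m \<kappa>) = sets borel"
  unfolding joint_law_def
  by (rule sets_bind) (auto simp: fiber_eq[OF kernel] joint_space_nonempty)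

lemma prob_space_joint_law: "prob_space (joint_law m \<kappa>)"
  unfolding joint_law_def
proof (rule prob_space.prob_space_bind[OF m(1) _ fiber_measurable'])
  have "prob_space (distr (\<kappa> x) borel (Pair x))" for x
    by (rule prob_space.prob_space_distr[OF prob_algebra_borelD(1)[OF kernel]])
      (simp add: prob_algebra_borelD(2)[OF kernel] cong: measurable_cong_sets)
  then show "AE x in m. prob_space (\<kappa> x \<bind> (\<lambda>y. return borel (x, y)))"
    by (simp add: fiber_eq[OF kernel])
qed

lemma AE_joint_law:
  assumes P: "Measurable.pred borel P"
  shows "(AE p in joint_law m \<kappa>. P p) \<longleftrightarrow> (AE x in m. AE y in \<kappa> x. P (x, y))"
proof -
  have *: "(AE p in distr (\<kappa> x) borel (Pair x). P p) \<longleftrightarrow> (AE y in \<kappa> x. P (x, y))" for x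
    by (rule AE_distr_iff) (use P in \<open>auto simp: prob_algebra_borelD(2)[OF kernel] pred_def cong: measurable_cong_sets\<close>)
  show ?thesis unfolding joint_law_def AE_bind[OF fiber_measurable' P] unfolding fiber_eq[OF kernel] * ..
qed

lemma distr_joint_law_fst: "distr (joint_law m \<kappa>) borel fst = m"
proof -
  have "distr (distr (\<kappa> x) borel (Pair x)) borel fst = return borel x" for x
  proof -
    have "distr (distr (\<kappa> x) borel (Pair x)) borel fst = distr (\<kappa> x) borel (\<lambda>_. x)"
      by (subst distr_distr) (auto simp: prob_algebra_borelD(2)[OF kernel] o_def cong: measurable_cong_sets)
    also have "\<dots> = return borel x"
      by (rule prob_space.distr_const[OF prob_algebra_borelD(1)[OF kernel]]) simp
    finally show ?thesis .
  qed
  then have "distr (joint_law m \<kappa>) borel fst = m \<bind> (\<lambda>x. return borel x)"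
    unfolding joint_law_def distr_bind[OF fiber_measurable' joint_space_nonempty fst_snd_borel(1)]
    by (simp add: fiber_eq[OF kernel])
  also have "\<dots> = m" by (rule bind_return'') (rule m(2))
  finally show ?thesis .
qed

lemma integral_joint_law:
  fixes f :: "real \<times> real \<Rightarrow> real"
  assumes [measurable]: "f \<in> borel_measurable borel" and B: "\<And>p. \<bar>f p\<bar> \<le> B"
  shows "(LINT p|joint_law m \<kappa>. f p) = (LINT x|m. LINT y|\<kappa> x. f (x, y))"
    and "integrable (joint_law m \<kappa>) f" "\<And>x. integrable (\<kappa> x) (\<lambda>y. f (x, y))"
    "integrable m (\<lambda>x. LINT y|\<kappa> x. f (x, y))"
proof -
  note pk = prob_algebra_borelD[OF kernel]
  have fin: "finite_measure m" "finite_measure (joint_law m \<kappa>)" "finite_measure (\<kappa> x)" for x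
    using m(1) prob_space_joint_law pk(1) by (auto intro: prob_space.finite_measure)
  have int_g: "integrable (joint_law m \<kappa>) g" if "g \<in> borel_measurable borel" "\<And>p. \<bar>g p\<bar> \<le> C"
    for g :: "real \<times> real \<Rightarrow> real" and C
    using that fin(2) by (intro finite_measure.integrable_const_bound[of _ _ C] AE_I2)
      (auto simp: sets_joint_law cong: measurable_cong_sets)
  have int_k: "integrable (\<kappa> x) (\<lambda>y. g (x, y))" if "g \<in> borel_measurable borel" "\<And>p. \<bar>g p\<bar> \<le> C"
    for g :: "real \<times> real \<Rightarrow> real" and C x
    using that fin(3) measurable_compose[OF Pair_borel that(1)]
    by (intro finite_measure.integrable_const_bound[of _ _ C] AE_I2)
      (auto simp: pk(2) cong: measurable_cong_sets)
  have k_bound: "\<bar>LINT y|\<kappa> x. g (x, y)\<bar> \<le> C" if "g \<in> borel_measurable borel" "\<And>p. \<bar>g p\<bar> \<le> C"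
    for g :: "real \<times> real \<Rightarrow> real" and C x
  proof -
    have "\<bar>LINT y|\<kappa> x. g (x, y)\<bar> \<le> (LINT y|\<kappa> x. \<bar>g (x, y)\<bar>)" by (rule integral_abs_bound)
    also have "\<dots> \<le> (LINT y|\<kappa> x. C)"
      using int_k[OF that, of x] fin(3)[of x] that(2)
      by (intro integral_mono) (auto simp: finite_measure.integrable_const)
    also have "\<dots> = C" using prob_space.prob_space[OF pk(1)[of x]] by (simp add: pk(3))
    finally show ?thesis .
  qed
  have k_meas: "(\<lambda>x. LINT y|\<kappa> x. g (x, y)) \<in> borel_measurable m" if "g \<in> borel_measurable borel"
    for g :: "real \<times> real \<Rightarrow> real"
  proof -
    have "(\<lambda>x. LINT p|distr (\<kappa> x) borel (Pair x). g p) \<in> borel_measurable borel"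
      using measurable_compose[OF measurable_prob_algebraD[OF fiber_measurable[OF kernel]]
          integral_measurable_subprob_algebra[OF that]] unfolding fiber_eq[OF kernel] .
    moreover have "(LINT p|distr (\<kappa> x) borel (Pair x). g p) = (LINT y|\<kappa> x. g (x, y))" for x
      by (rule integral_distr) (use that in \<open>auto simp: pk(2) cong: measurable_cong_sets\<close>)
    ultimately show ?thesis using m(2) by (simp cong: measurable_cong_sets)
  qed
  have int_m: "integrable m (\<lambda>x. LINT y|\<kappa> x. g (x, y))" if "g \<in> borel_measurable borel" "\<And>p. \<bar>g p\<bar> \<le> C"
    for g :: "real \<times> real \<Rightarrow> real" and C
    using fin(1) k_bound[OF that] k_meas[OF that(1)]
    by (intro finite_measure.integrable_const_bound[of _ _ C] AE_I2) auto
  show "integrable (joint_law m \<kappa>) f" "\<And>x. integrable (\<kappa> x) (\<lambda>y. f (x, y))"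
    "integrable m (\<lambda>x. LINT y|\<kappa> x. f (x, y))"
    using int_g int_k int_m assms by blast+
  \<comment> \<open>The integral formula for \<open>bind\<close> is one for nonnegative functions;
    shifting by the bound \<open>B\<close> makes it applicable, and total mass 1 undoes the shift on
    each side.\<close>
  define g where "g = (\<lambda>p. f p + B)"
  have g: "g \<in> borel_measurable borel" "\<And>p. \<bar>g p\<bar> \<le> 2 * B" and g0: "\<And>p. 0 \<le> g p"
  proof -
    show "g \<in> borel_measurable borel" unfolding g_def by measurable
    show "\<bar>g p\<bar> \<le> 2 * B" "0 \<le> g p" for p using B[of p] by (auto simp: g_def)
  qed
  have gn: "(\<lambda>p. ennreal (g p)) \<in> borel_measurable borel" using g(1) by simp
  have "ennreal (LINT p|joint_law m \<kappa>. g p) = (\<integral>\<^sup>+p. ennreal (g p) \<partial>joint_law m \<kappa>)"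
    using int_g[OF g] g0 by (subst nn_integral_eq_integral) auto
  also have "\<dots> = (\<integral>\<^sup>+x. \<integral>\<^sup>+p. ennreal (g p) \<partial>(\<kappa> x \<bind> (\<lambda>y. return borel (x, y))) \<partial>m)"
    unfolding joint_law_def by (rule nn_integral_bind[OF gn fiber_measurable'])
  also have "\<dots> = (\<integral>\<^sup>+x. \<integral>\<^sup>+y. ennreal (g (x, y)) \<partial>\<kappa> x \<partial>m)"
    unfolding fiber_eq[OF kernel] using gn
    by (subst nn_integral_distr) (auto simp: pk(2) cong: measurable_cong_sets)
  also have "\<dots> = (\<integral>\<^sup>+x. ennreal (LINT y|\<kappa> x. g (x, y)) \<partial>m)"
    using int_k[OF g] g0 by (subst nn_integral_eq_integral) auto
  also have "\<dots> = ennreal (LINT x|m. LINT y|\<kappa> x. g (x, y))"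
    using int_m[OF g] g0 by (subst nn_integral_eq_integral) (auto intro!: AE_I2 integral_nonneg_AE)
  finally have "(LINT p|joint_law m \<kappa>. g p) = (LINT x|m. LINT y|\<kappa> x. g (x, y))"
    using g0 by (subst (asm) ennreal_inj) (auto intro!: integral_nonneg_AE AE_I2)
  moreover have "(LINT p|joint_law m \<kappa>. g p) = (LINT p|joint_law m \<kappa>. f p) + B"
    using int_g[OF assms] fin(2) prob_space.prob_space[OF prob_space_joint_law]
    unfolding g_def by (subst Bochner_Integration.integral_add) (auto simp: finite_measure.integrable_const)
  moreover have "(LINT y|\<kappa> x. g (x, y)) = (LINT y|\<kappa> x. f (x, y)) + B" for x
    using int_k[OF assms] fin(3)[of x] prob_space.prob_space[OF pk(1)[of x]]
    unfolding g_def by (subst Bochner_Integration.integral_add) (auto simp: finite_measure.integrable_const)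
  moreover have "(LINT x|m. (LINT y|\<kappa> x. f (x, y)) + B) = (LINT x|m. LINT y|\<kappa> x. f (x, y)) + B"
    using int_m[OF assms] fin(1) prob_space.prob_space[OF m(1)]
    by (subst Bochner_Integration.integral_add) (auto simp: finite_measure.integrable_const)
  ultimately show "(LINT p|joint_law m \<kappa>. f p) = (LINT x|m. LINT y|\<kappa> x. f (x, y))" by simp
qed

end

text \<open>Values of \<open>q\<close> outside \<open>[0, 1]\<close> are clamped by the library's Bernoulli distribution.\<close>

lemma bernoulli_pmf_clamp: "bernoulli_pmf q = bernoulli_pmf (max 0 (min 1 q))"
  by (rule pmf_eqI) (simp add: bernoulli_pmf.rep_eq max_def min_def)

lemma emeasure_two_point_law:
  assumes A: "A \<in> sets borel"
  shows "emeasure (two_point_law q u v) A = ennreal (indicator A v * max 0 (min 1 q) + indicator A u * (1 - max 0 (min 1 q)))"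
proof -
  define p where "p = max 0 (min 1 q)"
  have p: "0 \<le> p" "p \<le> 1" by (auto simp: p_def)
  have "emeasure (two_point_law q u v) A = (\<integral>\<^sup>+y. indicator A y \<partial>two_point_law q u v)"
    using A by (simp add: two_point_law_def)
  also have "\<dots> = (\<integral>\<^sup>+c. indicator A (if c then v else u) \<partial>bernoulli_pmf q)"
    unfolding two_point_law_def using A by (subst nn_integral_distr) auto
  also have "\<dots> = indicator A v * ennreal p + indicator A u * ennreal (1 - p)"
    unfolding bernoulli_pmf_clamp[of q] p_def[symmetric] using p
    by (subst nn_integral_bernoulli_pmf) auto
  also have "\<dots> = ennreal (indicator A v * p + indicator A u * (1 - p))"
    using p ennreal_plus[of p "1 - p"] by (cases "v \<in> A"; cases "u \<in> A") simp_all
  finally show ?thesis by (simp add: p_def)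
qed

lemma prob_space_two_point_law: "prob_space (two_point_law q u v)"
  unfolding two_point_law_def by (intro prob_space.prob_space_distr measure_pmf.prob_space_axioms) simp

lemma sets_two_point_law [simp]: "sets (two_point_law q u v) = sets borel"
  by (simp add: two_point_law_def)

lemma two_point_law_measurable:
  assumes [measurable]: "q \<in> borel_measurable M" "u \<in> borel_measurable M" "v \<in> borel_measurable M"
  shows "(\<lambda>x. two_point_law (q x) (u x) (v x)) \<in> M \<rightarrow>\<^sub>M prob_algebra borel"
proof (rule measurable_prob_algebraI[OF prob_space_two_point_law], rule measurable_subprob_algebra)
  show "subprob_space (two_point_law (q x) (u x) (v x))" for x
    by (rule prob_space_imp_subprob_space[OF prob_space_two_point_law])
  fix A :: "real set" assume [measurable]: "A \<in> sets borel"
  show "(\<lambda>x. emeasure (two_point_law (q x) (u x) (v x)) A) \<in> borel_measurable M"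
    unfolding emeasure_two_point_law[OF \<open>A \<in> sets borel\<close>] by measurable
qed (rule sets_two_point_law)

lemma integral_two_point_law:
  fixes f :: "real \<Rightarrow> real"
  assumes "0 \<le> q" "q \<le> 1" "f \<in> borel_measurable borel"
  shows "(LINT y|two_point_law q u v. f y) = (1 - q) * f u + q * f v"
  unfolding two_point_law_def using assms by (subst integral_distr) auto

lemma integrable_two_point_law:
  fixes f :: "real \<Rightarrow> real"
  assumes "f \<in> borel_measurable borel"
  shows "integrable (two_point_law q u v) f"
  unfolding two_point_law_def using assms
  by (subst integrable_distr_eq) (auto intro: integrable_measure_pmf_finite)

lemma AE_two_point_law:
  assumes "P u" "P v" and [measurable]: "Measurable.pred borel P"
  shows "AE y in two_point_law q u v. P y"
  unfolding two_point_law_def using assms by (subst AE_distr_iff) (auto simp: pred_def)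

lemma mu_facts: "prob_space mu" "sets mu = sets borel" "AE x in mu. x \<in> {-1..1}"
  and nu_facts: "prob_space nu" "sets nu = sets borel" "AE x in nu. x \<in> {-2..2}"
  unfolding mu_def nu_def
  by (auto intro!: prob_space_uniform_measure AE_uniform_measureI)

lemma mu_integral:
  "f \<in> borel_measurable borel \<Longrightarrow> (LINT x|mu. f x :: real) = (LINT x:{-1..1}|lborel. f x) / 2"
  unfolding mu_def by (subst integral_uniform_measure_Icc) auto

section \<open>Barycenter, support and second marginal of the coupling\<close>

context curtain begin

lemma D_measurable [measurable]: "D \<in> borel_measurable borel"
proof -
  have "D x = (if x \<le> -1 then -1 else if x \<le> 1 then D (cl x) else x - k)" for x
  proof (cases "x \<le> -1")
    case True then show ?thesis by (simp add: D_map_def)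
  next
    case False then show ?thesis using D_right[of x] b_bounds by auto
  qed
  then have "D = (\<lambda>x. if x \<le> -1 then -1 else if x \<le> 1 then D (cl x) else x - k)" by (rule ext)
  then show ?thesis by (rule ssubst) measurable
qed

text \<open>Right of \<open>1\<close> the value of \<open>delta_right\<close> is a description operator applied to an unsatisfiable
  predicate, hence constant.\<close>

lemma U_measurable [measurable]: "U \<in> borel_measurable borel"
proof -
  define c where "c = (THE \<delta>::real. False)"
  have "zi x = c" if "1 < x" for x
  proof -
    have "\<not> (\<delta>b \<le> \<delta> \<and> \<delta> \<le> 1 \<and> x = z \<delta>)" for \<delta>
      using z_le[of \<delta> 1] \<delta>b_props k1 that by auto
    then have "(\<lambda>\<delta>. \<delta>b \<le> \<delta> \<and> \<delta> \<le> 1 \<and> x = z \<delta>) = (\<lambda>\<delta>. False)" by (intro ext) simp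
    then show ?thesis unfolding delta_right_def c_def by simp
  qed
  then have U1: "U x = x + c" if "1 < x" for x using U_right[of x] b_bounds that by simp
  have "U x = (if x \<le> -1 then -1 else if x \<le> 1 then U (cl x) else x + c)" for x
  proof (cases "x \<le> -1")
    case True then show ?thesis by (simp add: U_map_def)
  next
    case False then show ?thesis using U1[of x] by auto
  qed
  then have "U = (\<lambda>x. if x \<le> -1 then -1 else if x \<le> 1 then U (cl x) else x + c)" by (rule ext)
  then show ?thesis by (rule ssubst) measurable
qed

abbreviation "q \<equiv> q_of k"

lemma q_measurable [measurable]: "q \<in> borel_measurable borel"
  unfolding q_of_def[abs_def] by measurable

lemma q_eq: "-1 < x \<Longrightarrow> q x = - d x / (w x - d x)"
  by (simp add: q_of_def d_of_def w_of_def)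

lemma q_bounds: assumes "-1 \<le> x" "x \<le> 1" shows "0 \<le> q x \<and> q x \<le> 1"
proof (cases "x = -1")
  case True then show ?thesis by (simp add: q_of_def)
next
  case False
  then show ?thesis using w_pos[of x] d_neg[of x] assms unfolding q_eq[of x] by (simp add: q_eq field_simps)
qed

abbreviation "kap x \<equiv> two_point_law (q x) (D x) (U x)"

lemma kap_measurable: "kap \<in> borel \<rightarrow>\<^sub>M prob_algebra borel"
  by (rule two_point_law_measurable) measurable

lemma pi_eq: "pi_coupling k = joint_law mu kap" by (simp add: pi_coupling_def)

lemma AE_pi:
  assumes P: "Measurable.pred borel P" and DU: "\<And>x. -1 \<le> x \<Longrightarrow> x \<le> 1 \<Longrightarrow> P (x, D x) \<and> P (x, U x)"
  shows "AE p in pi_coupling k. P p"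
  unfolding pi_eq AE_joint_law[OF mu_facts(1,2) kap_measurable P]
  using mu_facts(3)
proof eventually_elim
  fix x :: real assume x: "x \<in> {-1..1}"
  show "AE y in kap x. P (x, y)"
    by (rule AE_two_point_law) (use DU[of x] x measurable_compose[OF Pair_borel P] in auto)
qed

lemma barycenter: "AE x in mu. integrable (kap x) (\<lambda>y. y) \<and> (LINT y|kap x. y) = x"
  using mu_facts(3)
proof eventually_elim
  fix x :: real assume x: "x \<in> {-1..1}"
  have "(1 - q x) * D x + q x * U x = x"
  proof (cases "x = -1")
    case True then show ?thesis by (simp add: D_m1 U_m1)
  next
    case False
    then have "w x - d x \<noteq> 0" using wd_pos'[of x] x by auto
    then have "q x * (w x - d x) = - d x" using False x by (simp add: q_eq)
    then show ?thesis by (simp add: w_of_def d_of_def algebra_simps)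
  qed
  then show "integrable (kap x) (\<lambda>y. y) \<and> (LINT y|kap x. y) = x"
    using q_bounds[of x] x by (simp add: integrable_two_point_law integral_two_point_law)
qed

text \<open>The union of the two graphs over \<open>[-1, 1]\<close> is compact, hence closed, and
  carries full mass; its complement is an open null set and misses the support.\<close>

lemma support_pi:
  assumes "p \<in> topological_support (pi_coupling k)"
  shows "\<exists>x\<in>{-1..1}. p = (x, D x) \<or> p = (x, U x)"
proof (rule ccontr)
  define \<Gamma> where "\<Gamma> = (\<lambda>x. (x, D x)) ` {-1..1} \<union> (\<lambda>x. (x, U x)) ` {-1..1}"
  have sets: "sets (pi_coupling k) = sets borel"
    unfolding pi_eq by (rule sets_joint_law[OF mu_facts(1,2) kap_measurable])
  have "compact \<Gamma>" unfolding \<Gamma>_def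
    by (intro compact_Un compact_continuous_image continuous_intros D_continuous U_continuous) auto
  then have cl: "closed \<Gamma>" by (rule compact_imp_closed)
  assume "\<not> ?thesis"
  then have "p \<in> - \<Gamma>" by (auto simp: \<Gamma>_def)
  moreover have "open (- \<Gamma>)" using cl by (simp add: open_Compl)
  ultimately have "emeasure (pi_coupling k) (- \<Gamma>) > 0" using assms by (auto simp: topological_support_def)
  moreover have "AE p in pi_coupling k. p \<in> \<Gamma>"
  proof (rule AE_pi)
    show "Measurable.pred borel (\<lambda>p. p \<in> \<Gamma>)" using cl by (simp add: pred_def borel_closed)
  qed (auto simp: \<Gamma>_def)
  then have "(AE p in pi_coupling k. p \<notin> - \<Gamma>)" by simp
  then have "emeasure (pi_coupling k) (- \<Gamma>) = 0"
    using cl sets sets_eq_imp_space_eq[OF sets] by (subst AE_iff_measurable[symmetric]) auto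
  ultimately show False by simp
qed

text \<open>An antiderivative of \<open>1 - q\<close>, the weight of the lower branch, obtained from
  \<open>LL_deriv\<close> left of \<open>b\<close> and from \<open>zi_deriv\<close> right of it. The
  pieces agree at \<open>b\<close> because \<open>LL b = zi b = \<delta>b\<close>.\<close>

definition Q1 :: "real \<Rightarrow> real" where "Q1 x = (if x \<le> b then - LL x / 2 else (x - zi x - b) / 2)"

lemma Q1_right: "b \<le> x \<Longrightarrow> Q1 x = (x - zi x - b) / 2"
  using LL_b zi_b by (auto simp: Q1_def)

lemma Q1_continuous: "continuous_on {-1..1} Q1"
proof -
  have "continuous_on {-1..b} Q1"
    by (rule continuous_on_eq[of _ "\<lambda>x. - LL x / 2"]) (auto simp: Q1_def intro!: continuous_intros LL_continuous)
  moreover have "continuous_on {b..1} Q1"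
    by (rule continuous_on_eq[of _ "\<lambda>x. (x - zi x - b) / 2"]) (auto simp: Q1_right intro!: continuous_intros zi_continuous)
  ultimately have "continuous_on ({-1..b} \<union> {b..1}) Q1" by (intro continuous_on_closed_Un) auto
  moreover have "{-1..b} \<union> {b..1} = {-1..1}" using b_bounds by auto
  ultimately show ?thesis by simp
qed

lemma Q1_deriv:
  assumes x: "-1 < x" "x < 1" "x \<noteq> b"
  shows "(Q1 has_real_derivative 1 - q x) (at x)"
proof (cases "x < b")
  case True
  have p: "0 < w x - d x" using wd_pos'[of x] x by simp
  have "((\<lambda>x. - LL x / 2) has_real_derivative - (- 2 * w x / (w x - d x)) / 2) (at x)"
    using True x by (intro DERIV_cdivide DERIV_minus LL_deriv) auto
  moreover have "- (- 2 * w x / (w x - d x)) / 2 = 1 - q x" unfolding q_eq[OF x(1)] using p by (simp add: field_simps)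
  ultimately have "((\<lambda>x. - LL x / 2) has_real_derivative 1 - q x) (at x)" by (rule DERIV_cong)
  then show ?thesis
    by (rule has_field_derivative_transform_within_open[where S = "{..<b}"]) (use True in \<open>auto simp: Q1_def\<close>)
next
  case False
  then have bx: "b < x" using x by simp
  have p: "0 < k + zi x" using zi_props[of x] \<delta>b_props k1 bx x by auto
  have "((\<lambda>x. (x - zi x - b) / 2) has_real_derivative (1 - (k - zi x) / (k + zi x) - 0) / 2) (at x)"
    using bx x by (intro DERIV_cdivide DERIV_diff zi_deriv DERIV_ident DERIV_const)
  moreover have "(1 - (k - zi x) / (k + zi x) - 0) / 2 = 1 - q x"
    unfolding q_eq[OF x(1)] using p x bx w_right[of x] d_right[of x] by (simp add: field_simps)
  ultimately have "((\<lambda>x. (x - zi x - b) / 2) has_real_derivative 1 - q x) (at x)" by (rule DERIV_cong)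
  then show ?thesis
    by (rule has_field_derivative_transform_within_open[where S = "{b<..}"]) (use bx in \<open>auto simp: Q1_right\<close>)
qed

lemma q_integral:
  assumes "-1 \<le> p" "p \<le> p'" "p' \<le> 1"
  shows "set_integrable lborel {p..p'} q" "(LINT x:{p..p'}|lborel. 1 - q x) = Q1 p' - Q1 p"
    "(LINT x:{p..p'}|lborel. q x) = (p' - Q1 p') - (p - Q1 p)"
proof -
  have b: "0 \<le> q u \<and> q u \<le> 1" if "p \<le> u" "u \<le> p'" for u using q_bounds[of u] that assms by auto
  then have b': "- q u \<le> 1 \<and> q u \<le> 1" if "p \<le> u" "u \<le> p'" for u using that by force
  note b = b b'
  show q: "set_integrable lborel {p..p'} q"
    by (rule set_integrable_bounded_Icc[where B = 1]) (use b assms in \<open>auto simp: abs_le_iff\<close>)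
  have q': "set_integrable lborel {p..p'} (\<lambda>x. 1 - q x)"
    by (rule set_integrable_bounded_Icc[where B = 1]) (use b assms in \<open>auto simp: abs_le_iff\<close>)
  have "((\<lambda>x. 1 - q x) has_integral Q1 p' - Q1 p) {p..p'}"
  proof (rule fundamental_theorem_of_calculus_interior_strong[where S = "{b}"])
    show "(Q1 has_vector_derivative 1 - q x) (at x)" if "x \<in> {p<..<p'} - {b}" for x
      using Q1_deriv[of x] that assms by (simp add: has_real_derivative_iff_has_vector_derivative)
    show "continuous_on {p..p'} Q1" using assms by (intro continuous_on_subset[OF Q1_continuous]) auto
  qed (use assms in auto)
  then show e: "(LINT x:{p..p'}|lborel. 1 - q x) = Q1 p' - Q1 p"
    using set_borel_integral_eq_integral(2)[OF q'] by (simp add: integral_unique)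
  have "(LINT x:{p..p'}|lborel. 1) = p' - p" using assms by (simp add: set_lebesgue_integral_def)
  moreover have "set_integrable lborel {p..p'} (\<lambda>x. 1 :: real)"
    by (rule set_integrable_bounded_Icc[where B = 1]) auto
  ultimately show "(LINT x:{p..p'}|lborel. q x) = (p' - Q1 p') - (p - Q1 p)"
    using e set_integral_diff(2)[OF _ q, of "\<lambda>x. 1"] by simp
qed

lemma t_mid: "-1 \<le> v \<Longrightarrow> v \<le> 2 \<Longrightarrow> -1 \<le> x \<Longrightarrow> x \<le> 1 \<Longrightarrow> U x \<le> v \<longleftrightarrow> x \<le> t v"
  using U_le_iff[of x "t v"] t_upper[of v] by simp

text \<open>\<open>D\<close> falls on \<open>[-1, b]\<close> and then rises as \<open>x - k\<close>,
  so its sublevel sets are intervals.\<close>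

lemma D_level:
  assumes "-1 \<le> x" "x \<le> 1" "-2 \<le> c" "c \<le> 2"
  shows "D x \<le> c \<longleftrightarrow> (if c < -1 then t c else -1) \<le> x \<and> x \<le> min 1 (c + k)"
proof (cases "x \<le> b")
  case True
  have "x \<le> min 1 (c + k)" using True b_bounds assms by (auto simp: b_of_def)
  moreover have "D x \<le> -1" using D_le_iff[of x "-1"] D_m1 assms True b_bounds by simp
  ultimately show ?thesis using D_le_iff[of x "t c"] t_lower[of c] assms True by auto
next
  case False
  have "t c \<le> x" if "c < -1" using t_lower[of c] that assms False by auto
  then show ?thesis using D_right[of x] False assms by auto
qed

lemma zi_LL:
  assumes "-2 \<le> c" "c \<le> -1" shows "zi (c + k) = LL (t c)"
proof -
  note l = t_lower[OF assms]
  have "LL (t c) \<le> 1" "\<delta>b \<le> LL (t c)" using LL_props[OF l(1,2)] ds_props by auto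
  moreover have "z (LL (t c)) = c + k" using D_left[OF l(1,2)] l(3) calculation by (simp add: yh_def y_of_def)
  ultimately show ?thesis using zi_z by metis
qed

text \<open>\<open>{D \<le> c}\<close> ends at \<open>min 1 (c + k)\<close> and
  \<open>{U \<le> c}\<close> at \<open>t c\<close>. While \<open>RR (t c) \<le> 1\<close>, both ends
  share one parameter, \<open>zi (c + k) = RR (t c)\<close>, which cancels and leaves an affine
  function of \<open>c\<close>. Otherwise the first end is 1 and \<open>U\<close> is
  explicit.\<close>

lemma mass_balance:
  assumes "-1 \<le> c" "c \<le> 2" shows "Q1 (min 1 (c + k)) + t c - Q1 (t c) + 1 = (c + 2) / 2"
proof -
  note u = t_upper[OF assms]
  show ?thesis
  proof (cases "t c \<le> b")
    case True
    have c: "c = yh (RR (t c))" using U_left[OF u(1) True] u(3) by simp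
    show ?thesis
    proof (cases "RR (t c) \<le> 1")
      case True
      have "\<delta>b \<le> RR (t c)" using LL_props[OF u(1) \<open>t c \<le> b\<close>] u by (simp add: RR_def)
      moreover have "z (RR (t c)) = c + k" using c True by (simp add: yh_def y_of_def)
      ultimately have zi: "zi (c + k) = RR (t c)" using zi_z[of "RR (t c)"] True by simp
      moreover have "c + k \<le> 1" using z_le[of "RR (t c)" 1] True \<open>z (RR (t c)) = c + k\<close> \<delta>b_props \<open>\<delta>b \<le> RR (t c)\<close> k1 by auto
      moreover have "b \<le> c + k" using assms by (simp add: b_of_def)
      ultimately show ?thesis using \<open>t c \<le> b\<close> by (simp add: Q1_right min_def) (simp add: Q1_def RR_def b_of_def field_simps)
    next
      case False
      then have "c + k > 1" "c = RR (t c) - k" using c by (auto simp: yh_def)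
      then show ?thesis using \<open>t c \<le> b\<close> Q1_right[of 1] zi_1 b_bounds by (simp add: Q1_def RR_def b_of_def field_simps)
    qed
  next
    case False
    have "c = t c + zi (t c)" using U_right[of "t c"] u(3) False by simp
    moreover have "1 \<le> c + k"
      using zi_props[of "t c"] False u calculation \<delta>b_bounds U_le_iff[of x0 "t c"] U_x0 x0_props b_bounds by auto
    ultimately show ?thesis using False Q1_right[of 1] Q1_right[of "t c"] zi_1 b_bounds by (simp add: field_simps)
  qed
qed

lemma pi_snd_cdf:
  assumes "-2 \<le> c" "c \<le> 2"
  shows "(LINT x:{-1..1}|lborel. (1 - q x) * indicator {..c} (D x) + q x * indicator {..c} (U x)) = (c + 2) / 2"
proof -
  define l where "l = (if c < -1 then t c else -1)"
  have l: "-1 \<le> l" "l \<le> min 1 (c + k)"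
    using t_lower[of c] assms b_bounds k1 by (auto simp: l_def b_of_def)
  note L = D_level[OF _ _ assms, folded l_def]
  have i: "integrable lborel (\<lambda>x. indicator {p..p'} x *\<^sub>R q x)" "integrable lborel (\<lambda>x. indicator {p..p'} x *\<^sub>R (1 - q x))"
    if "-1 \<le> p" "p \<le> p'" "p' \<le> 1" for p p'
  proof -
    note q = q_integral(1)[OF that]
    have "set_integrable lborel {p..p'} (\<lambda>x. 1 :: real)"
      by (rule set_integrable_bounded_Icc[where B = 1]) auto
    from set_integral_diff(1)[OF this q] q
    show "integrable lborel (\<lambda>x. indicator {p..p'} x *\<^sub>R q x)" "integrable lborel (\<lambda>x. indicator {p..p'} x *\<^sub>R (1 - q x))"
      by (simp_all add: set_integrable_def)
  qed
  show ?thesis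
  proof (cases "c < -1")
    case True
    have "-1 < U x" if "-1 < x" "x \<le> 1" for x using U_less_iff[of "-1" x] U_m1 that by simp
    then have U1: "-1 \<le> U x" if "-1 \<le> x" "x \<le> 1" for x using U_m1 that by (cases "x = -1") (auto simp: less_imp_le)
    then have "(LINT x:{-1..1}|lborel. (1 - q x) * indicator {..c} (D x) + q x * indicator {..c} (U x))
      = (LINT x:{l..min 1 (c + k)}|lborel. 1 - q x)"
      unfolding set_lebesgue_integral_def
    proof (intro Bochner_Integration.integral_cong)
      fix x
      show "indicator {-1..1} x *\<^sub>R ((1 - q x) * indicator {..c} (D x) + q x * indicator {..c} (U x))
        = indicator {l..min 1 (c + k)} x *\<^sub>R (1 - q x)"
      proof (cases "x \<in> {-1..1}")
        case x: True
        then have "\<not> U x \<le> c" using U1 True by force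
        then show ?thesis using L[of x] x by (simp add: indicator_def)
      next
        case False
        then show ?thesis using l by (auto simp: indicator_def)
      qed
    qed simp
    also have "\<dots> = Q1 (min 1 (c + k)) - Q1 l" using l by (intro q_integral) auto
    \<comment> \<open>Both ends of the interval share one parameter,
      \<open>zi (c + k) = LL (t c)\<close>, so it drops out of the difference.\<close>
    also have "\<dots> = (c + 2) / 2"
    proof -
      have "t c \<le> b" "c + k \<le> 1" "b \<le> c + k" using t_lower[of c] True assms k2 by (auto simp: b_of_def)
      then show ?thesis using zi_LL[of c] True assms
        by (simp add: l_def Q1_right min_def) (simp add: Q1_def b_of_def field_simps)
    qed
    finally show ?thesis .
  next
    case False
    have tc: "-1 \<le> t c" "t c \<le> 1" using t_upper[of c] False assms by auto
    have "(LINT x:{-1..1}|lborel. (1 - q x) * indicator {..c} (D x) + q x * indicator {..c} (U x))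
      = (LINT x|lborel. indicator {-1..min 1 (c + k)} x *\<^sub>R (1 - q x) + indicator {-1..t c} x *\<^sub>R q x)"
      unfolding set_lebesgue_integral_def
    proof (rule Bochner_Integration.integral_cong)
      fix x
      show "indicator {-1..1} x *\<^sub>R ((1 - q x) * indicator {..c} (D x) + q x * indicator {..c} (U x))
        = indicator {-1..min 1 (c + k)} x *\<^sub>R (1 - q x) + indicator {-1..t c} x *\<^sub>R q x"
      proof (cases "x \<in> {-1..1}")
        case True
        then show ?thesis using L[of x] t_mid[of c x] False assms by (simp add: indicator_def l_def)
      next
        case False
        then show ?thesis using tc by (auto simp: indicator_def)
      qed
    qed simp
    also have "\<dots> = (LINT x:{-1..min 1 (c + k)}|lborel. 1 - q x) + (LINT x:{-1..t c}|lborel. q x)"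
      unfolding set_lebesgue_integral_def using l tc False
      by (intro Bochner_Integration.integral_add i) (auto simp: l_def)
    also have "\<dots> = (Q1 (min 1 (c + k)) - Q1 (-1)) + ((t c - Q1 (t c)) - (-1 - Q1 (-1)))"
      using l tc False by (subst (1) q_integral(2), simp_all add: l_def) (subst q_integral(3), auto)
    also have "\<dots> = (c + 2) / 2" using mass_balance[of c] False assms by simp
    finally show ?thesis .
  qed
qed

lemma pi_snd: "distr (pi_coupling k) borel snd = nu"
proof (rule cdf_unique)
  note J = sets_joint_law[OF mu_facts(1,2) kap_measurable, folded pi_eq]
    prob_space_joint_law[OF mu_facts(1,2) kap_measurable, folded pi_eq]
  show "real_distribution nu" "real_distribution (distr (pi_coupling k) borel snd)"
    using nu_facts J by (auto simp: real_distribution_def real_distribution_axioms_def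
        intro!: prob_space.prob_space_distr cong: measurable_cong_sets)
  have cdf_pi: "cdf (distr (pi_coupling k) borel snd) c
      = (LINT x:{-1..1}|lborel. (1 - q x) * indicator {..c} (D x) + q x * indicator {..c} (U x)) / 2" for c
  proof -
    have m: "(\<lambda>p. indicator {..c} (snd p) :: real) \<in> borel_measurable (borel :: (real \<times> real) measure)" by measurable
    have "cdf (distr (pi_coupling k) borel snd) c = (LINT y|distr (pi_coupling k) borel snd. indicator {..c} y)"
      by (simp add: cdf_def)
    also have "\<dots> = (LINT p|pi_coupling k. indicator {..c} (snd p))"
      using J by (intro integral_distr) (auto cong: measurable_cong_sets)
    also have "\<dots> = (LINT x|mu. LINT y|kap x. indicator {..c} y)"
      unfolding pi_eq using integral_joint_law(1)[OF mu_facts(1,2) kap_measurable m, of 1] by (simp add: indicator_def)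
    also have "\<dots> = (LINT x|mu. (1 - q x) * indicator {..c} (D x) + q x * indicator {..c} (U x))"
    proof (rule integral_cong_AE)
      show "(\<lambda>x. LINT y|kap x. indicator {..c} y :: real) \<in> borel_measurable mu"
        using borel_measurable_integrable[OF integral_joint_law(4)[OF mu_facts(1,2) kap_measurable m, of 1]] by (simp add: indicator_def)
      show "(\<lambda>x. (1 - q x) * indicator {..c} (D x) + q x * indicator {..c} (U x)) \<in> borel_measurable mu"
        using mu_facts(2) by (simp cong: measurable_cong_sets)
      show "AE x in mu. (LINT y|kap x. indicator {..c} y :: real) = (1 - q x) * indicator {..c} (D x) + q x * indicator {..c} (U x)"
        using mu_facts(3)
      proof eventually_elim
        fix x :: real assume "x \<in> {-1..1}"
        then show "(LINT y|kap x. indicator {..c} y :: real) = (1 - q x) * indicator {..c} (D x) + q x * indicator {..c} (U x)"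
          using q_bounds[of x] by (intro integral_two_point_law) auto
      qed
    qed
    also have "\<dots> = (LINT x:{-1..1}|lborel. (1 - q x) * indicator {..c} (D x) + q x * indicator {..c} (U x)) / 2"
      by (rule mu_integral) measurable
    finally show ?thesis .
  qed
  show "cdf (distr (pi_coupling k) borel snd) = cdf nu"
  proof
    fix c :: real
    have nu: "cdf nu c = measure lborel ({-2..2} \<inter> {..c}) / 4"
      unfolding cdf_def nu_def by (subst measure_uniform_measure) auto
    have DU: "D x \<in> {-2..2}" "U x \<in> {-2..2}" if "x \<in> {-1..1}" for x
      using D_range[of x] U_range[of x] that k1 by auto
    consider "c < -2" | "-2 \<le> c" "c \<le> 2" | "2 < c" by linarith
    then show "cdf (distr (pi_coupling k) borel snd) c = cdf nu c"
    proof cases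
      case 1
      have "(LINT x:{-1..1}|lborel. (1 - q x) * indicator {..c} (D x) + q x * indicator {..c} (U x))
          = (LINT x:{-1..1::real}|lborel. 0)"
        by (rule set_lebesgue_integral_cong) (use DU 1 in \<open>force simp: indicator_def\<close>)+
      moreover have "{-2..2} \<inter> {..c} = {}" using 1 by auto
      ultimately show ?thesis unfolding cdf_pi nu by (simp add: set_lebesgue_integral_def)
    next
      case 2
      then have "{-2..2} \<inter> {..c} = {-2..c}" by auto
      then show ?thesis unfolding cdf_pi nu pi_snd_cdf[OF 2] using 2 by simp
    next
      case 3
      have "(LINT x:{-1..1}|lborel. (1 - q x) * indicator {..c} (D x) + q x * indicator {..c} (U x))
          = (LINT x:{-1..1::real}|lborel. 1)"
        by (rule set_lebesgue_integral_cong) (use DU 3 in \<open>force simp: indicator_def\<close>)+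
      moreover have "{-2..2} \<inter> {..c} = {-2..2}" using 3 by auto
      ultimately show ?thesis unfolding cdf_pi nu by (simp add: set_lebesgue_integral_def)
    qed
  qed
qed

lemma pi_in_M_class: "pi_coupling k \<in> M_class k"
  unfolding M_class_def
proof (intro CollectI conjI bexI)
  show "prob_space (pi_coupling k)" "sets (pi_coupling k) = sets borel" "distr (pi_coupling k) borel fst = mu"
    unfolding pi_eq
    by (rule prob_space_joint_law[OF mu_facts(1,2) kap_measurable] sets_joint_law[OF mu_facts(1,2) kap_measurable]
        distr_joint_law_fst[OF mu_facts(1,2) kap_measurable])+
  show "AE p in pi_coupling k. fst p - k \<le> snd p"
  proof (rule AE_pi)
    show "fst (x, D x) - k \<le> snd (x, D x) \<and> fst (x, U x) - k \<le> snd (x, U x)" if "-1 \<le> x" "x \<le> 1" for x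
      using d_ge[OF that] w_nonneg[OF that] k1 by (simp add: d_of_def w_of_def)
  qed measurable
qed (use pi_snd pi_eq barycenter kap_measurable in auto)

end

section \<open>Optimality\<close>

lemma clamped_continuous_borel:
  fixes g :: "real \<Rightarrow> real"
  assumes g: "continuous_on {a..c} g" and "a \<le> c"
  obtains B where "(\<lambda>x. g (max a (min c x))) \<in> borel_measurable borel" "\<And>x. \<bar>g (max a (min c x))\<bar> \<le> B" "0 \<le> B"
proof -
  have "continuous_on UNIV (\<lambda>x. g (max a (min c x)))"
    by (rule continuous_on_compose2[OF g]) (use \<open>a \<le> c\<close> in \<open>auto intro!: continuous_on_max continuous_on_min continuous_intros\<close>)
  then have m: "(\<lambda>x. g (max a (min c x))) \<in> borel_measurable borel" by (rule borel_measurable_continuous_onI)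
  have "bounded (g ` {a..c})" by (intro compact_imp_bounded compact_continuous_image g) simp
  then obtain B where B: "\<And>x. x \<in> {a..c} \<Longrightarrow> \<bar>g x\<bar> \<le> B" unfolding bounded_iff real_norm_def by blast
  have "\<bar>g (max a (min c x))\<bar> \<le> B" for x by (rule B) (use \<open>a \<le> c\<close> in auto)
  moreover have "0 \<le> B" using B[of a] \<open>a \<le> c\<close> by simp
  ultimately show thesis using that[OF m] by blast
qed

lemma M_classD:
  assumes "\<pi> \<in> M_class k"
  shows "prob_space \<pi>" "sets \<pi> = sets borel" "distr \<pi> borel fst = mu" "distr \<pi> borel snd = nu"
    "AE p in \<pi>. fst p \<in> {-1..1} \<and> snd p \<in> {-2..2} \<and> fst p - k \<le> snd p"
proof -
  show p: "prob_space \<pi>" "sets \<pi> = sets borel" "distr \<pi> borel fst = mu" "distr \<pi> borel snd = nu"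
    using assms by (auto simp: M_class_def)
  have fs: "fst \<in> \<pi> \<rightarrow>\<^sub>M borel" "snd \<in> \<pi> \<rightarrow>\<^sub>M borel" using p(2) by (auto cong: measurable_cong_sets)
  have ae: "AE x in distr \<pi> borel fst. x \<in> {-1..1}" "AE x in distr \<pi> borel snd. x \<in> {-2..2}"
    unfolding p(3,4) by (rule mu_facts(3) nu_facts(3))+
  have "AE p in \<pi>. fst p \<in> {-1..1}" "AE p in \<pi>. snd p \<in> {-2..2}"
    using AE_distrD[OF fs(1) ae(1)] AE_distrD[OF fs(2) ae(2)] by simp_all
  moreover have "AE p in \<pi>. fst p - k \<le> snd p" using assms by (simp add: M_class_def)
  ultimately show "AE p in \<pi>. fst p \<in> {-1..1} \<and> snd p \<in> {-2..2} \<and> fst p - k \<le> snd p"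
    by eventually_elim simp
qed

lemma M_class_integrable:
  fixes f :: "real \<times> real \<Rightarrow> real"
  assumes "\<pi> \<in> M_class k" "f \<in> borel_measurable borel" "\<And>p. \<bar>f p\<bar> \<le> B"
  shows "integrable \<pi> f"
  using M_classD(1,2)[OF assms(1)] assms(2,3)
  by (intro finite_measure.integrable_const_bound[of _ _ B] AE_I2 prob_space.finite_measure)
    (auto cong: measurable_cong_sets)

abbreviation c1 :: "real \<Rightarrow> real" where "c1 x \<equiv> max (-1) (min 1 x)"
abbreviation c2 :: "real \<Rightarrow> real" where "c2 x \<equiv> max (-2) (min 2 x)"
abbreviation c3 :: "real \<Rightarrow> real" where "c3 x \<equiv> max (-3) (min 3 x)"

lemma clamp3_measurable:
  fixes h :: "real \<Rightarrow> real"
  assumes "continuous_on {-3..3} h"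
  obtains B where "(\<lambda>p :: real \<times> real. h (c3 (snd p - fst p))) \<in> borel_measurable borel"
    "\<And>p :: real \<times> real. \<bar>h (c3 (snd p - fst p))\<bar> \<le> B"
proof -
  obtain B where B: "(\<lambda>x. h (c3 x)) \<in> borel_measurable borel" "\<And>x. \<bar>h (c3 x)\<bar> \<le> B"
    using clamped_continuous_borel[of "-3" 3 h] assms by auto
  have "(\<lambda>p :: real \<times> real. h (c3 (snd p - fst p))) \<in> borel_measurable borel"
    by (rule measurable_compose[OF _ B(1)]) measurable
  then show thesis using that B(2) by blast
qed

text \<open>Almost surely \<open>y - x\<close> lies in \<open>[-3, 3]\<close>, so the restriction
  may be traded for a clamp, which yields a bounded Borel integrand whatever \<open>h\<close> does
  elsewhere.\<close>

lemma cost_eq: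
  assumes \<pi>: "\<pi> \<in> M_class k" and h: "continuous_on {-3..3} h"
  shows "cost h \<pi> = (LINT p|\<pi>. h (c3 (snd p - fst p)))"
proof -
  obtain B where m: "(\<lambda>p :: real \<times> real. h (c3 (snd p - fst p))) \<in> borel_measurable borel"
    using clamp3_measurable[OF h] by blast
  have S: "{p :: real \<times> real. snd p - fst p \<in> {-3..3}} \<in> sets borel"
  proof -
    have "(\<lambda>p :: real \<times> real. snd p - fst p) -` {-3..3} \<inter> space borel \<in> sets borel"
      by (rule measurable_sets[of _ borel borel]) measurable
    then show ?thesis by (simp add: vimage_def)
  qed
  have "cost h \<pi> = (LINT p|\<pi>. indicator {p. snd p - fst p \<in> {-3..3}} p *\<^sub>R h (c3 (snd p - fst p)))"
    unfolding cost_def set_lebesgue_integral_def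
    by (rule Bochner_Integration.integral_cong) (auto simp: indicator_def)
  also have "\<dots> = (LINT p|\<pi>. h (c3 (snd p - fst p)))"
  proof (rule integral_cong_AE)
    show "AE p in \<pi>. indicator {p. snd p - fst p \<in> {-3..3}} p *\<^sub>R h (c3 (snd p - fst p)) = h (c3 (snd p - fst p))"
      using M_classD(5)[OF \<pi>] by eventually_elim (auto simp: indicator_def)
  qed (use M_classD(2)[OF \<pi>] m S in \<open>auto cong: measurable_cong_sets\<close>)
  finally show ?thesis .
qed

text \<open>The clamps only make the integrand bounded.\<close>

lemma martingale_integral:
  fixes \<theta> :: "real \<Rightarrow> real"
  assumes \<pi>: "\<pi> \<in> M_class k" and \<theta>: "\<theta> \<in> borel_measurable borel" "\<And>x. \<bar>\<theta> x\<bar> \<le> B" "0 \<le> B"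
  shows "(LINT p|\<pi>. \<theta> (fst p) * (c2 (snd p) - c1 (fst p))) = 0"
    "integrable \<pi> (\<lambda>p. \<theta> (fst p) * (c2 (snd p) - c1 (fst p)))"
proof -
  obtain \<kappa> where \<kappa>: "\<kappa> \<in> borel \<rightarrow>\<^sub>M prob_algebra borel" "\<pi> = joint_law mu \<kappa>"
    and bary: "AE x in mu. integrable (\<kappa> x) (\<lambda>y. y) \<and> (LINT y|\<kappa> x. y) = x"
    using \<pi> unfolding M_class_def by blast
  define f where "f = (\<lambda>p :: real \<times> real. \<theta> (fst p) * (c2 (snd p) - c1 (fst p)))"
  have [measurable]: "\<theta> \<in> borel_measurable borel" by (rule \<theta>(1))
  have f: "f \<in> borel_measurable borel" unfolding f_def by measurable
  have c: "\<bar>c2 v - c1 x\<bar> \<le> 3" for v x by (auto simp: max_def min_def)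
  have fB: "\<bar>f p\<bar> \<le> B * 3" for p
    unfolding f_def abs_mult using \<theta> c by (intro mult_mono) auto
  show "integrable \<pi> (\<lambda>p. \<theta> (fst p) * (c2 (snd p) - c1 (fst p)))"
    using M_class_integrable[OF \<pi> f fB] by (simp add: f_def)
  have P: "Measurable.pred borel (\<lambda>p :: real \<times> real. snd p \<in> {-2..2})" by measurable
  have "AE p in \<pi>. snd p \<in> {-2..2}" using M_classD(5)[OF \<pi>] by eventually_elim simp
  then have "AE x in mu. AE y in \<kappa> x. snd (x, y) \<in> {-2..2}"
    unfolding \<kappa>(2) by (simp only: AE_joint_law[OF mu_facts(1,2) \<kappa>(1) P])
  then have inner: "AE x in mu. (LINT y|\<kappa> x. f (x, y)) = 0"
    using bary mu_facts(3)
  proof eventually_elim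
    fix x assume y: "AE y in \<kappa> x. snd (x, y) \<in> {-2..2}" and b: "integrable (\<kappa> x) (\<lambda>y. y) \<and> (LINT y|\<kappa> x. y) = x"
      and x: "x \<in> {-1..1::real}"
    note pk = prob_algebra_borelD[OF \<kappa>(1), of x]
    have eq: "AE y in \<kappa> x. f (x, y) = \<theta> x * (y - x)" using y by eventually_elim (use x in \<open>simp add: f_def\<close>)
    have "(LINT y|\<kappa> x. f (x, y)) = (LINT y|\<kappa> x. \<theta> x * (y - x))"
      by (rule integral_cong_AE) (use eq pk(2) measurable_compose[OF Pair_borel f] in \<open>auto cong: measurable_cong_sets\<close>)
    also have "\<dots> = \<theta> x * ((LINT y|\<kappa> x. y) - (LINT y|\<kappa> x. x))"
      using b prob_space.finite_measure[OF pk(1)] by (simp add: finite_measure.integrable_const)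
    also have "\<dots> = 0" using b prob_space.prob_space[OF pk(1)] pk(3) by simp
    finally show "(LINT y|\<kappa> x. f (x, y)) = 0" .
  qed
  have "(LINT p|\<pi>. f p) = (LINT x|mu. LINT y|\<kappa> x. f (x, y))"
    unfolding \<kappa>(2) by (rule integral_joint_law(1)[OF mu_facts(1,2) \<kappa>(1) f fB])
  also have "\<dots> = (LINT x|mu. 0)"
    by (rule integral_cong_AE) (use inner borel_measurable_integrable[OF integral_joint_law(4)[OF mu_facts(1,2) \<kappa>(1) f fB]] in auto)
  finally show "(LINT p|\<pi>. \<theta> (fst p) * (c2 (snd p) - c1 (fst p))) = 0" by (simp add: f_def)
qed

context curtain begin

lemma Htail_U_continuous: "continuous_on {-1..1} (\<lambda>x. Htail r x (U x))"
proof -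
  have "continuous_on {-2..2} (psi_tail r)"
    using psi_tail_deriv by (intro DERIV_continuous_on) auto
  then have "continuous_on {-1..1} (\<lambda>x. psi_tail r (U x))"
    by (rule continuous_on_compose2[OF _ U_continuous]) (use U_range in force)
  then show ?thesis unfolding Htail_def
    by (intro continuous_intros continuous_on_max U_continuous TT_continuous[OF tail_good]) auto
qed

lemma weak_duality:
  fixes h \<phi> \<psi> \<theta> :: "real \<Rightarrow> real"
  assumes \<pi>: "\<pi> \<in> M_class k"
    and h: "continuous_on {-3..3} h" and \<phi>: "continuous_on {-1..1} \<phi>"
    and \<psi>: "continuous_on {-2..2} \<psi>" and \<theta>: "continuous_on {-1..1} \<theta>"
    and le: "\<And>x v. -1 \<le> x \<Longrightarrow> x \<le> 1 \<Longrightarrow> -2 \<le> v \<Longrightarrow> v \<le> 2 \<Longrightarrow> x - k \<le> v \<Longrightarrow> \<phi> x + \<psi> v + \<theta> x * (v - x) \<le> h (v - x)"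
    and eq: "\<And>x. -1 \<le> x \<Longrightarrow> x \<le> 1 \<Longrightarrow> \<phi> x + \<psi> (D x) + \<theta> x * d x = h (d x)"
      "\<And>x. -1 \<le> x \<Longrightarrow> x \<le> 1 \<Longrightarrow> \<phi> x + \<psi> (U x) + \<theta> x * w x = h (w x)"
  shows "cost h (pi_coupling k) \<le> cost h \<pi>"
proof -
  obtain B1 where B1: "(\<lambda>x. \<phi> (c1 x)) \<in> borel_measurable borel" "\<And>x. \<bar>\<phi> (c1 x)\<bar> \<le> B1"
    using clamped_continuous_borel[OF \<phi>] by auto
  obtain B2 where B2: "(\<lambda>x. \<psi> (c2 x)) \<in> borel_measurable borel" "\<And>x. \<bar>\<psi> (c2 x)\<bar> \<le> B2"
    using clamped_continuous_borel[OF \<psi>] by auto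
  obtain B3 where B3: "(\<lambda>x. \<theta> (c1 x)) \<in> borel_measurable borel" "\<And>x. \<bar>\<theta> (c1 x)\<bar> \<le> B3" "0 \<le> B3"
    using clamped_continuous_borel[OF \<theta>] by auto
  obtain B4 where B4: "(\<lambda>p :: real \<times> real. h (c3 (snd p - fst p))) \<in> borel_measurable borel"
    "\<And>p :: real \<times> real. \<bar>h (c3 (snd p - fst p))\<bar> \<le> B4" using clamp3_measurable[OF h] by blast
  define J where "J = (\<lambda>p. \<phi> (c1 (fst p)) + \<psi> (c2 (snd p)) + \<theta> (c1 (fst p)) * (c2 (snd p) - c1 (fst p)))"
  have [measurable]: "(\<lambda>x. \<phi> (c1 x)) \<in> borel_measurable borel" "(\<lambda>x. \<psi> (c2 x)) \<in> borel_measurable borel"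
    "(\<lambda>x. \<theta> (c1 x)) \<in> borel_measurable borel" by fact+
  have Jm: "J \<in> borel_measurable borel" unfolding J_def by measurable
  have J: "(LINT p|\<pi>'. J p) = (LINT x|mu. \<phi> (c1 x)) + (LINT y|nu. \<psi> (c2 y)) \<and> integrable \<pi>' J"
    if \<pi>': "\<pi>' \<in> M_class k" for \<pi>'
  proof -
    note M = M_classD[OF \<pi>'] and T = martingale_integral[OF \<pi>' B3]
    have fs: "fst \<in> \<pi>' \<rightarrow>\<^sub>M borel" "snd \<in> \<pi>' \<rightarrow>\<^sub>M borel" using M(2) by (auto cong: measurable_cong_sets)
    have i: "integrable \<pi>' (\<lambda>p. \<phi> (c1 (fst p)))" "integrable \<pi>' (\<lambda>p. \<psi> (c2 (snd p)))"
      using B1 B2 by (auto intro!: M_class_integrable[OF \<pi>'])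
    have "(LINT p|\<pi>'. \<phi> (c1 (fst p))) = (LINT x|mu. \<phi> (c1 x))"
      unfolding M(3)[symmetric] by (rule integral_distr[symmetric, OF fs(1)]) (rule B1(1))
    moreover have "(LINT p|\<pi>'. \<psi> (c2 (snd p))) = (LINT x|nu. \<psi> (c2 x))"
      unfolding M(4)[symmetric] by (rule integral_distr[symmetric, OF fs(2)]) (rule B2(1))
    ultimately show ?thesis unfolding J_def using i T by simp
  qed
  have "cost h (pi_coupling k) = (LINT p|pi_coupling k. J p)"
    unfolding cost_eq[OF pi_in_M_class h]
  proof (rule integral_cong_AE)
    show "AE p in pi_coupling k. h (c3 (snd p - fst p)) = J p"
    proof (rule AE_pi)
      show "Measurable.pred borel (\<lambda>p. h (c3 (snd p - fst p)) = J p)" using B4(1) Jm by measurable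
      fix x :: real assume x: "-1 \<le> x" "x \<le> 1"
      then show "h (c3 (snd (x, D x) - fst (x, D x))) = J (x, D x) \<and> h (c3 (snd (x, U x) - fst (x, U x))) = J (x, U x)"
        using eq[of x] D_range[OF x] U_range[OF x] k1 by (auto simp: J_def d_of_def w_of_def)
    qed
  qed (use B4(1) Jm M_classD(2)[OF pi_in_M_class] in \<open>auto cong: measurable_cong_sets\<close>)
  also have "\<dots> = (LINT p|\<pi>. J p)" using J[OF pi_in_M_class] J[OF \<pi>] by simp
  also have "\<dots> \<le> cost h \<pi>" unfolding cost_eq[OF \<pi> h]
  proof (rule integral_mono_AE)
    show "integrable \<pi> J" using J[OF \<pi>] by simp
    show "integrable \<pi> (\<lambda>p. h (c3 (snd p - fst p)))" by (rule M_class_integrable[OF \<pi> B4])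
    show "AE p in \<pi>. J p \<le> h (c3 (snd p - fst p))"
      using M_classD(5)[OF \<pi>]
    proof eventually_elim
      fix p :: "real \<times> real" assume "fst p \<in> {-1..1} \<and> snd p \<in> {-2..2} \<and> fst p - k \<le> snd p"
      then show "J p \<le> h (c3 (snd p - fst p))" using le[of "fst p" "snd p"] by (auto simp: J_def)
    qed
  qed
  finally show ?thesis .
qed

text \<open>Affine and quadratic terms have exact dual functions: \<open>p * u\<close> goes into
  \<theta>, and \<open>(v - x) ^ 2 / 2\<close> equals
  \<open>v ^ 2 / 2 - x ^ 2 / 2 - x * (v - x)\<close>. Hence \<open>p\<close> and \<open>q'\<close>
  may have any sign, and only the tail terms need nonnegative weights.\<close>

lemma cost_optimal_piecewise:
  fixes c r :: "nat \<Rightarrow> real" and m p q' :: real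
  assumes \<pi>: "\<pi> \<in> M_class k" and c: "\<And>i. i < N \<Longrightarrow> 0 \<le> c i"
  defines "h \<equiv> (\<lambda>u. m + p * u + q' * u\<^sup>2 / 2 + (\<Sum>i<N. c i * ((max 0 (u - r i))\<^sup>2 / 2)))"
  shows "cost h (pi_coupling k) \<le> cost h \<pi>"
proof (rule weak_duality[OF \<pi>, where
      \<phi> = "\<lambda>x. m - q' * x\<^sup>2 / 2 + (\<Sum>i<N. c i * Htail (r i) x (U x))" and
      \<psi> = "\<lambda>v. q' * v\<^sup>2 / 2 + (\<Sum>i<N. c i * psi_tail (r i) v)" and
      \<theta> = "\<lambda>x. p - q' * x - (\<Sum>i<N. c i * TT (tail (r i)) x)"])
  show "continuous_on {-3..3} h" unfolding h_def by (intro continuous_intros continuous_on_max)  auto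
  show "continuous_on {-1..1} (\<lambda>x. m - q' * x\<^sup>2 / 2 + (\<Sum>i<N. c i * Htail (r i) x (U x)))"
    by (intro continuous_intros Htail_U_continuous) auto
  have "continuous_on {-2..2} (psi_tail r)" for r
    using psi_tail_deriv by (intro DERIV_continuous_on) auto
  then show "continuous_on {-2..2} (\<lambda>v. q' * v\<^sup>2 / 2 + (\<Sum>i<N. c i * psi_tail (r i) v))"
    by (intro continuous_intros) auto
  show "continuous_on {-1..1} (\<lambda>x. p - q' * x - (\<Sum>i<N. c i * TT (tail (r i)) x))"
    by (intro continuous_intros TT_continuous[OF tail_good]) auto
  have key: "m - q' * x\<^sup>2 / 2 + (\<Sum>i<N. c i * Htail (r i) x (U x)) + (q' * v\<^sup>2 / 2 + (\<Sum>i<N. c i * psi_tail (r i) v))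
      + (p - q' * x - (\<Sum>i<N. c i * TT (tail (r i)) x)) * (v - x)
      = h (v - x) - (\<Sum>i<N. c i * (Htail (r i) x v - Htail (r i) x (U x)))" for x v
  proof -
    have "q' * (v - x)\<^sup>2 / 2 = q' * v\<^sup>2 / 2 - q' * x\<^sup>2 / 2 - q' * x * (v - x)"
      by (simp add: power2_eq_square field_simps)
    moreover have "(\<Sum>i<N. c i * (Htail (r i) x v - Htail (r i) x (U x)))
      = (\<Sum>i<N. c i * ((max 0 (v - x - r i))\<^sup>2 / 2)) - (\<Sum>i<N. c i * psi_tail (r i) v)
        + (\<Sum>i<N. c i * TT (tail (r i)) x) * (v - x) - (\<Sum>i<N. c i * Htail (r i) x (U x))"
      unfolding Htail_def[of _ x v] sum_distrib_right sum.distrib[symmetric] sum_subtractf[symmetric]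
      by (rule sum.cong) (auto simp: algebra_simps)
    ultimately show ?thesis unfolding h_def by (simp add: left_diff_distrib)
  qed
  show "m - q' * x\<^sup>2 / 2 + (\<Sum>i<N. c i * Htail (r i) x (U x)) + (q' * v\<^sup>2 / 2 + (\<Sum>i<N. c i * psi_tail (r i) v))
      + (p - q' * x - (\<Sum>i<N. c i * TT (tail (r i)) x)) * (v - x) \<le> h (v - x)"
    if "-1 \<le> x" "x \<le> 1" "-2 \<le> v" "v \<le> 2" "x - k \<le> v" for x v
  proof -
    have "0 \<le> (\<Sum>i<N. c i * (Htail (r i) x v - Htail (r i) x (U x)))"
      using c tail_dual(2)[OF that] by (intro sum_nonneg mult_nonneg_nonneg) auto
    then show ?thesis unfolding key by simp
  qed
  fix x :: real assume x: "-1 \<le> x" "x \<le> 1"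
  show "m - q' * x\<^sup>2 / 2 + (\<Sum>i<N. c i * Htail (r i) x (U x)) + (q' * (D x)\<^sup>2 / 2 + (\<Sum>i<N. c i * psi_tail (r i) (D x)))
      + (p - q' * x - (\<Sum>i<N. c i * TT (tail (r i)) x)) * d x = h (d x)"
    using key[of x "D x"] tail_dual(1)[OF x] by (simp add: d_of_def)
  show "m - q' * x\<^sup>2 / 2 + (\<Sum>i<N. c i * Htail (r i) x (U x)) + (q' * (U x)\<^sup>2 / 2 + (\<Sum>i<N. c i * psi_tail (r i) (U x)))
      + (p - q' * x - (\<Sum>i<N. c i * TT (tail (r i)) x)) * w x = h (w x)"
    using key[of x "U x"] by (simp add: w_of_def)
qed

lemma cost_close:
  assumes \<pi>: "\<pi> \<in> M_class k" and h: "continuous_on {-3..3} h" "continuous_on {-3..3} g"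
    and e: "\<And>u. u \<in> {-3..3} \<Longrightarrow> h u \<le> g u + e"
  shows "cost h \<pi> \<le> cost g \<pi> + e"
proof -
  obtain B where B: "(\<lambda>p :: real \<times> real. h (c3 (snd p - fst p))) \<in> borel_measurable borel"
    "\<And>p :: real \<times> real. \<bar>h (c3 (snd p - fst p))\<bar> \<le> B" using clamp3_measurable[OF h(1)] by blast
  obtain C where C: "(\<lambda>p :: real \<times> real. g (c3 (snd p - fst p))) \<in> borel_measurable borel"
    "\<And>p :: real \<times> real. \<bar>g (c3 (snd p - fst p))\<bar> \<le> C" using clamp3_measurable[OF h(2)] by blast
  note i = M_class_integrable[OF \<pi> B] M_class_integrable[OF \<pi> C]
  have c: "integrable \<pi> (\<lambda>p. e)"
    using prob_space.finite_measure[OF M_classD(1)[OF \<pi>]] by (simp add: finite_measure.integrable_const)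
  have "cost h \<pi> \<le> (LINT p|\<pi>. g (c3 (snd p - fst p)) + e)"
    unfolding cost_eq[OF \<pi> h(1)] using i c e by (intro integral_mono) auto
  also have "\<dots> = cost g \<pi> + e"
    unfolding cost_eq[OF \<pi> h(2)] using i c prob_space.prob_space[OF M_classD(1)[OF \<pi>]] by simp
  finally show ?thesis .
qed

text \<open>Dual functions built from \<open>h''\<close> are out of reach for a cost that is merely
  C^1. Optimality is instead transferred from costs whose derivative is a convex polygon, uniformly
  close to \<open>h\<close>.\<close>

lemma cost_optimal:
  fixes h h1 :: "real \<Rightarrow> real"
  assumes h: "\<And>u. u \<in> {-3..3} \<Longrightarrow> (h has_real_derivative h1 u) (at u within {-3..3})"
    and h1: "continuous_on {-3..3} h1" "convex_on {-3..3} h1" and \<pi>: "\<pi> \<in> M_class k"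
  shows "cost h (pi_coupling k) \<le> cost h \<pi>"
proof (rule field_le_epsilon)
  fix e :: real assume e: "0 < e"
  obtain N :: nat and p q' :: real and c r :: "nat \<Rightarrow> real" where c: "\<And>i. i < N \<Longrightarrow> 0 \<le> c i"
    and appr: "\<And>u. u \<in> {-3..-3 + 6} \<Longrightarrow> \<bar>h1 u - p - q' * u - (\<Sum>i<N. c i * max 0 (u - r i))\<bar> \<le> e / 12"
  proof (rule convex_piecewise_linear_approx[of "-3" 6 h1 "e / 12"])
    fix N :: nat and p q' :: real and c r :: "nat \<Rightarrow> real"
    assume "\<And>i. i < N \<Longrightarrow> 0 \<le> c i"
      "\<And>u. u \<in> {-3..-3 + 6} \<Longrightarrow> \<bar>h1 u - p - q' * u - (\<Sum>i<N. c i * max 0 (u - r i))\<bar> \<le> e / 12"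
    then show thesis by (rule that)
  qed (use h1 e in simp_all)
  define g where "g = (\<lambda>m u. m + p * u + q' * u\<^sup>2 / 2 + (\<Sum>i<N. c i * ((max 0 (u - r i))\<^sup>2 / 2)))"
  \<comment> \<open>Makes \<open>g m\<close> agree with \<open>h\<close> at -3, so that an error of
    \<open>e / 12\<close> in the derivative grows to at most \<open>e / 2\<close> over the length
    6.\<close>
  define m where "m = h (-3) - g 0 (-3)"
  have gd: "(g m has_real_derivative p + q' * u + (\<Sum>i<N. c i * max 0 (u - r i))) (at u within {-3..3})" for u
  proof -
    have "((\<lambda>u. (max 0 (u - r i))\<^sup>2 / 2) has_real_derivative max 0 (u - r i) * 1) (at u within {-3..3})" for i
      by (rule DERIV_chain2[OF half_square_pos_part_deriv]) (auto intro!: derivative_eq_intros)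
    then have "((\<lambda>u. (\<Sum>i<N. c i * ((max 0 (u - r i))\<^sup>2 / 2))) has_real_derivative (\<Sum>i<N. c i * (max 0 (u - r i) * 1))) (at u within {-3..3})"
      by (intro DERIV_sum DERIV_cmult)
    moreover have "((\<lambda>u. m + p * u + q' * u\<^sup>2 / 2) has_real_derivative p + q' * u) (at u within {-3..3})"
      by (auto intro!: derivative_eq_intros)
    ultimately show ?thesis unfolding g_def using DERIV_add by fastforce
  qed
  have close: "\<bar>h u - g m u\<bar> \<le> e / 2" if u: "u \<in> {-3..3}" for u
  proof -
    have "norm ((h u - g m u) - (h (-3) - g m (-3))) \<le> e / 12 * norm (u - (-3))"
    proof (rule field_differentiable_bound[where S = "{-3..3}"])
      fix s :: real assume s: "s \<in> {-3..3}"
      show "((\<lambda>u. h u - g m u) has_real_derivative h1 s - (p + q' * s + (\<Sum>i<N. c i * max 0 (s - r i)))) (at s within {-3..3})"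
        by (intro DERIV_diff h s gd)
      show "norm (h1 s - (p + q' * s + (\<Sum>i<N. c i * max 0 (s - r i)))) \<le> e / 12"
        using appr[of s] s by (simp add: algebra_simps)
    qed (use u in auto)
    also have "\<dots> \<le> e / 12 * 6" using u e by (intro mult_left_mono) auto
    finally show ?thesis by (simp add: m_def g_def)
  qed
  have close': "h u \<le> g m u + e / 2" "g m u \<le> h u + e / 2" if "u \<in> {-3..3}" for u
    using close[OF that] by (simp_all only: abs_le_iff) linarith+
  have hc: "continuous_on {-3..3} h" using h by (rule DERIV_continuous_on)
  have gc: "continuous_on {-3..3} (g m)" using gd by (rule DERIV_continuous_on)
  have "cost h (pi_coupling k) \<le> cost (g m) (pi_coupling k) + e / 2"
    by (rule cost_close[OF pi_in_M_class hc gc close'(1)])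
  moreover have "cost (g m) (pi_coupling k) \<le> cost (g m) \<pi>"
    unfolding g_def by (rule cost_optimal_piecewise[OF \<pi> c])
  moreover have "cost (g m) \<pi> \<le> cost h \<pi> + e / 2"
    by (rule cost_close[OF \<pi> gc hc close'(2)])
  ultimately show "cost h (pi_coupling k) \<le> cost h \<pi> + e" by linarith
qed

lemma V_eq:
  assumes "\<And>\<pi>. \<pi> \<in> M_class k \<Longrightarrow> cost h (pi_coupling k) \<le> cost h \<pi>"
  shows "V k h = cost h (pi_coupling k)"
  unfolding V_def by (rule cInf_eq_minimum) (use assms pi_in_M_class in auto)

end

theorem theorem4p2:
  fixes k :: real
  assumes "1 < k" and "k < 2"
  shows
    "(\<forall>h h1 :: real \<Rightarrow> real.
        (\<forall>t\<in>{-3..3}. (h has_real_derivative h1 t) (at t within {-3..3}))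
        \<and> continuous_on {-3..3} h1 \<and> convex_on {-3..3} h1
        \<longrightarrow> V k h = cost h (pi_coupling k))
   \<and> (\<forall>h h1 h2 h3 :: real \<Rightarrow> real.
        (\<forall>t\<in>{-3..3}. (h has_real_derivative h1 t) (at t within {-3..3}))
        \<and> (\<forall>t\<in>{-3..3}. (h1 has_real_derivative h2 t) (at t within {-3..3}))
        \<and> (\<forall>t\<in>{-3..3}. (h2 has_real_derivative h3 t) (at t within {-3..3}))
        \<and> continuous_on {-3..3} h3 \<and> (\<forall>t\<in>{-3..3}. h3 t \<ge> 0)
        \<longrightarrow> (\<forall>x\<in>{-1..1}. \<forall>y\<in>{-2..2} \<inter> {x - k..}.
               phi_fun k h h1 h2 x + psi_fun k h1 h2 y + theta_fun k h2 x * (y - x) \<le> h (y - x))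
            \<and> (\<forall>(x, y)\<in>topological_support (pi_coupling k).
               phi_fun k h h1 h2 x + psi_fun k h1 h2 y + theta_fun k h2 x * (y - x) = h (y - x)))"
proof -
  interpret curtain k by unfold_locales (rule assms)+
  show ?thesis
  proof (intro conjI allI impI)
    fix h h1 :: "real \<Rightarrow> real"
    assume "(\<forall>t\<in>{-3..3}. (h has_real_derivative h1 t) (at t within {-3..3}))
      \<and> continuous_on {-3..3} h1 \<and> convex_on {-3..3} h1"
    then show "V k h = cost h (pi_coupling k)" by (intro V_eq cost_optimal[where ?h1.0 = h1]) auto
  next
    fix h h1 h2 h3 :: "real \<Rightarrow> real"
    assume *: "(\<forall>t\<in>{-3..3}. (h has_real_derivative h1 t) (at t within {-3..3}))
        \<and> (\<forall>t\<in>{-3..3}. (h1 has_real_derivative h2 t) (at t within {-3..3}))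
        \<and> (\<forall>t\<in>{-3..3}. (h2 has_real_derivative h3 t) (at t within {-3..3}))
        \<and> continuous_on {-3..3} h3 \<and> (\<forall>t\<in>{-3..3}. h3 t \<ge> 0)"
    then have h: "\<And>t. t \<in> {-3..3} \<Longrightarrow> (h has_real_derivative h1 t) (at t within {-3..3})"
      and h1: "\<And>t. t \<in> {-3..3} \<Longrightarrow> (h1 has_real_derivative h2 t) (at t within {-3..3})"
      and h2: "\<And>t. t \<in> {-3..3} \<Longrightarrow> (h2 has_real_derivative h3 t) (at t within {-3..3})"
      and h3: "\<And>t. t \<in> {-3..3} \<Longrightarrow> 0 \<le> h3 t" by blast+
    have h2c: "continuous_on {-3..3} h2" using h2 by (rule DERIV_continuous_on)
    have mono: "h2 u \<le> h2 v" if "-3 \<le> u" "u \<le> v" "v \<le> 3" for u v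
    proof (rule deriv_nonneg_imp_le[where f = h2])
      show "continuous_on {u..v} h2" by (rule continuous_on_subset[OF h2c]) (use that in auto)
      show "\<exists>D. (h2 has_real_derivative D) (at s) \<and> 0 \<le> D" if "u < s" "s < v" for s
        using h2[of s] h3[of s] that \<open>-3 \<le> u\<close> \<open>v \<le> 3\<close> by (auto simp: at_within_Icc_at)
    qed (rule that)
    note dual = dual_functions[OF h h1 h2c mono]
    show "\<forall>x\<in>{-1..1}. \<forall>y\<in>{-2..2} \<inter> {x - k..}.
        phi_fun k h h1 h2 x + psi_fun k h1 h2 y + theta_fun k h2 x * (y - x) \<le> h (y - x)"
      using dual(3) by auto
    show "\<forall>(x, y)\<in>topological_support (pi_coupling k).
        phi_fun k h h1 h2 x + psi_fun k h1 h2 y + theta_fun k h2 x * (y - x) = h (y - x)"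
    proof clarify
      fix x y assume "(x, y) \<in> topological_support (pi_coupling k)"
      then have "-1 \<le> x" "x \<le> 1" "y = D x \<or> y = U x" using support_pi by fastforce+
      then show "phi_fun k h h1 h2 x + psi_fun k h1 h2 y + theta_fun k h2 x * (y - x) = h (y - x)"
        using dual(1,2) by auto
    qed
  qed
qed

end
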